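(* Let $s\ge 1$, $\varphi\in H^s(\mathbb{R})$, $T>0$, and let $\{\varepsilon_n\}_{n\in\mathbb{N}}$ be a decreasing sequence of positive real numbers converging to $0$. For each $n$ let $u_n\in C(\mathbb{R};H^s(\mathbb{R}))$ be the solution of the Kawahara equation $$u_t+u_{xxx}+\varepsilon_n\,\partial_x^5u+u\,u_x=0,\qquad (t,x)\in\mathbb{R}^2,$$ with $u_n(0)=\varphi$. Then $$u_n\to u\quad\text{in } C([0,T];H^s(\mathbb{R})),$$ where $u\in C(\mathbb{R};H^s(\mathbb{R}))$ is the unique solution of the KdV equation $u_t+u_{xxx}+u\,u_x=0$ with $u(0)=\varphi$.
   Context: $H^s(\mathbb{R})$ is the Sobolev space of real-valued functions with norm $\|f\|_{H^s}=\|J_x^sf\|_{L^2}$, where $J_x^s$ is the Fourier multiplier $(1+|\xi|^2)^{s/2}$. For each fixed $\varepsilon>0$ the Kawahara equation, and likewise the KdV equation, has for each initial datum in $H^s(\mathbb{R})$, $s\ge1$, a unique global solution in $C(\mathbb{R};H^s(\mathbb{R}))$ (known results); these are the solutions referred to. *)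

theory Defs
  imports "HOL-Analysis.Analysis"
begin

section \<open>The Fourier transform on the space of square-integrable functions\<close>

definition square_integrable :: "(real \<Rightarrow> complex) \<Rightarrow> bool" where
  "square_integrable f \<longleftrightarrow>
     f \<in> borel_measurable lborel \<and> integrable lborel (\<lambda>x. (cmod (f x))\<^sup>2)"

definition L2_norm :: "(real \<Rightarrow> complex) \<Rightarrow> real" where
  "L2_norm f = sqrt (LINT x|lborel. (cmod (f x))\<^sup>2)"

definition truncated_fourier :: "real \<Rightarrow> (real \<Rightarrow> complex) \<Rightarrow> real \<Rightarrow> complex" where
  "truncated_fourier R f \<xi> = (LINT x:{-R..R}|lborel. cis (- (\<xi> * x)) * f x)"

text \<open>
  Plancherel's transform: the limit in mean of the truncated Fourier integrals
  (convention: kernel \<open>exp (- i \<xi> x)\<close>, no normalising factor).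
  It is determined up to null sets, hence the choice operator in \<open>fourier\<close>.
\<close>

definition has_fourier :: "(real \<Rightarrow> complex) \<Rightarrow> (real \<Rightarrow> complex) \<Rightarrow> bool" where
  "has_fourier f F \<longleftrightarrow> square_integrable f \<and> square_integrable F \<and>
     ((\<lambda>R. L2_norm (\<lambda>\<xi>. truncated_fourier R f \<xi> - F \<xi>)) \<longlongrightarrow> 0) at_top"

definition fourier :: "(real \<Rightarrow> complex) \<Rightarrow> real \<Rightarrow> complex" where
  "fourier f = (SOME F. has_fourier f F)"

definition inverse_fourier :: "(real \<Rightarrow> complex) \<Rightarrow> real \<Rightarrow> complex" where
  "inverse_fourier F x = fourier F (- x) / of_real (2 * pi)"


section \<open>Sobolev spaces of real-valued functions on the line\<close>

definition bessel_symbol :: "real \<Rightarrow> real \<Rightarrow> real" where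
  "bessel_symbol s \<xi> = (1 + \<bar>\<xi>\<bar>\<^sup>2) powr (s / 2)"

definition bessel :: "real \<Rightarrow> (real \<Rightarrow> real) \<Rightarrow> real \<Rightarrow> complex" where
  "bessel s f =
     inverse_fourier (\<lambda>\<xi>. of_real (bessel_symbol s \<xi>) * fourier (\<lambda>x. of_real (f x)) \<xi>)"

text \<open>
  The Sobolev space for \<open>s \<ge> 0\<close>; for \<open>s < 0\<close> the definition would only give its
  intersection with the square-integrable functions. Elements are functions, not
  classes modulo null sets.
\<close>

definition sobolev :: "real \<Rightarrow> (real \<Rightarrow> real) set" where
  "sobolev s = {f. square_integrable (\<lambda>x. of_real (f x)) \<and>
     square_integrable (\<lambda>\<xi>. of_real (bessel_symbol s \<xi>) * fourier (\<lambda>x. of_real (f x)) \<xi>)}"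

definition sobolev_norm :: "real \<Rightarrow> (real \<Rightarrow> real) \<Rightarrow> real" where
  "sobolev_norm s f = L2_norm (bessel s f)"

definition sobolev_dist :: "real \<Rightarrow> (real \<Rightarrow> real) \<Rightarrow> (real \<Rightarrow> real) \<Rightarrow> real" where
  "sobolev_dist s f g = sobolev_norm s (\<lambda>x. f x - g x)"

definition continuous_in_sobolev :: "real \<Rightarrow> (real \<Rightarrow> real \<Rightarrow> real) \<Rightarrow> bool" where
  "continuous_in_sobolev s u \<longleftrightarrow> (\<forall>t. u t \<in> sobolev s) \<and>
     (\<forall>t\<^sub>0. ((\<lambda>t. sobolev_dist s (u t) (u t\<^sub>0)) \<longlongrightarrow> 0) (at t\<^sub>0))"

text \<open>Convergence in \<open>C([0,T]; H\<^sup>s)\<close>, i.e. in the norm \<open>sup\<close> over \<open>[0,T]\<close> of the Sobolev norm.\<close>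

definition converges_in_C_sobolev ::
  "real \<Rightarrow> real \<Rightarrow> (nat \<Rightarrow> real \<Rightarrow> real \<Rightarrow> real) \<Rightarrow> (real \<Rightarrow> real \<Rightarrow> real) \<Rightarrow> bool" where
  "converges_in_C_sobolev T s v w \<longleftrightarrow>
     uniform_limit {0..T} (\<lambda>n t. sobolev_dist s (v n t) (w t)) (\<lambda>t. 0) sequentially"


section \<open>Test functions on the plane\<close>

text \<open>Points are pairs \<open>(t, x)\<close>.\<close>

definition partial_t :: "(real \<times> real \<Rightarrow> real) \<Rightarrow> real \<times> real \<Rightarrow> real" where
  "partial_t f = (\<lambda>(t, x). deriv (\<lambda>\<tau>. f (\<tau>, x)) t)"

definition partial_x :: "(real \<times> real \<Rightarrow> real) \<Rightarrow> real \<times> real \<Rightarrow> real" where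
  "partial_x f = (\<lambda>(t, x). deriv (\<lambda>y. f (t, y)) x)"

primrec C_k :: "nat \<Rightarrow> (real \<times> real \<Rightarrow> real) \<Rightarrow> bool" where
  "C_k 0 f \<longleftrightarrow> continuous_on UNIV f"
| "C_k (Suc k) f \<longleftrightarrow> f differentiable_on UNIV \<and> C_k k (partial_t f) \<and> C_k k (partial_x f)"

definition test_function :: "(real \<times> real \<Rightarrow> real) \<Rightarrow> bool" where
  "test_function \<psi> \<longleftrightarrow> (\<forall>k. C_k k \<psi>) \<and> compact (closure {z. \<psi> z \<noteq> 0})"


section \<open>The Kawahara and KdV equations\<close>

text \<open>
  The equations are understood in the sense of distributions on the plane, with
  \<open>u u\<^sub>x = (u\<^sup>2 / 2)\<^sub>x\<close>; all derivatives are of odd order, so moving them to the test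
  function changes the sign of every term, and the common sign is dropped.
  The integrals are iterated because a curve of functions \<open>u t\<close>, each only determined
  up to a null set, need not be jointly measurable in \<open>(t, x)\<close>.
\<close>

definition kawahara_equation :: "real \<Rightarrow> (real \<Rightarrow> real \<Rightarrow> real) \<Rightarrow> bool" where
  "kawahara_equation \<epsilon> u \<longleftrightarrow> (\<forall>\<psi>. test_function \<psi> \<longrightarrow>
     (LINT t|lborel. LINT x|lborel.
        u t x * partial_t \<psi> (t, x)
        + u t x * (partial_x ^^ 3) \<psi> (t, x)
        + \<epsilon> * u t x * (partial_x ^^ 5) \<psi> (t, x)
        + (u t x)\<^sup>2 / 2 * partial_x \<psi> (t, x)) = 0)"

definition kdv_equation :: "(real \<Rightarrow> real \<Rightarrow> real) \<Rightarrow> bool" where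
  "kdv_equation u \<longleftrightarrow> (\<forall>\<psi>. test_function \<psi> \<longrightarrow>
     (LINT t|lborel. LINT x|lborel.
        u t x * partial_t \<psi> (t, x)
        + u t x * (partial_x ^^ 3) \<psi> (t, x)
        + (u t x)\<^sup>2 / 2 * partial_x \<psi> (t, x)) = 0)"

definition kawahara_solution ::
  "real \<Rightarrow> real \<Rightarrow> (real \<Rightarrow> real) \<Rightarrow> (real \<Rightarrow> real \<Rightarrow> real) \<Rightarrow> bool" where
  "kawahara_solution s \<epsilon> \<phi> u \<longleftrightarrow>
     continuous_in_sobolev s u \<and> kawahara_equation \<epsilon> u \<and> (AE x in lborel. u 0 x = \<phi> x)"

definition kdv_solution ::
  "real \<Rightarrow> (real \<Rightarrow> real) \<Rightarrow> (real \<Rightarrow> real \<Rightarrow> real) \<Rightarrow> bool" where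
  "kdv_solution s \<phi> u \<longleftrightarrow>
     continuous_in_sobolev s u \<and> kdv_equation u \<and> (AE x in lborel. u 0 x = \<phi> x)"

end

theory Submission
  imports Defs "HOL-Probability.Characteristic_Functions" "HOL-Probability.Sinc_Integral"
begin

text \<open>
  Testing the weak formulation with \<open>\<theta>(t) \<omega>(x/R) e\<^sup>- \<^sup>i\<^sup>\<xi>\<^sup>x\<close> and letting \<open>R\<close> tend to infinity shows that
  the Fourier transform \<open>f t \<xi>\<close> of a solution satisfies, at every frequency,
  \<open>f' = i (\<xi>\<^sup>3 - \<epsilon> \<xi>\<^sup>5) f + bil f f\<close>, so neither existence nor uniqueness theory is needed.
  For a weight \<open>W\<close>, the derivative of \<open>\<integral> W |f|\<^sup>2\<close> is a trilinear form over \<open>x + y + z = 0\<close> whose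
  symmetrised symbol is controlled by the lowest frequency. The resonance function equals
  \<open>x y z (3 - 5/2 \<epsilon> (x\<^sup>2 + y\<^sup>2 + z\<^sup>2))\<close>. Where its second factor is large, one integrates by parts in
  time; the remaining frequencies have slices of bounded measure, uniformly in \<open>\<epsilon> \<le> 1\<close>, and there
  the Cauchy-Schwarz inequality suffices. On a time interval whose length only depends on the
  \<open>H\<^sup>1\<close> norm this gives \<open>\<integral> W |f t|\<^sup>2 \<le> 2 \<integral> W |f 0|\<^sup>2\<close> uniformly in \<open>\<epsilon>\<close>, and the same argument applied
  to the frequency-truncated difference of a Kawahara and a KdV solution shows that this
  difference tends to zero in \<open>L\<^sup>2\<close>. Weights that coincide with the \<open>H\<^sup>s\<close> weight at high frequencies
  and are small at low ones bound the tails uniformly, which upgrades the convergence to \<open>H\<^sup>s\<close>.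
  A continuity argument keeps the \<open>H\<^sup>1\<close> norms bounded, and finitely many short steps reach \<open>T\<close>.
\<close>

section \<open>Lebesgue norms of nonnegative functions\<close>

text \<open>The factor \<open>3 - 5/2 \<epsilon> Q\<close> of the resonance function vanishes where
  \<open>Q = 6 / (5 \<epsilon>)\<close>, at frequencies that escape to infinity as
  \<open>\<epsilon>\<close> tends to 0; no lower bound for it is uniform. Two facts about a function
  of \<open>H^1\<close> norm \<open>H\<close> carry the estimates: its transform \<open>F\<close> is
  in \<open>L^1\<close>, and \<open>|x| F\<close> is in \<open>L^2\<close>. Symmetrisation leaves
  one derivative on the lowest frequency. Nonresonant interactions recover it by division, so
  \<open>F\<close> in \<open>L^1\<close> is enough; resonant ones must put \<open>|x| F\<close> in
  \<open>L^2\<close>, and the square root of the slice measure replaces the missing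
  \<open>L^1\<close> bound. Integration by parts in time leaves boundary terms without a factor
  \<open>t\<close>: they are made small by a threshold \<open>K\<close> depending on
  \<open>H\<close>, and only then is the time step chosen. In the difference of two solutions
  \<open>\<epsilon> \<xi>^5\<close> is not controlled by the available norms; below a cutoff
  \<open>L\<close> it is a forcing term of size \<open>\<epsilon> L^5\<close>, and the part above
  \<open>L\<close> is \<open>O(1/L)\<close> in \<open>L^2\<close>. Hence \<open>L\<close> is fixed
  before \<open>\<epsilon>\<close> becomes small.\<close>

abbreviation nnl :: "(real \<Rightarrow> ennreal) \<Rightarrow> ennreal" (binder "NN " 10) where
  "nnl f \<equiv> integral\<^sup>N lborel f"

abbreviation enorm :: "complex \<Rightarrow> ennreal" where
  "enorm z \<equiv> ennreal (cmod z)"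

text \<open>Norm bounds by a real number, as predicates on \<open>ennreal\<close> functions:
  finiteness needs no separate argument, and the squared form of \<open>b2\<close> avoids square
  roots of \<open>ennreal\<close> values.\<close>

definition b1 :: "(real \<Rightarrow> ennreal) \<Rightarrow> real \<Rightarrow> bool" where
  "b1 A a \<longleftrightarrow> A \<in> borel_measurable borel \<and> 0 \<le> a \<and> (NN x. A x) \<le> ennreal a"

definition b2 :: "(real \<Rightarrow> ennreal) \<Rightarrow> real \<Rightarrow> bool" where
  "b2 A a \<longleftrightarrow> A \<in> borel_measurable borel \<and> 0 \<le> a \<and> (NN x. (A x)\<^sup>2) \<le> ennreal (a\<^sup>2)"

lemma b1_measurable[measurable_dest]: "b1 A a \<Longrightarrow> A \<in> borel_measurable borel"
  and b1_nonneg: "b1 A a \<Longrightarrow> 0 \<le> a"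
  and b1_le: "b1 A a \<Longrightarrow> (NN x. A x) \<le> ennreal a"
  by (auto simp: b1_def)

lemma b2_measurable[measurable_dest]: "b2 A a \<Longrightarrow> A \<in> borel_measurable borel"
  and b2_nonneg: "b2 A a \<Longrightarrow> 0 \<le> a"
  and b2_le: "b2 A a \<Longrightarrow> (NN x. (A x)\<^sup>2) \<le> ennreal (a\<^sup>2)"
  by (auto simp: b2_def)

lemma ennreal_power2_le_D: "(X::ennreal)\<^sup>2 \<le> ennreal (c\<^sup>2) \<Longrightarrow> 0 \<le> c \<Longrightarrow> X \<le> ennreal c"
proof (cases X)
  case (real r)
  assume *: "X\<^sup>2 \<le> ennreal (c\<^sup>2)" "0 \<le> c"
  then have "ennreal (r\<^sup>2) \<le> ennreal (c\<^sup>2)" using real by (simp add: ennreal_power)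
  then have "r\<^sup>2 \<le> c\<^sup>2" by (simp add: ennreal_le_iff)
  then have "r \<le> c" using *(2) power2_le_imp_le by blast
  then show ?thesis using real * by (simp add: ennreal_leI)
next
  case top
  assume *: "X\<^sup>2 \<le> ennreal (c\<^sup>2)" "0 \<le> c"
  then show ?thesis using top by (simp add: power2_eq_square ennreal_mult_top top_unique)
qed

lemma nn_integral_mult_le:
  assumes [measurable]: "A \<in> borel_measurable M" "B \<in> borel_measurable M"
    and "(\<integral>\<^sup>+x. (A x)\<^sup>2 \<partial>M) \<le> ennreal (a\<^sup>2)" "(\<integral>\<^sup>+x. (B x)\<^sup>2 \<partial>M) \<le> ennreal (b\<^sup>2)" "0 \<le> a" "0 \<le> b"
  shows "(\<integral>\<^sup>+x. A x * B x \<partial>M) \<le> ennreal (a * b)"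
proof (rule ennreal_power2_le_D)
  have "(\<integral>\<^sup>+x. A x * B x \<partial>M)\<^sup>2 \<le> (\<integral>\<^sup>+x. (A x)\<^sup>2 \<partial>M) * (\<integral>\<^sup>+x. (B x)\<^sup>2 \<partial>M)"
    by (rule Cauchy_Schwarz_nn_integral) auto
  also have "\<dots> \<le> ennreal (a\<^sup>2) * ennreal (b\<^sup>2)"
    by (intro mult_mono assms) auto
  also have "\<dots> = ennreal ((a * b)\<^sup>2)"
    by (simp add: ennreal_mult power_mult_distrib)
  finally show "(\<integral>\<^sup>+x. A x * B x \<partial>M)\<^sup>2 \<le> ennreal ((a * b)\<^sup>2)" .
qed (use assms in auto)

lemma b2_mult: "b2 A a \<Longrightarrow> b2 B b \<Longrightarrow> b1 (\<lambda>x. A x * B x) (a * b)"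
  unfolding b1_def using nn_integral_mult_le[of A lborel B a b] by (auto simp: b2_def)

lemma b2_mono:
  "b2 A a \<Longrightarrow> B \<in> borel_measurable borel \<Longrightarrow> (\<And>x. B x \<le> A x) \<Longrightarrow> a \<le> b \<Longrightarrow> b2 B b"
proof -
  assume *: "b2 A a" "B \<in> borel_measurable borel" "\<And>x. B x \<le> A x" "a \<le> b"
  have "(NN x. (B x)\<^sup>2) \<le> (NN x. (A x)\<^sup>2)"
    by (intro nn_integral_mono power_mono * ) auto
  also have "\<dots> \<le> ennreal (b\<^sup>2)"
    using b2_le[OF *(1)] b2_nonneg[OF *(1)] *(4)
    by (meson ennreal_leI order_trans power_mono)
  finally show ?thesis using * b2_nonneg[OF *(1)] by (auto simp: b2_def)
qed

lemma b2_cmult: "b2 A a \<Longrightarrow> 0 \<le> c \<Longrightarrow> b2 (\<lambda>x. ennreal c * A x) (c * a)"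
proof -
  assume *: "b2 A a" "0 \<le> c"
  have [measurable]: "A \<in> borel_measurable borel" using * by (simp add: b2_def)
  have "(NN x. (ennreal c * A x)\<^sup>2) = ennreal (c\<^sup>2) * (NN x. (A x)\<^sup>2)"
    using * by (simp add: power_mult_distrib ennreal_power nn_integral_cmult)
  also have "\<dots> \<le> ennreal (c\<^sup>2) * ennreal (a\<^sup>2)"
    by (intro mult_left_mono b2_le *) auto
  finally show ?thesis using * by (auto simp: b2_def ennreal_mult power_mult_distrib)
qed

lemma b2_add:
  assumes "b2 A a" "b2 B b"
  shows "b2 (\<lambda>x. A x + B x) (a + b)"
proof -
  have [measurable]: "A \<in> borel_measurable borel" "B \<in> borel_measurable borel"
    using assms by (auto simp: b2_def)
  have "(NN x. (A x + B x)\<^sup>2) =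
      (NN x. (A x)\<^sup>2) + (NN x. 2 * (A x * B x)) + (NN x. (B x)\<^sup>2)"
    by (simp add: power2_sum nn_integral_add algebra_simps)
  also have "(NN x. 2 * (A x * B x)) = 2 * (NN x. A x * B x)"
    by (simp add: nn_integral_cmult)
  also have "(NN x. (A x)\<^sup>2) + 2 * (NN x. A x * B x) + (NN x. (B x)\<^sup>2)
      \<le> ennreal (a\<^sup>2) + 2 * ennreal (a * b) + ennreal (b\<^sup>2)"
    using b2_le assms b1_le[OF b2_mult[OF assms]] by (intro add_mono mult_left_mono) auto
  also have "\<dots> = ennreal ((a + b)\<^sup>2)"
    using b2_nonneg[OF assms(1)] b2_nonneg[OF assms(2)]
    by (simp add: power2_sum ennreal_plus algebra_simps flip: ennreal_numeral ennreal_mult)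
  finally show ?thesis using b2_nonneg assms by (auto simp: b2_def)
qed

section \<open>Square integrable functions\<close>

lemma square_integrable_measurable[measurable_dest]:
  "square_integrable f \<Longrightarrow> f \<in> borel_measurable borel"
  by (simp add: square_integrable_def)

lemma L2_norm_nonneg[simp]: "0 \<le> L2_norm f"
  by (simp add: L2_norm_def)

lemma nn_integral_L2_norm:
  assumes "square_integrable f"
  shows "(NN x. (enorm (f x))\<^sup>2) = ennreal ((L2_norm f)\<^sup>2)"
  using assms unfolding square_integrable_def L2_norm_def
  by (subst real_sqrt_pow2) (auto simp: ennreal_power nn_integral_eq_integral)

lemma square_integrable_b2:
  "square_integrable f \<longleftrightarrow> f \<in> borel_measurable borel \<and> (\<exists>a. b2 (\<lambda>x. enorm (f x)) a)"
proof
  assume "square_integrable f"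
  then show "f \<in> borel_measurable borel \<and> (\<exists>a. b2 (\<lambda>x. enorm (f x)) a)"
    using nn_integral_L2_norm[of f]
    by (auto simp: square_integrable_def b2_def intro!: exI[of _ "L2_norm f"])
next
  assume *: "f \<in> borel_measurable borel \<and> (\<exists>a. b2 (\<lambda>x. enorm (f x)) a)"
  then obtain a where a: "b2 (\<lambda>x. enorm (f x)) a" by auto
  have "integrable lborel (\<lambda>x. (cmod (f x))\<^sup>2)"
    using * b2_le[OF a] by (intro integrableI_bounded) (auto simp: ennreal_power intro: le_less_trans)
  then show "square_integrable f" using * by (auto simp: square_integrable_def)
qed

lemma b2_L2_norm: "square_integrable f \<Longrightarrow> b2 (\<lambda>x. enorm (f x)) (L2_norm f)"
  using nn_integral_L2_norm[of f] by (auto simp: square_integrable_def b2_def)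

lemma L2_norm_le_b2: "b2 (\<lambda>x. enorm (f x)) a \<Longrightarrow> f \<in> borel_measurable borel \<Longrightarrow> L2_norm f \<le> a"
proof -
  assume *: "b2 (\<lambda>x. enorm (f x)) a" "f \<in> borel_measurable borel"
  then have "square_integrable f" by (auto simp: square_integrable_b2)
  then have "ennreal ((L2_norm f)\<^sup>2) \<le> ennreal (a\<^sup>2)"
    using b2_le[OF *(1)] nn_integral_L2_norm by metis
  then show ?thesis using b2_nonneg[OF *(1)] by (simp add: ennreal_le_iff abs_le_square_iff[symmetric])
qed

lemma square_integrable_lift:
  assumes "square_integrable f" "g \<in> borel_measurable borel" "\<And>x. cmod (g x) \<le> c * cmod (f x)" "0 \<le> c"
  shows "square_integrable g" "L2_norm g \<le> c * L2_norm f"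
proof -
  have "b2 (\<lambda>x. enorm (g x)) (c * L2_norm f)"
    using assms by (intro b2_mono[OF b2_cmult[OF b2_L2_norm[OF assms(1)] assms(4)]])
      (auto simp flip: ennreal_mult intro!: ennreal_leI)
  then show "square_integrable g" "L2_norm g \<le> c * L2_norm f"
    using assms L2_norm_le_b2 by (auto simp: square_integrable_b2)
qed

lemma square_integrable_sum:
  assumes "square_integrable f" "square_integrable g" "h \<in> borel_measurable borel"
    "\<And>x. cmod (h x) \<le> cmod (f x) + cmod (g x)"
  shows "square_integrable h" "L2_norm h \<le> L2_norm f + L2_norm g"
proof -
  have "b2 (\<lambda>x. enorm (h x)) (L2_norm f + L2_norm g)"
    using assms by (intro b2_mono[OF b2_add[OF b2_L2_norm[OF assms(1)] b2_L2_norm[OF assms(2)]]])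
      (auto simp flip: ennreal_plus intro!: ennreal_leI)
  then show "square_integrable h" "L2_norm h \<le> L2_norm f + L2_norm g"
    using assms L2_norm_le_b2 by (auto simp: square_integrable_b2)
qed

lemma square_integrable_diff:
  assumes "square_integrable f" "square_integrable g"
  shows "square_integrable (\<lambda>x. f x - g x)" "L2_norm (\<lambda>x. f x - g x) \<le> L2_norm f + L2_norm g"
proof -
  note [measurable] = square_integrable_measurable[OF assms(1)] square_integrable_measurable[OF assms(2)]
  show "square_integrable (\<lambda>x. f x - g x)" "L2_norm (\<lambda>x. f x - g x) \<le> L2_norm f + L2_norm g"
    by (rule square_integrable_sum[OF assms]; simp add: norm_triangle_ineq4)+
qed

lemma square_integrable_add:
  assumes "square_integrable f" "square_integrable g"
  shows "square_integrable (\<lambda>x. f x + g x)" "L2_norm (\<lambda>x. f x + g x) \<le> L2_norm f + L2_norm g"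
proof -
  note [measurable] = square_integrable_measurable[OF assms(1)] square_integrable_measurable[OF assms(2)]
  show "square_integrable (\<lambda>x. f x + g x)" "L2_norm (\<lambda>x. f x + g x) \<le> L2_norm f + L2_norm g"
    by (rule square_integrable_sum[OF assms]; simp add: norm_triangle_ineq)+
qed

lemma square_integrable_cmult: "square_integrable f \<Longrightarrow> square_integrable (\<lambda>x. c * f x)"
  by (rule square_integrable_lift[where c="cmod c"]) (auto simp: norm_mult dest: square_integrable_measurable)

lemma L2_norm_cmult: "L2_norm (\<lambda>x. c * f x) = cmod c * L2_norm f"
  by (simp add: L2_norm_def norm_mult power_mult_distrib real_sqrt_mult)

lemma L2_norm_cong_AE:
  "AE x in lborel. f x = g x \<Longrightarrow> f \<in> borel_measurable borel \<Longrightarrow> g \<in> borel_measurable borel \<Longrightarrow> L2_norm f = L2_norm g"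
  unfolding L2_norm_def by (intro arg_cong[of _ _ sqrt] integral_cong_AE) (auto elim: eventually_mono)

lemma L2_norm_minus_commute: "L2_norm (\<lambda>x. f x - g x) = L2_norm (\<lambda>x. g x - f x)"
  by (simp add: L2_norm_def norm_minus_commute)

lemma L2_norm_triangle_diff:
  assumes "square_integrable f" "square_integrable g" "square_integrable h"
  shows "L2_norm (\<lambda>x. f x - h x) \<le> L2_norm (\<lambda>x. f x - g x) + L2_norm (\<lambda>x. g x - h x)"
  using square_integrable_add(2)[OF square_integrable_diff(1)[OF assms(1,2)] square_integrable_diff(1)[OF assms(2,3)]]
  by simp

lemma L2_norm_reverse_triangle:
  assumes "square_integrable f" "square_integrable g"
  shows "\<bar>L2_norm f - L2_norm g\<bar> \<le> L2_norm (\<lambda>x. f x - g x)"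
  using L2_norm_triangle_diff[of f g "\<lambda>_. 0"] L2_norm_triangle_diff[of g f "\<lambda>_. 0"] assms
  by (simp add: L2_norm_minus_commute[of f g] square_integrable_def abs_le_iff)

lemma L2_norm_eq_0D:
  assumes "square_integrable f" "L2_norm f = 0"
  shows "AE x in lborel. f x = 0"
proof -
  have "(NN x. (enorm (f x))\<^sup>2) = 0"
    using nn_integral_L2_norm[OF assms(1)] assms(2) by simp
  then show ?thesis
    using assms(1) by (subst (asm) nn_integral_0_iff_AE) (auto simp: square_integrable_def)
qed

lemma square_integrable_mult:
  assumes "square_integrable f" "square_integrable g"
  shows "integrable lborel (\<lambda>x. f x * g x)" "cmod (LBINT x. f x * g x) \<le> L2_norm f * L2_norm g"
proof -
  note [measurable] = square_integrable_measurable[OF assms(1)] square_integrable_measurable[OF assms(2)]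
  have *: "(NN x. ennreal (norm (f x * g x))) \<le> ennreal (L2_norm f * L2_norm g)"
    using b1_le[OF b2_mult[OF b2_L2_norm[OF assms(1)] b2_L2_norm[OF assms(2)]]]
    by (simp add: norm_mult ennreal_mult)
  show i: "integrable lborel (\<lambda>x. f x * g x)"
    using * by (intro integrableI_bounded) (auto intro: le_less_trans)
  have "enorm (LBINT x. f x * g x) \<le> ennreal (L2_norm f * L2_norm g)"
    using integral_norm_bound_ennreal[OF i] * by (rule order_trans)
  then show "cmod (LBINT x. f x * g x) \<le> L2_norm f * L2_norm g"
    by (simp add: ennreal_le_iff)
qed

text \<open>Fatou's lemma applied to the squares. It serves wherever a pointwise limit has to
  inherit a norm bound and no majorant is at hand.\<close>

lemma L2_norm_Fatou:
  assumes F: "\<And>n. square_integrable (F n)" and [measurable]: "G \<in> borel_measurable borel"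
    and lim: "AE x in lborel. (\<lambda>n. F n x) \<longlonglongrightarrow> G x"
    and le: "eventually (\<lambda>n. L2_norm (F n) \<le> a) sequentially"
  shows "square_integrable G" "L2_norm G \<le> a"
proof -
  note [measurable] = square_integrable_measurable[OF F]
  obtain n0 where "L2_norm (F n0) \<le> a" using le by (auto simp: eventually_sequentially)
  then have a: "0 \<le> a" using L2_norm_nonneg order_trans by blast
  have "(NN x. (enorm (G x))\<^sup>2) = (NN x. liminf (\<lambda>n. (enorm (F n x))\<^sup>2))"
  proof (rule nn_integral_cong_AE, use lim in eventually_elim)
    fix x assume "(\<lambda>n. F n x) \<longlonglongrightarrow> G x"
    then have "(\<lambda>n. ennreal ((cmod (F n x))\<^sup>2)) \<longlonglongrightarrow> ennreal ((cmod (G x))\<^sup>2)"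
      by (intro tendsto_ennrealI tendsto_intros)
    from lim_imp_Liminf[OF _ this]
    show "(enorm (G x))\<^sup>2 = liminf (\<lambda>n. (enorm (F n x))\<^sup>2)"
      by (simp add: ennreal_power)
  qed
  also have "\<dots> \<le> liminf (\<lambda>n. (NN x. (enorm (F n x))\<^sup>2))"
    by (rule nn_integral_liminf) simp
  also have "\<dots> = liminf (\<lambda>n. ennreal ((L2_norm (F n))\<^sup>2))"
    by (simp add: nn_integral_L2_norm[OF F])
  also have "\<dots> \<le> limsup (\<lambda>n. ennreal ((L2_norm (F n))\<^sup>2))"
    by (rule Liminf_le_Limsup) simp
  also have "\<dots> \<le> ennreal (a\<^sup>2)"
    using le by (intro Limsup_bounded) (auto elim!: eventually_mono intro!: ennreal_leI power_mono)
  finally have "b2 (\<lambda>x. enorm (G x)) a" using a by (simp add: b2_def)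
  then show "square_integrable G" "L2_norm G \<le> a"
    using L2_norm_le_b2 square_integrable_b2 by auto
qed

lemma integrable_indicator_Icc[simp]: fixes a b :: real shows "integrable lborel (indicat_real {a..b})"
  by (intro integrable_real_indicator) (auto simp: emeasure_lborel_Icc_eq)

lemma Fubini_bound:
  fixes h :: "real \<Rightarrow> real \<Rightarrow> complex"
  assumes [measurable]: "case_prod h \<in> borel_measurable (borel \<Otimes>\<^sub>M borel)"
    and f: "integrable lborel f" and g: "integrable lborel g"
    and le: "\<And>x y. cmod (h x y) \<le> f x * g y"
  shows "(LBINT x. LBINT y. h x y) = (LBINT y. LBINT x. h x y)"
proof -
  have [measurable]: "f \<in> borel_measurable borel" "g \<in> borel_measurable borel"
    using f g by auto
  have fg: "integrable (lborel \<Otimes>\<^sub>M lborel) (\<lambda>(x, y). f x * g y)"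
    using f g by (intro lborel_pair.Fubini_integrable) (auto simp: abs_mult)
  have "integrable (lborel \<Otimes>\<^sub>M lborel) (case_prod h)"
    by (rule Bochner_Integration.integrable_bound[OF fg])
      (auto intro!: AE_I2 order_trans[OF le abs_ge_self] simp del: abs_mult)
  from lborel_pair.Fubini_integral[OF this] show ?thesis by simp
qed

section \<open>Plancherel's theorem\<close>

definition FT :: "(real \<Rightarrow> complex) \<Rightarrow> real \<Rightarrow> complex" where
  "FT g \<xi> = (LBINT x. cis (- (\<xi> * x)) * g x)"

lemma measurable_cis[measurable]: "cis \<in> borel_measurable borel"
  by (intro borel_measurable_continuous_onI continuous_intros)

lemma measurable_cnj[measurable]: "cnj \<in> borel_measurable borel"
  by (intro borel_measurable_continuous_onI continuous_intros)

lemma LIMSEQ_ex_less: "f \<longlonglongrightarrow> (0::real) \<Longrightarrow> e > 0 \<Longrightarrow> \<exists>n. f n < e"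
  by (metis (no_types, lifting) eventually_sequentially order_refl order_tendstoD(2))

lemma cmod_FT_le: "cmod (FT g \<xi>) \<le> (LBINT x. cmod (g x))"
  unfolding FT_def by (rule order_trans[OF integral_norm_bound]) (simp add: norm_mult)

lemma measurable_FT[measurable]:
  assumes [measurable]: "g \<in> borel_measurable borel"
  shows "FT g \<in> borel_measurable borel"
  unfolding FT_def[abs_def] by measurable

lemma FT_cmult: "K * FT c \<xi> = (LBINT x. K * (cis (- (\<xi> * x)) * c x))"
  by (simp add: FT_def)

lemma integrable_cis_mult: "integrable lborel g \<Longrightarrow> integrable lborel (\<lambda>x. cis (- (\<xi> * x)) * g x)"
  by (rule Bochner_Integration.integrable_bound[where f=g]) (auto simp: norm_mult)

lemma FT_diff:
  assumes "integrable lborel f" "integrable lborel g"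
  shows "FT (\<lambda>x. f x - g x) \<xi> = FT f \<xi> - FT g \<xi>"
  unfolding FT_def right_diff_distrib
  by (intro Bochner_Integration.integral_diff integrable_cis_mult assms)

text \<open>The characteristic function of the standard normal distribution, rescaled by
  \<open>\<delta>\<close>.\<close>

lemma gauss_FT:
  assumes "\<delta> > 0"
  shows "(LBINT \<xi>. cis (\<xi> * x) * of_real (exp (- (\<delta> * \<xi>)\<^sup>2 / 2)))
     = of_real (sqrt (2 * pi) / \<delta> * exp (- (x / \<delta>)\<^sup>2 / 2))"
proof -
  have "complex_of_real (exp (- (x / \<delta>)\<^sup>2 / 2)) = char std_normal_distribution (x / \<delta>)"
    by (simp add: char_std_normal_distribution)
  also have "\<dots> = (LBINT y. std_normal_density y *\<^sub>R iexp (x / \<delta> * y))"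
    unfolding char_def by (subst integral_density) auto
  also have "\<dots> = (LBINT y. (1 / sqrt (2 * pi)) *\<^sub>R (cis (x / \<delta> * y) * of_real (exp (- y\<^sup>2 / 2))))"
    by (intro Bochner_Integration.integral_cong) (auto simp: std_normal_density_def cis_conv_exp scaleR_conv_of_real)
  also have "\<dots> = (1 / sqrt (2 * pi)) *\<^sub>R (LBINT y. cis (x / \<delta> * y) * of_real (exp (- y\<^sup>2 / 2)))"
    by simp
  also have "(LBINT y. cis (x / \<delta> * y) * of_real (exp (- y\<^sup>2 / 2))) =
      \<delta> *\<^sub>R (LBINT \<xi>. cis (\<xi> * x) * of_real (exp (- (\<delta> * \<xi>)\<^sup>2 / 2)))"
    using assms by (subst lborel_integral_real_affine[where c=\<delta> and t=0])
      (auto intro!: Bochner_Integration.integral_cong simp: mult.commute)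
  finally show ?thesis
    using assms by (simp add: scaleR_conv_of_real field_simps)
qed

lemma integrable_gauss:
  fixes \<delta> :: real
  assumes "\<delta> > 0"
  shows "integrable lborel (\<lambda>\<xi>. exp (- (\<delta> * \<xi>)\<^sup>2 / 2))"
proof -
  have "integrable lborel (\<lambda>x. sqrt (2 * pi) * std_normal_density x)"
    by simp
  from lborel_integrable_real_affine[OF this, of \<delta> 0] assms show ?thesis
    by (simp add: std_normal_density_def)
qed

text \<open>A Gaussian factor makes the iterated integral for \<open>|FT c|^2\<close> absolutely
  convergent. Exchanging the integrals turns it into \<open>2 pi\<close> times the pairing of
  \<open>c\<close> with its own Gaussian average at scale \<open>\<delta>\<close>. As
  \<open>\<delta>\<close> decreases to 0, monotone convergence applies on the frequency side and
  dominated convergence on the other.\<close>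

lemma Plancherel_continuous:
  fixes c :: "real \<Rightarrow> complex"
  assumes cont: "continuous_on UNIV c" and supp: "\<And>x. R < \<bar>x\<bar> \<Longrightarrow> c x = 0"
  shows "square_integrable (FT c)" "L2_norm (FT c) = sqrt (2 * pi) * L2_norm c"
    "integrable lborel c" "square_integrable c"
proof -
  have [measurable]: "c \<in> borel_measurable borel"
    using cont by (simp add: borel_measurable_continuous_onI)
  have "bounded (c ` {-R..R})"
    by (intro compact_imp_bounded compact_continuous_image continuous_on_subset[OF cont]) auto
  then obtain M0 where "\<forall>y\<in>c ` {-R..R}. cmod y \<le> M0"
    unfolding bounded_iff by blast
  then have M0: "\<And>x. x \<in> {-R..R} \<Longrightarrow> cmod (c x) \<le> M0" by blast
  define M where "M = max 0 M0"
  have M: "cmod (c x) \<le> M * indicator {-R..R} x" "cmod (c x) \<le> M" "0 \<le> M" for x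
  proof -
    have "R < \<bar>x\<bar> \<or> x \<in> {-R..R}" by auto
    then show "cmod (c x) \<le> M * indicator {-R..R} x" "cmod (c x) \<le> M" "0 \<le> M"
      using M0[of x] supp[of x] by (auto simp: M_def indicator_def)
  qed
  show ic: "integrable lborel c"
    by (rule Bochner_Integration.integrable_bound[where f="\<lambda>x. M * indicator {-R..R} x"])
      (use M in \<open>auto intro!: AE_I2 simp: abs_mult\<close>)
  have "integrable lborel (\<lambda>x. (cmod (c x))\<^sup>2)"
    by (rule Bochner_Integration.integrable_bound[where f="\<lambda>x. M * cmod (c x)"])
      (use M ic in \<open>auto intro!: AE_I2 mult_right_mono simp: abs_mult power2_eq_square\<close>)
  then show sc: "square_integrable c" by (simp add: square_integrable_def)
  define B where "B = (LBINT x. cmod (c x))"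
  have B: "cmod (FT c \<xi>) \<le> B" "0 \<le> B" for \<xi>
    using cmod_FT_le[of c] by (auto simp: B_def)
  have step: "(LBINT \<xi>. exp (- (\<delta> * \<xi>)\<^sup>2 / 2) * (cmod (FT c \<xi>))\<^sup>2) =
      2 * pi * Re (LBINT x. c x * cnj (LBINT z. std_normal_density z *\<^sub>R c (x + \<delta> * z)))"
    if "\<delta> > 0" for \<delta> :: real
  proof -
    let ?g = "\<lambda>\<xi>. complex_of_real (exp (- (\<delta> * \<xi>)\<^sup>2 / 2))"
    have "complex_of_real (LBINT \<xi>. exp (- (\<delta> * \<xi>)\<^sup>2 / 2) * (cmod (FT c \<xi>))\<^sup>2) =
       (LBINT \<xi>. ?g \<xi> * (FT c \<xi> * cnj (FT c \<xi>)))"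
      by (simp add: complex_norm_square[symmetric] flip: integral_complex_of_real)
    also have "\<dots> = (LBINT \<xi>. LBINT x. ?g \<xi> * cnj (FT c \<xi>) * (cis (- (\<xi> * x)) * c x))"
      by (simp only: FT_cmult[symmetric]) (simp add: ac_simps)
    also have "\<dots> = (LBINT x. LBINT \<xi>. ?g \<xi> * cnj (FT c \<xi>) * (cis (- (\<xi> * x)) * c x))"
    proof (rule Fubini_bound[where f="\<lambda>\<xi>. exp (- (\<delta> * \<xi>)\<^sup>2 / 2) * B" and g="\<lambda>x. cmod (c x)"])
      show "integrable lborel (\<lambda>\<xi>. exp (- (\<delta> * \<xi>)\<^sup>2 / 2) * B)"
        using integrable_gauss[OF that] by (rule integrable_mult_left)
      show "integrable lborel (\<lambda>x. cmod (c x))" using ic by simp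
    qed (use B in \<open>auto simp: norm_mult mult_right_mono\<close>)
    also have "\<dots> = (LBINT x. c x * cnj (LBINT \<xi>. ?g \<xi> * FT c \<xi> * cis (\<xi> * x)))"
    proof (rule Bochner_Integration.integral_cong[OF refl])
      fix x
      have "(LBINT \<xi>. ?g \<xi> * cnj (FT c \<xi>) * (cis (- (\<xi> * x)) * c x)) =
         c x * (LBINT \<xi>. cnj (?g \<xi> * FT c \<xi> * cis (\<xi> * x)))"
        by (subst integral_mult_right_zero[symmetric]) (simp add: cis_cnj ac_simps)
      then show "(LBINT \<xi>. ?g \<xi> * cnj (FT c \<xi>) * (cis (- (\<xi> * x)) * c x)) =
         c x * cnj (LBINT \<xi>. ?g \<xi> * FT c \<xi> * cis (\<xi> * x))" by (simp only: Bochner_Integration.integral_cnj)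
    qed
    also have "\<dots> = (LBINT x. c x * cnj (2 * pi * (LBINT z. std_normal_density z *\<^sub>R c (x + \<delta> * z))))"
    proof (intro Bochner_Integration.integral_cong arg_cong2[where f="(*)"] arg_cong[of _ _ cnj] refl)
      fix x
      have "(LBINT \<xi>. ?g \<xi> * FT c \<xi> * cis (\<xi> * x)) =
         (LBINT \<xi>. LBINT y. ?g \<xi> * cis (\<xi> * (x - y)) * c y)"
      proof -
        have eq: "?g \<xi> * cis (\<xi> * (x - y)) * c y = ?g \<xi> * cis (\<xi> * x) * (cis (- (\<xi> * y)) * c y)" for \<xi> y
          using cis_mult[of "\<xi> * x" "- (\<xi> * y)"] by (simp add: right_diff_distrib mult.assoc)
        show ?thesis by (simp only: eq FT_cmult[symmetric]) (simp only: ac_simps)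
      qed
      also have "\<dots> = (LBINT y. LBINT \<xi>. ?g \<xi> * cis (\<xi> * (x - y)) * c y)"
        by (rule Fubini_bound[where f="\<lambda>\<xi>. exp (- (\<delta> * \<xi>)\<^sup>2 / 2)" and g="\<lambda>x. cmod (c x)"])
          (use integrable_gauss[OF that] ic in \<open>auto simp: norm_mult\<close>)
      also have "\<dots> = (LBINT y. (LBINT \<xi>. cis (\<xi> * (x - y)) * ?g \<xi>) * c y)"
        by (simp add: ac_simps flip: integral_mult_right_zero)
      also have "\<dots> = (LBINT y. of_real (sqrt (2 * pi) / \<delta> * exp (- ((x - y) / \<delta>)\<^sup>2 / 2)) * c y)"
        by (simp only: gauss_FT[OF that])
      also have "\<dots> = \<delta> *\<^sub>R (LBINT z. of_real (sqrt (2 * pi) / \<delta> * exp (- (z)\<^sup>2 / 2)) * c (x + \<delta> * z))"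
        using that by (subst lborel_integral_real_affine[where c=\<delta> and t=x]) auto
      also have "\<dots> = (LBINT z. (2 * pi) *\<^sub>R (std_normal_density z *\<^sub>R c (x + \<delta> * z)))"
        using that by (subst integral_scaleR_right[symmetric], intro Bochner_Integration.integral_cong refl)
          (auto simp: std_normal_density_def scaleR_conv_of_real field_simps simp flip: of_real_mult)
      finally show "(LBINT \<xi>. ?g \<xi> * FT c \<xi> * cis (\<xi> * x)) =
         2 * pi * (LBINT z. std_normal_density z *\<^sub>R c (x + \<delta> * z))"
        by (simp add: scaleR_conv_of_real)
    qed
    also have "\<dots> = complex_of_real (2 * pi) * (LBINT x. c x * cnj (LBINT z. std_normal_density z *\<^sub>R c (x + \<delta> * z)))"
      by (subst integral_mult_right_zero[symmetric]) (simp add: ac_simps)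
    finally show ?thesis by (auto dest: arg_cong[of _ _ Re])
  qed
  \<comment> \<open>A decreasing sequence of scales, so that the Gaussian factors increase and
    monotone convergence is available.\<close>
  define d where "d n = 1 / real (Suc n)" for n
  have d0: "d n > 0" for n by (simp add: d_def)
  have dlim: "d \<longlonglongrightarrow> 0" unfolding d_def by (rule LIMSEQ_Suc[OF lim_1_over_n])
  have ddec: "d (Suc n) \<le> d n" for n by (simp add: d_def frac_le)
  have inner: "(\<lambda>n. LBINT z. std_normal_density z *\<^sub>R c (x + d n * z)) \<longlonglongrightarrow> c x" for x
  proof -
    have "(\<lambda>n. LBINT z. std_normal_density z *\<^sub>R c (x + d n * z)) \<longlonglongrightarrow>
        (LBINT z. std_normal_density z *\<^sub>R c x)"
    proof (rule integral_dominated_convergence[where w="\<lambda>z. std_normal_density z * M"])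
      show "AE z in lborel. (\<lambda>n. std_normal_density z *\<^sub>R c (x + d n * z)) \<longlonglongrightarrow> std_normal_density z *\<^sub>R c x"
      proof (rule AE_I2, intro tendsto_intros)
        fix z
        have "(\<lambda>n. x + d n * z) \<longlonglongrightarrow> x + 0 * z" by (intro tendsto_intros dlim)
        moreover have "isCont c x" using cont by (simp add: continuous_on_eq_continuous_at)
        ultimately show "(\<lambda>n. c (x + d n * z)) \<longlonglongrightarrow> c x" by (intro isCont_tendsto_compose[of x c]) simp_all
      qed
    qed (use M in \<open>auto intro!: mult_left_mono\<close>)
    also have "(LBINT z. std_normal_density z *\<^sub>R c x) = (LBINT z. std_normal_density z) *\<^sub>R c x"
      by (rule integral_scaleR_left) simp
    also have "\<dots> = c x" by simp
    finally show ?thesis .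
  qed
  have inner_le: "cmod (LBINT z. std_normal_density z *\<^sub>R c (x + d n * z)) \<le> M" for x n
  proof -
    have "cmod (LBINT z. std_normal_density z *\<^sub>R c (x + d n * z)) \<le> (LBINT z. std_normal_density z * M)"
      by (rule Bochner_Integration.integral_norm_bound_integral[OF Bochner_Integration.integrable_bound[where f="\<lambda>z. std_normal_density z * M"]])
        (use M in \<open>auto intro!: mult_left_mono simp: abs_mult\<close>)
    then show ?thesis by simp
  qed
  have "(\<lambda>n. LBINT x. c x * cnj (LBINT z. std_normal_density z *\<^sub>R c (x + d n * z))) \<longlonglongrightarrow>
      (LBINT x. c x * cnj (c x))"
    by (rule integral_dominated_convergence[where w="\<lambda>z. cmod (c z) * M"])
      (use M ic inner_le in \<open>auto intro!: tendsto_intros inner mult_left_mono simp: norm_mult\<close>)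
  moreover have "(LBINT x. c x * cnj (c x)) = complex_of_real ((L2_norm c)\<^sup>2)"
    by (simp add: L2_norm_def complex_norm_square[symmetric] integral_nonneg_AE flip: integral_complex_of_real)
  ultimately have R: "(\<lambda>n. LBINT \<xi>. exp (- (d n * \<xi>)\<^sup>2 / 2) * (cmod (FT c \<xi>))\<^sup>2) \<longlonglongrightarrow> 2 * pi * (L2_norm c)\<^sup>2"
    by (subst step[OF d0]) (auto intro!: tendsto_eq_intros)
  have L: "(\<lambda>n. (NN \<xi>. ennreal (exp (- (d n * \<xi>)\<^sup>2 / 2) * (cmod (FT c \<xi>))\<^sup>2))) \<longlonglongrightarrow>
      (NN \<xi>. ennreal ((cmod (FT c \<xi>))\<^sup>2))"
  proof (rule nn_integral_LIMSEQ)
    show "incseq (\<lambda>n \<xi>. ennreal (exp (- (d n * \<xi>)\<^sup>2 / 2) * (cmod (FT c \<xi>))\<^sup>2))"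
      using ddec d0 less_imp_le[OF d0]
      by (intro incseq_SucI) (auto simp: le_fun_def power_mult_distrib intro!: ennreal_leI mult_right_mono power_mono)
    fix \<xi>
    have "(\<lambda>n. exp (- (d n * \<xi>)\<^sup>2 / 2) * (cmod (FT c \<xi>))\<^sup>2) \<longlonglongrightarrow> exp (- (0 * \<xi>)\<^sup>2 / 2) * (cmod (FT c \<xi>))\<^sup>2"
      by (intro tendsto_intros dlim) simp
    then show "(\<lambda>n. ennreal (exp (- (d n * \<xi>)\<^sup>2 / 2) * (cmod (FT c \<xi>))\<^sup>2)) \<longlonglongrightarrow> ennreal ((cmod (FT c \<xi>))\<^sup>2)"
      by (intro tendsto_ennrealI) simp
  qed auto
  have "(NN \<xi>. ennreal (exp (- (d n * \<xi>)\<^sup>2 / 2) * (cmod (FT c \<xi>))\<^sup>2)) =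
     ennreal (LBINT \<xi>. exp (- (d n * \<xi>)\<^sup>2 / 2) * (cmod (FT c \<xi>))\<^sup>2)" for n
  proof (rule nn_integral_eq_integral)
    show "integrable lborel (\<lambda>\<xi>. exp (- (d n * \<xi>)\<^sup>2 / 2) * (cmod (FT c \<xi>))\<^sup>2)"
      by (rule Bochner_Integration.integrable_bound[where f="\<lambda>\<xi>. exp (- (d n * \<xi>)\<^sup>2 / 2) * B\<^sup>2"])
        (use B integrable_gauss[OF d0] in \<open>auto intro!: mult_left_mono power_mono simp: abs_mult\<close>)
  qed auto
  then have "(\<lambda>n. (NN \<xi>. ennreal (exp (- (d n * \<xi>)\<^sup>2 / 2) * (cmod (FT c \<xi>))\<^sup>2))) \<longlonglongrightarrow>
      ennreal (2 * pi * (L2_norm c)\<^sup>2)"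
    using R by (auto intro!: tendsto_ennrealI)
  with L have eq: "(NN \<xi>. ennreal ((cmod (FT c \<xi>))\<^sup>2)) = ennreal (2 * pi * (L2_norm c)\<^sup>2)"
    by (rule LIMSEQ_unique)
  then have b: "b2 (\<lambda>\<xi>. enorm (FT c \<xi>)) (sqrt (2 * pi) * L2_norm c)"
    by (auto simp: b2_def ennreal_power power_mult_distrib)
  then show s: "square_integrable (FT c)" by (auto simp: square_integrable_b2)
  have "ennreal ((L2_norm (FT c))\<^sup>2) = ennreal ((sqrt (2 * pi) * L2_norm c)\<^sup>2)"
    using nn_integral_L2_norm[OF s] eq by (simp add: ennreal_power power_mult_distrib)
  then show "L2_norm (FT c) = sqrt (2 * pi) * L2_norm c"
    by (simp add: ennreal_inj)
qed

text \<open>Two successive approximations, both by dominated convergence: truncation in height, then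
  continuous functions that converge almost everywhere and are forced into a common bound and a
  common support.\<close>

lemma continuous_approximation:
  fixes g :: "real \<Rightarrow> complex"
  assumes g: "square_integrable g" and supp: "\<And>x. R < \<bar>x\<bar> \<Longrightarrow> g x = 0"
  shows "\<exists>c. (\<forall>n. continuous_on UNIV (c n) \<and> (\<forall>x. R + 1 < \<bar>x\<bar> \<longrightarrow> c n x = 0)) \<and>
    (\<lambda>n. L2_norm (\<lambda>x. g x - c n x)) \<longlonglongrightarrow> 0"
proof -
  note [measurable] = square_integrable_measurable[OF g]
  have i2: "integrable lborel (\<lambda>x. (cmod (g x))\<^sup>2)" using g by (simp add: square_integrable_def)
  have ex: "\<exists>c. continuous_on UNIV c \<and> (\<forall>x. R + 1 < \<bar>x\<bar> \<longrightarrow> c x = 0) \<and> L2_norm (\<lambda>x. g x - c x) < e"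
    if "e > 0" for e
  proof -
    define h where "h n x = (if cmod (g x) \<le> real n then g x else 0)" for n x
    have [measurable]: "h n \<in> borel_measurable borel" for n unfolding h_def[abs_def] by measurable
    have "(\<lambda>n. LBINT x. (cmod (g x - h n x))\<^sup>2) \<longlonglongrightarrow> integral\<^sup>L lborel (\<lambda>x::real. 0::real)"
    proof (rule integral_dominated_convergence[where f="\<lambda>_. 0" and w="\<lambda>x. (cmod (g x))\<^sup>2"])
      show "AE x in lborel. (\<lambda>n. (cmod (g x - h n x))\<^sup>2) \<longlonglongrightarrow> 0"
      proof (rule AE_I2)
        fix x
        obtain N where "cmod (g x) \<le> real N" using real_arch_simple by blast
        then have "eventually (\<lambda>n. (cmod (g x - h n x))\<^sup>2 = 0) sequentially"
          unfolding eventually_sequentially h_def by (intro exI[of _ N]) auto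
        then show "(\<lambda>n. (cmod (g x - h n x))\<^sup>2) \<longlonglongrightarrow> 0" by (rule tendsto_eventually)
      qed
    qed (use i2 in \<open>auto simp: h_def\<close>)
    from tendsto_real_sqrt[OF this] have "(\<lambda>n. L2_norm (\<lambda>x. g x - h n x)) \<longlonglongrightarrow> 0"
      by (simp add: L2_norm_def)
    from LIMSEQ_ex_less[OF this half_gt_zero[OF that]] obtain N where N: "L2_norm (\<lambda>x. g x - h N x) < e / 2"
      by blast
    define M where "M = real N"
    have hM: "cmod (h N x) \<le> M" for x by (simp add: h_def M_def)
    \<comment> \<open>\<open>measurable_on\<close> supplies continuous functions converging to
      \<open>h N\<close> off a negligible set.\<close>
    have "h N measurable_on UNIV"
      by (rule lebesgue_measurable_imp_measurable_on) (auto intro!: measurable_completion)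
    then obtain Z k where Z: "negligible Z" and k: "\<And>n. continuous_on UNIV (k n)"
      and klim: "\<And>x. x \<notin> Z \<Longrightarrow> (\<lambda>n. k n x) \<longlonglongrightarrow> h N x"
      unfolding measurable_on_def by auto
    have "AE x in lebesgue. x \<notin> Z"
      by (rule AE_not_in) (use Z in \<open>simp add: negligible_iff_null_sets\<close>)
    then have AEZ: "AE x in lborel. x \<notin> Z" by (simp add: AE_completion_iff)
    define p where "p x = max 0 (min 1 (R + 1 - \<bar>x\<bar>))" for x :: real
    \<comment> \<open>The radial retraction onto the disc of radius \<open>M\<close>. It fixes the
      values of \<open>h N\<close>, so it preserves the limit while bounding the
      approximants.\<close>
    define cl where "cl y = (M / max M (cmod y)) *\<^sub>R y" for y :: complex
    define c where "c n x = p x *\<^sub>R cl (k n x)" for n x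
    have M0: "0 \<le> M" by (simp add: M_def)
    show ?thesis
    proof (cases "M = 0")
      case True
      then have "h N x = 0" for x using hM[of x] by simp
      then show ?thesis using N that by (intro exI[of _ "\<lambda>_. 0"]) auto
    next
      case False
      with M0 have Mp: "M > 0" by simp
      have clM: "cmod (cl y) \<le> M" for y
        using Mp by (auto simp: cl_def field_simps max_def)
      have clc: "continuous_on UNIV cl"
        unfolding cl_def[abs_def] using Mp by (intro continuous_intros) auto
      have cc: "continuous_on UNIV (c n)" for n
        unfolding c_def[abs_def] p_def
        by (intro continuous_intros continuous_on_compose2[OF clc] k) auto
      have [measurable]: "c n \<in> borel_measurable borel" for n
        by (intro borel_measurable_continuous_onI cc)
      have p: "0 \<le> p x" "p x \<le> 1" "R + 1 < \<bar>x\<bar> \<Longrightarrow> p x = 0" "\<bar>x\<bar> \<le> R \<Longrightarrow> p x = 1" for x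
        by (auto simp: p_def)
      have hs: "h N x = 0" if "R < \<bar>x\<bar>" for x using supp[OF that] by (simp add: h_def)
      have diffM: "(cmod (h N x - c n x))\<^sup>2 \<le> (2 * M)\<^sup>2 * indicator {-(R+1)..R+1} x" for n x
      proof (cases "R + 1 < \<bar>x\<bar>")
        case True
        then show ?thesis using hs[of x] p(3)[of x] by (simp add: c_def)
      next
        case False
        have "cmod (c n x) \<le> M"
          unfolding c_def using mult_mono[OF p(2)[of x] clM[of "k n x"]] p(1)[of x] by simp
        then have "cmod (h N x - c n x) \<le> 2 * M"
          using hM[of x] norm_triangle_ineq4[of "h N x" "c n x"] by simp
        then have "(cmod (h N x - c n x))\<^sup>2 \<le> (2 * M)\<^sup>2" by (intro power_mono) auto
        then show ?thesis using False by (auto simp: indicator_def)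
      qed
      have "(\<lambda>n. LBINT x. (cmod (h N x - c n x))\<^sup>2) \<longlonglongrightarrow> integral\<^sup>L lborel (\<lambda>x::real. 0::real)"
      proof (rule integral_dominated_convergence[where f="\<lambda>_. 0" and w="\<lambda>x. (2 * M)\<^sup>2 * indicator {-(R+1)..R+1} x"])
        show "AE x in lborel. (\<lambda>n. (cmod (h N x - c n x))\<^sup>2) \<longlonglongrightarrow> 0"
          using AEZ
        proof eventually_elim
          case (elim x)
          have "(\<lambda>n. c n x) \<longlonglongrightarrow> p x *\<^sub>R cl (h N x)"
            unfolding c_def using clc
            by (intro tendsto_intros isCont_tendsto_compose[OF _ klim[OF elim]])
              (simp add: continuous_on_eq_continuous_at)
          also have "p x *\<^sub>R cl (h N x) = h N x"
            using hs[of x] p(4)[of x] hM[of x] Mp by (cases "R < \<bar>x\<bar>") (auto simp: cl_def max_def)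
          finally have "(\<lambda>n. (cmod (h N x - c n x))\<^sup>2) \<longlonglongrightarrow> (cmod (h N x - h N x))\<^sup>2"
            by (intro tendsto_intros)
          then show ?case by simp
        qed
      qed (use diffM in auto)
      from tendsto_real_sqrt[OF this] have "(\<lambda>n. L2_norm (\<lambda>x. h N x - c n x)) \<longlonglongrightarrow> 0"
        by (simp add: L2_norm_def)
      from LIMSEQ_ex_less[OF this half_gt_zero[OF that]] obtain n where n: "L2_norm (\<lambda>x. h N x - c n x) < e / 2"
      by blast
      have sh: "square_integrable (h N)"
        by (rule square_integrable_lift[OF g, where c=1]) (auto simp: h_def)
      have sc: "square_integrable (c n)"
        by (rule Plancherel_continuous(4)[OF cc, where R="R+1"]) (simp add: c_def p)
      have "L2_norm (\<lambda>x. g x - c n x) < e"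
        using L2_norm_triangle_diff[OF g sh sc] N n by simp
      then show ?thesis using cc p(3) by (intro exI[of _ "c n"]) (auto simp: c_def)
    qed
  qed
  have "\<forall>n. \<exists>c. continuous_on UNIV c \<and> (\<forall>x. R + 1 < \<bar>x\<bar> \<longrightarrow> c x = 0) \<and> L2_norm (\<lambda>x. g x - c x) < 1 / real (Suc n)"
    by (intro allI ex) simp
  then obtain c where c: "\<And>n. continuous_on UNIV (c n)" "\<And>n x. R + 1 < \<bar>x\<bar> \<Longrightarrow> c n x = 0"
    "\<And>n. L2_norm (\<lambda>x. g x - c n x) < 1 / real (Suc n)"
    by metis
  have "(\<lambda>n. L2_norm (\<lambda>x. g x - c n x)) \<longlonglongrightarrow> 0"
    by (rule tendsto_sandwich[OF always_eventually always_eventually tendsto_const LIMSEQ_Suc[OF lim_1_over_n]])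
      (simp, intro allI less_imp_le c(3))
  then show ?thesis using c by blast
qed

lemma integrable_compact_support:
  assumes g: "square_integrable g" and supp: "\<And>x. R < \<bar>x\<bar> \<Longrightarrow> g x = 0"
  shows "integrable lborel g" "(LBINT x. cmod (g x)) \<le> sqrt (2 * \<bar>R\<bar>) * L2_norm g"
proof -
  note [measurable] = square_integrable_measurable[OF g]
  have i: "b2 (\<lambda>x. indicator {-\<bar>R\<bar>..\<bar>R\<bar>} x) (sqrt (2 * \<bar>R\<bar>))"
    by (auto simp: b2_def simp flip: indicator_inter_arith power2_eq_square intro!: eq_refl)
      (simp add: power2_eq_square flip: indicator_inter_arith)
  have eq: "enorm (g x) = indicator {-\<bar>R\<bar>..\<bar>R\<bar>} x * enorm (g x)" for x
    using supp[of x] by (auto simp: indicator_def)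
  have *: "(NN x. enorm (g x)) \<le> ennreal (sqrt (2 * \<bar>R\<bar>) * L2_norm g)"
    by (subst eq) (rule b1_le[OF b2_mult[OF i b2_L2_norm[OF g]]])
  show ig: "integrable lborel g"
    using * by (intro integrableI_bounded) (auto intro: le_less_trans)
  then show "(LBINT x. cmod (g x)) \<le> sqrt (2 * \<bar>R\<bar>) * L2_norm g"
    using * by (subst (asm) nn_integral_eq_integral) auto
qed

text \<open>The approximants live on one bounded interval, so \<open>L^2\<close> convergence implies
  \<open>L^1\<close> convergence and the transforms converge at every frequency. Fatou's lemma then
  carries the isometry from the differences \<open>c n - c m\<close> over to
  \<open>g - c m\<close>.\<close>

lemma Plancherel_compact_support:
  assumes g: "square_integrable g" and supp: "\<And>x. R < \<bar>x\<bar> \<Longrightarrow> g x = 0"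
  shows "square_integrable (FT g)" "L2_norm (FT g) = sqrt (2 * pi) * L2_norm g"
proof -
  note [measurable] = square_integrable_measurable[OF g]
  obtain c where c: "\<And>n. continuous_on UNIV (c n)" "\<And>n x. R + 1 < \<bar>x\<bar> \<Longrightarrow> c n x = 0"
    and lim: "(\<lambda>n. L2_norm (\<lambda>x. g x - c n x)) \<longlonglongrightarrow> 0"
    using continuous_approximation[OF assms] by blast
  have P: "square_integrable (FT (c n))" "L2_norm (FT (c n)) = sqrt (2 * pi) * L2_norm (c n)"
    "integrable lborel (c n)" "square_integrable (c n)" for n
    using Plancherel_continuous[of "c n" "R + 1"] c by auto
  have supp': "R + 1 < \<bar>x\<bar> \<Longrightarrow> g x = 0" for x using supp[of x] by simp
  have ig: "integrable lborel g" by (rule integrable_compact_support[OF g supp])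
  have sd: "square_integrable (\<lambda>x. g x - c n x)" for n by (intro square_integrable_diff g P)
  have FTlim: "(\<lambda>n. FT (c n) \<xi>) \<longlonglongrightarrow> FT g \<xi>" for \<xi>
  proof (rule LIM_zero_cancel, rule Lim_null_comparison)
    show "\<forall>\<^sub>F n in sequentially. norm (FT (c n) \<xi> - FT g \<xi>) \<le> sqrt (2 * \<bar>R + 1\<bar>) * L2_norm (\<lambda>x. g x - c n x)"
    proof (rule always_eventually, rule allI)
      fix n
      have "norm (FT (c n) \<xi> - FT g \<xi>) = cmod (FT (\<lambda>x. g x - c n x) \<xi>)"
        by (simp add: FT_diff[OF ig P(3)] norm_minus_commute)
      also have "\<dots> \<le> (LBINT x. cmod (g x - c n x))" by (rule cmod_FT_le)
      also have "\<dots> \<le> sqrt (2 * \<bar>R + 1\<bar>) * L2_norm (\<lambda>x. g x - c n x)"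
        by (rule integrable_compact_support[OF sd]) (simp add: c supp')
      finally show "norm (FT (c n) \<xi> - FT g \<xi>) \<le> sqrt (2 * \<bar>R + 1\<bar>) * L2_norm (\<lambda>x. g x - c n x)" .
    qed
    show "(\<lambda>n. sqrt (2 * \<bar>R + 1\<bar>) * L2_norm (\<lambda>x. g x - c n x)) \<longlonglongrightarrow> 0"
      using tendsto_mult_right_zero[OF lim] by simp
  qed
  have Pd: "L2_norm (\<lambda>\<xi>. FT (c n) \<xi> - FT (c m) \<xi>) = sqrt (2 * pi) * L2_norm (\<lambda>x. c n x - c m x)" for n m
    using Plancherel_continuous(2)[of "\<lambda>x. c n x - c m x" "R + 1"] c
    by (simp add: continuous_on_diff FT_diff[OF P(3) P(3), abs_def, symmetric])
  have dist: "square_integrable (\<lambda>\<xi>. FT g \<xi> - FT (c m) \<xi>) \<and>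
      L2_norm (\<lambda>\<xi>. FT g \<xi> - FT (c m) \<xi>) \<le> sqrt (2 * pi) * (e + L2_norm (\<lambda>x. g x - c m x))" if "e > 0" for e m
  proof -
    have ev: "eventually (\<lambda>n. L2_norm (\<lambda>\<xi>. FT (c n) \<xi> - FT (c m) \<xi>) \<le> sqrt (2 * pi) * (e + L2_norm (\<lambda>x. g x - c m x))) sequentially"
      using order_tendstoD(2)[OF lim that]
    proof eventually_elim
      case (elim n)
      have "L2_norm (\<lambda>x. c n x - c m x) \<le> e + L2_norm (\<lambda>x. g x - c m x)"
        using L2_norm_triangle_diff[OF P(4) g P(4), of n m] elim L2_norm_minus_commute[of "c n" g] by simp
      then show ?case unfolding Pd by (intro mult_left_mono) auto
    qed
    note [measurable] = square_integrable_measurable[OF P(1)[of m]]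
    have "AE \<xi> in lborel. (\<lambda>n. FT (c n) \<xi> - FT (c m) \<xi>) \<longlonglongrightarrow> FT g \<xi> - FT (c m) \<xi>"
      by (intro AE_I2 tendsto_diff FTlim tendsto_const)
    from L2_norm_Fatou[OF square_integrable_diff(1)[OF P(1) P(1)] _ this ev] show ?thesis
      by simp
  qed
  have "square_integrable (\<lambda>\<xi>. (FT g \<xi> - FT (c 0) \<xi>) + FT (c 0) \<xi>)"
    by (intro square_integrable_add P) (use dist[of 1 0] in auto)
  then show s: "square_integrable (FT g)" by simp
  have le: "L2_norm (\<lambda>\<xi>. FT g \<xi> - FT (c m) \<xi>) \<le> sqrt (2 * pi) * L2_norm (\<lambda>x. g x - c m x)" for m
  proof (rule field_le_epsilon)
    fix e :: real assume "e > 0"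
    then show "L2_norm (\<lambda>\<xi>. FT g \<xi> - FT (c m) \<xi>) \<le> sqrt (2 * pi) * L2_norm (\<lambda>x. g x - c m x) + e"
      using dist[of "e / sqrt (2 * pi)" m] by (simp add: distrib_left)
  qed
  have l1: "(\<lambda>n. L2_norm (FT (c n)) - L2_norm (FT g)) \<longlonglongrightarrow> 0"
    by (rule Lim_null_comparison[OF always_eventually tendsto_mult_right_zero[OF lim, of "sqrt (2 * pi)"]])
      (use L2_norm_reverse_triangle[OF P(1) s] le L2_norm_minus_commute[of "FT (c _)" "FT g"] in \<open>auto intro: order_trans\<close>)
  have l2: "(\<lambda>n. L2_norm (c n) - L2_norm g) \<longlonglongrightarrow> 0"
    by (rule Lim_null_comparison[OF always_eventually lim])
      (use L2_norm_reverse_triangle[OF P(4) g] L2_norm_minus_commute[of "c _" g] in auto)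
  have "(\<lambda>n. sqrt (2 * pi) * L2_norm (c n)) \<longlonglongrightarrow> L2_norm (FT g)"
    using LIM_zero_cancel[OF l1] by (simp add: P(2))
  moreover have "(\<lambda>n. sqrt (2 * pi) * L2_norm (c n)) \<longlonglongrightarrow> sqrt (2 * pi) * L2_norm g"
    by (intro tendsto_intros LIM_zero_cancel[OF l2])
  ultimately show "L2_norm (FT g) = sqrt (2 * pi) * L2_norm g" by (rule LIMSEQ_unique)
qed

section \<open>The transform as a limit in mean: isometry, existence, Parseval's identity\<close>

definition cut :: "real \<Rightarrow> (real \<Rightarrow> complex) \<Rightarrow> real \<Rightarrow> complex" where
  "cut R f x = indicator {-R..R} x *\<^sub>R f x"

lemma truncated_fourier_eq_FT: "truncated_fourier R f = FT (cut R f)"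
  unfolding truncated_fourier_def FT_def cut_def[abs_def] set_lebesgue_integral_def
  by (auto intro!: Bochner_Integration.integral_cong)

lemma measurable_cut[measurable]: "f \<in> borel_measurable borel \<Longrightarrow> cut R f \<in> borel_measurable borel"
  unfolding cut_def[abs_def] by simp

lemma square_integrable_cut: "square_integrable f \<Longrightarrow> square_integrable (cut R f)"
  by (rule square_integrable_lift[where c=1]) (auto simp: cut_def indicator_def square_integrable_measurable)

lemma cut_support: "R < \<bar>x\<bar> \<Longrightarrow> cut R f x = 0"
  by (auto simp: cut_def indicator_def)

lemma integrable_cut: "square_integrable f \<Longrightarrow> integrable lborel (cut R f)"
  by (rule integrable_compact_support(1)[OF square_integrable_cut cut_support])

lemma Plancherel_truncated:
  assumes "square_integrable f" 
  shows "square_integrable (truncated_fourier R f)" "L2_norm (truncated_fourier R f) = sqrt (2 * pi) * L2_norm (cut R f)"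
  unfolding truncated_fourier_eq_FT
  using Plancherel_compact_support[OF square_integrable_cut cut_support] assms by auto

lemma L2_norm_tail:
  assumes "square_integrable f"
  shows "((\<lambda>R. L2_norm (\<lambda>x. f x - cut R f x)) \<longlongrightarrow> 0) at_top"
proof -
  note [measurable] = square_integrable_measurable[OF assms]
  have "((\<lambda>R. LBINT x. (cmod (f x - cut R f x))\<^sup>2) \<longlongrightarrow> integral\<^sup>L lborel (\<lambda>x::real. 0::real)) at_top"
  proof (rule integral_dominated_convergence_at_top[where w="\<lambda>x. (cmod (f x))\<^sup>2"])
    show "AE x in lborel. ((\<lambda>R. (cmod (f x - cut R f x))\<^sup>2) \<longlongrightarrow> 0) at_top"
    proof (rule AE_I2)
      fix x
      have "eventually (\<lambda>R. (cmod (f x - cut R f x))\<^sup>2 = 0) at_top"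
        using eventually_ge_at_top[of "\<bar>x\<bar>"] by eventually_elim (auto simp: cut_def indicator_def)
      then show "((\<lambda>R. (cmod (f x - cut R f x))\<^sup>2) \<longlongrightarrow> 0) at_top" by (rule tendsto_eventually)
    qed
    show "\<forall>\<^sub>F R in at_top. AE x in lborel. norm ((cmod (f x - cut R f x))\<^sup>2) \<le> (cmod (f x))\<^sup>2"
      by (auto simp: cut_def indicator_def)
  qed (use assms in \<open>auto simp: square_integrable_def\<close>)
  from tendsto_real_sqrt[OF this] show ?thesis by (simp add: L2_norm_def)
qed

lemma L2_norm_cut:
  assumes "square_integrable f"
  shows "((\<lambda>R. L2_norm (cut R f)) \<longlongrightarrow> L2_norm f) at_top"
proof (rule LIM_zero_cancel, rule Lim_null_comparison[OF always_eventually L2_norm_tail[OF assms]], rule allI)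
  show "norm (L2_norm (cut R f) - L2_norm f) \<le> L2_norm (\<lambda>x. f x - cut R f x)" for R
    using L2_norm_reverse_triangle[OF square_integrable_cut assms, OF assms, of R]
    by (simp add: L2_norm_minus_commute[of "cut R f"])
qed

lemma truncated_fourier_lincomb:
  assumes "square_integrable f" "square_integrable g"
  shows "truncated_fourier R (\<lambda>x. a * f x + b * g x) \<xi> = a * truncated_fourier R f \<xi> + b * truncated_fourier R g \<xi>"
proof -
  have i: "integrable lborel (\<lambda>x. cis (- (\<xi> * x)) * cut R f x)" "integrable lborel (\<lambda>x. cis (- (\<xi> * x)) * cut R g x)"
    using assms by (auto intro!: integrable_cis_mult integrable_cut)
  have "truncated_fourier R (\<lambda>x. a * f x + b * g x) \<xi> =
     (LBINT x. a * (cis (- (\<xi> * x)) * cut R f x) + b * (cis (- (\<xi> * x)) * cut R g x))"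
    unfolding truncated_fourier_eq_FT FT_def
    by (intro Bochner_Integration.integral_cong) (auto simp: cut_def indicator_def algebra_simps)
  then show ?thesis using i by (simp add: truncated_fourier_eq_FT FT_def)
qed

lemma has_fourierD:
  assumes "has_fourier f F"
  shows "square_integrable f" "square_integrable F"
    "((\<lambda>R. L2_norm (\<lambda>\<xi>. truncated_fourier R f \<xi> - F \<xi>)) \<longlongrightarrow> 0) at_top"
  using assms by (auto simp: has_fourier_def)

lemma has_fourier_norm:
  assumes "has_fourier f F"
  shows "L2_norm F = sqrt (2 * pi) * L2_norm f"
proof -
  note h = has_fourierD[OF assms]
  have "((\<lambda>R. L2_norm (truncated_fourier R f)) \<longlongrightarrow> L2_norm F) at_top"
    by (rule LIM_zero_cancel, rule Lim_null_comparison[OF always_eventually h(3)])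
      (use L2_norm_reverse_triangle[OF Plancherel_truncated(1)[OF h(1)] h(2)] in simp)
  moreover have "((\<lambda>R. L2_norm (truncated_fourier R f)) \<longlongrightarrow> sqrt (2 * pi) * L2_norm f) at_top"
    unfolding Plancherel_truncated(2)[OF h(1)] by (intro tendsto_intros L2_norm_cut h)
  ultimately show ?thesis by (rule tendsto_unique[rotated]) simp
qed

lemma has_fourier_lincomb:
  assumes "has_fourier f F" "has_fourier g G"
  shows "has_fourier (\<lambda>x. a * f x + b * g x) (\<lambda>\<xi>. a * F \<xi> + b * G \<xi>)"
proof -
  note f = has_fourierD[OF assms(1)] and g = has_fourierD[OF assms(2)]
  note T = Plancherel_truncated(1)[OF f(1)] Plancherel_truncated(1)[OF g(1)]
  have "((\<lambda>R. L2_norm (\<lambda>\<xi>. truncated_fourier R (\<lambda>x. a * f x + b * g x) \<xi> - (a * F \<xi> + b * G \<xi>))) \<longlongrightarrow> 0) at_top"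
  proof (rule Lim_null_comparison[OF always_eventually], rule allI)
    fix R
    have "L2_norm (\<lambda>\<xi>. truncated_fourier R (\<lambda>x. a * f x + b * g x) \<xi> - (a * F \<xi> + b * G \<xi>)) =
       L2_norm (\<lambda>\<xi>. a * (truncated_fourier R f \<xi> - F \<xi>) + b * (truncated_fourier R g \<xi> - G \<xi>))"
      by (simp add: truncated_fourier_lincomb[OF f(1) g(1)] algebra_simps)
    also have "\<dots> \<le> cmod a * L2_norm (\<lambda>\<xi>. truncated_fourier R f \<xi> - F \<xi>) + cmod b * L2_norm (\<lambda>\<xi>. truncated_fourier R g \<xi> - G \<xi>)"
      using square_integrable_add(2)[OF square_integrable_cmult square_integrable_cmult, OF square_integrable_diff(1) square_integrable_diff(1)]
        T f g by (simp add: L2_norm_cmult)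
    finally show "norm (L2_norm (\<lambda>\<xi>. truncated_fourier R (\<lambda>x. a * f x + b * g x) \<xi> - (a * F \<xi> + b * G \<xi>))) \<le>
        cmod a * L2_norm (\<lambda>\<xi>. truncated_fourier R f \<xi> - F \<xi>) + cmod b * L2_norm (\<lambda>\<xi>. truncated_fourier R g \<xi> - G \<xi>)"
      by simp
  next
    show "((\<lambda>R. cmod a * L2_norm (\<lambda>\<xi>. truncated_fourier R f \<xi> - F \<xi>) + cmod b * L2_norm (\<lambda>\<xi>. truncated_fourier R g \<xi> - G \<xi>)) \<longlongrightarrow> 0) at_top"
      using f(3) g(3) by (auto intro!: tendsto_eq_intros)
  qed
  then show ?thesis using f g by (simp add: has_fourier_def square_integrable_add square_integrable_cmult)
qed

lemma has_fourier_diff: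
  "has_fourier f F \<Longrightarrow> has_fourier g G \<Longrightarrow> has_fourier (\<lambda>x. f x - g x) (\<lambda>\<xi>. F \<xi> - G \<xi>)"
  using has_fourier_lincomb[of f F g G 1 "-1"] by simp

text \<open>This makes the choice inside \<open>fourier\<close> harmless: by linearity and isometry
  the difference of two candidates has norm 0.\<close>

lemma has_fourier_unique_AE:
  assumes "has_fourier f F" "has_fourier g G" "AE x in lborel. f x = g x"
  shows "AE \<xi> in lborel. F \<xi> = G \<xi>"
proof -
  note h = has_fourier_diff[OF assms(1,2)]
  note m = square_integrable_measurable[OF has_fourierD(1)[OF h]]
  have "L2_norm (\<lambda>x. f x - g x) = L2_norm (\<lambda>x. 0)"
    by (rule L2_norm_cong_AE[OF _ m]) (use assms(3) in auto)
  then have "L2_norm (\<lambda>\<xi>. F \<xi> - G \<xi>) = 0"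
    using has_fourier_norm[OF h] by (simp add: L2_norm_def)
  from L2_norm_eq_0D[OF has_fourierD(2)[OF h] this] show ?thesis by simp
qed

text \<open>By isometry the truncated transforms form a Cauchy family in \<open>L^2\<close>. Along a
  rapidly convergent sequence \<open>r k\<close> they also converge almost everywhere, and Fatou's
  lemma identifies the pointwise limit as the limit in mean.\<close>

lemma has_fourier_exists:
  assumes f: "square_integrable f"
  shows "\<exists>F. has_fourier f F"
proof -
  define t where "t R = L2_norm (\<lambda>x. f x - cut R f x)" for R
  define c where "c = sqrt (2 * pi)"
  have c: "c > 0" by (simp add: c_def)
  have t0: "(t \<longlongrightarrow> 0) at_top" unfolding t_def by (rule L2_norm_tail[OF f])
  have tn: "0 \<le> t R" for R by (simp add: t_def)
  note T = Plancherel_truncated(1)[OF f]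
  have dist: "L2_norm (\<lambda>\<xi>. truncated_fourier R f \<xi> - truncated_fourier S f \<xi>) \<le> c * (t R + t S)" for R S
  proof -
    have eq: "(\<lambda>\<xi>. truncated_fourier R f \<xi> - truncated_fourier S f \<xi>) = FT (\<lambda>x. cut R f x - cut S f x)"
      by (rule ext) (simp add: truncated_fourier_eq_FT FT_diff integrable_cut f)
    have "L2_norm (\<lambda>\<xi>. truncated_fourier R f \<xi> - truncated_fourier S f \<xi>) = c * L2_norm (\<lambda>x. cut R f x - cut S f x)"
      unfolding c_def eq
      by (rule Plancherel_compact_support(2)[where R="max R S"])
        (auto intro!: square_integrable_diff square_integrable_cut f simp: cut_support)
    also have "L2_norm (\<lambda>x. cut R f x - cut S f x) \<le> t R + t S"
      using L2_norm_triangle_diff[OF square_integrable_cut[OF f] f square_integrable_cut[OF f], of R S]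
      by (simp add: t_def L2_norm_minus_commute[of "cut R f"])
    finally show ?thesis using c by simp
  qed
  have "\<exists>R. t R < (1/4)^k" for k :: nat
    using order_tendstoD(2)[OF t0, of "(1/4)^k"] by (auto dest: eventually_happens)
  then obtain r where r: "\<And>k. t (r k) < (1/4)^k" by metis
  define G where "G k = truncated_fourier (r k) f" for k
  have G: "square_integrable (G k)" for k by (simp add: G_def T)
  note [measurable] = square_integrable_measurable[OF G]
  define D where "D k \<xi> = G (Suc k) \<xi> - G k \<xi>" for k \<xi>
  have D: "square_integrable (D k)" for k unfolding D_def by (intro square_integrable_diff G)
  have [measurable]: "D k \<in> borel_measurable borel" for k unfolding D_def[abs_def] by measurable
  have Dn: "L2_norm (D k) \<le> 2 * c * (1/4)^k" for k
  proof -
    have "L2_norm (D k) \<le> c * (t (r (Suc k)) + t (r k))"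
      unfolding D_def G_def by (rule dist)
    also have "\<dots> \<le> c * ((1/4)^k + (1/4)^k)"
    proof (intro mult_left_mono add_mono)
      show "t (r k) \<le> (1/4)^k" using r by (rule less_imp_le)
      show "t (r (Suc k)) \<le> (1/4)^k"
        by (rule order_trans[OF less_imp_le[OF r] power_decreasing]) auto
    qed (use c in simp)
    finally show ?thesis by (simp only: mult_2 distrib_left distrib_right)
  qed
  \<comment> \<open>The squared norms of \<open>D k\<close> decay like \<open>16^(-k)\<close>, which
    leaves room for the weight \<open>4^k\<close>. Finiteness of the weighted sum at
    \<open>\<xi>\<close> then gives the pointwise geometric bound \<open>2^(-k)\<close> for
    \<open>D k \<xi>\<close>.\<close>
  have "(NN \<xi>. (\<Sum>k. ennreal (4^k) * (enorm (D k \<xi>))\<^sup>2)) = (\<Sum>k. (NN \<xi>. ennreal (4^k) * (enorm (D k \<xi>))\<^sup>2))"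
    by (rule nn_integral_suminf) simp
  also have "\<dots> = (\<Sum>k. ennreal (4^k * (L2_norm (D k))\<^sup>2))"
    by (intro suminf_cong) (simp add: nn_integral_cmult nn_integral_L2_norm[OF D] ennreal_mult)
  also have "\<dots> \<le> (\<Sum>k. ennreal (4 * c\<^sup>2 * (1/4)^k))"
  proof (intro suminf_le ennreal_leI)
    fix k
    have "4^k * (L2_norm (D k))\<^sup>2 \<le> 4^k * (2 * c * (1/4)^k)\<^sup>2"
      using Dn[of k] by (intro mult_left_mono power_mono) auto
    also have "\<dots> = 4 * c\<^sup>2 * (1/4)^k"
    proof -
      have "(4::real)^k * ((1/4)^k * (1/4)^k) = (1/4)^k"
        by (simp add: power_divide)
      then show ?thesis by (simp add: power2_eq_square ac_simps)
    qed
    finally show "4^k * (L2_norm (D k))\<^sup>2 \<le> 4 * c\<^sup>2 * (1/4)^k" .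
  qed auto
  also have "\<dots> = ennreal (\<Sum>k. 4 * c\<^sup>2 * (1/4)^k)"
    by (rule suminf_ennreal2[OF _ summable_mult[OF summable_geometric]]) auto
  finally have "(NN \<xi>. (\<Sum>k. ennreal (4^k) * (enorm (D k \<xi>))\<^sup>2)) \<noteq> \<infinity>"
    by (auto simp: top_unique)
  then have "AE \<xi> in lborel. (\<Sum>k. ennreal (4^k) * (enorm (D k \<xi>))\<^sup>2) \<noteq> \<infinity>"
    by (intro nn_integral_noteq_infinite) auto
  then have conv: "AE \<xi> in lborel. convergent (\<lambda>k. G k \<xi>)"
  proof eventually_elim
    case (elim \<xi>)
    then obtain C where C: "(\<Sum>k. ennreal (4^k) * (enorm (D k \<xi>))\<^sup>2) = ennreal C" "0 \<le> C"
      by (cases "(\<Sum>k. ennreal (4^k) * (enorm (D k \<xi>))\<^sup>2)") auto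
    have "cmod (D k \<xi>) \<le> sqrt C * (1/2)^k" for k
    proof -
      have "(\<Sum>j\<in>{k}. ennreal (4^j) * (enorm (D j \<xi>))\<^sup>2) \<le> (\<Sum>k. ennreal (4^k) * (enorm (D k \<xi>))\<^sup>2)"
        by (rule sum_le_suminf) auto
      then have "ennreal (4^k * (cmod (D k \<xi>))\<^sup>2) \<le> ennreal C"
        using C by (simp add: ennreal_mult ennreal_power)
      then have "4^k * (cmod (D k \<xi>))\<^sup>2 \<le> C" using C(2) by (simp add: ennreal_le_iff)
      then have "(2^k * cmod (D k \<xi>))\<^sup>2 \<le> C"
      proof -
        have "(4::real)^k = 2^k * 2^k" by (simp flip: power_mult_distrib)
        then show ?thesis using \<open>4^k * (cmod (D k \<xi>))\<^sup>2 \<le> C\<close> by (simp only: power2_eq_square ac_simps)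
      qed
      then have "2^k * cmod (D k \<xi>) \<le> sqrt C" by (rule real_le_rsqrt)
      then have "cmod (D k \<xi>) \<le> sqrt C / 2^k" by (subst pos_le_divide_eq) (auto simp: mult.commute)
      then show ?thesis by (simp only: power_one_over[symmetric] divide_inverse mult_1_left power_inverse)
    qed
    then have "summable (\<lambda>k. D k \<xi>)"
      using summable_comparison_test'[OF summable_mult[OF summable_geometric[of "1/2::real"], of "sqrt C"], of 0 "\<lambda>k. D k \<xi>"]
      by simp
    then have "convergent (\<lambda>n. \<Sum>k<n. D k \<xi>)" by (simp add: summable_iff_convergent)
    moreover have "(\<Sum>k<n. D k \<xi>) = G n \<xi> - G 0 \<xi>" for n
      unfolding D_def by (rule sum_lessThan_telescope)
    ultimately have "convergent (\<lambda>n. (G n \<xi> - G 0 \<xi>) + G 0 \<xi>)"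
      by (intro convergent_add convergent_const) simp
    then show ?case by simp
  qed
  define F where "F \<xi> = lim (\<lambda>k. G k \<xi>)" for \<xi>
  have [measurable]: "F \<in> borel_measurable borel"
    unfolding F_def[abs_def] by measurable
  have lim: "AE \<xi> in lborel. (\<lambda>k. G k \<xi>) \<longlonglongrightarrow> F \<xi>"
    using conv by eventually_elim (simp add: F_def convergent_LIMSEQ_iff)
  have tr: "(\<lambda>k. t (r k)) \<longlonglongrightarrow> 0"
    by (rule tendsto_sandwich[OF always_eventually always_eventually tendsto_const LIMSEQ_realpow_zero[of "1/4"]])
      (auto intro: less_imp_le r tn)
  have FT: "square_integrable (\<lambda>\<xi>. truncated_fourier R f \<xi> - F \<xi>) \<and>
     L2_norm (\<lambda>\<xi>. truncated_fourier R f \<xi> - F \<xi>) \<le> c * (t R + e)" if "e > 0" for R e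
  proof -
    have ev: "eventually (\<lambda>k. L2_norm (\<lambda>\<xi>. truncated_fourier R f \<xi> - G k \<xi>) \<le> c * (t R + e)) sequentially"
      using order_tendstoD(2)[OF tr that]
    proof eventually_elim
      case (elim k)
      have "c * (t R + t (r k)) \<le> c * (t R + e)" using elim c by (intro mult_left_mono) auto
      then show ?case unfolding G_def using dist[of R "r k"] by simp
    qed
    note [measurable] = square_integrable_measurable[OF T[of R]]
    have "AE \<xi> in lborel. (\<lambda>k. truncated_fourier R f \<xi> - G k \<xi>) \<longlonglongrightarrow> truncated_fourier R f \<xi> - F \<xi>"
      using lim by eventually_elim (intro tendsto_intros)
    from L2_norm_Fatou[OF square_integrable_diff(1)[OF T G] _ this ev] show ?thesis by simp
  qed
  have sF: "square_integrable F"
    using square_integrable_diff(1)[OF T[of 0] conjunct1[OF FT[OF zero_less_one]], of 0] by simp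
  have "L2_norm (\<lambda>\<xi>. truncated_fourier R f \<xi> - F \<xi>) \<le> c * t R" for R
  proof (rule field_le_epsilon)
    fix e :: real assume "e > 0"
    then have "L2_norm (\<lambda>\<xi>. truncated_fourier R f \<xi> - F \<xi>) \<le> c * (t R + e / c)"
      using conjunct2[OF FT[OF divide_pos_pos[OF _ c], of e R]] by blast
    also have "\<dots> = c * t R + e" using c by (simp add: distrib_left)
    finally show "L2_norm (\<lambda>\<xi>. truncated_fourier R f \<xi> - F \<xi>) \<le> c * t R + e" .
  qed
  then have "((\<lambda>R. L2_norm (\<lambda>\<xi>. truncated_fourier R f \<xi> - F \<xi>)) \<longlongrightarrow> 0) at_top"
    by (intro Lim_null_comparison[OF always_eventually tendsto_mult_right_zero[OF t0, of c]]) simp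
  then show ?thesis using f sF by (auto simp: has_fourier_def)
qed

lemma has_fourier_fourier: "square_integrable f \<Longrightarrow> has_fourier f (fourier f)"
  unfolding fourier_def by (rule someI_ex[OF has_fourier_exists])

lemma has_fourier_FT:
  assumes g: "square_integrable g" and supp: "\<And>x. R < \<bar>x\<bar> \<Longrightarrow> g x = 0"
  shows "has_fourier g (FT g)"
proof -
  have "eventually (\<lambda>S. L2_norm (\<lambda>\<xi>. truncated_fourier S g \<xi> - FT g \<xi>) = 0) at_top"
    using eventually_ge_at_top[of R]
  proof eventually_elim
    case (elim S)
    have "cut S g = g" using elim supp by (auto simp: cut_def indicator_def fun_eq_iff abs_if)
    then show ?case by (simp add: truncated_fourier_eq_FT L2_norm_def)
  qed
  then show ?thesis
    using g Plancherel_compact_support(1)[OF assms] by (auto simp: has_fourier_def intro: tendsto_eventually)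
qed

lemma L2_norm_affine: "\<bar>c\<bar> = 1 \<Longrightarrow> L2_norm (\<lambda>x. f (a + c * x)) = L2_norm f"
  unfolding L2_norm_def by (subst (2) lborel_integral_real_affine[where c=c and t=a]) auto

lemma square_integrable_affine:
  assumes "square_integrable f" "\<bar>c\<bar> = 1"
  shows "square_integrable (\<lambda>x. f (a + c * x))"
  using assms lborel_integrable_real_affine[of "\<lambda>x. (cmod (f x))\<^sup>2" c a]
  by (auto simp: square_integrable_def)

lemma has_fourier_modulate:
  assumes "has_fourier f F"
  shows "has_fourier (\<lambda>x. cis (- (a * x)) * f x) (\<lambda>\<xi>. F (\<xi> + a))"
proof -
  note f = has_fourierD[OF assms]
  have "truncated_fourier R (\<lambda>x. cis (- (a * x)) * f x) \<xi> = truncated_fourier R f (\<xi> + a)" for R \<xi>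
    unfolding truncated_fourier_def
    by (intro arg_cong[of _ _ "\<lambda>f. set_lebesgue_integral _ _ f"])
      (simp add: fun_eq_iff cis_mult distrib_right flip: mult.assoc)
  then have "L2_norm (\<lambda>\<xi>. truncated_fourier R (\<lambda>x. cis (- (a * x)) * f x) \<xi> - F (\<xi> + a)) =
      L2_norm (\<lambda>\<xi>. truncated_fourier R f \<xi> - F \<xi>)" for R
    using L2_norm_affine[of 1 "\<lambda>\<xi>. truncated_fourier R f \<xi> - F \<xi>" a] by (simp add: add.commute)
  moreover have "square_integrable (\<lambda>x. cis (- (a * x)) * f x)"
    by (rule square_integrable_lift[OF f(1), where c=1])
      (use square_integrable_measurable[OF f(1)] in \<open>auto simp: norm_mult\<close>)
  moreover have "square_integrable (\<lambda>\<xi>. F (\<xi> + a))"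
    using square_integrable_affine[OF f(2), of 1 a] by (simp add: add.commute)
  ultimately show ?thesis using f by (simp add: has_fourier_def)
qed

lemma has_fourier_cnj:
  assumes "has_fourier f F"
  shows "has_fourier (\<lambda>x. cnj (f x)) (\<lambda>\<xi>. cnj (F (- \<xi>)))"
proof -
  note f = has_fourierD[OF assms]
  have "truncated_fourier R (\<lambda>x. cnj (f x)) \<xi> = cnj (truncated_fourier R f (- \<xi>))" for R \<xi>
    unfolding truncated_fourier_def set_lebesgue_integral_def
    by (subst Bochner_Integration.integral_cnj[symmetric])
      (auto intro!: Bochner_Integration.integral_cong simp: cis_cnj)
  moreover have "L2_norm (\<lambda>\<xi>. cnj (truncated_fourier R f (-\<xi>)) - cnj (F (-\<xi>))) =
      L2_norm (\<lambda>\<xi>. truncated_fourier R f \<xi> - F \<xi>)" for R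
    using L2_norm_affine[of "-1" "\<lambda>\<xi>. truncated_fourier R f \<xi> - F \<xi>" 0]
    by (simp add: L2_norm_def flip: complex_cnj_diff)
  moreover have "square_integrable (\<lambda>x. cnj (f x))"
    by (rule square_integrable_lift[OF f(1), where c=1])
      (use square_integrable_measurable[OF f(1)] in auto)
  moreover have "square_integrable (\<lambda>\<xi>. cnj (F (- \<xi>)))"
    by (rule square_integrable_lift[where c=1 and f="\<lambda>\<xi>. F (-\<xi>)"])
      (use square_integrable_affine[OF f(2), of "-1" 0] square_integrable_measurable[OF f(2)] in auto)
  ultimately show ?thesis using f by (simp add: has_fourier_def)
qed

text \<open>The redundant factors \<open>1 *\<close> give all four norms the shape of
  \<open>has_fourier_lincomb\<close>, so that Parseval's identity follows from the isometry by
  rewriting.\<close>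

lemma L2_polarization:
  assumes "square_integrable f" "square_integrable g"
  shows "4 * (LBINT x. f x * cnj (g x)) =
    of_real ((L2_norm (\<lambda>x. 1 * f x + 1 * g x))\<^sup>2) - of_real ((L2_norm (\<lambda>x. 1 * f x + (-1) * g x))\<^sup>2)
    + \<i> * of_real ((L2_norm (\<lambda>x. 1 * f x + \<i> * g x))\<^sup>2) - \<i> * of_real ((L2_norm (\<lambda>x. 1 * f x + (-\<i>) * g x))\<^sup>2)"
proof -
  have s: "square_integrable (\<lambda>x. 1 * f x + b * g x)" for b
    by (intro square_integrable_add square_integrable_cmult assms)
  have L: "complex_of_real ((L2_norm h)\<^sup>2) = (LBINT x. h x * cnj (h x))" for h
    by (simp add: L2_norm_def complex_norm_square[symmetric] integral_nonneg_AE flip: integral_complex_of_real)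
  have i: "integrable lborel (\<lambda>x. (1 * f x + b * g x) * cnj (1 * f x + b * g x))" for b
    using s[of b] unfolding complex_norm_square[symmetric] square_integrable_def
    by (intro integrable_of_real) auto
  have "4 * (LBINT x. f x * cnj (g x)) = (LBINT x. 4 * (f x * cnj (g x)))" by simp
  also have "\<dots> = (LBINT x. (1 * f x + 1 * g x) * cnj (1 * f x + 1 * g x) -
     (1 * f x + (-1) * g x) * cnj (1 * f x + (-1) * g x) + \<i> * ((1 * f x + \<i> * g x) * cnj (1 * f x + \<i> * g x))
     - \<i> * ((1 * f x + (-\<i>) * g x) * cnj (1 * f x + (-\<i>) * g x)))"
    by (intro Bochner_Integration.integral_cong refl) (simp add: algebra_simps)
  also have "\<dots> = (LBINT x. (1 * f x + 1 * g x) * cnj (1 * f x + 1 * g x)) -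
     (LBINT x. (1 * f x + (-1) * g x) * cnj (1 * f x + (-1) * g x)) + \<i> * (LBINT x. (1 * f x + \<i> * g x) * cnj (1 * f x + \<i> * g x))
     - \<i> * (LBINT x. (1 * f x + (-\<i>) * g x) * cnj (1 * f x + (-\<i>) * g x))"
    by (simp only: Bochner_Integration.integral_diff Bochner_Integration.integral_add
       Bochner_Integration.integrable_diff Bochner_Integration.integrable_add i integrable_mult_right integral_mult_right_zero)
  finally show ?thesis unfolding L .
qed

lemma Parseval:
  assumes "has_fourier f F" "has_fourier g G"
  shows "2 * pi * (LBINT x. f x * cnj (g x)) = (LBINT \<xi>. F \<xi> * cnj (G \<xi>))"
proof -
  have "L2_norm (\<lambda>\<xi>. 1 * F \<xi> + b * G \<xi>) = sqrt (2 * pi) * L2_norm (\<lambda>x. 1 * f x + b * g x)" for b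
    by (rule has_fourier_norm[OF has_fourier_lincomb[OF assms]])
  then have "4 * (LBINT \<xi>. F \<xi> * cnj (G \<xi>)) = 2 * pi * (4 * (LBINT x. f x * cnj (g x)))"
    unfolding L2_polarization[OF has_fourierD(2)[OF assms(1)] has_fourierD(2)[OF assms(2)]]
      L2_polarization[OF has_fourierD(1)[OF assms(1)] has_fourierD(1)[OF assms(2)]]
    by (simp only:) (simp add: power_mult_distrib algebra_simps)
  then show ?thesis by simp
qed

text \<open>Parseval's identity for \<open>u\<close> and its modulation by
  \<open>cis (- (\<xi> * x))\<close>; as \<open>u\<close> is real, the product on the left is
  \<open>u^2\<close>. This is the convolution theorem at every single frequency, with no exceptional
  null set.\<close>

lemma FT_square:
  fixes u :: "real \<Rightarrow> real"
  assumes "has_fourier (\<lambda>x. of_real (u x)) F"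
  shows "2 * pi * FT (\<lambda>x. of_real ((u x)\<^sup>2)) \<xi> = (LBINT \<eta>. F (\<eta> + \<xi>) * cnj (F \<eta>))"
  using Parseval[OF has_fourier_modulate[OF assms, of \<xi>] assms]
  by (simp add: FT_def power2_eq_square mult.assoc)

section \<open>Convolution and trilinear estimates\<close>

lemma nn_integral_translate:
  fixes f :: "real \<Rightarrow> ennreal"
  assumes [measurable]: "f \<in> borel_measurable borel"
  shows "(NN x. f (a + x)) = (NN x. f x)"
    and "(NN x. f (x + a)) = (NN x. f x)"
    and "(NN x. f (a - x)) = (NN x. f x)"
    and "(NN x. f (- x - a)) = (NN x. f x)"
  using nn_integral_real_affine[of f 1 a] nn_integral_real_affine[of f "-1" a]
    nn_integral_real_affine[of f "-1" "-a"]
  by (auto simp: add.commute)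

definition conv :: "(real \<Rightarrow> ennreal) \<Rightarrow> (real \<Rightarrow> ennreal) \<Rightarrow> real \<Rightarrow> ennreal" where
  "conv A B \<xi> = (NN \<eta>. A \<eta> * B (\<xi> - \<eta>))"

lemma measurable_conv[measurable]:
  assumes [measurable]: "A \<in> borel_measurable borel" "B \<in> borel_measurable borel"
  shows "conv A B \<in> borel_measurable borel"
  unfolding conv_def[abs_def] by measurable

lemma conv_commute:
  assumes [measurable]: "A \<in> borel_measurable borel" "B \<in> borel_measurable borel"
  shows "conv A B \<xi> = conv B A \<xi>"
  using nn_integral_translate(3)[of "\<lambda>\<eta>. A \<eta> * B (\<xi> - \<eta>)" \<xi>] unfolding conv_def
  by (simp add: mult.commute)

lemma b1_conv:
  assumes A: "b1 A a" and B: "b1 B b"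
  shows "b1 (conv A B) (a * b)"
proof -
  note [measurable] = b1_measurable[OF A] b1_measurable[OF B]
  have "(NN \<xi>. conv A B \<xi>) = (NN \<eta>. NN \<xi>. A \<eta> * B (\<xi> - \<eta>))"
    unfolding conv_def by (rule lborel_pair.Fubini') measurable
  also have "\<dots> = (NN \<eta>. A \<eta> * (NN \<xi>. B \<xi>))"
    using nn_integral_translate(2)[of B "- _"] by (simp add: nn_integral_cmult)
  also have "\<dots> = (NN \<eta>. A \<eta>) * (NN \<xi>. B \<xi>)"
    by (simp add: nn_integral_multc)
  also have "\<dots> \<le> ennreal a * ennreal b"
    by (intro mult_mono b1_le assms) auto
  finally show ?thesis using b1_nonneg[OF A] b1_nonneg[OF B]
    by (simp add: b1_def ennreal_mult)
qed

text \<open>Young's inequality for \<open>L^1\<close> and \<open>L^2\<close>: the Cauchy-Schwarz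
  inequality with respect to the measure of density \<open>A\<close>, whose total mass is at most
  \<open>a\<close>.\<close>

lemma b2_conv:
  assumes A: "b1 A a" and B: "b2 B b"
  shows "b2 (conv A B) (a * b)"
proof -
  note [measurable] = b1_measurable[OF A] b2_measurable[OF B]
  have sq: "(conv A B \<xi>)\<^sup>2 \<le> ennreal a * (NN \<eta>. A \<eta> * (B (\<xi> - \<eta>))\<^sup>2)" for \<xi>
  proof -
    let ?M = "density lborel A"
    have "(conv A B \<xi>)\<^sup>2 = (\<integral>\<^sup>+\<eta>. 1 * B (\<xi> - \<eta>) \<partial>?M)\<^sup>2"
      unfolding conv_def by (simp add: nn_integral_density)
    also have "\<dots> \<le> (\<integral>\<^sup>+\<eta>. 1\<^sup>2 \<partial>?M) * (\<integral>\<^sup>+\<eta>. (B (\<xi> - \<eta>))\<^sup>2 \<partial>?M)"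
      by (rule Cauchy_Schwarz_nn_integral) auto
    also have "\<dots> = (NN \<eta>. A \<eta>) * (NN \<eta>. A \<eta> * (B (\<xi> - \<eta>))\<^sup>2)"
      by (simp add: nn_integral_density emeasure_density)
    also have "\<dots> \<le> ennreal a * (NN \<eta>. A \<eta> * (B (\<xi> - \<eta>))\<^sup>2)"
      by (intro mult_right_mono b1_le[OF A]) auto
    finally show ?thesis .
  qed
  have "(NN \<xi>. (conv A B \<xi>)\<^sup>2) \<le> (NN \<xi>. ennreal a * conv A (\<lambda>x. (B x)\<^sup>2) \<xi>)"
    unfolding conv_def[of A "\<lambda>x. (B x)\<^sup>2"] by (intro nn_integral_mono sq)
  also have "\<dots> = ennreal a * (NN \<xi>. conv A (\<lambda>x. (B x)\<^sup>2) \<xi>)"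
    by (simp add: nn_integral_cmult)
  also have "\<dots> \<le> ennreal a * ennreal (a * b\<^sup>2)"
    by (intro mult_left_mono b1_le[OF b1_conv[OF A]]) (use b2_le[OF B] in \<open>auto simp: b1_def\<close>)
  also have "\<dots> = ennreal ((a * b)\<^sup>2)"
    using b1_nonneg[OF A] by (simp add: ennreal_mult[symmetric] power2_eq_square ac_simps)
  finally show ?thesis using b1_nonneg[OF A] b2_nonneg[OF B] by (simp add: b2_def)
qed

text \<open>Cauchy-Schwarz in \<open>x\<close> at fixed \<open>\<eta>\<close>, uniformly by
  translation invariance. It applies when the factor in \<open>\<eta>\<close> carries no
  derivative.\<close>

lemma trilinear_L1:
  assumes A: "b2 A a" and B: "b2 B b" and C: "b1 C c"
  shows "(NN \<eta>. NN x. A x * B (x + \<eta>) * C \<eta>) \<le> ennreal (a * b * c)"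
proof -
  note [measurable] = b2_measurable[OF A] b2_measurable[OF B] b1_measurable[OF C]
  have B': "b2 (\<lambda>x. B (x + \<eta>)) b" for \<eta>
    using B nn_integral_translate(2)[of "\<lambda>x. (B x)\<^sup>2" \<eta>] by (simp add: b2_def)
  have "(NN \<eta>. NN x. A x * B (x + \<eta>) * C \<eta>) =
     (NN \<eta>. (NN x. A x * B (x + \<eta>)) * C \<eta>)"
    by (simp add: nn_integral_multc)
  also have "\<dots> \<le> (NN \<eta>. ennreal (a * b) * C \<eta>)"
    by (intro nn_integral_mono mult_right_mono b1_le[OF b2_mult[OF A B']]) auto
  also have "\<dots> = ennreal (a * b) * (NN \<eta>. C \<eta>)" by (simp add: nn_integral_cmult)
  also have "\<dots> \<le> ennreal (a * b) * ennreal c" by (intro mult_left_mono b1_le C) auto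
  finally show ?thesis using b2_nonneg[OF A] b2_nonneg[OF B] b1_nonneg[OF C] by (simp add: ennreal_mult)
qed

text \<open>The third factor is only in \<open>L\<^sup>2\<close>: one gains from the measure of the slices of the domain.\<close>

lemma trilinear_slices:
  assumes A: "b2 A a" and B: "b2 B b" and C: "b2 C c"
    and S[measurable]: "Measurable.pred (borel \<Otimes>\<^sub>M borel) (\<lambda>(\<eta>, x). S \<eta> x)"
    and \<mu>: "\<And>\<eta>. emeasure lborel {x. S \<eta> x} \<le> ennreal \<mu>" "0 \<le> \<mu>"
  shows "(NN \<eta>. NN x. A x * B (x + \<eta>) * C \<eta> * indicator {x. S \<eta> x} x) \<le> ennreal (sqrt \<mu> * a * b * c)"
proof -
  note [measurable] = b2_measurable[OF A] b2_measurable[OF B] b2_measurable[OF C]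
  have [measurable]: "Measurable.pred borel (S \<eta>)" for \<eta> by measurable
  define k where "k \<eta> = (NN x. A x * B (x + \<eta>) * indicator {x. S \<eta> x} x)" for \<eta>
  have [measurable]: "(\<lambda>(\<eta>, x). indicator {x. S \<eta> x} x :: ennreal) \<in> borel_measurable (borel \<Otimes>\<^sub>M borel)"
    unfolding indicator_def by measurable
  have km[measurable]: "k \<in> borel_measurable borel"
    unfolding k_def[abs_def] by measurable
  have k2: "(k \<eta>)\<^sup>2 \<le> ennreal \<mu> * (NN x. (A x)\<^sup>2 * (B (x + \<eta>))\<^sup>2)" for \<eta>
  proof -
    have "(k \<eta>)\<^sup>2 \<le> (NN x. (A x * B (x + \<eta>))\<^sup>2) * (NN x. (indicator {x. S \<eta> x} x)\<^sup>2)"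
      unfolding k_def by (rule Cauchy_Schwarz_nn_integral) auto
    also have "(NN x. (indicator {x. S \<eta> x} x)\<^sup>2) = (NN x. indicator {x. S \<eta> x} x)"
      by (intro nn_integral_cong) (auto simp: indicator_def)
    also have "\<dots> = emeasure lborel {x. S \<eta> x}" by simp
    also have "(NN x. (A x * B (x + \<eta>))\<^sup>2) * emeasure lborel {x. S \<eta> x} \<le>
       (NN x. (A x * B (x + \<eta>))\<^sup>2) * ennreal \<mu>"
      by (intro mult_left_mono \<mu>) auto
    finally show ?thesis by (simp add: power_mult_distrib mult.commute)
  qed
  have "(NN \<eta>. (k \<eta>)\<^sup>2) \<le> (NN \<eta>. ennreal \<mu> * (NN x. (A x)\<^sup>2 * (B (x + \<eta>))\<^sup>2))"
    by (intro nn_integral_mono k2)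
  also have "\<dots> = ennreal \<mu> * (NN \<eta>. NN x. (A x)\<^sup>2 * (B (x + \<eta>))\<^sup>2)"
    by (rule nn_integral_cmult) measurable
  also have "(NN \<eta>. NN x. (A x)\<^sup>2 * (B (x + \<eta>))\<^sup>2) =
     (NN x. NN \<eta>. (A x)\<^sup>2 * (B (x + \<eta>))\<^sup>2)"
    by (rule lborel_pair.Fubini') measurable
  also have "\<dots> = (NN x. (A x)\<^sup>2) * (NN \<eta>. (B \<eta>)\<^sup>2)"
    using nn_integral_translate(1)[of "\<lambda>x. (B x)\<^sup>2"] by (simp add: nn_integral_cmult nn_integral_multc)
  also have "ennreal \<mu> * \<dots> \<le> ennreal \<mu> * (ennreal (a\<^sup>2) * ennreal (b\<^sup>2))"
    by (intro mult_left_mono mult_mono b2_le A B) auto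
  also have "\<dots> = ennreal ((sqrt \<mu> * a * b)\<^sup>2)"
    using \<mu>(2) by (simp add: ennreal_mult power_mult_distrib mult.assoc)
  finally have "b2 k (sqrt \<mu> * a * b)"
    using b2_nonneg[OF A] b2_nonneg[OF B] \<mu>(2) by (simp add: b2_def)
  from b1_le[OF b2_mult[OF this C]]
  have "(NN \<eta>. k \<eta> * C \<eta>) \<le> ennreal (sqrt \<mu> * a * b * c)" .
  also have "(NN \<eta>. k \<eta> * C \<eta>) =
     (NN \<eta>. NN x. A x * B (x + \<eta>) * C \<eta> * indicator {x. S \<eta> x} x)"
    unfolding k_def by (intro nn_integral_cong, subst nn_integral_multc[symmetric]) (auto simp: ac_simps)
  finally show ?thesis .
qed

text \<open>Cauchy-Schwarz against \<open>1 / sqrt (1 + x^2)\<close>, whose square has integral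
  \<open>pi\<close>; the factor 2 comes from \<open>pi <= 2^2\<close>. This is how an
  \<open>H^1\<close> bound makes the transform integrable.\<close>

lemma b1_weighted:
  assumes "b2 (\<lambda>\<xi>. ennreal (sqrt (1 + \<xi>\<^sup>2)) * A \<xi>) h" and [measurable]: "A \<in> borel_measurable borel"
  shows "b1 A (2 * h)"
proof -
  have "(NN x. ennreal (inverse (1 + x\<^sup>2))) = ennreal (LBINT x. inverse (1 + x\<^sup>2))"
    using integrable_inverse_1_plus_square
    by (intro nn_integral_eq_integral) (auto simp: set_integrable_def)
  also have "(LBINT x. inverse (1 + x\<^sup>2)) = pi"
    using LBINT_inverse_1_plus_square by (simp add: interval_lebesgue_integral_def set_lebesgue_integral_def)
  finally have *: "b2 (\<lambda>x. ennreal (inverse (sqrt (1 + x\<^sup>2)))) 2"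
    using ennreal_leI[of pi 4] pi_less_4 by (simp add: b2_def ennreal_power power_inverse)
  have "b1 (\<lambda>\<xi>. ennreal (inverse (sqrt (1 + \<xi>\<^sup>2))) * (ennreal (sqrt (1 + \<xi>\<^sup>2)) * A \<xi>)) (2 * h)"
    by (rule b2_mult[OF * assms(1)])
  also have "(\<lambda>\<xi>. ennreal (inverse (sqrt (1 + \<xi>\<^sup>2))) * (ennreal (sqrt (1 + \<xi>\<^sup>2)) * A \<xi>)) = A"
  proof
    fix \<xi> :: real
    have "sqrt (1 + \<xi>\<^sup>2) \<noteq> 0" by (simp add: add_pos_nonneg less_imp_neq[symmetric])
    then show "ennreal (inverse (sqrt (1 + \<xi>\<^sup>2))) * (ennreal (sqrt (1 + \<xi>\<^sup>2)) * A \<xi>) = A \<xi>"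
      by (simp add: mult.assoc[symmetric] flip: ennreal_mult)
  qed
  finally show ?thesis .
qed

section \<open>Admissible weights\<close>

text \<open>\<open>W\<close> is even, nondecreasing in \<open>|x|\<close>, and
  \<open>W x / |x|^c\<close> is nonincreasing; the quotient is multiplied out so that the origin
  needs no exception. As no derivative of \<open>W\<close> occurs, the class is stable under
  \<open>min\<close>, which both the bounded truncations and \<open>tail_weight\<close>
  require.\<close>

definition adm :: "nat \<Rightarrow> (real \<Rightarrow> real) \<Rightarrow> bool" where
  "adm c W \<longleftrightarrow> W \<in> borel_measurable borel \<and> (\<forall>x. 0 \<le> W x) \<and>
     (\<forall>x y. \<bar>y\<bar> \<le> \<bar>x\<bar> \<longrightarrow> W y \<le> W x \<and> W x * \<bar>y\<bar>^c \<le> W y * \<bar>x\<bar>^c)"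

lemma admD:
  assumes "adm c W"
  shows "W \<in> borel_measurable borel" "0 \<le> W x" "\<bar>y\<bar> \<le> \<bar>x\<bar> \<Longrightarrow> W y \<le> W x"
    "\<bar>y\<bar> \<le> \<bar>x\<bar> \<Longrightarrow> W x * \<bar>y\<bar>^c \<le> W y * \<bar>x\<bar>^c"
  using assms by (auto simp: adm_def)

lemma adm_even: "adm c W \<Longrightarrow> W (- x) = W x"
  using admD(3)[of c W x "-x"] admD(3)[of c W "-x" x] by simp

lemma adm_const: "0 \<le> r \<Longrightarrow> adm c (\<lambda>_. r)"
  by (auto simp: adm_def intro!: mult_left_mono power_mono)

lemma adm_min:
  assumes V: "adm c V" and W: "adm c W"
  shows "adm c (\<lambda>x. min (V x) (W x))"
  unfolding adm_def
proof (intro conjI allI impI)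
  note [measurable] = admD(1)[OF V] admD(1)[OF W]
  show "(\<lambda>x. min (V x) (W x)) \<in> borel_measurable borel" by measurable
  show "0 \<le> min (V x) (W x)" for x using admD(2)[OF V] admD(2)[OF W] by simp
  fix x y :: real assume xy: "\<bar>y\<bar> \<le> \<bar>x\<bar>"
  show "min (V y) (W y) \<le> min (V x) (W x)" by (intro min.mono admD(3)[OF V xy] admD(3)[OF W xy])
  have "min (V x) (W x) * \<bar>y\<bar>^c \<le> V y * \<bar>x\<bar>^c"
    by (rule order_trans[OF mult_right_mono[OF min.cobounded1] admD(4)[OF V xy]]) simp
  moreover have "min (V x) (W x) * \<bar>y\<bar>^c \<le> W y * \<bar>x\<bar>^c"
    by (rule order_trans[OF mult_right_mono[OF min.cobounded2] admD(4)[OF W xy]]) simp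
  ultimately show "min (V x) (W x) * \<bar>y\<bar>^c \<le> min (V y) (W y) * \<bar>x\<bar>^c"
    by (cases "V y \<le> W y") (simp_all add: min_absorb1 min_absorb2)
qed

lemma adm_cmult: "adm c W \<Longrightarrow> 0 \<le> r \<Longrightarrow> adm c (\<lambda>x. r * W x)"
  by (auto simp: adm_def mult.assoc intro!: mult_left_mono)

text \<open>For \<open>|y| <= |x|\<close> the quotient \<open>(1 + x^2) / (1 + y^2)\<close> is at
  most \<open>(x / y)^2\<close>; after taking the power \<open>s\<close>, the exponent
  \<open>2 * s\<close> is enlarged to \<open>c\<close> because the base is at least 1.\<close>

lemma adm_bessel:
  assumes "0 \<le> s" "2 * s \<le> real c"
  shows "adm c (\<lambda>x. (1 + x\<^sup>2) powr s)"
  unfolding adm_def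
proof (intro conjI allI impI)
  fix x y :: real assume xy: "\<bar>y\<bar> \<le> \<bar>x\<bar>"
  then have sq: "y\<^sup>2 \<le> x\<^sup>2" by (simp add: abs_le_square_iff)
  then show "(1 + y\<^sup>2) powr s \<le> (1 + x\<^sup>2) powr s" by (intro powr_mono2 assms) auto
  have pos: "1 + y\<^sup>2 > 0" "1 + x\<^sup>2 > 0" by (auto intro: add_pos_nonneg)
  show "(1 + x\<^sup>2) powr s * \<bar>y\<bar>^c \<le> (1 + y\<^sup>2) powr s * \<bar>x\<bar>^c"
  proof (cases "y = 0")
    case True
    have "0 < c \<or> s = 0" using assms by auto
    then show ?thesis using True by (cases "c = 0") (auto simp: zero_power)
  next
    case False
    then have y: "\<bar>y\<bar> > 0" and r: "\<bar>x\<bar> / \<bar>y\<bar> \<ge> 1" using xy by auto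
    have "(1 + x\<^sup>2) * y\<^sup>2 \<le> (1 + y\<^sup>2) * x\<^sup>2" using sq by (simp add: algebra_simps)
    then have "(1 + x\<^sup>2) * y\<^sup>2 \<le> x\<^sup>2 * (1 + y\<^sup>2)" by (simp only: mult.commute)
    then have "1 + x\<^sup>2 \<le> x\<^sup>2 * (1 + y\<^sup>2) / y\<^sup>2" using False by (intro mult_imp_le_div_pos) auto
    then have "1 + x\<^sup>2 \<le> (\<bar>x\<bar> / \<bar>y\<bar>)\<^sup>2 * (1 + y\<^sup>2)" by (simp add: power_divide)
    then have "(1 + x\<^sup>2) / (1 + y\<^sup>2) \<le> (\<bar>x\<bar> / \<bar>y\<bar>)\<^sup>2"
      using pos(1) by (intro mult_imp_div_pos_le)
    then have "((1 + x\<^sup>2) / (1 + y\<^sup>2)) powr s \<le> ((\<bar>x\<bar> / \<bar>y\<bar>)\<^sup>2) powr s"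
      using pos assms by (intro powr_mono2) auto
    also have "((\<bar>x\<bar> / \<bar>y\<bar>)\<^sup>2) powr s = (\<bar>x\<bar> / \<bar>y\<bar>) powr (2 * s)"
    proof -
      have "(\<bar>x\<bar> / \<bar>y\<bar>)\<^sup>2 = (\<bar>x\<bar> / \<bar>y\<bar>) powr 2" using r by (subst powr_numeral) auto
      then show ?thesis by (simp only: powr_powr)
    qed
    also have "\<dots> \<le> (\<bar>x\<bar> / \<bar>y\<bar>) powr (real c)"
      using r assms by (intro powr_mono) auto
    also have "\<dots> = (\<bar>x\<bar> / \<bar>y\<bar>)^c" using r y xy by (subst powr_realpow) auto
    finally have "(1 + x\<^sup>2) powr s / (1 + y\<^sup>2) powr s \<le> \<bar>x\<bar>^c / \<bar>y\<bar>^c"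
      by (simp add: powr_divide power_divide)
    then have "(1 + x\<^sup>2) powr s / (1 + y\<^sup>2) powr s * ((1 + y\<^sup>2) powr s * \<bar>y\<bar>^c) \<le>
        \<bar>x\<bar>^c / \<bar>y\<bar>^c * ((1 + y\<^sup>2) powr s * \<bar>y\<bar>^c)"
      by (rule mult_right_mono) auto
    then show ?thesis using pos(1) y by (simp add: mult.commute)
  qed
qed auto

lemma adm_double:
  assumes W: "adm c W" and le: "\<bar>x\<bar> \<le> 2 * \<bar>y\<bar>"
  shows "W x \<le> 2^c * W y"
proof (cases "\<bar>y\<bar> \<le> \<bar>x\<bar>")
  case True
  show ?thesis
  proof (cases "y = 0")
    case True
    then show ?thesis using le admD(2)[OF W, of 0] mult_right_mono[of 1 "2^c" "W 0"] by simp
  next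
    case False
    have "W x * \<bar>y\<bar>^c \<le> W y * \<bar>x\<bar>^c" by (rule admD(4)[OF W True])
    also have "\<dots> \<le> W y * (2 * \<bar>y\<bar>)^c"
      using le by (intro mult_left_mono power_mono admD[OF W]) auto
    finally show ?thesis using False by (simp add: power_mult_distrib mult.commute)
  qed
next
  case False
  then have "W x \<le> 1 * W y" using admD(3)[OF W, of x y] by simp
  also have "\<dots> \<le> 2^c * W y" by (intro mult_right_mono admD[OF W]) auto
  finally show ?thesis .
qed

lemma adm_sqrt_double:
  assumes W: "adm c W" and le: "\<bar>x\<bar> \<le> 2 * \<bar>y\<bar>"
  shows "sqrt (W x) \<le> 2^c * sqrt (W y)"
proof -
  have "1 \<le> (2::real)^c" by simp
  then have "(2::real)^c * 1 \<le> 2^c * 2^c" by (intro mult_left_mono) auto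
  then have "2^c * W y \<le> (2^c)\<^sup>2 * W y"
    by (intro mult_right_mono admD[OF W]) (simp add: power2_eq_square)
  then have "W x \<le> (2^c)\<^sup>2 * W y" using adm_double[OF assms] by simp
  then have "sqrt (W x) \<le> sqrt ((2^c)\<^sup>2 * W y)" by simp
  then show ?thesis by (simp add: real_sqrt_mult)
qed

lemma adm_sqrt_add:
  assumes W: "adm c W"
  shows "sqrt (W (x + y)) \<le> 2^c * (sqrt (W x) + sqrt (W y))"
proof -
  have "0 \<le> sqrt (W x)" "0 \<le> sqrt (W y)" using admD(2)[OF W] by auto
  then have p: "0 \<le> 2^c * sqrt (W x)" "0 \<le> 2^c * sqrt (W y)" by auto
  have "\<bar>x + y\<bar> \<le> 2 * \<bar>x\<bar> \<or> \<bar>x + y\<bar> \<le> 2 * \<bar>y\<bar>" by linarith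
  then show ?thesis
    using adm_sqrt_double[OF W, of "x + y" x] adm_sqrt_double[OF W, of "x + y" y] p
    by (auto simp: distrib_left)
qed

text \<open>A mean value inequality without derivatives. With \<open>r = |y| / |x|\<close> the
  growth condition says \<open>W x * r^c <= W y\<close>, and Bernoulli's inequality bounds
  \<open>r^c\<close> from below by \<open>1 + c * (r - 1)\<close>.\<close>

lemma adm_diff:
  assumes W: "adm c W" and le: "\<bar>y\<bar> \<le> \<bar>x\<bar>"
  shows "(W x - W y) * \<bar>y\<bar> \<le> c * W x * (\<bar>x\<bar> - \<bar>y\<bar>)"
proof (cases "x = 0")
  case False
  define r where "r = \<bar>y\<bar> / \<bar>x\<bar>"
  have r: "0 \<le> r" "r \<le> 1" "\<bar>y\<bar> = r * \<bar>x\<bar>" using False le by (auto simp: r_def)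
  have "W x * r^c * \<bar>x\<bar>^c \<le> W y * \<bar>x\<bar>^c"
    using admD(4)[OF W le] by (simp add: r(3) power_mult_distrib mult.assoc)
  then have 1: "W x * r^c \<le> W y" using False by simp
  have "1 + real c * (r - 1) \<le> (1 + (r - 1))^c" using r by (intro Bernoulli_inequality) simp
  then have "W x * (1 + real c * (r - 1)) \<le> W x * r^c"
    by (intro mult_left_mono admD[OF W]) simp
  with 1 have "W x - W y \<le> c * W x * (1 - r)" by (simp add: algebra_simps)
  then have "(W x - W y) * \<bar>y\<bar> \<le> c * W x * (1 - r) * \<bar>y\<bar>" by (intro mult_right_mono) auto
  also have "\<dots> = c * W x * (r * (\<bar>x\<bar> - \<bar>y\<bar>))" by (simp add: r(3) algebra_simps)
  also have "\<dots> \<le> c * W x * (\<bar>x\<bar> - \<bar>y\<bar>)"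
    using mult_right_mono[OF r(2), of "\<bar>x\<bar> - \<bar>y\<bar>"] le admD(2)[OF W, of x] by (intro mult_left_mono) auto
  finally show ?thesis .
qed (use le in simp)

text \<open>Symmetrisation of the symbol of \<open>d/dt \<integral> W |f|\<^sup>2\<close>; on \<open>x + y + z = 0\<close> it gains a factor
  of the size of the lowest frequency.\<close>

definition energy_symbol :: "(real \<Rightarrow> real) \<Rightarrow> real \<Rightarrow> real \<Rightarrow> real \<Rightarrow> real" where
  "energy_symbol W x y z = W x * x + W y * y + W z * z"

text \<open>The two high frequencies nearly cancel: \<open>W x * x + W y * y\<close> equals
  \<open>- W x * z - (W x - W y) * y\<close>, and \<open>adm_diff\<close> bounds the last term by a
  multiple of \<open>W x * |z|\<close>. Since the high frequencies are within a factor 2 of each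
  other, \<open>W x\<close> can be shared between them as \<open>sqrt (W x) * sqrt (W y)\<close>,
  one root for each \<open>L^2\<close> factor.\<close>

lemma energy_symbol_bound:
  assumes W: "adm c W" and s: "x + y + z = 0" and z: "\<bar>z\<bar> \<le> \<bar>x\<bar>" "\<bar>z\<bar> \<le> \<bar>y\<bar>"
  shows "\<bar>energy_symbol W x y z\<bar> \<le> (2 + real c) * 2^c * (sqrt (W x) * sqrt (W y) * \<bar>z\<bar>)"
proof -
  have main: "\<bar>energy_symbol W x y z\<bar> \<le> (2 + real c) * 2^c * (sqrt (W x) * sqrt (W y) * \<bar>z\<bar>)"
    if s: "x + y + z = 0" and z: "\<bar>z\<bar> \<le> \<bar>y\<bar>" "\<bar>y\<bar> \<le> \<bar>x\<bar>" for x y z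
  proof -
    have x: "x = - y - z" using s by simp
    have Wx: "0 \<le> W x" "W y \<le> W x" "W z \<le> W x" "0 \<le> W y" "0 \<le> W z"
      using admD(2,3)[OF W] z by auto
    have "\<bar>W z * z\<bar> \<le> W x * \<bar>z\<bar>" using Wx by (simp add: abs_mult mult_right_mono)
    moreover have "\<bar>W x * x + W y * y\<bar> \<le> W x * \<bar>z\<bar> + (W x - W y) * \<bar>y\<bar>"
    proof -
      have "W x * x + W y * y = - (W x * z) - (W x - W y) * y"
        by (subst (2) x) (simp add: algebra_simps)
      then show ?thesis using Wx abs_triangle_ineq4[of "- (W x * z)" "(W x - W y) * y"]
        by (simp add: abs_mult)
    qed
    moreover have "(W x - W y) * \<bar>y\<bar> \<le> c * W x * \<bar>z\<bar>"
    proof -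
      have "\<bar>x\<bar> - \<bar>y\<bar> \<le> \<bar>z\<bar>" using s by linarith
      then have "c * W x * (\<bar>x\<bar> - \<bar>y\<bar>) \<le> c * W x * \<bar>z\<bar>" using Wx by (intro mult_left_mono) auto
      then show ?thesis using adm_diff[OF W z(2)] by simp
    qed
    moreover have "\<bar>energy_symbol W x y z\<bar> \<le> \<bar>W x * x + W y * y\<bar> + \<bar>W z * z\<bar>"
      unfolding energy_symbol_def by (rule abs_triangle_ineq)
    ultimately have "\<bar>energy_symbol W x y z\<bar> \<le> W x * \<bar>z\<bar> + c * W x * \<bar>z\<bar> + W x * \<bar>z\<bar>" by linarith
    also have "\<dots> = (2 + real c) * (W x * \<bar>z\<bar>)" by (simp add: algebra_simps)
    finally have "\<bar>energy_symbol W x y z\<bar> \<le> (2 + real c) * (W x * \<bar>z\<bar>)" .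
    also have "\<dots> \<le> (2 + real c) * (2^c * (sqrt (W x) * sqrt (W y)) * \<bar>z\<bar>)"
    proof (intro mult_left_mono mult_right_mono)
      have "\<bar>x\<bar> \<le> 2 * \<bar>y\<bar>" using s z by linarith
      from mult_left_mono[OF adm_sqrt_double[OF W this], of "sqrt (W x)"] Wx
      show "W x \<le> 2^c * (sqrt (W x) * sqrt (W y))" by (simp add: ac_simps)
    qed auto
    finally show ?thesis by (simp only: mult.assoc)
  qed
  show ?thesis
  proof (cases "\<bar>y\<bar> \<le> \<bar>x\<bar>")
    case True
    then show ?thesis using main[OF s z(2)] by simp
  next
    case False
    then show ?thesis using main[of y x z] s z by (simp add: energy_symbol_def ac_simps)
  qed
qed

section \<open>The resonance function\<close>

definition phase :: "real \<Rightarrow> real \<Rightarrow> real" where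
  "phase \<epsilon> \<xi> = \<xi>^3 - \<epsilon> * \<xi>^5"

definition res :: "real \<Rightarrow> real \<Rightarrow> real \<Rightarrow> real \<Rightarrow> real" where
  "res \<epsilon> x y z = phase \<epsilon> x + phase \<epsilon> y + phase \<epsilon> z"

lemma res_factor:
  assumes "x + y + z = 0"
  shows "res \<epsilon> x y z = x * y * z * (3 - 5/2 * \<epsilon> * (x\<^sup>2 + y\<^sup>2 + z\<^sup>2))"
proof -
  have "2 * res \<epsilon> x y z = x * y * z * (6 - 5 * \<epsilon> * (x\<^sup>2 + y\<^sup>2 + z\<^sup>2))"
    using assms unfolding res_def phase_def by algebra
  then show ?thesis by (simp add: right_diff_distrib)
qed

text \<open>With \<open>E\<close> the second factor of the resonance function and \<open>Q\<close>
  the sum of squares, this is \<open>K <= |E| * sqrt Q\<close>, squared to avoid the root. As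
  \<open>sqrt Q\<close> is comparable to the highest frequency, the condition provides exactly one
  derivative, with a gain of \<open>K\<close>.\<close>

definition nonres :: "real \<Rightarrow> real \<Rightarrow> real \<Rightarrow> real \<Rightarrow> real \<Rightarrow> bool" where
  "nonres \<epsilon> K x y z \<longleftrightarrow> K\<^sup>2 \<le> (3 - 5/2 * \<epsilon> * (x\<^sup>2 + y\<^sup>2 + z\<^sup>2))\<^sup>2 * (x\<^sup>2 + y\<^sup>2 + z\<^sup>2)"

text \<open>The factor \<open>|z|\<close> pays for the energy symbol, and \<open>1 + |v|\<close> for
  the derivative in the nonlinearity when the equation is inserted for a time derivative.\<close>

lemma nonres_bound:
  assumes e: "0 \<le> \<epsilon>" "\<epsilon> \<le> 1" and K: "6 \<le> K" and nr: "nonres \<epsilon> K x y z"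
    and s: "x + y + z = 0" and z: "\<bar>z\<bar> \<le> \<bar>x\<bar>" "\<bar>z\<bar> \<le> \<bar>y\<bar>" and v: "v \<in> {x, y, z}"
  shows "K * \<bar>z\<bar> * (1 + \<bar>v\<bar>) \<le> 12 * \<bar>res \<epsilon> x y z\<bar>"
proof -
  define Q where "Q = x\<^sup>2 + y\<^sup>2 + z\<^sup>2"
  define E where "E = 3 - 5/2 * \<epsilon> * Q"
  define M where "M = max \<bar>x\<bar> \<bar>y\<bar>"
  have Q0: "0 \<le> Q" by (simp add: Q_def)
  have KE: "K\<^sup>2 \<le> E\<^sup>2 * Q" using nr by (simp add: nonres_def E_def Q_def)
  \<comment> \<open>Here \<open>6 <= K\<close> and \<open>\<epsilon> <= 1\<close> enter: for
    \<open>Q < 1\<close> one has \<open>|E| <= 3\<close>, hence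
    \<open>E^2 * Q <= 9 < 36 <= K^2\<close>. The lower bound on \<open>Q\<close> allows
    \<open>1 + |v|\<close> to be absorbed into the highest frequency.\<close>
  have Q1: "1 \<le> Q"
  proof (rule ccontr)
    assume "\<not> 1 \<le> Q"
    then have q: "Q < 1" by simp
    have "\<epsilon> * Q \<le> 1 * 1" using e q Q0 by (intro mult_mono) auto
    moreover have "0 \<le> \<epsilon> * Q" using e Q0 by (intro mult_nonneg_nonneg)
    ultimately have "\<bar>E\<bar> \<le> 3" unfolding E_def abs_le_iff by linarith
    then have "E\<^sup>2 \<le> 3\<^sup>2" using abs_le_square_iff[of E 3] by simp
    then have "E\<^sup>2 * Q \<le> 3\<^sup>2 * 1" using q Q0 by (intro mult_mono) auto
    moreover have "6\<^sup>2 \<le> K\<^sup>2" using K by (intro power_mono) auto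
    ultimately show False using KE by simp
  qed
  have M: "0 \<le> M" "\<bar>x\<bar> \<le> M" "\<bar>y\<bar> \<le> M" "\<bar>z\<bar> \<le> M" using z by (auto simp: M_def)
  have sqM: "x\<^sup>2 \<le> M\<^sup>2" "y\<^sup>2 \<le> M\<^sup>2" "z\<^sup>2 \<le> M\<^sup>2"
    using M by (metis abs_le_square_iff abs_of_nonneg)+
  then have QM: "Q \<le> 3 * M\<^sup>2" by (simp add: Q_def)
  then have "(1/2)\<^sup>2 \<le> M\<^sup>2" using Q1 by (simp add: power2_eq_square)
  then have M1: "1/2 \<le> M" using M(1) by (rule power2_le_imp_le)
  have "Q \<le> 4 * M\<^sup>2" using QM zero_le_power2[of M] by linarith
  then have sqQ: "sqrt Q \<le> 2 * M"
    using M by (intro real_le_lsqrt) (auto simp: power_mult_distrib Q0)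
  have v': "1 + \<bar>v\<bar> \<le> 3 * M" using v M M1 by auto
  have xy: "M\<^sup>2 \<le> 2 * (\<bar>x\<bar> * \<bar>y\<bar>)"
  proof -
    have "\<bar>x\<bar> \<le> 2 * \<bar>y\<bar>" "\<bar>y\<bar> \<le> 2 * \<bar>x\<bar>" using s z by linarith+
    then have "\<bar>x\<bar> * \<bar>x\<bar> \<le> \<bar>x\<bar> * (2 * \<bar>y\<bar>)" "\<bar>y\<bar> * \<bar>y\<bar> \<le> (2 * \<bar>x\<bar>) * \<bar>y\<bar>"
      by (simp_all only: mult_left_mono mult_right_mono abs_ge_zero)
    then show ?thesis by (auto simp: M_def max_def power2_eq_square)
  qed
  have "K \<le> \<bar>E\<bar> * sqrt Q"
  proof (rule power2_le_imp_le)
    show "K\<^sup>2 \<le> (\<bar>E\<bar> * sqrt Q)\<^sup>2" using KE Q0 by (simp add: power_mult_distrib)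
  qed (use Q0 in auto)
  also have "\<dots> \<le> \<bar>E\<bar> * (2 * M)" using sqQ by (intro mult_left_mono) auto
  finally have KM: "K \<le> \<bar>E\<bar> * (2 * M)" .
  have "K * \<bar>z\<bar> * (1 + \<bar>v\<bar>) \<le> (\<bar>E\<bar> * (2 * M)) * \<bar>z\<bar> * (3 * M)"
    using KM v' K M by (intro mult_mono mult_nonneg_nonneg) auto
  also have "\<dots> = 6 * \<bar>E\<bar> * \<bar>z\<bar> * M\<^sup>2" by (simp add: power2_eq_square)
  also have "\<dots> \<le> 6 * \<bar>E\<bar> * \<bar>z\<bar> * (2 * (\<bar>x\<bar> * \<bar>y\<bar>))" using xy by (intro mult_left_mono) auto
  also have "\<dots> = 12 * \<bar>res \<epsilon> x y z\<bar>"
    by (simp add: res_factor[OF s] abs_mult E_def Q_def)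
  finally show ?thesis .
qed

text \<open>Regard \<open>E\<close> as a function of \<open>\<sigma>\<close>. Since
  \<open>|E| * \<sigma> < K < \<sigma>\<close>, the value \<open>|E|\<close> is below 1, which
  forces \<open>\<epsilon> * \<sigma>^2\<close> to be at least \<open>3/10\<close>. So
  \<open>E\<close> is strictly decreasing with slope at least \<open>3 / \<sigma>\<close> in
  absolute value, whereas \<open>|E|\<close> itself is below \<open>K / \<sigma>\<close>: two such
  points are at distance at most \<open>2/3 * K\<close>.\<close>

lemma resonant_close:
  fixes \<epsilon> K a b \<eta> :: real
  assumes e: "0 \<le> \<epsilon>" and K: "1 \<le> K"
    and S: "\<And>\<sigma>. \<sigma> \<in> {a, b} \<Longrightarrow> K < \<sigma> \<and> 3/2 * \<bar>\<eta>\<bar> \<le> \<sigma> \<and>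
      (3 - 5/2 * \<epsilon> * (2 * \<sigma>\<^sup>2 + 3/2 * \<eta>\<^sup>2))\<^sup>2 * (2 * \<sigma>\<^sup>2 + 3/2 * \<eta>\<^sup>2) < K\<^sup>2"
    and ab: "a \<le> b"
  shows "b - a \<le> K"
proof -
  define E where "E \<sigma> = 3 - 5/2 * \<epsilon> * (2 * \<sigma>\<^sup>2 + 3/2 * \<eta>\<^sup>2)" for \<sigma>
  have E: "\<bar>E \<sigma>\<bar> * \<sigma> < K" if "\<sigma> \<in> {a, b}" for \<sigma>
  proof (rule power2_less_imp_less)
    have "(\<bar>E \<sigma>\<bar> * \<sigma>)\<^sup>2 \<le> (E \<sigma>)\<^sup>2 * (2 * \<sigma>\<^sup>2 + 3/2 * \<eta>\<^sup>2)"
      unfolding power_mult_distrib power2_abs by (intro mult_left_mono) auto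
    also have "\<dots> < K\<^sup>2" using S[OF that] by (simp add: E_def)
    finally show "(\<bar>E \<sigma>\<bar> * \<sigma>)\<^sup>2 < K\<^sup>2" .
  qed (use K in auto)
  have a: "K < a" "3/2 * \<bar>\<eta>\<bar> \<le> a" using S[of a] by auto
  have b0: "0 < b" "0 < a" using a K ab by auto
  have "\<bar>E a\<bar> * a < 1 * a" using E[of a] a by simp
  then have "\<bar>E a\<bar> < 1" using b0 by (simp only: mult_less_cancel_right)
  then have 2: "2 < 5/2 * \<epsilon> * (2 * a\<^sup>2 + 3/2 * \<eta>\<^sup>2)" unfolding E_def by linarith
  \<comment> \<open>The low frequency contributes little to the sum of squares, which is therefore
    at most \<open>8/3 * a^2\<close>; this gives \<open>2 < 20/3 * \<epsilon> * a^2\<close>.\<close>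
  have "(3/2 * \<bar>\<eta>\<bar>)\<^sup>2 \<le> a\<^sup>2" using a by (intro power_mono) auto
  then have "3/2 * \<eta>\<^sup>2 \<le> 2/3 * a\<^sup>2" by (simp add: power_mult_distrib power_divide)
  then have "5/2 * \<epsilon> * (2 * a\<^sup>2 + 3/2 * \<eta>\<^sup>2) \<le> 5/2 * \<epsilon> * (8/3 * a\<^sup>2)"
    using e by (intro mult_left_mono) auto
  with 2 have 3: "3/10 \<le> \<epsilon> * a\<^sup>2" by simp
  have "E a - E b = 5 * \<epsilon> * ((b - a) * (b + a))"
    by (simp add: E_def power2_eq_square algebra_simps)
  then have "5 * \<epsilon> * ((b - a) * (b + a)) * a = (E a - E b) * a" by simp
  also have "\<dots> = E a * a - E b * a" by (rule left_diff_distrib)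
  also have "\<dots> \<le> \<bar>E a\<bar> * a + \<bar>E b\<bar> * b"
  proof -
    have "E a * a \<le> \<bar>E a\<bar> * a" "(- E b) * a \<le> \<bar>E b\<bar> * a"
      using b0 by (intro mult_right_mono; simp)+
    moreover have "\<bar>E b\<bar> * a \<le> \<bar>E b\<bar> * b"
      using ab by (intro mult_left_mono) auto
    ultimately show ?thesis by linarith
  qed
  also have "\<dots> \<le> 2 * K" using E[of a] E[of b] by simp
  finally have 4: "5 * \<epsilon> * ((b - a) * (b + a)) * a \<le> 2 * K" .
  have "3 * (b - a) \<le> 10 * (\<epsilon> * a\<^sup>2) * (b - a)" using 3 ab by (intro mult_right_mono) auto
  also have "\<dots> = 5 * \<epsilon> * ((b - a) * (a + a)) * a" by (simp add: power2_eq_square algebra_simps)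
  also have "\<dots> \<le> 5 * \<epsilon> * ((b - a) * (b + a)) * a"
    using e ab b0 by (intro mult_right_mono mult_left_mono) auto
  finally show ?thesis using 4 K by simp
qed

text \<open>Uniformly in \<open>\<epsilon>\<close>, the frequencies which are resonant with a given low frequency
  \<open>\<eta>\<close> stay in three bounded intervals: around the origin and around the two zeros
  of the second factor of the resonance function.\<close>

lemma resonant_measure:
  assumes e: "0 \<le> \<epsilon>" and K: "1 \<le> K"
  shows "emeasure lborel {x. \<bar>\<eta>\<bar> \<le> \<bar>x\<bar> \<and> \<bar>\<eta>\<bar> \<le> \<bar>x + \<eta>\<bar> \<and> \<not> nonres \<epsilon> K x (- x - \<eta>) \<eta>} \<le> ennreal (6 * K)"
proof -
  define P where "P = {\<sigma>. K < \<sigma> \<and> 3/2 * \<bar>\<eta>\<bar> \<le> \<sigma> \<and>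
      (3 - 5/2 * \<epsilon> * (2 * \<sigma>\<^sup>2 + 3/2 * \<eta>\<^sup>2))\<^sup>2 * (2 * \<sigma>\<^sup>2 + 3/2 * \<eta>\<^sup>2) < K\<^sup>2}"
  have "\<exists>\<sigma>0. P \<subseteq> {\<sigma>0 - K..\<sigma>0 + K}"
  proof (cases "P = {}")
    case False
    then obtain \<sigma>0 where \<sigma>0: "\<sigma>0 \<in> P" by auto
    have *: "\<bar>\<sigma> - \<sigma>0\<bar> \<le> K" if "\<sigma> \<in> P" for \<sigma>
    proof -
      show ?thesis
      proof (cases "\<sigma> \<le> \<sigma>0")
        case True
        have "\<sigma>0 - \<sigma> \<le> K"
          by (rule resonant_close[OF e K _ True, where \<eta>=\<eta>]) (use that \<sigma>0 in \<open>auto simp: P_def\<close>)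
        then show ?thesis using True by simp
      next
        case False
        then have "\<sigma>0 \<le> \<sigma>" by simp
        have "\<sigma> - \<sigma>0 \<le> K"
          by (rule resonant_close[OF e K _ \<open>\<sigma>0 \<le> \<sigma>\<close>, where \<eta>=\<eta>]) (use that \<sigma>0 in \<open>auto simp: P_def\<close>)
        then show ?thesis using False by simp
      qed
    qed
    have "\<sigma> \<in> {\<sigma>0 - K..\<sigma>0 + K}" if "\<sigma> \<in> P" for \<sigma>
      using *[OF that] by (simp add: abs_le_iff)
    then show ?thesis by blast
  qed auto
  then obtain \<sigma>0 where \<sigma>0: "P \<subseteq> {\<sigma>0 - K..\<sigma>0 + K}" by auto
  have sub: "{x. \<bar>\<eta>\<bar> \<le> \<bar>x\<bar> \<and> \<bar>\<eta>\<bar> \<le> \<bar>x + \<eta>\<bar> \<and> \<not> nonres \<epsilon> K x (- x - \<eta>) \<eta>} \<subseteq>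
     {- \<eta>/2 - K..- \<eta>/2 + K} \<union> {\<sigma>0 - \<eta>/2 - K..\<sigma>0 - \<eta>/2 + K} \<union> {- \<sigma>0 - \<eta>/2 - K..- \<sigma>0 - \<eta>/2 + K}"
  proof (rule subsetI, rule UnCI, rule UnCI)
    fix x assume "x \<in> {x. \<bar>\<eta>\<bar> \<le> \<bar>x\<bar> \<and> \<bar>\<eta>\<bar> \<le> \<bar>x + \<eta>\<bar> \<and> \<not> nonres \<epsilon> K x (- x - \<eta>) \<eta>}"
      and x4: "x \<notin> {- \<sigma>0 - \<eta>/2 - K..- \<sigma>0 - \<eta>/2 + K}" "x \<notin> {\<sigma>0 - \<eta>/2 - K..\<sigma>0 - \<eta>/2 + K}"
    then have x: "\<bar>\<eta>\<bar> \<le> \<bar>x\<bar>" "\<bar>\<eta>\<bar> \<le> \<bar>x + \<eta>\<bar>" "\<not> nonres \<epsilon> K x (- x - \<eta>) \<eta>" by auto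
    show "x \<in> {- \<eta>/2 - K..- \<eta>/2 + K}"
    proof (rule ccontr)
    assume x5: "x \<notin> {- \<eta>/2 - K..- \<eta>/2 + K}"
    \<comment> \<open>The midpoint of \<open>x\<close> and \<open>x + \<eta>\<close>. In this
      variable the sum of squares is even, and the two conditions that make \<open>\<eta>\<close>
      the lowest frequency become \<open>3/2 * |\<eta>| <= |\<sigma>|\<close>.\<close>
    define \<sigma> where "\<sigma> = x + \<eta>/2"
    have Q: "x\<^sup>2 + (- x - \<eta>)\<^sup>2 + \<eta>\<^sup>2 = 2 * \<bar>\<sigma>\<bar>\<^sup>2 + 3/2 * \<eta>\<^sup>2"
      unfolding power2_abs \<sigma>_def by (simp add: power2_eq_square algebra_simps)
    have "3/2 * \<bar>\<eta>\<bar> \<le> \<bar>\<sigma>\<bar>" using x(1,2) by (simp add: \<sigma>_def abs_if split: if_splits)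
    moreover have "K < \<bar>\<sigma>\<bar>" using x5 by (auto simp: \<sigma>_def)
    moreover have "(3 - 5/2 * \<epsilon> * (2 * \<bar>\<sigma>\<bar>\<^sup>2 + 3/2 * \<eta>\<^sup>2))\<^sup>2 * (2 * \<bar>\<sigma>\<bar>\<^sup>2 + 3/2 * \<eta>\<^sup>2) < K\<^sup>2"
      using x(3) unfolding nonres_def Q by simp
    ultimately have "\<bar>\<sigma>\<bar> \<in> P" unfolding P_def by simp
    then have "\<bar>\<sigma>\<bar> \<in> {\<sigma>0 - K..\<sigma>0 + K}" using \<sigma>0 by auto
    then show False using x4 by (auto simp: \<sigma>_def abs_if split: if_splits)
    qed
  qed
  have "emeasure lborel {x. \<bar>\<eta>\<bar> \<le> \<bar>x\<bar> \<and> \<bar>\<eta>\<bar> \<le> \<bar>x + \<eta>\<bar> \<and> \<not> nonres \<epsilon> K x (- x - \<eta>) \<eta>} \<le>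
     emeasure lborel ({- \<eta>/2 - K..- \<eta>/2 + K} \<union> {\<sigma>0 - \<eta>/2 - K..\<sigma>0 - \<eta>/2 + K} \<union> {- \<sigma>0 - \<eta>/2 - K..- \<sigma>0 - \<eta>/2 + K})"
    by (rule emeasure_mono[OF sub]) simp
  also have "\<dots> \<le> emeasure lborel {- \<eta>/2 - K..- \<eta>/2 + K} + emeasure lborel {\<sigma>0 - \<eta>/2 - K..\<sigma>0 - \<eta>/2 + K}
      + emeasure lborel {- \<sigma>0 - \<eta>/2 - K..- \<sigma>0 - \<eta>/2 + K}"
    by (intro order_trans[OF emeasure_subadditive] add_right_mono emeasure_subadditive) auto
  also have "\<dots> = ennreal (6 * K)"
    using K by (simp add: ennreal_plus[symmetric] del: ennreal_plus)
  finally show ?thesis .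
qed

section \<open>Time integrals of trilinear expressions\<close>

text \<open>Instantiated below as a \<open>measurable (raw)\<close> rule for each jointly measurable
  curve, so that terms such as \<open>f \<tau> (x + \<eta>)\<close> are treated
  automatically.\<close>

lemma measurable_curried:
  assumes "case_prod f \<in> borel_measurable (borel \<Otimes>\<^sub>M borel)" "g \<in> borel_measurable M" "h \<in> borel_measurable M"
  shows "(\<lambda>w. f (g w) (h w)) \<in> borel_measurable M"
proof -
  have "(\<lambda>w. (g w, h w)) \<in> M \<rightarrow>\<^sub>M borel \<Otimes>\<^sub>M borel" using assms by measurable
  from measurable_compose[OF this assms(1)] show ?thesis by simp
qed

text \<open>Tonelli's theorem. Time is the innermost variable because the pointwise bounds on
  \<open>tri\<close> are obtained at fixed frequencies, while the trilinear estimates hold at fixed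
  time.\<close>

lemma nn_integral_time_bound:
  assumes [measurable]: "(\<lambda>(\<tau>, y, x). k \<tau> y x) \<in> borel_measurable (borel \<Otimes>\<^sub>M borel \<Otimes>\<^sub>M borel)"
    and le: "\<And>\<tau>. \<tau> \<in> {0..t} \<Longrightarrow> (NN y. NN x. k \<tau> y x) \<le> ennreal B" and t: "0 \<le> t"
  shows "(NN y. NN x. NN \<tau>. indicator {0..t} \<tau> * k \<tau> y x) \<le> ennreal (t * B)"
proof -
  have m: "(\<lambda>(\<tau>, y, x). k \<tau> y x) \<in> borel_measurable (lborel \<Otimes>\<^sub>M lborel \<Otimes>\<^sub>M lborel)"
    by simp
  have [measurable]: "(\<lambda>w. k (f w) (g w) (h w)) \<in> borel_measurable M"
    if "f \<in> borel_measurable M" "g \<in> borel_measurable M" "h \<in> borel_measurable M" for f g h and M :: "'z measure"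
  proof -
    have "(\<lambda>w. (f w, g w, h w)) \<in> M \<rightarrow>\<^sub>M borel \<Otimes>\<^sub>M borel \<Otimes>\<^sub>M borel" using that by measurable
    from measurable_compose[OF this assms(1)] show ?thesis by simp
  qed
  have km: "(\<lambda>(x, \<tau>). indicator {0..t} \<tau> * k \<tau> y x) \<in> borel_measurable (lborel \<Otimes>\<^sub>M lborel)" for y
  proof -
    have "(\<lambda>w. (snd w, y, fst w)) \<in> borel \<Otimes>\<^sub>M borel \<rightarrow>\<^sub>M borel \<Otimes>\<^sub>M borel \<Otimes>\<^sub>M borel" by measurable
    from measurable_compose[OF this assms(1)] show ?thesis by (simp add: split_beta')
  qed
  have km2: "(\<lambda>(y, \<tau>). indicator {0..t} \<tau> * (NN x. k \<tau> y x)) \<in> borel_measurable (lborel \<Otimes>\<^sub>M lborel)"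
  proof -
    have "(\<lambda>w. (snd (fst w), fst (fst w), snd w)) \<in> (borel \<Otimes>\<^sub>M borel) \<Otimes>\<^sub>M borel \<rightarrow>\<^sub>M borel \<Otimes>\<^sub>M borel \<Otimes>\<^sub>M borel" by measurable
    from measurable_compose[OF this assms(1)]
    have [measurable]: "(\<lambda>(w, x). k (snd w) (fst w) x) \<in> borel_measurable ((borel \<Otimes>\<^sub>M borel) \<Otimes>\<^sub>M lborel)"
      by (simp add: split_beta')
    have [measurable]: "(\<lambda>w. (NN x. k (snd w) (fst w) x)) \<in> borel_measurable (borel \<Otimes>\<^sub>M borel)"
      by measurable
    show ?thesis by (simp add: split_beta')
  qed
  have kx: "k \<tau> y \<in> borel_measurable borel" for \<tau> y
  proof -
    have "(\<lambda>w. (\<tau>, y, w)) \<in> borel \<rightarrow>\<^sub>M borel \<Otimes>\<^sub>M borel \<Otimes>\<^sub>M borel" by measurable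
    from measurable_compose[OF this assms(1)] show ?thesis by simp
  qed
  have ky: "(\<lambda>y. (NN x. k \<tau> y x)) \<in> borel_measurable lborel" for \<tau>
  proof -
    have "(\<lambda>w. (\<tau>, fst w, snd w)) \<in> borel \<Otimes>\<^sub>M lborel \<rightarrow>\<^sub>M borel \<Otimes>\<^sub>M borel \<Otimes>\<^sub>M borel" by measurable
    from measurable_compose[OF this assms(1)]
    have [measurable]: "(\<lambda>(y, x). k \<tau> y x) \<in> borel_measurable (borel \<Otimes>\<^sub>M lborel)" by (simp add: split_beta')
    show ?thesis by measurable
  qed
  have "(NN y. NN x. NN \<tau>. indicator {0..t} \<tau> * k \<tau> y x) =
      (NN y. NN \<tau>. indicator {0..t} \<tau> * (NN x. k \<tau> y x))"
  proof (rule nn_integral_cong)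
    fix y
    have "(NN x. NN \<tau>. indicator {0..t} \<tau> * k \<tau> y x) =
       (NN \<tau>. NN x. indicator {0..t} \<tau> * k \<tau> y x)"
      by (rule lborel_pair.Fubini'[OF km, symmetric])
    also have "\<dots> = (NN \<tau>. indicator {0..t} \<tau> * (NN x. k \<tau> y x))"
      by (intro nn_integral_cong nn_integral_cmult) (simp add: kx)
    finally show "(NN x. NN \<tau>. indicator {0..t} \<tau> * k \<tau> y x) =
       (NN \<tau>. indicator {0..t} \<tau> * (NN x. k \<tau> y x))" .
  qed
  also have "\<dots> = (NN \<tau>. NN y. indicator {0..t} \<tau> * (NN x. k \<tau> y x))"
    by (rule lborel_pair.Fubini'[OF km2, symmetric])
  also have "\<dots> = (NN \<tau>. indicator {0..t} \<tau> * (NN y. NN x. k \<tau> y x))"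
    by (intro nn_integral_cong nn_integral_cmult ky)
  also have "\<dots> \<le> (NN \<tau>. indicator {0..t} \<tau> * ennreal B)"
    using le by (intro nn_integral_mono) (auto simp: indicator_def)
  also have "\<dots> = ennreal t * ennreal B" using t by (simp add: nn_integral_multc)
  also have "\<dots> = ennreal (t * B)" using t by (simp add: ennreal_mult')
  finally show ?thesis .
qed

text \<open>The time integral is taken at fixed frequencies and before absolute values, which is
  what permits integration by parts in time.\<close>

definition tri :: "(real \<Rightarrow> real \<Rightarrow> complex) \<Rightarrow> (real \<Rightarrow> real \<Rightarrow> complex) \<Rightarrow> (real \<Rightarrow> real \<Rightarrow> complex) \<Rightarrow>
    real \<Rightarrow> real \<Rightarrow> real \<Rightarrow> real \<Rightarrow> complex" where
  "tri a b c t x y z = (LBINT \<tau>. indicator {0..t} \<tau> *\<^sub>R (a \<tau> x * b \<tau> y * c \<tau> z))"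

text \<open>Valid without integrability, because the Bochner integral of a function that is not
  integrable is 0.\<close>

lemma integral_norm_le_nn_integral: "enorm (LINT x|M. f x) \<le> (\<integral>\<^sup>+x. enorm (f x) \<partial>M)"
  by (cases "integrable M f") (simp_all add: integral_norm_bound_ennreal not_integrable_integral_eq)

lemma tri_le:
  "enorm (tri a b c t x y z) \<le>
     (NN \<tau>. indicator {0..t} \<tau> * (enorm (a \<tau> x) * enorm (b \<tau> y) * enorm (c \<tau> z)))"
  unfolding tri_def
  by (rule order_trans[OF integral_norm_le_nn_integral])
    (auto intro!: nn_integral_mono simp: indicator_def norm_mult ennreal_mult)

text \<open>Integration by parts in time, in the form without oscillating exponentials.\<close>

lemma normal_form:
  assumes t: "0 \<le> t"
    and a: "\<And>\<tau>. \<tau> \<in> {0..t} \<Longrightarrow> ((\<lambda>\<tau>. a \<tau> x) has_vector_derivative \<i> * of_real p * a \<tau> x + A \<tau>) (at \<tau> within {0..t})"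
    and b: "\<And>\<tau>. \<tau> \<in> {0..t} \<Longrightarrow> ((\<lambda>\<tau>. b \<tau> y) has_vector_derivative \<i> * of_real q * b \<tau> y + B \<tau>) (at \<tau> within {0..t})"
    and c: "\<And>\<tau>. \<tau> \<in> {0..t} \<Longrightarrow> ((\<lambda>\<tau>. c \<tau> z) has_vector_derivative \<i> * of_real r * c \<tau> z + C \<tau>) (at \<tau> within {0..t})"
    and cont: "continuous_on {0..t} A" "continuous_on {0..t} B" "continuous_on {0..t} C"
  shows "ennreal (\<bar>p + q + r\<bar> * cmod (tri a b c t x y z)) \<le>
    enorm (a t x) * enorm (b t y) * enorm (c t z) +
    enorm (a 0 x) * enorm (b 0 y) * enorm (c 0 z) +
    (NN \<tau>. indicator {0..t} \<tau> * (enorm (A \<tau>) * enorm (b \<tau> y) * enorm (c \<tau> z)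
       + enorm (a \<tau> x) * enorm (B \<tau>) * enorm (c \<tau> z)
       + enorm (a \<tau> x) * enorm (b \<tau> y) * enorm (C \<tau>)))"
proof -
  define P where "P \<tau> = a \<tau> x * b \<tau> y * c \<tau> z" for \<tau>
  define R where "R \<tau> = A \<tau> * b \<tau> y * c \<tau> z + a \<tau> x * B \<tau> * c \<tau> z + a \<tau> x * b \<tau> y * C \<tau>" for \<tau>
  have ca: "continuous_on {0..t} (\<lambda>\<tau>. a \<tau> x)" "continuous_on {0..t} (\<lambda>\<tau>. b \<tau> y)" "continuous_on {0..t} (\<lambda>\<tau>. c \<tau> z)"
    using continuous_on_vector_derivative[OF a] continuous_on_vector_derivative[OF b]
      continuous_on_vector_derivative[OF c] by auto
  have cP: "continuous_on {0..t} P" and cR: "continuous_on {0..t} R"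
    unfolding P_def[abs_def] R_def[abs_def] by (intro continuous_intros ca cont)+
  have dP: "(P has_vector_derivative (\<i> * of_real (p + q + r) * P \<tau> + R \<tau>)) (at \<tau> within {0..t})"
    if "\<tau> \<in> {0..t}" for \<tau>
    unfolding P_def[abs_def]
    by (rule derivative_eq_intros a[OF that] b[OF that] c[OF that] refl has_vector_derivative_eq_rhs)+
      (simp add: R_def algebra_simps)
  have "(LBINT \<tau>. indicator {0..t} \<tau> *\<^sub>R (\<i> * of_real (p + q + r) * P \<tau> + R \<tau>)) = P t - P 0"
    by (rule integral_FTC_Icc[OF t dP]) (auto intro!: continuous_intros cP cR)
  moreover have i: "integrable lborel (\<lambda>\<tau>. indicator {0..t} \<tau> *\<^sub>R P \<tau>)" "integrable lborel (\<lambda>\<tau>. indicator {0..t} \<tau> *\<^sub>R R \<tau>)"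
    by (rule borel_integrable_compact[OF compact_Icc cP]) (rule borel_integrable_compact[OF compact_Icc cR])
  moreover have "indicator {0..t} \<tau> *\<^sub>R (\<i> * of_real (p + q + r) * P \<tau> + R \<tau>) =
      \<i> * of_real (p + q + r) * (indicator {0..t} \<tau> *\<^sub>R P \<tau>) + indicator {0..t} \<tau> *\<^sub>R R \<tau>" for \<tau>
    by (simp only: scaleR_add_right mult_scaleR_right)
  moreover have "(LBINT \<tau>. indicator {0..t} \<tau> *\<^sub>R P \<tau>) = tri a b c t x y z"
    by (simp only: tri_def P_def)
  ultimately have eq: "\<i> * of_real (p + q + r) * tri a b c t x y z = P t - P 0 - (LBINT \<tau>. indicator {0..t} \<tau> *\<^sub>R R \<tau>)"
    by (simp only: Bochner_Integration.integral_add integrable_mult_right integral_mult_right_zero eq_diff_eq)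
  have "\<bar>p + q + r\<bar> * cmod (tri a b c t x y z) = cmod (\<i> * of_real (p + q + r) * tri a b c t x y z)"
    by (simp add: norm_mult del: of_real_add)
  also have "\<dots> \<le> cmod (P t) + cmod (P 0) + cmod (LBINT \<tau>. indicator {0..t} \<tau> *\<^sub>R R \<tau>)"
    unfolding eq by (rule order_trans[OF norm_triangle_ineq4 add_right_mono[OF norm_triangle_ineq4]])
  finally have "ennreal (\<bar>p + q + r\<bar> * cmod (tri a b c t x y z)) \<le>
     enorm (P t) + enorm (P 0) + enorm (LBINT \<tau>. indicator {0..t} \<tau> *\<^sub>R R \<tau>)"
    by (simp add: ennreal_leI flip: ennreal_plus)
  also have "enorm (LBINT \<tau>. indicator {0..t} \<tau> *\<^sub>R R \<tau>) \<le>
     (NN \<tau>. indicator {0..t} \<tau> * (enorm (A \<tau>) * enorm (b \<tau> y) * enorm (c \<tau> z)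
       + enorm (a \<tau> x) * enorm (B \<tau>) * enorm (c \<tau> z)
       + enorm (a \<tau> x) * enorm (b \<tau> y) * enorm (C \<tau>)))"
  proof (rule order_trans[OF integral_norm_le_nn_integral nn_integral_mono])
    fix \<tau>
    have "cmod (R \<tau>) \<le> cmod (A \<tau> * b \<tau> y * c \<tau> z) + cmod (a \<tau> x * B \<tau> * c \<tau> z) + cmod (a \<tau> x * b \<tau> y * C \<tau>)"
      unfolding R_def by (rule order_trans[OF norm_triangle_ineq add_right_mono[OF norm_triangle_ineq]])
    then show "enorm (indicator {0..t} \<tau> *\<^sub>R R \<tau>) \<le> indicator {0..t} \<tau> * (enorm (A \<tau>) * enorm (b \<tau> y) * enorm (c \<tau> z)
       + enorm (a \<tau> x) * enorm (B \<tau>) * enorm (c \<tau> z)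
       + enorm (a \<tau> x) * enorm (b \<tau> y) * enorm (C \<tau>))"
      by (auto simp: indicator_def norm_mult ennreal_leI simp flip: ennreal_mult ennreal_plus)
  qed
  finally show ?thesis by (simp add: P_def norm_mult ennreal_mult add_left_mono)
qed

text \<open>The dispersive term is an imaginary multiple of \<open>g\<close> and drops out of the
  derivative of \<open>|g|^2\<close>.\<close>

lemma energy_pointwise:
  assumes t: "0 \<le> t"
    and g: "\<And>\<tau>. \<tau> \<in> {0..t} \<Longrightarrow> (g has_vector_derivative \<i> * of_real p * g \<tau> + E \<tau>) (at \<tau> within {0..t})"
    and cont: "continuous_on {0..t} E"
  shows "(cmod (g t))\<^sup>2 - (cmod (g 0))\<^sup>2 = 2 * Re (LBINT \<tau>. indicator {0..t} \<tau> *\<^sub>R (cnj (g \<tau>) * E \<tau>))"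
proof -
  let ?I = "LBINT \<tau>. indicator {0..t} \<tau> *\<^sub>R (cnj (g \<tau>) * E \<tau>)"
  have cg: "continuous_on {0..t} g"
    by (rule continuous_on_vector_derivative[OF g])
  have d: "((\<lambda>\<tau>. g \<tau> * cnj (g \<tau>)) has_vector_derivative (cnj (g \<tau>) * E \<tau> + cnj (cnj (g \<tau>) * E \<tau>))) (at \<tau> within {0..t})"
    if "\<tau> \<in> {0..t}" for \<tau>
    by (rule derivative_eq_intros g[OF that] has_vector_derivative_cnj refl has_vector_derivative_eq_rhs)+
      (simp add: algebra_simps)
  have i: "integrable lborel (\<lambda>\<tau>. indicator {0..t} \<tau> *\<^sub>R (cnj (g \<tau>) * E \<tau>))"
    by (rule borel_integrable_compact[OF compact_Icc]) (intro continuous_intros cg cont)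
  have "g t * cnj (g t) - g 0 * cnj (g 0) =
     (LBINT \<tau>. indicator {0..t} \<tau> *\<^sub>R (cnj (g \<tau>) * E \<tau> + cnj (cnj (g \<tau>) * E \<tau>)))"
    by (rule integral_FTC_Icc[OF t d, symmetric]) (auto intro!: continuous_intros cg cont)
  also have "\<dots> = (LBINT \<tau>. indicator {0..t} \<tau> *\<^sub>R (cnj (g \<tau>) * E \<tau>) + cnj (indicator {0..t} \<tau> *\<^sub>R (cnj (g \<tau>) * E \<tau>)))"
    by (simp add: scaleR_add_right)
  also have "\<dots> = ?I + cnj ?I"
    by (subst Bochner_Integration.integral_add[OF i])
      (use i in \<open>simp_all only: Bochner_Integration.integral_cnj integrable_cnj\<close>)
  finally have "of_real ((cmod (g t))\<^sup>2) - of_real ((cmod (g 0))\<^sup>2) =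
     ?I + cnj ?I"
    by (simp only: complex_norm_square)
  from arg_cong[OF this, of Re] show ?thesis by simp
qed

text \<open>The Fourier transform of \<open>- (u\<^sup>2 / 2)\<^sub>x\<close> in terms of the Fourier transform of \<open>u\<close>.\<close>

definition bil :: "(real \<Rightarrow> complex) \<Rightarrow> (real \<Rightarrow> complex) \<Rightarrow> real \<Rightarrow> complex" where
  "bil g h \<xi> = - (\<i> * of_real (\<xi> / (4 * pi))) * (LBINT \<eta>. g \<eta> * h (\<xi> - \<eta>))"

lemma bil_le: "enorm (bil g h \<xi>) \<le> ennreal \<bar>\<xi>\<bar> * conv (\<lambda>\<eta>. enorm (g \<eta>)) (\<lambda>\<eta>. enorm (h \<eta>)) \<xi>"
proof -
  have "enorm (bil g h \<xi>) = ennreal (\<bar>\<xi>\<bar> / (4 * pi)) * enorm (LBINT \<eta>. g \<eta> * h (\<xi> - \<eta>))"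
  proof -
    have "cmod (bil g h \<xi>) = \<bar>\<xi>\<bar> / (4 * pi) * cmod (LBINT \<eta>. g \<eta> * h (\<xi> - \<eta>))"
      by (simp add: bil_def norm_mult norm_divide)
    then show ?thesis by (simp only:) (rule ennreal_mult; simp)
  qed
  also have "\<dots> \<le> ennreal \<bar>\<xi>\<bar> * (NN \<eta>. enorm (g \<eta> * h (\<xi> - \<eta>)))"
  proof (intro mult_mono integral_norm_le_nn_integral ennreal_leI)
    have "1 \<le> 4 * pi" using pi_gt3 by linarith
    then have "\<bar>\<xi>\<bar> / (4 * pi) \<le> \<bar>\<xi>\<bar> / 1" by (intro divide_left_mono) auto
    then show "\<bar>\<xi>\<bar> / (4 * pi) \<le> \<bar>\<xi>\<bar>" by simp
  qed auto
  finally show ?thesis by (simp add: conv_def norm_mult ennreal_mult)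
qed

lemma Fubini_nn:
  fixes h :: "real \<Rightarrow> real \<Rightarrow> complex"
  assumes [measurable]: "case_prod h \<in> borel_measurable (borel \<Otimes>\<^sub>M borel)"
    and fin: "(NN x. NN y. enorm (h x y)) < \<infinity>"
  shows "integrable (lborel \<Otimes>\<^sub>M lborel) (case_prod h)"
    "(LBINT x. LBINT y. h x y) = (LBINT y. LBINT x. h x y)"
    "(LBINT x. LBINT y. h x y) = (LINT w|(lborel \<Otimes>\<^sub>M lborel). case_prod h w)"
    "integrable lborel (\<lambda>x. LBINT y. h x y)"
proof -
  have "(\<integral>\<^sup>+w. enorm (case_prod h w) \<partial>(lborel \<Otimes>\<^sub>M lborel)) = (NN x. NN y. enorm (h x y))"
    by (subst lborel.nn_integral_fst[symmetric]) auto
  then show i: "integrable (lborel \<Otimes>\<^sub>M lborel) (case_prod h)"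
    using fin by (intro integrableI_bounded) auto
  from lborel_pair.Fubini_integral[OF i] show "(LBINT x. LBINT y. h x y) = (LBINT y. LBINT x. h x y)"
    by simp
  from lborel_pair.integral_fst'[OF i] show "(LBINT x. LBINT y. h x y) = (LINT w|(lborel \<Otimes>\<^sub>M lborel). case_prod h w)"
    by simp
  from lborel_pair.integrable_fst'[OF i] show "integrable lborel (\<lambda>x. LBINT y. h x y)"
    by simp
qed

lemma measurable_tri:
  assumes a: "case_prod a \<in> borel_measurable (borel \<Otimes>\<^sub>M borel)" and b: "case_prod b \<in> borel_measurable (borel \<Otimes>\<^sub>M borel)"
    and c: "case_prod c \<in> borel_measurable (borel \<Otimes>\<^sub>M borel)"
    and [measurable]: "f \<in> borel_measurable M" "g \<in> borel_measurable M" "h \<in> borel_measurable M"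
  shows "(\<lambda>w. tri a b c t (f w) (g w) (h w)) \<in> borel_measurable M"
proof -
  note [measurable (raw)] = measurable_curried[OF a] measurable_curried[OF b] measurable_curried[OF c]
  show ?thesis unfolding tri_def by measurable
qed

text \<open>The value at \<open>- \<xi>\<close> stands for the conjugate at \<open>\<xi>\<close>;
  with it the three arguments of \<open>tri\<close> have sum 0. Continuity in time bounds the factor
  \<open>w\<close> on the compact interval, so that Fubini's theorem applies at fixed
  \<open>\<xi>\<close>.\<close>

lemma bil_energy:
  assumes z: "case_prod z \<in> borel_measurable (borel \<Otimes>\<^sub>M borel)" and w: "case_prod w \<in> borel_measurable (borel \<Otimes>\<^sub>M borel)"
    and v: "case_prod v \<in> borel_measurable (borel \<Otimes>\<^sub>M borel)"
    and b: "\<And>\<tau>. \<tau> \<in> {0..t} \<Longrightarrow> b2 (\<lambda>\<xi>. enorm (z \<tau> \<xi>)) Z" "\<And>\<tau>. \<tau> \<in> {0..t} \<Longrightarrow> b2 (\<lambda>\<xi>. enorm (v \<tau> \<xi>)) V"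
    and cont: "continuous_on {0..t} (\<lambda>\<tau>. w \<tau> (- \<xi>))"
  shows "(LBINT \<tau>. indicator {0..t} \<tau> *\<^sub>R (w \<tau> (- \<xi>) * bil (z \<tau>) (v \<tau>) \<xi>)) =
     - (\<i> * of_real (\<xi> / (4 * pi))) * (LBINT \<eta>. tri z w v t \<eta> (- \<xi>) (\<xi> - \<eta>))"
proof -
  let ?P = "\<lambda>\<tau> \<eta>. z \<tau> \<eta> * w \<tau> (- \<xi>) * v \<tau> (\<xi> - \<eta>)"
  note [measurable (raw)] = measurable_curried[OF z] measurable_curried[OF w] measurable_curried[OF v]
  let ?c = "- (\<i> * of_real (\<xi> / (4 * pi))) :: complex"
  have "bounded ((\<lambda>\<tau>. w \<tau> (- \<xi>)) ` {0..t})"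
    by (rule compact_imp_bounded[OF compact_continuous_image[OF cont compact_Icc]])
  then obtain C where "\<forall>y\<in>(\<lambda>\<tau>. w \<tau> (- \<xi>)) ` {0..t}. cmod y \<le> C"
    unfolding bounded_iff by blast
  then have C: "cmod (w \<tau> (- \<xi>)) \<le> C" if "\<tau> \<in> {0..t}" for \<tau> using that by auto
  have fin: "(NN \<tau>. NN \<eta>. enorm (indicator {0..t} \<tau> *\<^sub>R ?P \<tau> \<eta>)) < \<infinity>"
  proof (rule le_less_trans)
    show "(NN \<tau>. NN \<eta>. enorm (indicator {0..t} \<tau> *\<^sub>R ?P \<tau> \<eta>)) \<le>
      (NN \<tau>. ennreal (C * (Z * V)) * indicator {0..t} \<tau>)"
    proof (rule nn_integral_mono)
      fix \<tau>
      show "(NN \<eta>. enorm (indicator {0..t} \<tau> *\<^sub>R ?P \<tau> \<eta>)) \<le> ennreal (C * (Z * V)) * indicator {0..t} \<tau>"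
      proof (cases "\<tau> \<in> {0..t}")
        case True
        have v': "b2 (\<lambda>\<eta>. enorm (v \<tau> (\<xi> - \<eta>))) V"
          using b(2)[OF True] nn_integral_translate(3)[of "\<lambda>x. (enorm (v \<tau> x))\<^sup>2" \<xi>] by (simp add: b2_def)
        have "(NN \<eta>. enorm (?P \<tau> \<eta>)) =
           enorm (w \<tau> (- \<xi>)) * (NN \<eta>. enorm (z \<tau> \<eta>) * enorm (v \<tau> (\<xi> - \<eta>)))"
        proof -
          have "enorm (?P \<tau> \<eta>) =
              enorm (w \<tau> (- \<xi>)) * (enorm (z \<tau> \<eta>) * enorm (v \<tau> (\<xi> - \<eta>)))" for \<eta>
            by (simp add: norm_mult ennreal_mult mult.assoc mult.left_commute)
          then show ?thesis by (simp only:) (rule nn_integral_cmult, measurable)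
        qed
        also have "\<dots> \<le> ennreal C * ennreal (Z * V)"
          by (intro mult_mono ennreal_leI C[OF True] b1_le[OF b2_mult[OF b(1)[OF True] v']]) auto
        also have "\<dots> = ennreal (C * (Z * V))"
          using b2_nonneg[OF b(1)[OF True]] b2_nonneg[OF v'] by (intro ennreal_mult''[symmetric]) simp
        finally show ?thesis using True by simp
      qed simp
    qed
    show "(NN \<tau>. ennreal (C * (Z * V)) * indicator {0..t} \<tau>) < \<infinity>"
      by (simp add: nn_integral_cmult_indicator ennreal_mult_less_top emeasure_lborel_Icc_eq)
  qed
  have "(LBINT \<tau>. indicator {0..t} \<tau> *\<^sub>R (w \<tau> (- \<xi>) * bil (z \<tau>) (v \<tau>) \<xi>)) =
     (LBINT \<tau>. ?c * (LBINT \<eta>. indicator {0..t} \<tau> *\<^sub>R ?P \<tau> \<eta>))"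
  proof (rule Bochner_Integration.integral_cong[OF refl])
    fix \<tau>
    have "(LBINT \<eta>. z \<tau> \<eta> * w \<tau> (- \<xi>) * v \<tau> (\<xi> - \<eta>)) = w \<tau> (- \<xi>) * (LBINT \<eta>. z \<tau> \<eta> * v \<tau> (\<xi> - \<eta>))"
      by (subst integral_mult_right_zero[symmetric]) (simp add: ac_simps)
    then show "indicator {0..t} \<tau> *\<^sub>R (w \<tau> (- \<xi>) * bil (z \<tau>) (v \<tau>) \<xi>) =
       ?c * (LBINT \<eta>. indicator {0..t} \<tau> *\<^sub>R ?P \<tau> \<eta>)"
      by (simp add: bil_def scaleR_conv_of_real)
  qed
  also have "\<dots> = ?c * (LBINT \<tau>. LBINT \<eta>. indicator {0..t} \<tau> *\<^sub>R ?P \<tau> \<eta>)"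
    by (rule integral_mult_right_zero)
  also have "(LBINT \<tau>. LBINT \<eta>. indicator {0..t} \<tau> *\<^sub>R ?P \<tau> \<eta>) =
     (LBINT \<eta>. LBINT \<tau>. indicator {0..t} \<tau> *\<^sub>R ?P \<tau> \<eta>)"
    by (rule Fubini_nn(2)[OF _ fin]) measurable
  finally show ?thesis by (simp add: tri_def)
qed

text \<open>Two transpositions generate all permutations of \<open>x\<close>, \<open>y\<close>,
  \<open>- x - y\<close>, so the integrals with \<open>h x\<close>, \<open>h y\<close> and
  \<open>h (- x - y)\<close> coincide. Each has to converge absolutely beforehand, since the
  cancellation appears only in their sum.\<close>

lemma symmetrize:
  fixes h :: "real \<Rightarrow> real" and I :: "real \<Rightarrow> real \<Rightarrow> complex"
  assumes Im: "case_prod I \<in> borel_measurable (borel \<Otimes>\<^sub>M borel)" and [measurable]: "h \<in> borel_measurable borel"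
    and sym: "\<And>x y. I x y = I y x" "\<And>x y. I (- x - y) y = I x y"
    and fin: "(NN y. NN x. enorm (of_real (h y) * I x y)) < \<infinity>"
  shows "ennreal (3 * cmod (LBINT y. LBINT x. of_real (h y) * I x y)) \<le>
    (NN y. NN x. ennreal (\<bar>h x + h y + h (- x - y)\<bar> * cmod (I x y)))"
proof -
  note [measurable (raw)] = measurable_curried[OF Im]
  let ?F1 = "\<lambda>y x. of_real (h y) * I x y" and ?F2 = "\<lambda>y x. of_real (h x) * I x y"
    and ?F3 = "\<lambda>y x. of_real (h (- x - y)) * I x y"
  have "(NN y. NN x. enorm (?F2 y x)) = (NN x. NN y. enorm (?F2 y x))"
    by (rule lborel_pair.Fubini'[symmetric]) measurable
  also have "\<dots> = (NN y. NN x. enorm (?F1 y x))" by (simp only: sym(1))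
  finally have fin2: "(NN y. NN x. enorm (?F2 y x)) < \<infinity>" using fin by simp
  have "(NN x. enorm (?F3 y x)) = (NN x. enorm (?F2 y x))" for y
    using nn_integral_translate(4)[of "\<lambda>x. enorm (?F2 y x)" y] by (simp add: sym(2))
  then have fin3: "(NN y. NN x. enorm (?F3 y x)) < \<infinity>" using fin2 by simp
  have m: "case_prod ?F1 \<in> borel_measurable (borel \<Otimes>\<^sub>M borel)" "case_prod ?F2 \<in> borel_measurable (borel \<Otimes>\<^sub>M borel)"
    "case_prod ?F3 \<in> borel_measurable (borel \<Otimes>\<^sub>M borel)"
    by measurable
  have 2: "(LBINT y. LBINT x. ?F2 y x) = (LBINT y. LBINT x. ?F1 y x)"
    unfolding Fubini_nn(2)[OF m(2) fin2] by (simp only: sym(1))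
  have 3: "(LBINT x. ?F3 y x) = (LBINT x. ?F2 y x)" for y
    using lborel_integral_real_affine[of "-1" "\<lambda>x. ?F2 y x" "- y"]
    by (simp add: sym(2) minus_diff_commute)
  have "3 * (LBINT y. LBINT x. ?F1 y x) =
     (LBINT y. LBINT x. ?F2 y x) + (LBINT y. LBINT x. ?F1 y x) + (LBINT y. LBINT x. ?F3 y x)"
    by (simp only: 3) (simp only: 2, simp)
  also have "\<dots> = (LINT w|(lborel \<Otimes>\<^sub>M lborel). case_prod ?F2 w + case_prod ?F1 w + case_prod ?F3 w)"
    unfolding Fubini_nn(3)[OF m(1) fin] Fubini_nn(3)[OF m(2) fin2] Fubini_nn(3)[OF m(3) fin3]
    by (simp only: Bochner_Integration.integral_add Bochner_Integration.integrable_add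
        Fubini_nn(1)[OF m(1) fin] Fubini_nn(1)[OF m(2) fin2] Fubini_nn(1)[OF m(3) fin3])
  finally have eq: "3 * (LBINT y. LBINT x. ?F1 y x) =
     (LINT w|(lborel \<Otimes>\<^sub>M lborel). case_prod ?F2 w + case_prod ?F1 w + case_prod ?F3 w)" .
  have "3 * cmod (LBINT y. LBINT x. ?F1 y x) = cmod (3 * (LBINT y. LBINT x. ?F1 y x))"
    by (simp only: norm_mult norm_numeral)
  then have "ennreal (3 * cmod (LBINT y. LBINT x. ?F1 y x)) =
     enorm (LINT w|(lborel \<Otimes>\<^sub>M lborel). case_prod ?F2 w + case_prod ?F1 w + case_prod ?F3 w)"
    unfolding eq by (rule arg_cong)
  also have "\<dots> \<le> (\<integral>\<^sup>+w. enorm (case_prod ?F2 w + case_prod ?F1 w + case_prod ?F3 w) \<partial>(lborel \<Otimes>\<^sub>M lborel))"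
    by (rule integral_norm_le_nn_integral)
  also have "\<dots> = (NN y. NN x. enorm (?F2 y x + ?F1 y x + ?F3 y x))"
    by (subst lborel.nn_integral_fst[symmetric]) (use m in simp_all)
  also have "\<dots> = (NN y. NN x. ennreal (\<bar>h x + h y + h (- x - y)\<bar> * cmod (I x y)))"
    by (intro nn_integral_cong) (simp add: norm_mult flip: distrib_right of_real_add)
  finally show ?thesis .
qed

text \<open>Every point lies in a region where one of the three frequencies is lowest, and by
  symmetry the regions contribute equally. The factor 3 cancels the one gained in
  \<open>symmetrize\<close>.\<close>

lemma symmetric_low_frequency:
  fixes \<Phi> :: "real \<Rightarrow> real \<Rightarrow> real \<Rightarrow> ennreal"
  assumes m: "\<And>f g h M. f \<in> borel_measurable M \<Longrightarrow> g \<in> borel_measurable M \<Longrightarrow> h \<in> borel_measurable M \<Longrightarrow>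
      (\<lambda>w. \<Phi> (f w) (g w) (h w)) \<in> borel_measurable (M :: (real \<times> real) measure)"
    and sym: "\<And>x y z. \<Phi> x y z = \<Phi> y x z" "\<And>x y z. \<Phi> x y z = \<Phi> x z y"
  shows "(NN y. NN x. \<Phi> x y (- x - y)) \<le>
    3 * (NN \<eta>. NN x. \<Phi> x (- x - \<eta>) \<eta> * indicator {x. \<bar>\<eta>\<bar> \<le> \<bar>x\<bar> \<and> \<bar>\<eta>\<bar> \<le> \<bar>x + \<eta>\<bar>} x)"
proof -
  define low where "low x y z = (if \<bar>z\<bar> \<le> \<bar>x\<bar> \<and> \<bar>z\<bar> \<le> \<bar>y\<bar> then 1 else 0 :: ennreal)" for x y z :: real
  have lowm: "(\<lambda>w. low (f w) (g w) (h w)) \<in> borel_measurable M"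
    if [measurable]: "f \<in> borel_measurable M" "g \<in> borel_measurable M" "h \<in> borel_measurable M" for f g h and M :: "(real \<times> real) measure"
    unfolding low_def by measurable
  define G where "G y x = \<Phi> x (- x - y) y * low x (- x - y) y" for y x
  have Gm: "(\<lambda>w. G (f w) (g w)) \<in> borel_measurable M"
    if [measurable]: "f \<in> borel_measurable M" "g \<in> borel_measurable M" for f g and M :: "(real \<times> real) measure"
    unfolding G_def by (intro borel_measurable_times_ennreal m lowm) measurable
  have Gm1[measurable]: "(\<lambda>(x, y). G y x) \<in> borel_measurable (lborel \<Otimes>\<^sub>M lborel)" "(\<lambda>(x, y). G x y) \<in> borel_measurable (lborel \<Otimes>\<^sub>M lborel)"
    unfolding split_beta' by (intro Gm; measurable)+
  have Gs: "G y \<in> borel_measurable borel" "(\<lambda>y. G y x) \<in> borel_measurable borel" for y x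
    using measurable_compose[OF measurable_Pair1' Gm1(2)] measurable_compose[OF measurable_Pair1' Gm1(1)] by (auto; fail)+
  have 1: "\<Phi> x y (- x - y) \<le> G y x + G x y + G (- x - y) x" for x y
  proof -
    have eq: "\<Phi> x (- x - y) y = \<Phi> x y (- x - y)" "\<Phi> y (- y - x) x = \<Phi> x y (- x - y)"
      using sym(2)[of x "- x - y" y] sym(2)[of y "- y - x" x] sym(1)[of y x] by (simp_all add: minus_diff_commute)
    consider "\<bar>y\<bar> \<le> \<bar>x\<bar> \<and> \<bar>y\<bar> \<le> \<bar>- x - y\<bar>" | "\<bar>x\<bar> \<le> \<bar>y\<bar> \<and> \<bar>x\<bar> \<le> \<bar>- y - x\<bar>" | "\<bar>- x - y\<bar> \<le> \<bar>x\<bar> \<and> \<bar>- x - y\<bar> \<le> \<bar>y\<bar>"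
      by linarith
    then show ?thesis
    proof cases
      case 1
      then have "G y x = \<Phi> x y (- x - y)" by (simp add: G_def low_def eq(1))
      then show ?thesis by (simp add: add_increasing2)
    next
      case 2
      then have "G x y = \<Phi> x y (- x - y)" by (simp add: G_def low_def eq(2))
      then show ?thesis by (simp add: add_increasing2 add_increasing)
    next
      case 3
      then have "G (- x - y) x = \<Phi> x y (- x - y)" by (simp add: G_def low_def)
      then show ?thesis by (simp add: add_increasing)
    qed
  qed
  have 2: "(NN y. NN x. G x y) = (NN y. NN x. G y x)"
    by (rule lborel_pair.Fubini'[OF Gm1(2)])
  have "(NN y. NN x. G (- x - y) x) = (NN x. NN y. G (- x - y) x)"
    by (rule lborel_pair.Fubini') (unfold split_beta', intro Gm; measurable)
  also have "\<dots> = (NN x. NN y. G y x)"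
    using nn_integral_translate(3)[OF Gs(2), of "- _"] by simp
  finally have 3: "(NN y. NN x. G (- x - y) x) = (NN y. NN x. G y x)"
    by (simp only: 2)
  have "(NN y. NN x. \<Phi> x y (- x - y)) \<le> (NN y. NN x. G y x + G x y + G (- x - y) x)"
    by (intro nn_integral_mono 1)
  also have "\<dots> = (NN y. NN x. G y x) + (NN y. NN x. G x y)
      + (NN y. NN x. G (- x - y) x)"
  proof -
    have [measurable]: "(\<lambda>w. G (f w) (g w)) \<in> borel_measurable M"
      if "f \<in> borel_measurable M" "g \<in> borel_measurable M" for f g and M :: "(real \<times> real) measure"
      using Gm that .
    have G3: "(\<lambda>(y, x). G y x) \<in> borel_measurable (borel \<Otimes>\<^sub>M lborel)" "(\<lambda>(y, x). G x y) \<in> borel_measurable (borel \<Otimes>\<^sub>M lborel)"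
      "(\<lambda>(y, x). G (- x - y) x) \<in> borel_measurable (borel \<Otimes>\<^sub>M lborel)"
      unfolding split_beta' by (intro Gm; measurable)+
    note [measurable] = G3
    have g3: "(\<lambda>x. G (- x - y) x) \<in> borel_measurable lborel" for y
      using measurable_compose[OF measurable_Pair1' G3(3)] by auto
    show ?thesis
      by (simp add: nn_integral_add Gs g3)
  qed
  also have "\<dots> = 3 * (NN y. NN x. G y x)"
  proof -
    have "X + X + X = 3 * X" for X :: ennreal
    proof -
      have "3 * X = (1 + 1 + 1) * X" by simp
      also have "\<dots> = X + X + X" by (simp only: distrib_right mult_1_left)
      finally show ?thesis by (rule HOL.sym)
    qed
    then show ?thesis unfolding 2 3 .
  qed
  also have "(NN y. NN x. G y x) =
     (NN \<eta>. NN x. \<Phi> x (- x - \<eta>) \<eta> * indicator {x. \<bar>\<eta>\<bar> \<le> \<bar>x\<bar> \<and> \<bar>\<eta>\<bar> \<le> \<bar>x + \<eta>\<bar>} x)"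
  proof -
    have "\<bar>- x - \<eta>\<bar> = \<bar>x + \<eta>\<bar>" for x \<eta> :: real by linarith
    then show ?thesis by (intro nn_integral_cong) (auto simp: G_def low_def indicator_def)
  qed
  finally show ?thesis .
qed

section \<open>Energy estimates on the Fourier side\<close>

definition wb :: "(real \<Rightarrow> real) \<Rightarrow> (real \<Rightarrow> complex) \<Rightarrow> real \<Rightarrow> bool" where
  "wb W g a \<longleftrightarrow> b2 (\<lambda>\<xi>. ennreal (sqrt (W \<xi>)) * enorm (g \<xi>)) a"

abbreviation h1_weight :: "real \<Rightarrow> real" where
  "h1_weight \<equiv> \<lambda>\<xi>. 1 + \<xi>\<^sup>2"

lemma wb_h1D:
  assumes "wb h1_weight g H" and [measurable]: "g \<in> borel_measurable borel"
  shows "b2 (\<lambda>\<xi>. enorm (g \<xi>)) H" "b2 (\<lambda>\<xi>. ennreal \<bar>\<xi>\<bar> * enorm (g \<xi>)) H"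
    "b1 (\<lambda>\<xi>. enorm (g \<xi>)) (2 * H)" "0 \<le> H"
proof -
  note h = assms(1)[unfolded wb_def]
  have 1: "1 \<le> sqrt (1 + \<xi>\<^sup>2)" and 2: "\<bar>\<xi>\<bar> \<le> sqrt (1 + \<xi>\<^sup>2)" for \<xi> :: real
    by (auto intro: real_le_rsqrt)
  show "b2 (\<lambda>\<xi>. enorm (g \<xi>)) H"
  proof (rule b2_mono[OF h])
    show "enorm (g \<xi>) \<le> ennreal (sqrt (1 + \<xi>\<^sup>2)) * enorm (g \<xi>)" for \<xi>
      using mult_right_mono[OF 1[of \<xi>], of "cmod (g \<xi>)"] by (simp add: ennreal_leI flip: ennreal_mult)
  qed auto
  show "b2 (\<lambda>\<xi>. ennreal \<bar>\<xi>\<bar> * enorm (g \<xi>)) H"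
    by (rule b2_mono[OF h]) (auto intro!: mult_right_mono ennreal_leI 2)
  show "b1 (\<lambda>\<xi>. enorm (g \<xi>)) (2 * H)"
    by (rule b1_weighted[OF h]) simp
  show "0 \<le> H" using b2_nonneg[OF h] .
qed

lemma conv_even:
  assumes [measurable]: "A \<in> borel_measurable borel" "B \<in> borel_measurable borel"
    and even: "\<And>x. A (- x) = A x" "\<And>x. B (- x) = B x"
  shows "conv A B (- \<xi>) = conv A B \<xi>"
proof -
  have "conv A B (- \<xi>) = (NN \<eta>. A (0 - \<eta>) * B (- \<xi> - (0 - \<eta>)))"
    unfolding conv_def by (rule nn_integral_translate(3)[symmetric]) measurable
  also have "\<dots> = conv A B \<xi>"
    unfolding conv_def using even(2)[of "\<xi> - _"] by (simp add: even)
  finally show ?thesis .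
qed

text \<open>By \<open>adm_sqrt_add\<close> the root of the weight moves onto one of the two factors,
  and Young's inequality leaves the other factor in \<open>L^1\<close>.\<close>

lemma b2_weighted_conv:
  assumes W: "adm c W" and g: "b1 A a" and V: "b2 (\<lambda>\<xi>. ennreal (sqrt (W \<xi>)) * A \<xi>) X"
  shows "b2 (\<lambda>\<xi>. ennreal (sqrt (W \<xi>)) * conv A A \<xi>) (2 * 2^c * a * X)"
proof -
  note [measurable] = b1_measurable[OF g] admD(1)[OF W]
  let ?V = "\<lambda>\<xi>. ennreal (sqrt (W \<xi>)) * A \<xi>"
  have b: "b2 (\<lambda>\<xi>. ennreal (2 * 2^c) * conv A ?V \<xi>) (2 * 2^c * (a * X))"
    by (rule b2_cmult[OF b2_conv[OF g V]]) simp
  show ?thesis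
  proof (rule b2_mono[OF b])
    fix \<xi>
    have "ennreal (sqrt (W \<xi>)) * conv A A \<xi> = (NN \<eta>. ennreal (sqrt (W \<xi>)) * (A \<eta> * A (\<xi> - \<eta>)))"
      unfolding conv_def by (rule nn_integral_cmult[symmetric]) measurable
    also have "\<dots> \<le> (NN \<eta>. ennreal (2^c) * (?V \<eta> * A (\<xi> - \<eta>)) + ennreal (2^c) * (A \<eta> * ?V (\<xi> - \<eta>)))"
    proof (rule nn_integral_mono)
      fix \<eta>
      have "ennreal (sqrt (W \<xi>)) \<le> ennreal (2^c) * ennreal (sqrt (W \<eta>)) + ennreal (2^c) * ennreal (sqrt (W (\<xi> - \<eta>)))"
        using adm_sqrt_add[OF W, of \<eta> "\<xi> - \<eta>"] admD(2)[OF W]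
        by (simp add: distrib_left ennreal_leI flip: ennreal_mult ennreal_plus)
      from mult_right_mono[OF this, of "A \<eta> * A (\<xi> - \<eta>)"]
      show "ennreal (sqrt (W \<xi>)) * (A \<eta> * A (\<xi> - \<eta>)) \<le> ennreal (2^c) * (?V \<eta> * A (\<xi> - \<eta>)) + ennreal (2^c) * (A \<eta> * ?V (\<xi> - \<eta>))"
        by (simp add: distrib_right distrib_left ac_simps)
    qed
    also have "\<dots> = ennreal (2^c) * conv ?V A \<xi> + ennreal (2^c) * conv A ?V \<xi>"
      unfolding conv_def by (subst nn_integral_add) (auto simp: nn_integral_cmult)
    also have "conv ?V A \<xi> = conv A ?V \<xi>" by (rule conv_commute) measurable
    also have "ennreal (2^c) * conv A ?V \<xi> + ennreal (2^c) * conv A ?V \<xi> = ennreal (2 * 2^c) * conv A ?V \<xi>"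
      by (simp add: ennreal_mult flip: mult_2 mult.assoc)
    finally show "ennreal (sqrt (W \<xi>)) * conv A A \<xi> \<le> ennreal (2 * 2^c) * conv A ?V \<xi>" .
  qed auto
qed

text \<open>The Fourier transform of a real-valued solution of the Kawahara equation, as an ordinary
  differential equation at each frequency.\<close>

locale fsol =
  fixes \<epsilon> :: real and f :: "real \<Rightarrow> real \<Rightarrow> complex"
  assumes meas: "case_prod f \<in> borel_measurable (borel \<Otimes>\<^sub>M borel)"
    and reality: "f t (- \<xi>) = cnj (f t \<xi>)"
    and deriv: "0 \<le> t \<Longrightarrow> ((\<lambda>t. f t \<xi>) has_vector_derivative
      \<i> * of_real (phase \<epsilon> \<xi>) * f t \<xi> + bil (f t) (f t) \<xi>) (at t within {0..})"
    and cont_bil: "continuous_on {0..} (\<lambda>t. bil (f t) (f t) \<xi>)"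
begin

abbreviation F :: "real \<Rightarrow> real \<Rightarrow> ennreal" where "F \<tau> \<xi> \<equiv> enorm (f \<tau> \<xi>)"
text \<open>By \<open>bil_le\<close>, a majorant for the nonlinearity once its derivative factor
  \<open>|\<xi>|\<close> is removed.\<close>

abbreviation Y :: "real \<Rightarrow> real \<Rightarrow> ennreal" where "Y \<tau> \<equiv> conv (\<lambda>\<eta>. F \<tau> \<eta>) (\<lambda>\<eta>. F \<tau> \<eta>)"

lemmas meas_raw[measurable (raw)] = measurable_curried[OF meas]

lemma Y_meas[measurable (raw)]:
  assumes [measurable]: "g \<in> borel_measurable M" "h \<in> borel_measurable M"
  shows "(\<lambda>w. Y (g w) (h w)) \<in> borel_measurable M"
  unfolding conv_def by measurable

lemma F_even: "F \<tau> (- \<xi>) = F \<tau> \<xi>"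
  by (simp add: reality)

lemma Y_even: "Y \<tau> (- \<xi>) = Y \<tau> \<xi>"
  by (rule conv_even) (auto simp: F_even)

lemma deriv_on:
  "\<tau> \<in> {0..t} \<Longrightarrow> ((\<lambda>t. f t \<xi>) has_vector_derivative
      \<i> * of_real (phase \<epsilon> \<xi>) * f \<tau> \<xi> + bil (f \<tau>) (f \<tau>) \<xi>) (at \<tau> within {0..t})"
  by (rule has_vector_derivative_within_subset[OF deriv]) auto

lemma cont_bil_on: "continuous_on {0..t} (\<lambda>t. bil (f t) (f t) \<xi>)"
  by (rule continuous_on_subset[OF cont_bil]) auto

lemma cont_f_on: "continuous_on {0..t} (\<lambda>t. f t \<xi>)"
  by (rule continuous_on_vector_derivative[OF deriv_on])

text \<open>Inserting the equation into \<open>normal_form\<close> costs at most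
  \<open>1 + |v|\<close>, with \<open>v\<close> the highest frequency, and
  \<open>nonres_bound\<close> returns \<open>K * |\<eta>| * (1 + |v|)\<close>. Everything is carried
  out with the factor \<open>1 + |v|\<close> in front, which is cancelled at the end.\<close>

lemma nonres_pointwise:
  assumes t: "0 \<le> t" and e: "0 \<le> \<epsilon>" "\<epsilon> \<le> 1" and K: "6 \<le> K" and W: "adm c W"
    and low: "\<bar>\<eta>\<bar> \<le> \<bar>x\<bar>" "\<bar>\<eta>\<bar> \<le> \<bar>x + \<eta>\<bar>" and nr: "nonres \<epsilon> K x (- x - \<eta>) \<eta>"
  shows "ennreal K * ennreal (\<bar>energy_symbol W x (- x - \<eta>) \<eta>\<bar> * cmod (tri f f f t x (- x - \<eta>) \<eta>)) \<le>
    ennreal (12 * ((2 + real c) * 2^c)) * (ennreal (sqrt (W x)) * ennreal (sqrt (W (x + \<eta>))) *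
      (F t x * F t (x + \<eta>) * F t \<eta> + F 0 x * F 0 (x + \<eta>) * F 0 \<eta> +
       (NN \<tau>. indicator {0..t} \<tau> * (Y \<tau> x * F \<tau> (x + \<eta>) * F \<tau> \<eta> + F \<tau> x * Y \<tau> (x + \<eta>) * F \<tau> \<eta>
          + F \<tau> x * F \<tau> (x + \<eta>) * Y \<tau> \<eta>))))"
proof -
  define C where "C = (2 + real c) * 2^c"
  have C: "0 \<le> C" by (simp add: C_def)
  define z where "z = - x - \<eta>"
  have zabs: "\<bar>z\<bar> = \<bar>x + \<eta>\<bar>" and s: "x + z + \<eta> = 0" and zx: "z = - (x + \<eta>)" by (auto simp: z_def)
  have Wz: "W z = W (x + \<eta>)" "\<And>\<tau>. F \<tau> z = F \<tau> (x + \<eta>)" "\<And>\<tau>. Y \<tau> z = Y \<tau> (x + \<eta>)"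
    unfolding zx by (rule adm_even[OF W] F_even Y_even)+
  \<comment> \<open>As \<open>\<eta>\<close> is the lowest frequency, the highest one is
    \<open>x\<close> or \<open>z\<close>.\<close>
  obtain v where v: "v \<in> {x, z, \<eta>}" "\<bar>x\<bar> \<le> \<bar>v\<bar>" "\<bar>z\<bar> \<le> \<bar>v\<bar>" "\<bar>\<eta>\<bar> \<le> \<bar>v\<bar>"
  proof (cases "\<bar>x\<bar> \<le> \<bar>z\<bar>")
    case True
    then show ?thesis using that[of z] low by (simp add: zabs)
  next
    case False
    then show ?thesis using that[of x] low by simp
  qed
  let ?m = "\<bar>energy_symbol W x z \<eta>\<bar>" and ?T = "cmod (tri f f f t x z \<eta>)" and ?w = "sqrt (W x) * sqrt (W (x + \<eta>))"
  let ?I = "\<lambda>\<tau>. Y \<tau> x * F \<tau> z * F \<tau> \<eta> + F \<tau> x * Y \<tau> z * F \<tau> \<eta> + F \<tau> x * F \<tau> z * Y \<tau> \<eta>"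
  let ?D = "\<lambda>\<tau>. enorm (bil (f \<tau>) (f \<tau>) x) * F \<tau> z * F \<tau> \<eta> + F \<tau> x * enorm (bil (f \<tau>) (f \<tau>) z) * F \<tau> \<eta> + F \<tau> x * F \<tau> z * enorm (bil (f \<tau>) (f \<tau>) \<eta>)"
  let ?NI = "NN \<tau>. indicator {0..t} \<tau> * ?I \<tau>"
  have w0: "0 \<le> ?w" using admD(2)[OF W] by simp
  have m: "?m \<le> C * (?w * \<bar>\<eta>\<bar>)"
    using energy_symbol_bound[OF W s] low by (simp add: zabs C_def Wz)
  have nb: "K * \<bar>\<eta>\<bar> * (1 + \<bar>v\<bar>) \<le> 12 * \<bar>res \<epsilon> x z \<eta>\<bar>"
    by (rule nonres_bound[OF e K _ s]) (use nr low v in \<open>auto simp: z_def\<close>)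
  have "(1 + \<bar>v\<bar>) * (K * (?m * ?T)) \<le> (1 + \<bar>v\<bar>) * (K * ((C * (?w * \<bar>\<eta>\<bar>)) * ?T))"
    using m K by (intro mult_left_mono mult_right_mono) auto
  also have "\<dots> = (C * ?w) * (K * \<bar>\<eta>\<bar> * (1 + \<bar>v\<bar>)) * ?T" by (simp only: ac_simps)
  also have "\<dots> \<le> (C * ?w) * (12 * \<bar>res \<epsilon> x z \<eta>\<bar>) * ?T"
    using nb C w0 by (intro mult_left_mono mult_right_mono) auto
  also have "\<dots> = 12 * C * ?w * (\<bar>res \<epsilon> x z \<eta>\<bar> * ?T)" by (simp only: ac_simps)
  finally have "ennreal ((1 + \<bar>v\<bar>) * (K * (?m * ?T))) \<le> ennreal (12 * C * ?w * (\<bar>res \<epsilon> x z \<eta>\<bar> * ?T))"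
    by (rule ennreal_leI)
  also have "\<dots> = ennreal (12 * C * ?w) * ennreal (\<bar>res \<epsilon> x z \<eta>\<bar> * ?T)"
    using C w0 by (intro ennreal_mult) auto
  finally have N0: "ennreal ((1 + \<bar>v\<bar>) * (K * (?m * ?T))) \<le> ennreal (12 * C * ?w) * ennreal (\<bar>res \<epsilon> x z \<eta>\<bar> * ?T)" .
  have N1: "ennreal (\<bar>res \<epsilon> x z \<eta>\<bar> * ?T) \<le> F t x * F t z * F t \<eta> + F 0 x * F 0 z * F 0 \<eta> +
     (NN \<tau>. indicator {0..t} \<tau> * ?D \<tau>)"
    unfolding res_def by (rule normal_form[OF t deriv_on deriv_on deriv_on cont_bil_on cont_bil_on cont_bil_on])
  have "(NN \<tau>. indicator {0..t} \<tau> * ?D \<tau>)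
     \<le> (NN \<tau>. ennreal (1 + \<bar>v\<bar>) * (indicator {0..t} \<tau> * ?I \<tau>))"
  proof (rule nn_integral_mono)
    fix \<tau>
    have b: "enorm (bil (f \<tau>) (f \<tau>) \<xi>) \<le> ennreal (1 + \<bar>v\<bar>) * Y \<tau> \<xi>" if "\<bar>\<xi>\<bar> \<le> \<bar>v\<bar>" for \<xi>
      by (rule order_trans[OF bil_le]) (intro mult_right_mono ennreal_leI; use that in simp)
    have "?D \<tau>
       \<le> (ennreal (1 + \<bar>v\<bar>) * Y \<tau> x) * F \<tau> z * F \<tau> \<eta> + F \<tau> x * (ennreal (1 + \<bar>v\<bar>) * Y \<tau> z) * F \<tau> \<eta>
        + F \<tau> x * F \<tau> z * (ennreal (1 + \<bar>v\<bar>) * Y \<tau> \<eta>)"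
      by (intro add_mono mult_left_mono mult_right_mono b v) auto
    also have "\<dots> = ennreal (1 + \<bar>v\<bar>) * ?I \<tau>"
      by (simp only: distrib_left ac_simps)
    finally have "?D \<tau>
       \<le> ennreal (1 + \<bar>v\<bar>) * ?I \<tau>" .
    then show "indicator {0..t} \<tau> * ?D \<tau>
       \<le> ennreal (1 + \<bar>v\<bar>) * (indicator {0..t} \<tau> * ?I \<tau>)"
      by (cases "\<tau> \<in> {0..t}") auto
  qed
  also have "(NN \<tau>. ennreal (1 + \<bar>v\<bar>) * (indicator {0..t} \<tau> * ?I \<tau>)) =
     ennreal (1 + \<bar>v\<bar>) * ?NI"
    by (rule nn_integral_cmult) measurable
  finally have N2: "(NN \<tau>. indicator {0..t} \<tau> * ?D \<tau>)
     \<le> ennreal (1 + \<bar>v\<bar>) * ?NI" .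
  have N3: "F t x * F t z * F t \<eta> + F 0 x * F 0 z * F 0 \<eta> + ennreal (1 + \<bar>v\<bar>) * ?NI
     \<le> ennreal (1 + \<bar>v\<bar>) * (F t x * F t z * F t \<eta> + F 0 x * F 0 z * F 0 \<eta> + ?NI)"
  proof -
    have "1 \<le> ennreal (1 + \<bar>v\<bar>)" by (metis abs_ge_zero ennreal_1 ennreal_leI le_add_same_cancel1)
    from mult_right_mono[OF this] have "X \<le> ennreal (1 + \<bar>v\<bar>) * X" for X by simp
    then show ?thesis unfolding distrib_left by (intro add_mono) auto
  qed
  have "ennreal ((1 + \<bar>v\<bar>) * (K * (?m * ?T))) \<le> ennreal (12 * C * ?w) *
     (ennreal (1 + \<bar>v\<bar>) * (F t x * F t z * F t \<eta> + F 0 x * F 0 z * F 0 \<eta> + ?NI))"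
    by (rule order_trans[OF N0 mult_left_mono[OF order_trans[OF N1 order_trans[OF add_left_mono[OF N2] N3]]]]) simp
  then have "ennreal (1 + \<bar>v\<bar>) * (ennreal K * ennreal (?m * ?T)) \<le> ennreal (1 + \<bar>v\<bar>) * (ennreal (12 * C * ?w) *
     (F t x * F t z * F t \<eta> + F 0 x * F 0 z * F 0 \<eta> + ?NI))"
    using K by (simp only: ennreal_mult' ennreal_mult'' mult.left_commute abs_ge_zero add_nonneg_nonneg zero_le_one)
  then have "ennreal K * ennreal (?m * ?T) \<le> ennreal (12 * C * ?w) *
     (F t x * F t z * F t \<eta> + F 0 x * F 0 z * F 0 \<eta> + ?NI)"
    by (subst (asm) ennreal_mult_le_mult_iff) (auto simp: add_pos_nonneg)
  also have "ennreal (12 * C * ?w) = ennreal (12 * C) * (ennreal (sqrt (W x)) * ennreal (sqrt (W (x + \<eta>))))"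
    using C admD(2)[OF W] by (simp add: ennreal_mult)
  finally show ?thesis by (simp only: Wz(2,3) C_def[symmetric] z_def[symmetric] mult.assoc)
qed

text \<open>Boundedness of the weight enters qualitatively: it makes the unsymmetrised double
  integral converge absolutely, with the derivative on an \<open>L^2\<close> factor. The constant
  \<open>B\<close> is absent from the conclusion, and so from all bounds derived from it.\<close>

lemma energy_le_low:
  assumes t: "0 \<le> t" and W: "adm c W" and B: "\<And>x. W x \<le> B"
    and H: "\<And>\<tau>. \<tau> \<in> {0..t} \<Longrightarrow> wb h1_weight (f \<tau>) H"
  shows "ennreal \<bar>(LBINT \<xi>. W \<xi> * (cmod (f t \<xi>))\<^sup>2) - (LBINT \<xi>. W \<xi> * (cmod (f 0 \<xi>))\<^sup>2)\<bar> \<le>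
    (NN \<eta>. NN x. ennreal (\<bar>energy_symbol W x (- x - \<eta>) \<eta>\<bar> * cmod (tri f f f t x (- x - \<eta>) \<eta>)) *
       indicator {x. \<bar>\<eta>\<bar> \<le> \<bar>x\<bar> \<and> \<bar>\<eta>\<bar> \<le> \<bar>x + \<eta>\<bar>} x)"
proof -
  note [measurable] = admD(1)[OF W]
  note [measurable (raw)] = measurable_tri[OF meas meas meas]
  have H': "b2 (F \<tau>) H" "b2 (\<lambda>\<xi>. ennreal \<bar>\<xi>\<bar> * F \<tau> \<xi>) H" "b1 (F \<tau>) (2 * H)" "0 \<le> H" if "\<tau> \<in> {0..t}" for \<tau>
    using wb_h1D[OF H[OF that]] by auto
  have H0: "0 \<le> H" using H'(4)[of 0] t by simp
  have B0: "0 \<le> B" using admD(2)[OF W, of 0] B[of 0] by simp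
  define I where "I x y = tri f f f t x y (- x - y)" for x y
  define J where "J = (LBINT y. LBINT x. of_real (W y * y) * I x y)"
  have fin: "(NN y. NN x. enorm (of_real (W y * y) * I x y)) < \<infinity>"
  proof -
    have "(NN y. NN x. enorm (of_real (W y * y) * I x y)) =
       (NN x. NN y. enorm (of_real (W y * y) * I x y))"
      unfolding I_def by (rule lborel_pair.Fubini') measurable
    also have "\<dots> \<le> (NN x. NN y. NN \<tau>. indicator {0..t} \<tau> * (ennreal B * ((ennreal \<bar>y\<bar> * F \<tau> y) * F \<tau> (y + x) * F \<tau> x)))"
    proof (intro nn_integral_mono)
      fix x y
      have Fe: "F \<tau> (- x - y) = F \<tau> (y + x)" for \<tau> using F_even[of \<tau> "y + x"] by (simp add: minus_diff_commute)
      have "enorm (of_real (W y * y) * I x y) = ennreal (W y * \<bar>y\<bar>) * enorm (I x y)"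
        using admD(2)[OF W] by (simp add: norm_mult abs_mult ennreal_mult)
      also have "\<dots> \<le> ennreal (B * \<bar>y\<bar>) * (NN \<tau>. indicator {0..t} \<tau> * (F \<tau> x * F \<tau> y * F \<tau> (- x - y)))"
        unfolding I_def using B by (intro mult_mono tri_le ennreal_leI mult_right_mono) auto
      also have "\<dots> = (NN \<tau>. ennreal (B * \<bar>y\<bar>) * (indicator {0..t} \<tau> * (F \<tau> x * F \<tau> y * F \<tau> (- x - y))))"
        by (rule nn_integral_cmult[symmetric]) measurable
      also have "\<dots> = (NN \<tau>. indicator {0..t} \<tau> * (ennreal B * ((ennreal \<bar>y\<bar> * F \<tau> y) * F \<tau> (y + x) * F \<tau> x)))"
        using B0 by (intro nn_integral_cong) (simp add: Fe ennreal_mult ac_simps)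
      finally show "enorm (of_real (W y * y) * I x y) \<le>
        (NN \<tau>. indicator {0..t} \<tau> * (ennreal B * ((ennreal \<bar>y\<bar> * F \<tau> y) * F \<tau> (y + x) * F \<tau> x)))" .
    qed
    also have "\<dots> \<le> ennreal (t * (B * (H * H * (2 * H))))"
    proof (rule nn_integral_time_bound[OF _ _ t])
      fix \<tau> assume \<tau>: "\<tau> \<in> {0..t}"
      have "(NN x. NN y. ennreal B * ((ennreal \<bar>y\<bar> * F \<tau> y) * F \<tau> (y + x) * F \<tau> x)) =
         ennreal B * (NN x. NN y. (ennreal \<bar>y\<bar> * F \<tau> y) * F \<tau> (y + x) * F \<tau> x)"
        by (simp add: nn_integral_cmult)
      also have "\<dots> \<le> ennreal B * ennreal (H * H * (2 * H))"
        by (intro mult_left_mono trilinear_L1 H' \<tau>) auto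
      also have "\<dots> = ennreal (B * (H * H * (2 * H)))" using H0 B0 by (intro ennreal_mult[symmetric]) auto
      finally show "(NN x. NN y. ennreal B * ((ennreal \<bar>y\<bar> * F \<tau> y) * F \<tau> (y + x) * F \<tau> x)) \<le> ennreal (B * (H * H * (2 * H)))" .
    qed measurable
    finally show ?thesis by (rule le_less_trans) simp
  qed
  have Jm: "case_prod (\<lambda>y x. of_real (W y * y) * I x y) \<in> borel_measurable (borel \<Otimes>\<^sub>M borel)"
    unfolding I_def by measurable
  define G where "G \<xi> = of_real (W \<xi>) * (- (\<i> * of_real (\<xi> / (4 * pi))) * (LBINT \<eta>. tri f f f t \<eta> (- \<xi>) (\<xi> - \<eta>)))" for \<xi>
  have Gm: "G (- y) = \<i> / (4 * pi) * (LBINT x. of_real (W y * y) * I x y)" for y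
    unfolding G_def I_def by (simp add: adm_even[OF W] minus_diff_commute)
  have iG: "integrable lborel G"
  proof -
    have "integrable lborel (\<lambda>y. G (- y))"
      unfolding Gm by (intro integrable_mult_right Fubini_nn(4)[OF Jm fin])
    then show ?thesis using lborel_integrable_real_affine_iff[of "-1" G 0] by simp
  qed
  have LG: "(LBINT \<xi>. G \<xi>) = \<i> / (4 * pi) * J"
    using lborel_integral_real_affine[of "-1" G 0] by (simp add: Gm J_def)
  have pt: "W \<xi> * (cmod (f t \<xi>))\<^sup>2 - W \<xi> * (cmod (f 0 \<xi>))\<^sup>2 = 2 * Re (G \<xi>)" for \<xi>
  proof -
    have "(LBINT \<tau>. indicator {0..t} \<tau> *\<^sub>R (f \<tau> (- \<xi>) * bil (f \<tau>) (f \<tau>) \<xi>)) =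
     - (\<i> * of_real (\<xi> / (4 * pi))) * (LBINT \<eta>. tri f f f t \<eta> (- \<xi>) (\<xi> - \<eta>))"
      by (rule bil_energy[OF meas meas meas H'(1) H'(1) cont_f_on])
    moreover have "(cmod (f t \<xi>))\<^sup>2 - (cmod (f 0 \<xi>))\<^sup>2 = 2 * Re (LBINT \<tau>. indicator {0..t} \<tau> *\<^sub>R (f \<tau> (- \<xi>) * bil (f \<tau>) (f \<tau>) \<xi>))"
      unfolding reality by (rule energy_pointwise[OF t deriv_on cont_bil_on])
    ultimately have "(cmod (f t \<xi>))\<^sup>2 - (cmod (f 0 \<xi>))\<^sup>2 = 2 * Re (- (\<i> * of_real (\<xi> / (4 * pi))) * (LBINT \<eta>. tri f f f t \<eta> (- \<xi>) (\<xi> - \<eta>)))"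
      by (simp only:)
    moreover have "Re (of_real (W \<xi>) * z) = W \<xi> * Re z" for z by simp
    ultimately have "W \<xi> * ((cmod (f t \<xi>))\<^sup>2 - (cmod (f 0 \<xi>))\<^sup>2) = 2 * Re (G \<xi>)"
      unfolding G_def by (simp only: mult.left_commute)
    then show ?thesis by (simp only: right_diff_distrib)
  qed
  have iW: "integrable lborel (\<lambda>\<xi>. W \<xi> * (cmod (f \<tau> \<xi>))\<^sup>2)" if "\<tau> \<in> {0..t}" for \<tau>
  proof (rule Bochner_Integration.integrable_bound[where f="\<lambda>\<xi>. B * (cmod (f \<tau> \<xi>))\<^sup>2"])
    have "square_integrable (f \<tau>)" using H'(1)[OF that] by (auto simp: square_integrable_b2)
    then show "integrable lborel (\<lambda>\<xi>. B * (cmod (f \<tau> \<xi>))\<^sup>2)" by (simp add: square_integrable_def)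
  qed (use B admD(2)[OF W] B0 in \<open>auto intro!: AE_I2 mult_right_mono simp: abs_mult\<close>)
  have "(LBINT \<xi>. W \<xi> * (cmod (f t \<xi>))\<^sup>2) - (LBINT \<xi>. W \<xi> * (cmod (f 0 \<xi>))\<^sup>2) =
     (LBINT \<xi>. 2 * Re (G \<xi>))"
    using t by (subst Bochner_Integration.integral_diff[symmetric]) (auto simp: pt iW)
  also have "\<dots> = 2 * Re (\<i> / (4 * pi) * J)"
    unfolding LG[symmetric] using iG by simp
  finally have "\<bar>(LBINT \<xi>. W \<xi> * (cmod (f t \<xi>))\<^sup>2) - (LBINT \<xi>. W \<xi> * (cmod (f 0 \<xi>))\<^sup>2)\<bar> = 2 * \<bar>Re (\<i> / (4 * pi) * J)\<bar>"
    by (simp only: abs_mult abs_numeral)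
  also have "\<dots> \<le> 2 * cmod (\<i> / (4 * pi) * J)" by (intro mult_left_mono abs_Re_le_cmod) auto
  also have "\<dots> \<le> cmod J"
    using pi_gt3 mult_left_mono[of 1 "2 * pi" "cmod J"] by (simp add: norm_mult norm_divide divide_le_eq)
  finally have "ennreal \<bar>(LBINT \<xi>. W \<xi> * (cmod (f t \<xi>))\<^sup>2) - (LBINT \<xi>. W \<xi> * (cmod (f 0 \<xi>))\<^sup>2)\<bar> \<le> enorm J"
    by (rule ennreal_leI)
  also have "\<dots> \<le> (NN \<eta>. NN x. ennreal (\<bar>energy_symbol W x (- x - \<eta>) \<eta>\<bar> * cmod (tri f f f t x (- x - \<eta>) \<eta>)) *
       indicator {x. \<bar>\<eta>\<bar> \<le> \<bar>x\<bar> \<and> \<bar>\<eta>\<bar> \<le> \<bar>x + \<eta>\<bar>} x)" (is "_ \<le> ?low")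
  proof -
    let ?\<Phi> = "\<lambda>x y z. ennreal (\<bar>energy_symbol W x y z\<bar> * cmod (tri f f f t x y z))"
    have "ennreal (3 * cmod J) \<le> (NN y. NN x. ennreal (\<bar>W x * x + W y * y + W (- x - y) * (- x - y)\<bar> * cmod (I x y)))"
      unfolding J_def
    proof (rule symmetrize[OF _ _ _ _ fin])
      show "case_prod I \<in> borel_measurable (borel \<Otimes>\<^sub>M borel)" unfolding I_def by measurable
      show "I x y = I y x" for x y unfolding I_def tri_def by (simp add: mult.commute minus_diff_commute)
      show "I (- x - y) y = I x y" for x y unfolding I_def tri_def by (simp add: mult.commute mult.left_commute)
    qed measurable
    also have "\<dots> = (NN y. NN x. ?\<Phi> x y (- x - y))"
      unfolding I_def energy_symbol_def by (simp only: add.assoc)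
    also have "\<dots> \<le> 3 * ?low"
    proof (rule symmetric_low_frequency)
      show "?\<Phi> x y z = ?\<Phi> y x z" for x y z unfolding energy_symbol_def tri_def by (simp add: ac_simps)
      show "?\<Phi> x y z = ?\<Phi> x z y" for x y z unfolding energy_symbol_def tri_def by (simp add: ac_simps)
      fix g1 g2 g3 :: "(real \<times> real) \<Rightarrow> real" and M
      assume [measurable]: "g1 \<in> borel_measurable M" "g2 \<in> borel_measurable M" "g3 \<in> borel_measurable M"
      show "(\<lambda>w. ?\<Phi> (g1 w) (g2 w) (g3 w)) \<in> borel_measurable M"
        unfolding energy_symbol_def by measurable
    qed
    finally have "3 * enorm J \<le> 3 * ?low" by (simp add: ennreal_mult)
    then show ?thesis by (subst (asm) ennreal_mult_le_mult_iff) auto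
  qed
  finally show ?thesis .
qed

end

context fsol
begin

text \<open>The integrand is dominated by the resonant part \<open>R\<close>, the two boundary terms
  \<open>b\<close> of the integration by parts, and the part \<open>N\<close> with the nonlinearity
  inserted. In \<open>R\<close> the derivative stays on \<open>F \<tau> \<eta>\<close> in
  \<open>L^2\<close>, and the slices of measure \<open>6 * K\<close> are used; \<open>b\<close> and
  \<open>N\<close> carry the factor \<open>1 / K\<close>. The number \<open>20 * 2^c\<close> rounds
  up \<open>16 * 2^c + 4\<close>.\<close>

lemma low_le:
  assumes t: "0 \<le> t" and e: "0 \<le> \<epsilon>" "\<epsilon> \<le> 1" and K: "6 \<le> K" and W: "adm c W"
    and H: "\<And>\<tau>. \<tau> \<in> {0..t} \<Longrightarrow> wb h1_weight (f \<tau>) H"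
    and X: "\<And>\<tau>. \<tau> \<in> {0..t} \<Longrightarrow> wb W (f \<tau>) X"
  shows "(NN \<eta>. NN x. ennreal (\<bar>energy_symbol W x (- x - \<eta>) \<eta>\<bar> * cmod (tri f f f t x (- x - \<eta>) \<eta>)) *
       indicator {x. \<bar>\<eta>\<bar> \<le> \<bar>x\<bar> \<and> \<bar>\<eta>\<bar> \<le> \<bar>x + \<eta>\<bar>} x) \<le>
    ennreal ((2 + real c) * 2^c * (X\<^sup>2 * (t * (sqrt (6 * K) * H) + 12 / K * (4 * H + t * (20 * 2^c * H\<^sup>2)))))"
proof -
  define C where "C = (2 + real c) * 2^c"
  have C: "0 \<le> C" by (simp add: C_def)
  note [measurable] = admD(1)[OF W]
  have H': "b2 (F \<tau>) H" "b2 (\<lambda>\<xi>. ennreal \<bar>\<xi>\<bar> * F \<tau> \<xi>) H" "b1 (F \<tau>) (2 * H)" "0 \<le> H" if "\<tau> \<in> {0..t}" for \<tau>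
    using wb_h1D[OF H[OF that]] by auto
  have H0: "0 \<le> H" using H'(4)[of 0] t by simp
  define V where "V \<tau> \<xi> = ennreal (sqrt (W \<xi>)) * F \<tau> \<xi>" for \<tau> \<xi>
  define Z where "Z \<tau> \<xi> = ennreal (sqrt (W \<xi>)) * Y \<tau> \<xi>" for \<tau> \<xi>
  have V: "b2 (V \<tau>) X" if "\<tau> \<in> {0..t}" for \<tau>
    using X[OF that] by (simp add: wb_def V_def[abs_def])
  have X0: "0 \<le> X" using V[of 0] t by (auto simp: b2_def)
  have Z: "b2 (Z \<tau>) (4 * 2^c * H * X)" if "\<tau> \<in> {0..t}" for \<tau>
    using b2_weighted_conv[OF W H'(3)[OF that] V[OF that, unfolded V_def[abs_def]]]
    by (simp add: Z_def[abs_def] mult.assoc mult.left_commute)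
  have Yb: "b1 (Y \<tau>) (2 * H * (2 * H))" if "\<tau> \<in> {0..t}" for \<tau>
    by (rule b1_conv[OF H'(3) H'(3)]) (use that in auto)
  have [measurable (raw)]: "(\<lambda>w. V (g w) (h w)) \<in> borel_measurable M" "(\<lambda>w. Z (g w) (h w)) \<in> borel_measurable M"
    if [measurable]: "g \<in> borel_measurable M" "h \<in> borel_measurable M" for g h and M :: "'z measure"
    unfolding V_def Z_def by measurable
  define S where "S \<eta> x \<longleftrightarrow> \<bar>\<eta>\<bar> \<le> \<bar>x\<bar> \<and> \<bar>\<eta>\<bar> \<le> \<bar>x + \<eta>\<bar> \<and> \<not> nonres \<epsilon> K x (- x - \<eta>) \<eta>" for \<eta> x
  have Sm[measurable]: "Measurable.pred (borel \<Otimes>\<^sub>M borel) (\<lambda>(\<eta>, x). S \<eta> x)"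
    unfolding S_def nonres_def by measurable
  have Si: "(\<lambda>w. indicator {x. S (g w) x} (h w) :: ennreal) \<in> borel_measurable M"
    if [measurable]: "g \<in> borel_measurable M" "h \<in> borel_measurable M" for g h and M :: "'z measure"
    unfolding indicator_def S_def nonres_def mem_Collect_eq by measurable
  note [measurable (raw)] = Si
  define R where "R \<eta> x = (NN \<tau>. indicator {0..t} \<tau> * (V \<tau> x * V \<tau> (x + \<eta>) * (ennreal \<bar>\<eta>\<bar> * F \<tau> \<eta>) * indicator {x. S \<eta> x} x))" for \<eta> x
  define N where "N \<eta> x = (NN \<tau>. indicator {0..t} \<tau> * (Z \<tau> x * V \<tau> (x + \<eta>) * F \<tau> \<eta> + V \<tau> x * Z \<tau> (x + \<eta>) * F \<tau> \<eta>
      + V \<tau> x * V \<tau> (x + \<eta>) * Y \<tau> \<eta>))" for \<eta> x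
  define b where "b \<tau> \<eta> x = V \<tau> x * V \<tau> (x + \<eta>) * F \<tau> \<eta>" for \<tau> \<eta> x
  have [measurable (raw)]: "(\<lambda>w. R (g w) (h w)) \<in> borel_measurable M" "(\<lambda>w. N (g w) (h w)) \<in> borel_measurable M" "(\<lambda>w. b \<tau> (g w) (h w)) \<in> borel_measurable M"
    if [measurable]: "g \<in> borel_measurable M" "h \<in> borel_measurable M" for g h \<tau> and M :: "'z measure"
    unfolding R_def N_def b_def by measurable
  let ?P = "\<lambda>\<eta> x. ennreal (\<bar>energy_symbol W x (- x - \<eta>) \<eta>\<bar> * cmod (tri f f f t x (- x - \<eta>) \<eta>)) *
       indicator {x. \<bar>\<eta>\<bar> \<le> \<bar>x\<bar> \<and> \<bar>\<eta>\<bar> \<le> \<bar>x + \<eta>\<bar>} x"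
  have pt: "?P \<eta> x \<le> ennreal C * R \<eta> x + ennreal (12 * C / K) * (b t \<eta> x + b 0 \<eta> x + N \<eta> x)" for \<eta> x
  proof (cases "\<bar>\<eta>\<bar> \<le> \<bar>x\<bar> \<and> \<bar>\<eta>\<bar> \<le> \<bar>x + \<eta>\<bar>")
    case low: True
    have Fz: "F \<tau> (- x - \<eta>) = F \<tau> (x + \<eta>)" for \<tau> using F_even[of \<tau> "x + \<eta>"] by simp
    show ?thesis
    proof (cases "nonres \<epsilon> K x (- x - \<eta>) \<eta>")
      case True
      have eq: "ennreal (sqrt (W x)) * ennreal (sqrt (W (x + \<eta>))) *
      (F t x * F t (x + \<eta>) * F t \<eta> + F 0 x * F 0 (x + \<eta>) * F 0 \<eta> +
       (NN \<tau>. indicator {0..t} \<tau> * (Y \<tau> x * F \<tau> (x + \<eta>) * F \<tau> \<eta> + F \<tau> x * Y \<tau> (x + \<eta>) * F \<tau> \<eta>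
          + F \<tau> x * F \<tau> (x + \<eta>) * Y \<tau> \<eta>))) = b t \<eta> x + b 0 \<eta> x + N \<eta> x"
        (is "?w * (?B1 + ?B2 + integral\<^sup>N lborel ?g) = _")
      proof -
        have "?w * integral\<^sup>N lborel ?g = (NN \<tau>. ?w * ?g \<tau>)"
          by (rule nn_integral_cmult[symmetric]) measurable
        also have "\<dots> = N \<eta> x"
          unfolding N_def V_def Z_def by (intro nn_integral_cong) (simp only: distrib_left ac_simps)
        finally show ?thesis
          unfolding b_def V_def distrib_left by (simp only: ac_simps)
      qed
      have "ennreal K * ?P \<eta> x \<le> ennreal (12 * C) * (b t \<eta> x + b 0 \<eta> x + N \<eta> x)"
        using nonres_pointwise[OF t e K W conjunct1[OF low] conjunct2[OF low] True] low
        unfolding eq C_def by simp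
      then have "ennreal (1 / K) * (ennreal K * ?P \<eta> x) \<le> ennreal (1 / K) * (ennreal (12 * C) * (b t \<eta> x + b 0 \<eta> x + N \<eta> x))"
        by (rule mult_left_mono) simp
      moreover have "ennreal (1 / K) * ennreal K = 1" "ennreal (1 / K) * ennreal (12 * C) = ennreal (12 * C / K)"
        using K C by (simp_all flip: ennreal_mult)
      ultimately have "?P \<eta> x \<le> ennreal (12 * C / K) * (b t \<eta> x + b 0 \<eta> x + N \<eta> x)"
        by (simp only: mult.assoc[symmetric] mult_1_left)
      then show ?thesis by (rule order_trans) simp
    next
      case False
      then have Sx: "S \<eta> x" using low by (simp add: S_def)
      have m: "\<bar>energy_symbol W x (- x - \<eta>) \<eta>\<bar> \<le> C * (sqrt (W x) * sqrt (W (x + \<eta>)) * \<bar>\<eta>\<bar>)"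
        using energy_symbol_bound[OF W, of x "- x - \<eta>" \<eta>] low adm_even[OF W, of "x + \<eta>"] abs_minus_cancel[of "x + \<eta>"]
        by (simp add: C_def)
      have "?P \<eta> x = ennreal \<bar>energy_symbol W x (- x - \<eta>) \<eta>\<bar> * enorm (tri f f f t x (- x - \<eta>) \<eta>)"
        using low by (simp add: ennreal_mult)
      also have "\<dots> \<le> ennreal (C * (sqrt (W x) * sqrt (W (x + \<eta>)) * \<bar>\<eta>\<bar>)) *
         (NN \<tau>. indicator {0..t} \<tau> * (F \<tau> x * F \<tau> (- x - \<eta>) * F \<tau> \<eta>))"
        by (intro mult_mono tri_le ennreal_leI m) auto
      also have "\<dots> = (NN \<tau>. ennreal (C * (sqrt (W x) * sqrt (W (x + \<eta>)) * \<bar>\<eta>\<bar>)) * (indicator {0..t} \<tau> * (F \<tau> x * F \<tau> (- x - \<eta>) * F \<tau> \<eta>)))"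
        by (rule nn_integral_cmult[symmetric]) measurable
      also have "\<dots> = (NN \<tau>. ennreal C * (indicator {0..t} \<tau> * (V \<tau> x * V \<tau> (x + \<eta>) * (ennreal \<bar>\<eta>\<bar> * F \<tau> \<eta>) * indicator {x. S \<eta> x} x)))"
        using C admD(2)[OF W] Sx
        by (intro nn_integral_cong) (simp add: Fz V_def ennreal_mult ac_simps)
      also have "\<dots> = ennreal C * R \<eta> x"
        unfolding R_def by (rule nn_integral_cmult) measurable
      finally show ?thesis by (rule order_trans) simp
    qed
  qed simp
  have iR: "(NN \<eta>. NN x. R \<eta> x) \<le> ennreal (t * (sqrt (6 * K) * X * X * H))"
    unfolding R_def
  proof (rule nn_integral_time_bound[OF _ _ t])
    fix \<tau> assume \<tau>: "\<tau> \<in> {0..t}"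
    show "(NN \<eta>. NN x. V \<tau> x * V \<tau> (x + \<eta>) * (ennreal \<bar>\<eta>\<bar> * F \<tau> \<eta>) * indicator {x. S \<eta> x} x) \<le> ennreal (sqrt (6 * K) * X * X * H)"
      by (rule trilinear_slices[OF V V H'(2) Sm]) (use \<tau> resonant_measure[OF e(1), of K] K in \<open>auto simp: S_def\<close>)
  qed measurable
  have ib: "(NN \<eta>. NN x. b \<tau> \<eta> x) \<le> ennreal (X * X * (2 * H))" if "\<tau> \<in> {0..t}" for \<tau>
    unfolding b_def by (rule trilinear_L1[OF V V H'(3)]) (use that in auto)
  have iN: "(NN \<eta>. NN x. N \<eta> x) \<le> ennreal (t * (20 * 2^c * H\<^sup>2 * X\<^sup>2))"
    unfolding N_def
  proof (rule nn_integral_time_bound[OF _ _ t])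
    fix \<tau> assume \<tau>: "\<tau> \<in> {0..t}"
    have "(NN \<eta>. NN x. Z \<tau> x * V \<tau> (x + \<eta>) * F \<tau> \<eta> + V \<tau> x * Z \<tau> (x + \<eta>) * F \<tau> \<eta> + V \<tau> x * V \<tau> (x + \<eta>) * Y \<tau> \<eta>) =
       (NN \<eta>. NN x. Z \<tau> x * V \<tau> (x + \<eta>) * F \<tau> \<eta>) + (NN \<eta>. NN x. V \<tau> x * Z \<tau> (x + \<eta>) * F \<tau> \<eta>)
       + (NN \<eta>. NN x. V \<tau> x * V \<tau> (x + \<eta>) * Y \<tau> \<eta>)"
      by (simp add: nn_integral_add)
    also have "\<dots> \<le> ennreal (4 * 2^c * H * X * X * (2 * H)) + ennreal (X * (4 * 2^c * H * X) * (2 * H)) + ennreal (X * X * (2 * H * (2 * H)))"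
      by (intro add_mono trilinear_L1 V Z H' Yb \<tau>)
    also have "\<dots> = ennreal ((16 * 2^c + 4) * H\<^sup>2 * X\<^sup>2)"
      using H0 X0 by (simp add: power2_eq_square algebra_simps flip: ennreal_plus)
    also have "\<dots> \<le> ennreal (20 * 2^c * H\<^sup>2 * X\<^sup>2)"
      using one_le_power[of "2::real" c] by (intro ennreal_leI mult_right_mono) auto
    finally show "(NN \<eta>. NN x. Z \<tau> x * V \<tau> (x + \<eta>) * F \<tau> \<eta> + V \<tau> x * Z \<tau> (x + \<eta>) * F \<tau> \<eta> + V \<tau> x * V \<tau> (x + \<eta>) * Y \<tau> \<eta>)
      \<le> ennreal (20 * 2^c * H\<^sup>2 * X\<^sup>2)" .
  qed measurable
  have "(NN \<eta>. NN x. ?P \<eta> x) \<le>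
     (NN \<eta>. NN x. ennreal C * R \<eta> x + ennreal (12 * C / K) * (b t \<eta> x + b 0 \<eta> x + N \<eta> x))"
    by (intro nn_integral_mono pt)
  also have "\<dots> = ennreal C * (NN \<eta>. NN x. R \<eta> x) + ennreal (12 * C / K) *
     ((NN \<eta>. NN x. b t \<eta> x) + (NN \<eta>. NN x. b 0 \<eta> x) + (NN \<eta>. NN x. N \<eta> x))"
    by (simp add: nn_integral_add nn_integral_cmult)
  also have "\<dots> \<le> ennreal C * ennreal (t * (sqrt (6 * K) * X * X * H)) + ennreal (12 * C / K) *
     (ennreal (X * X * (2 * H)) + ennreal (X * X * (2 * H)) + ennreal (t * (20 * 2^c * H\<^sup>2 * X\<^sup>2)))"
    using t by (intro add_mono mult_left_mono iR ib iN) auto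
  also have "\<dots> = ennreal (C * (t * (sqrt (6 * K) * X * X * H)) + 12 * C / K * (X * X * (2 * H) + X * X * (2 * H) + t * (20 * 2^c * H\<^sup>2 * X\<^sup>2)))"
  proof -
    have "ennreal a * ennreal a' + ennreal d * (ennreal p + ennreal q + ennreal r) = ennreal (a * a' + d * (p + q + r))"
      if "0 \<le> a" "0 \<le> a'" "0 \<le> d" "0 \<le> p" "0 \<le> q" "0 \<le> r" for a a' d p q r
      using that by (simp add: ennreal_mult)
    then show ?thesis using C K H0 X0 t by simp
  qed
  also have "C * (t * (sqrt (6 * K) * X * X * H)) + 12 * C / K * (X * X * (2 * H) + X * X * (2 * H) + t * (20 * 2^c * H\<^sup>2 * X\<^sup>2)) =
     C * (X\<^sup>2 * (t * (sqrt (6 * K) * H) + 12 / K * (4 * H + t * (20 * 2^c * H\<^sup>2))))"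
    by (simp add: power2_eq_square algebra_simps)
  finally show ?thesis unfolding C_def .
qed

lemma energy_estimate:
  assumes t: "0 \<le> t" and e: "0 \<le> \<epsilon>" "\<epsilon> \<le> 1" and K: "6 \<le> K" and W: "adm c W" and B: "\<And>x. W x \<le> B"
    and H: "\<And>\<tau>. \<tau> \<in> {0..t} \<Longrightarrow> wb h1_weight (f \<tau>) H"
    and X: "\<And>\<tau>. \<tau> \<in> {0..t} \<Longrightarrow> wb W (f \<tau>) X"
  shows "\<bar>(LBINT \<xi>. W \<xi> * (cmod (f t \<xi>))\<^sup>2) - (LBINT \<xi>. W \<xi> * (cmod (f 0 \<xi>))\<^sup>2)\<bar> \<le>
    (2 + real c) * 2^c * (X\<^sup>2 * (t * (sqrt (6 * K) * H) + 12 / K * (4 * H + t * (20 * 2^c * H\<^sup>2))))"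
proof -
  have "0 \<le> H" using wb_h1D(4)[OF H[of 0]] t by simp
  then have "0 \<le> (2 + real c) * 2^c * (X\<^sup>2 * (t * (sqrt (6 * K) * H) + 12 / K * (4 * H + t * (20 * 2^c * H\<^sup>2))))"
    using t K by simp
  moreover have "ennreal \<bar>(LBINT \<xi>. W \<xi> * (cmod (f t \<xi>))\<^sup>2) - (LBINT \<xi>. W \<xi> * (cmod (f 0 \<xi>))\<^sup>2)\<bar> \<le>
    ennreal ((2 + real c) * 2^c * (X\<^sup>2 * (t * (sqrt (6 * K) * H) + 12 / K * (4 * H + t * (20 * 2^c * H\<^sup>2)))))"
    by (rule order_trans[OF energy_le_low[OF t W B H] low_le[OF t e K W H X]])
  ultimately show ?thesis by (simp only: ennreal_le_iff)
qed

end

section \<open>A priori bounds in weighted norms on short time intervals\<close>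

definition wnorm2 :: "(real \<Rightarrow> real) \<Rightarrow> (real \<Rightarrow> complex) \<Rightarrow> ennreal" where
  "wnorm2 W g = (NN \<xi>. ennreal (W \<xi>) * (enorm (g \<xi>))\<^sup>2)"

lemma wb_wnorm2:
  assumes [measurable]: "W \<in> borel_measurable borel" "g \<in> borel_measurable borel" and W: "\<And>x. 0 \<le> W x"
  shows "wb W g a \<longleftrightarrow> 0 \<le> a \<and> wnorm2 W g \<le> ennreal (a\<^sup>2)"
proof -
  have "(ennreal (sqrt (W \<xi>)) * enorm (g \<xi>))\<^sup>2 = ennreal (W \<xi>) * (enorm (g \<xi>))\<^sup>2" for \<xi>
    using W by (simp add: power_mult_distrib ennreal_power)
  then show ?thesis by (auto simp: wb_def b2_def wnorm2_def)
qed

text \<open>Let \<open>S\<close> be the supremum of the weighted energy over the interval; it is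
  finite because the weight is bounded. Smallness turns \<open>energy_estimate\<close> into
  \<open>E \<tau> <= E 0 + S / 2\<close>, and taking the supremum gives
  \<open>S <= 2 * E 0\<close>.\<close>

lemma (in fsol) a_priori_bounded:
  assumes t: "0 \<le> t" and e: "0 \<le> \<epsilon>" "\<epsilon> \<le> 1" and K: "6 \<le> K" and W: "adm c W" and B: "\<And>x. W x \<le> B"
    and H: "\<And>\<tau>. \<tau> \<in> {0..t} \<Longrightarrow> wb h1_weight (f \<tau>) H"
    and small: "(2 + real c) * 2^c * (t * (sqrt (6 * K) * H) + 12 / K * (4 * H + t * (20 * 2^c * H\<^sup>2))) \<le> 1/2"
    and \<tau>: "\<tau> \<in> {0..t}"
  shows "wnorm2 W (f \<tau>) \<le> 2 * wnorm2 W (f 0)"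
proof -
  define E where "E \<tau> = (LBINT \<xi>. W \<xi> * (cmod (f \<tau> \<xi>))\<^sup>2)" for \<tau>
  note [measurable] = admD(1)[OF W]
  have B0: "0 \<le> B" using admD(2)[OF W, of 0] B[of 0] by simp
  have H0: "0 \<le> H" using wb_h1D(4)[OF H[of 0]] t by simp
  have le: "wnorm2 W (f \<tau>) \<le> ennreal (B * H\<^sup>2)" if "\<tau> \<in> {0..t}" for \<tau>
  proof -
    have b: "b2 (F \<tau>) H" using wb_h1D(1)[OF H[OF that]] by simp
    have "wnorm2 W (f \<tau>) \<le> (NN \<xi>. ennreal B * (F \<tau> \<xi>)\<^sup>2)"
      unfolding wnorm2_def by (intro nn_integral_mono mult_right_mono ennreal_leI B) auto
    also have "\<dots> = ennreal B * (NN \<xi>. (F \<tau> \<xi>)\<^sup>2)" by (rule nn_integral_cmult) measurable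
    also have "\<dots> \<le> ennreal B * ennreal (H\<^sup>2)" by (intro mult_left_mono b2_le[OF b]) auto
    finally show ?thesis using B0 by (simp add: ennreal_mult)
  qed
  have eq: "wnorm2 W (f \<tau>) = ennreal (E \<tau>)" if "\<tau> \<in> {0..t}" for \<tau>
  proof -
    have wn: "wnorm2 W (f \<tau>) = (NN \<xi>. ennreal (W \<xi> * (cmod (f \<tau> \<xi>))\<^sup>2))"
      unfolding wnorm2_def using admD(2)[OF W] by (simp add: ennreal_mult ennreal_power)
    have "integrable lborel (\<lambda>\<xi>. W \<xi> * (cmod (f \<tau> \<xi>))\<^sup>2)"
      using le[OF that] admD(2)[OF W] unfolding wn by (intro integrableI_nonneg) (auto intro: le_less_trans)
    then show ?thesis unfolding wn E_def using admD(2)[OF W] by (intro nn_integral_eq_integral) auto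
  qed
  have E0: "0 \<le> E \<tau>" for \<tau> unfolding E_def using admD(2)[OF W] by (intro integral_nonneg_AE) auto
  have bdd: "bdd_above (E ` {0..t})"
    using le eq E0 B0 by (intro bdd_aboveI[of _ "B * H\<^sup>2"]) (auto simp: ennreal_le_iff)
  define S where "S = (SUP \<tau>\<in>{0..t}. E \<tau>)"
  have S: "E \<tau> \<le> S" if "\<tau> \<in> {0..t}" for \<tau> unfolding S_def by (rule cSUP_upper[OF that bdd])
  have S0: "0 \<le> S" using S[of 0] E0[of 0] t by simp
  have X: "wb W (f \<tau>) (sqrt S)" if "\<tau> \<in> {0..t}" for \<tau>
    using S[OF that] S0 admD(2)[OF W] eq[OF that] by (subst wb_wnorm2) (auto intro: ennreal_leI)
  have step: "E \<tau> \<le> E 0 + S / 2" if \<tau>: "\<tau> \<in> {0..t}" for \<tau>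
  proof -
    have "\<bar>E \<tau> - E 0\<bar> \<le> (2 + real c) * 2^c * ((sqrt S)\<^sup>2 * (\<tau> * (sqrt (6 * K) * H) + 12 / K * (4 * H + \<tau> * (20 * 2^c * H\<^sup>2))))"
      unfolding E_def by (rule energy_estimate[OF _ e K W B H X]) (use \<tau> in auto)
    also have "\<dots> = S * ((2 + real c) * 2^c * (\<tau> * (sqrt (6 * K) * H) + 12 / K * (4 * H + \<tau> * (20 * 2^c * H\<^sup>2))))"
      using S0 by simp
    also have "\<dots> \<le> S * ((2 + real c) * 2^c * (t * (sqrt (6 * K) * H) + 12 / K * (4 * H + t * (20 * 2^c * H\<^sup>2))))"
      using \<tau> S0 H0 K by (intro mult_left_mono add_mono mult_right_mono) auto
    also have "\<dots> \<le> S * (1/2)" using S0 by (intro mult_left_mono small) auto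
    finally have "\<bar>E \<tau> - E 0\<bar> \<le> S * (1/2)" .
    then show ?thesis using abs_ge_self[of "E \<tau> - E 0"] by linarith
  qed
  have "S \<le> E 0 + S / 2" unfolding S_def[of] using t step[unfolded S_def] by (intro cSUP_least) auto
  then have "E \<tau> \<le> 2 * E 0" using S[OF \<tau>] by simp
  then have "ennreal (E \<tau>) \<le> ennreal (2 * E 0)" by (rule ennreal_leI)
  also have "\<dots> = 2 * ennreal (E 0)" using E0 by (simp add: ennreal_mult)
  finally show ?thesis using eq[OF \<tau>] eq[of 0] t by simp
qed

text \<open>Monotone convergence. The truncations of an admissible weight are bounded and admissible
  with the same \<open>c\<close>, so that no constant depends on the truncation height.\<close>

lemma wnorm2_truncate:
  assumes W: "adm c W" and [measurable]: "g \<in> borel_measurable borel"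
    and le: "\<And>n::nat. wnorm2 (\<lambda>x. min (W x) (real n)) g \<le> C"
  shows "wnorm2 W g \<le> C"
proof -
  note [measurable] = admD(1)[OF W]
  have "(\<lambda>n. wnorm2 (\<lambda>x. min (W x) (real n)) g) \<longlonglongrightarrow> wnorm2 W g"
    unfolding wnorm2_def
  proof (rule nn_integral_LIMSEQ)
    show "incseq (\<lambda>n \<xi>. ennreal (min (W \<xi>) (real n)) * (enorm (g \<xi>))\<^sup>2)"
      by (intro incseq_SucI) (auto simp: le_fun_def intro!: mult_right_mono ennreal_leI min.mono)
    fix \<xi>
    obtain N where "W \<xi> \<le> real N" using real_arch_simple by blast
    then have "eventually (\<lambda>n. ennreal (min (W \<xi>) (real n)) * (enorm (g \<xi>))\<^sup>2 = ennreal (W \<xi>) * (enorm (g \<xi>))\<^sup>2) sequentially"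
      unfolding eventually_sequentially by (intro exI[of _ N]) (auto simp: min_def)
    then show "(\<lambda>n. ennreal (min (W \<xi>) (real n)) * (enorm (g \<xi>))\<^sup>2) \<longlonglongrightarrow> ennreal (W \<xi>) * (enorm (g \<xi>))\<^sup>2"
      by (rule tendsto_eventually)
  qed auto
  then show ?thesis by (rule LIMSEQ_le_const2) (use le in auto)
qed

lemma wnorm2_mono: "(\<And>x. V x \<le> W x) \<Longrightarrow> wnorm2 V g \<le> wnorm2 W g"
  unfolding wnorm2_def by (intro nn_integral_mono mult_right_mono ennreal_leI) auto

lemma a_priori:
  assumes H0: "0 \<le> H"
  shows "\<exists>\<delta>>0. \<forall>\<epsilon> f t W. fsol \<epsilon> f \<longrightarrow> 0 \<le> \<epsilon> \<longrightarrow> \<epsilon> \<le> 1 \<longrightarrow> 0 \<le> t \<longrightarrow> t \<le> \<delta> \<longrightarrow>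
    (\<forall>\<tau>\<in>{0..t}. wb h1_weight (f \<tau>) H) \<longrightarrow> adm c W \<longrightarrow> wnorm2 W (f t) \<le> 2 * wnorm2 W (f 0)"
proof -
  define M where "M = (2 + real c) * 2^c"
  \<comment> \<open>With this threshold the contribution \<open>48 * M * H / K\<close> of the
    boundary terms, which has no factor \<open>t\<close>, is at most \<open>1/4\<close>.\<close>
  define K where "K = 6 + 192 * M * H"
  have M: "0 < M" by (simp add: M_def)
  have K: "6 \<le> K" using M H0 by (simp add: K_def)
  define D where "D = M * (sqrt (6 * K) * H + 12 / K * (20 * 2^c * H\<^sup>2))"
  have D: "0 \<le> D" unfolding D_def using M K H0 by auto
  \<comment> \<open>Chosen after \<open>K\<close>, so that the terms proportional to time,
    \<open>t * D\<close>, also stay below \<open>1/4\<close>.\<close>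
  define \<delta> where "\<delta> = 1 / (4 * D + 1)"
  have \<delta>: "0 < \<delta>" unfolding \<delta>_def using D by auto
  have small: "M * (t * (sqrt (6 * K) * H) + 12 / K * (4 * H + t * (20 * 2^c * H\<^sup>2))) \<le> 1/2" if t: "0 \<le> t" "t \<le> \<delta>" for t
  proof -
    have "M * (t * (sqrt (6 * K) * H) + 12 / K * (4 * H + t * (20 * 2^c * H\<^sup>2))) = t * D + 48 * M * H / K"
      by (simp add: D_def algebra_simps)
    also have "48 * M * H / K \<le> 1/4"
    proof -
      have "48 * M * H \<le> 1/4 * K" unfolding K_def by simp
      then show ?thesis using K by (simp add: pos_divide_le_eq)
    qed
    also have "t * D \<le> \<delta> * D" using t D by (intro mult_right_mono) auto
    also have "\<delta> * D \<le> 1/4" using D by (simp add: \<delta>_def divide_le_eq)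
    finally show ?thesis by simp
  qed
  show ?thesis
  proof (intro exI[of _ \<delta>] conjI allI impI \<delta>)
    fix \<epsilon> f t W
    assume f: "fsol \<epsilon> f" and e: "0 \<le> \<epsilon>" "\<epsilon> \<le> 1" and t: "0 \<le> t" "t \<le> \<delta>" and H: "\<forall>\<tau>\<in>{0..t}. wb h1_weight (f \<tau>) H" and W: "adm c W"
    interpret fsol \<epsilon> f by (rule f)
    show "wnorm2 W (f t) \<le> 2 * wnorm2 W (f 0)"
    proof (rule wnorm2_truncate[OF W])
      fix n :: nat
      have "wnorm2 (\<lambda>x. min (W x) (real n)) (f t) \<le> 2 * wnorm2 (\<lambda>x. min (W x) (real n)) (f 0)"
        using small[OF t] H t
        by (intro a_priori_bounded[OF t(1) e K adm_min[OF W adm_const], of "real n" "real n"]) (auto simp: M_def)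
      also have "\<dots> \<le> 2 * wnorm2 W (f 0)" by (intro mult_left_mono wnorm2_mono) auto
      finally show "wnorm2 (\<lambda>x. min (W x) (real n)) (f t) \<le> 2 * wnorm2 W (f 0)" .
    qed measurable
  qed
qed

section \<open>The difference of two solutions\<close>

definition cutoff :: "real \<Rightarrow> (real \<Rightarrow> real \<Rightarrow> complex) \<Rightarrow> real \<Rightarrow> real \<Rightarrow> complex" where
  "cutoff L g \<tau> \<xi> = (if \<bar>\<xi>\<bar> \<le> L then g \<tau> \<xi> else 0)"

lemma measurable_cutoff:
  assumes m: "case_prod g \<in> borel_measurable (borel \<Otimes>\<^sub>M borel)"
  shows "case_prod (cutoff L g) \<in> borel_measurable (borel \<Otimes>\<^sub>M borel)"
proof -
  note [measurable (raw)] = measurable_curried[OF m]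
  show ?thesis unfolding cutoff_def split_beta' by measurable
qed

lemma trilinear_time:
  assumes a: "case_prod a \<in> borel_measurable (borel \<Otimes>\<^sub>M borel)" and b: "case_prod b \<in> borel_measurable (borel \<Otimes>\<^sub>M borel)"
    and c: "case_prod c \<in> borel_measurable (borel \<Otimes>\<^sub>M borel)" and h[measurable]: "h \<in> borel_measurable borel" and t: "0 \<le> t"
    and A: "\<And>\<tau>. \<tau> \<in> {0..t} \<Longrightarrow> b1 (\<lambda>\<xi>. enorm (a \<tau> \<xi>)) A"
    and B: "\<And>\<tau>. \<tau> \<in> {0..t} \<Longrightarrow> b2 (\<lambda>\<xi>. ennreal \<bar>h \<xi>\<bar> * enorm (b \<tau> \<xi>)) B"
    and C: "\<And>\<tau>. \<tau> \<in> {0..t} \<Longrightarrow> b2 (\<lambda>\<xi>. enorm (c \<tau> \<xi>)) C"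
    and ce: "\<And>\<tau> \<xi>. cmod (c \<tau> (- \<xi>)) = cmod (c \<tau> \<xi>)"
  shows "(NN y. NN x. enorm (of_real (h y) * tri a b c t x y (- x - y))) \<le> ennreal (t * (B * C * A))"
proof -
  note [measurable (raw)] = measurable_curried[OF a] measurable_curried[OF b] measurable_curried[OF c] measurable_tri[OF a b c]
  have "(NN y. NN x. enorm (of_real (h y) * tri a b c t x y (- x - y))) =
     (NN x. NN y. enorm (of_real (h y) * tri a b c t x y (- x - y)))"
    by (rule lborel_pair.Fubini') measurable
  also have "\<dots> \<le> (NN x. NN y. NN \<tau>. indicator {0..t} \<tau> * ((ennreal \<bar>h y\<bar> * enorm (b \<tau> y)) * enorm (c \<tau> (y + x)) * enorm (a \<tau> x)))"
  proof (intro nn_integral_mono)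
    fix x y
    have ce': "cmod (c \<tau> (- x - y)) = cmod (c \<tau> (y + x))" for \<tau> using ce[of \<tau> "y + x"] by (simp add: minus_diff_commute)
    have "enorm (of_real (h y) * tri a b c t x y (- x - y)) = ennreal \<bar>h y\<bar> * enorm (tri a b c t x y (- x - y))"
      by (simp add: norm_mult ennreal_mult)
    also have "\<dots> \<le> ennreal \<bar>h y\<bar> * (NN \<tau>. indicator {0..t} \<tau> * (enorm (a \<tau> x) * enorm (b \<tau> y) * enorm (c \<tau> (- x - y))))"
      by (intro mult_left_mono tri_le) auto
    also have "\<dots> = (NN \<tau>. ennreal \<bar>h y\<bar> * (indicator {0..t} \<tau> * (enorm (a \<tau> x) * enorm (b \<tau> y) * enorm (c \<tau> (- x - y)))))"
      by (rule nn_integral_cmult[symmetric]) measurable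
    also have "\<dots> = (NN \<tau>. indicator {0..t} \<tau> * ((ennreal \<bar>h y\<bar> * enorm (b \<tau> y)) * enorm (c \<tau> (y + x)) * enorm (a \<tau> x)))"
      by (intro nn_integral_cong) (simp only: ce' ac_simps)
    finally show "enorm (of_real (h y) * tri a b c t x y (- x - y)) \<le> (NN \<tau>. indicator {0..t} \<tau> * ((ennreal \<bar>h y\<bar> * enorm (b \<tau> y)) * enorm (c \<tau> (y + x)) * enorm (a \<tau> x)))" .
  qed
  also have "\<dots> \<le> ennreal (t * (B * C * A))"
  proof (rule nn_integral_time_bound[OF _ _ t])
    fix \<tau> assume \<tau>: "\<tau> \<in> {0..t}"
    show "(NN x. NN y. (ennreal \<bar>h y\<bar> * enorm (b \<tau> y)) * enorm (c \<tau> (y + x)) * enorm (a \<tau> x)) \<le> ennreal (B * C * A)"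
      by (rule trilinear_L1[OF B C A]) (use \<tau> in auto)
  qed measurable
  finally show ?thesis .
qed

text \<open>The bilinear version of \<open>g^2 - h^2 = (g + h) * (g - h)\<close>: it leaves a single
  factor with the difference of the two solutions.\<close>

lemma bil_diff:
  assumes "square_integrable g" "square_integrable h"
  shows "bil g g \<xi> - bil h h \<xi> = bil (\<lambda>\<eta>. g \<eta> + h \<eta>) (\<lambda>\<eta>. g \<eta> - h \<eta>) \<xi>"
proof -
  have r: "square_integrable (\<lambda>\<eta>. k (\<xi> - \<eta>))" if "square_integrable k" for k
    using square_integrable_affine[OF that, of "-1" \<xi>] by simp
  note i = square_integrable_mult(1)[OF assms(1) r[OF assms(1)]] square_integrable_mult(1)[OF assms(1) r[OF assms(2)]]
    square_integrable_mult(1)[OF assms(2) r[OF assms(1)]] square_integrable_mult(1)[OF assms(2) r[OF assms(2)]]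
  have c: "(LBINT \<eta>. g \<eta> * h (\<xi> - \<eta>)) = (LBINT \<eta>. h \<eta> * g (\<xi> - \<eta>))"
    using lborel_integral_real_affine[of "-1" "\<lambda>\<eta>. g \<eta> * h (\<xi> - \<eta>)" \<xi>] by (simp add: mult.commute)
  have "(LBINT \<eta>. (g \<eta> + h \<eta>) * (g (\<xi> - \<eta>) - h (\<xi> - \<eta>))) =
     (LBINT \<eta>. g \<eta> * g (\<xi> - \<eta>) - g \<eta> * h (\<xi> - \<eta>) + h \<eta> * g (\<xi> - \<eta>) - h \<eta> * h (\<xi> - \<eta>))"
    by (intro Bochner_Integration.integral_cong refl) (simp add: algebra_simps)
  also have "\<dots> = (LBINT \<eta>. g \<eta> * g (\<xi> - \<eta>)) - (LBINT \<eta>. h \<eta> * h (\<xi> - \<eta>))"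
    using i by (simp add: c)
  finally show ?thesis by (simp add: bil_def right_diff_distrib)
qed

lemma measurable_bil_raw:
  assumes a: "case_prod a \<in> borel_measurable (borel \<Otimes>\<^sub>M borel)" and b: "case_prod b \<in> borel_measurable (borel \<Otimes>\<^sub>M borel)"
    and [measurable]: "g \<in> borel_measurable M" "h \<in> borel_measurable M"
  shows "(\<lambda>w. bil (a (g w)) (b (g w)) (h w)) \<in> borel_measurable M"
proof -
  note [measurable (raw)] = measurable_curried[OF a] measurable_curried[OF b]
  show ?thesis unfolding bil_def by measurable
qed

text \<open>\<open>y\<close> bounds the \<open>L^2\<close> distance of the two curves on the time
  interval; it will be the root of a supremum, which is absorbed as in the a priori estimate.
  \<open>K\<close> separates resonant from nonresonant frequencies, and \<open>L\<close> is the
  frequency cutoff.\<close>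

locale fsol_pair = A: fsol \<epsilon> a + B: fsol 0 b for \<epsilon> a b +
  fixes t H K L y :: real
  assumes t: "0 \<le> t" and \<epsilon>0: "0 \<le> \<epsilon>" and K: "1 \<le> K" and L: "1 \<le> L"
    and aH: "\<And>\<tau>. \<tau> \<in> {0..t} \<Longrightarrow> wb h1_weight (a \<tau>) H"
    and bH: "\<And>\<tau>. \<tau> \<in> {0..t} \<Longrightarrow> wb h1_weight (b \<tau>) H"
    and yH: "y \<le> 2 * H"
    and y: "\<And>\<tau>. \<tau> \<in> {0..t} \<Longrightarrow> b2 (\<lambda>\<xi>. enorm (a \<tau> \<xi> - b \<tau> \<xi>)) y"
begin

definition w :: "real \<Rightarrow> real \<Rightarrow> complex" where "w \<tau> \<xi> = a \<tau> \<xi> - b \<tau> \<xi>"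
definition z :: "real \<Rightarrow> real \<Rightarrow> complex" where "z \<tau> \<xi> = a \<tau> \<xi> + b \<tau> \<xi>"
definition wL :: "real \<Rightarrow> real \<Rightarrow> complex" where "wL = cutoff L w"
definition wH :: "real \<Rightarrow> real \<Rightarrow> complex" where "wH \<tau> \<xi> = w \<tau> \<xi> - wL \<tau> \<xi>"

abbreviation Fa :: "real \<Rightarrow> real \<Rightarrow> ennreal" where "Fa \<tau> \<xi> \<equiv> enorm (a \<tau> \<xi>)"
abbreviation Fw :: "real \<Rightarrow> real \<Rightarrow> ennreal" where "Fw \<tau> \<xi> \<equiv> enorm (w \<tau> \<xi>)"
abbreviation Fz :: "real \<Rightarrow> real \<Rightarrow> ennreal" where "Fz \<tau> \<xi> \<equiv> enorm (z \<tau> \<xi>)"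
abbreviation Q :: "real \<Rightarrow> real \<Rightarrow> ennreal" where "Q \<tau> \<equiv> conv (\<lambda>\<eta>. Fz \<tau> \<eta>) (\<lambda>\<eta>. Fw \<tau> \<eta>)"

lemma w_meas: "case_prod w \<in> borel_measurable (borel \<Otimes>\<^sub>M borel)"
  and z_meas: "case_prod z \<in> borel_measurable (borel \<Otimes>\<^sub>M borel)"
  unfolding w_def z_def split_beta' by measurable

lemma wL_meas: "case_prod wL \<in> borel_measurable (borel \<Otimes>\<^sub>M borel)"
  unfolding wL_def by (rule measurable_cutoff[OF w_meas])

lemmas wz_raw[measurable (raw)] = measurable_curried[OF w_meas] measurable_curried[OF z_meas] measurable_curried[OF wL_meas]

lemma wH_meas: "case_prod wH \<in> borel_measurable (borel \<Otimes>\<^sub>M borel)"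
  unfolding wH_def split_beta' by measurable

lemmas wH_raw[measurable (raw)] = measurable_curried[OF wH_meas]

lemma Q_meas[measurable (raw)]:
  assumes [measurable]: "g \<in> borel_measurable M" "h \<in> borel_measurable M"
  shows "(\<lambda>w. Q (g w) (h w)) \<in> borel_measurable M"
  unfolding conv_def by measurable

lemma w_reality: "w \<tau> (- \<xi>) = cnj (w \<tau> \<xi>)" and z_reality: "z \<tau> (- \<xi>) = cnj (z \<tau> \<xi>)"
  and wL_reality: "wL \<tau> (- \<xi>) = cnj (wL \<tau> \<xi>)"
  by (simp_all add: w_def z_def wL_def cutoff_def A.reality B.reality)

lemma Q_even: "Q \<tau> (- \<xi>) = Q \<tau> \<xi>"
  by (rule conv_even) (auto simp: w_reality z_reality)

lemma H0: "0 \<le> H" using wb_h1D(4)[OF aH[of 0]] t by simp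

lemma y0: "0 \<le> y" using y[of 0] t by (auto simp: b2_def)

lemma a_bounds:
  assumes "\<tau> \<in> {0..t}"
  shows "b2 (Fa \<tau>) H" "b1 (Fa \<tau>) (2 * H)" "b1 (A.Y \<tau>) (4 * H\<^sup>2)" "b1 (B.Y \<tau>) (4 * H\<^sup>2)"
proof -
  show "b2 (Fa \<tau>) H" and a: "b1 (Fa \<tau>) (2 * H)" using wb_h1D[OF aH[OF assms]] by auto
  show "b1 (A.Y \<tau>) (4 * H\<^sup>2)" using b1_conv[OF a a] by (simp add: power2_eq_square)
  have b: "b1 (B.F \<tau>) (2 * H)" using wb_h1D[OF bH[OF assms]] by auto
  show "b1 (B.Y \<tau>) (4 * H\<^sup>2)" using b1_conv[OF b b] by (simp add: power2_eq_square)
qed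

lemma wz_h1:
  assumes "\<tau> \<in> {0..t}" and v: "v \<in> {w, z}"
  shows "wb h1_weight (v \<tau>) (2 * H)"
proof -
  have [measurable]: "v \<tau> \<in> borel_measurable borel" using v by auto
  have "b2 (\<lambda>\<xi>. ennreal (sqrt (1 + \<xi>\<^sup>2)) * enorm (v \<tau> \<xi>)) (H + H)"
  proof (rule b2_mono[OF b2_add[OF aH[OF assms(1), unfolded wb_def] bH[OF assms(1), unfolded wb_def]]])
    fix \<xi>
    have "cmod (v \<tau> \<xi>) \<le> cmod (a \<tau> \<xi>) + cmod (b \<tau> \<xi>)"
      using v by (auto simp: w_def z_def norm_triangle_ineq norm_triangle_ineq4)
    then show "ennreal (sqrt (1 + \<xi>\<^sup>2)) * enorm (v \<tau> \<xi>) \<le>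
       ennreal (sqrt (1 + \<xi>\<^sup>2)) * Fa \<tau> \<xi> + ennreal (sqrt (1 + \<xi>\<^sup>2)) * B.F \<tau> \<xi>"
      unfolding distrib_left[symmetric] by (intro mult_left_mono) (auto simp: ennreal_leI simp flip: ennreal_plus)
  qed auto
  then show ?thesis by (simp add: wb_def)
qed

lemma wz_bounds:
  assumes "\<tau> \<in> {0..t}"
  shows "b1 (Fz \<tau>) (4 * H)" "b2 (\<lambda>\<xi>. ennreal \<bar>\<xi>\<bar> * Fz \<tau> \<xi>) (2 * H)" "b2 (\<lambda>\<xi>. ennreal \<bar>\<xi>\<bar> * Fw \<tau> \<xi>) (2 * H)"
    "b2 (Fw \<tau>) y" "b2 (Q \<tau>) (4 * H * y)" "b2 (Fz \<tau>) (2 * H)"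
proof -
  show z1: "b1 (Fz \<tau>) (4 * H)" using wb_h1D(3)[OF wz_h1[OF assms, of z]] by simp
  show "b2 (\<lambda>\<xi>. ennreal \<bar>\<xi>\<bar> * Fz \<tau> \<xi>) (2 * H)" using wb_h1D(2)[OF wz_h1[OF assms, of z]] by simp
  show "b2 (Fz \<tau>) (2 * H)" using wb_h1D(1)[OF wz_h1[OF assms, of z]] by simp
  show "b2 (\<lambda>\<xi>. ennreal \<bar>\<xi>\<bar> * Fw \<tau> \<xi>) (2 * H)" using wb_h1D(2)[OF wz_h1[OF assms, of w]] by simp
  show w: "b2 (Fw \<tau>) y" using y[OF assms] by (simp add: w_def)
  show "b2 (Q \<tau>) (4 * H * y)" by (rule b2_conv[OF z1 w])
qed

lemma wL_le: "cmod (wL \<tau> \<xi>) \<le> cmod (w \<tau> \<xi>)" by (simp add: wL_def cutoff_def)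

lemma wL_bounds:
  assumes "\<tau> \<in> {0..t}"
  shows "b2 (\<lambda>\<xi>. enorm (wL \<tau> \<xi>)) y" "b2 (\<lambda>\<xi>. ennreal \<bar>\<xi>\<bar> * enorm (wL \<tau> \<xi>)) (2 * H)"
    "b2 (\<lambda>\<xi>. enorm (wH \<tau> \<xi>)) (2 * H / L)"
proof -
  show "b2 (\<lambda>\<xi>. enorm (wL \<tau> \<xi>)) y"
    by (rule b2_mono[OF wz_bounds(4)[OF assms]]) (auto intro: ennreal_leI wL_le)
  show "b2 (\<lambda>\<xi>. ennreal \<bar>\<xi>\<bar> * enorm (wL \<tau> \<xi>)) (2 * H)"
    by (rule b2_mono[OF wz_bounds(3)[OF assms]]) (auto intro!: mult_left_mono ennreal_leI wL_le)
  show "b2 (\<lambda>\<xi>. enorm (wH \<tau> \<xi>)) (2 * H / L)"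
  proof (rule b2_mono[OF b2_cmult[OF wz_bounds(3)[OF assms], of "1 / L"]])
    fix \<xi>
    have "cmod (wH \<tau> \<xi>) \<le> 1 / L * (\<bar>\<xi>\<bar> * cmod (w \<tau> \<xi>))"
    proof (cases "\<bar>\<xi>\<bar> \<le> L")
      case False
      then have "1 * cmod (w \<tau> \<xi>) \<le> \<bar>\<xi>\<bar> / L * cmod (w \<tau> \<xi>)" using L by (intro mult_right_mono) auto
      then show ?thesis using False by (simp add: wH_def wL_def cutoff_def)
    qed (use L in \<open>simp add: wH_def wL_def cutoff_def\<close>)
    then show "enorm (wH \<tau> \<xi>) \<le> ennreal (1 / L) * (ennreal \<bar>\<xi>\<bar> * Fw \<tau> \<xi>)"
      using L by (simp add: ennreal_leI flip: ennreal_mult)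
  qed (use L in auto)
qed

lemma square_integrable_ab:
  assumes "\<tau> \<in> {0..t}" shows "square_integrable (a \<tau>)" "square_integrable (b \<tau>)"
  using wb_h1D(1)[OF aH[OF assms]] wb_h1D(1)[OF bH[OF assms]] by (auto simp: square_integrable_b2)

lemma bil_zw: "\<tau> \<in> {0..t} \<Longrightarrow> bil (a \<tau>) (a \<tau>) \<xi> - bil (b \<tau>) (b \<tau>) \<xi> = bil (z \<tau>) (w \<tau>) \<xi>"
  using bil_diff[OF square_integrable_ab] unfolding z_def[abs_def] w_def[abs_def] by simp

text \<open>\<open>Ew\<close> and \<open>Ez\<close> are what remains when sum and difference are
  both given the KdV phase \<open>phase 0\<close>: the fifth order dispersion of \<open>a\<close>
  has become a forcing term.\<close>

definition Ew :: "real \<Rightarrow> real \<Rightarrow> complex" where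
  "Ew \<xi> \<tau> = - (\<i> * of_real (\<epsilon> * \<xi>^5)) * a \<tau> \<xi> + (bil (a \<tau>) (a \<tau>) \<xi> - bil (b \<tau>) (b \<tau>) \<xi>)"
definition Ez :: "real \<Rightarrow> real \<Rightarrow> complex" where
  "Ez \<xi> \<tau> = - (\<i> * of_real (\<epsilon> * \<xi>^5)) * a \<tau> \<xi> + (bil (a \<tau>) (a \<tau>) \<xi> + bil (b \<tau>) (b \<tau>) \<xi>)"

lemma phase_split: "of_real (phase \<epsilon> \<xi>) = of_real (phase 0 \<xi>) - complex_of_real (\<epsilon> * \<xi>^5)"
  by (simp add: phase_def)

lemma deriv_w: "\<tau> \<in> {0..t} \<Longrightarrow> ((\<lambda>\<tau>. w \<tau> \<xi>) has_vector_derivative \<i> * of_real (phase 0 \<xi>) * w \<tau> \<xi> + Ew \<xi> \<tau>) (at \<tau> within {0..t})"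
  and deriv_z: "\<tau> \<in> {0..t} \<Longrightarrow> ((\<lambda>\<tau>. z \<tau> \<xi>) has_vector_derivative \<i> * of_real (phase 0 \<xi>) * z \<tau> \<xi> + Ez \<xi> \<tau>) (at \<tau> within {0..t})"
  using has_vector_derivative_diff[OF A.deriv_on B.deriv_on, of \<tau> t \<xi> \<xi>] has_vector_derivative_add[OF A.deriv_on B.deriv_on, of \<tau> t \<xi> \<xi>]
  unfolding w_def z_def Ew_def Ez_def phase_split by (simp_all add: algebra_simps)

lemma cont_Ew: "continuous_on {0..t} (Ew \<xi>)" and cont_Ez: "continuous_on {0..t} (Ez \<xi>)"
  unfolding Ew_def[abs_def] Ez_def[abs_def]
  by (intro continuous_intros A.cont_f_on A.cont_bil_on B.cont_bil_on)+

lemma cont_w: "continuous_on {0..t} (\<lambda>\<tau>. w \<tau> \<xi>)"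
  by (rule continuous_on_vector_derivative[OF deriv_w])

lemma Ew_le:
  assumes "\<bar>\<xi>\<bar> \<le> L" "\<tau> \<in> {0..t}"
  shows "enorm (Ew \<xi> \<tau>) \<le> ennreal (\<epsilon> * L^5) * Fa \<tau> \<xi> + ennreal \<bar>\<xi>\<bar> * Q \<tau> \<xi>"
proof -
  have "cmod (Ew \<xi> \<tau>) \<le> cmod (- (\<i> * of_real (\<epsilon> * \<xi>^5)) * a \<tau> \<xi>) + cmod (bil (z \<tau>) (w \<tau>) \<xi>)"
    unfolding Ew_def bil_zw[OF assms(2)] by (rule norm_triangle_ineq)
  then have "enorm (Ew \<xi> \<tau>) \<le> enorm (- (\<i> * of_real (\<epsilon> * \<xi>^5)) * a \<tau> \<xi>) + enorm (bil (z \<tau>) (w \<tau>) \<xi>)"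
    by (simp add: ennreal_leI del: of_real_mult flip: ennreal_plus)
  also have "\<dots> \<le> ennreal (\<epsilon> * L^5) * Fa \<tau> \<xi> + ennreal \<bar>\<xi>\<bar> * Q \<tau> \<xi>"
  proof (intro add_mono bil_le)
    have "\<epsilon> * \<bar>\<xi>\<bar>^5 \<le> \<epsilon> * L^5" using assms(1) \<epsilon>0 by (intro mult_left_mono power_mono) auto
    then have "\<epsilon> * \<bar>\<xi>\<bar>^5 * cmod (a \<tau> \<xi>) \<le> \<epsilon> * L^5 * cmod (a \<tau> \<xi>)" by (rule mult_right_mono) simp
    then have "cmod (- (\<i> * of_real (\<epsilon> * \<xi>^5)) * a \<tau> \<xi>) \<le> \<epsilon> * L^5 * cmod (a \<tau> \<xi>)"
      using \<epsilon>0 by (simp add: norm_mult norm_power abs_mult power_abs)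
    then show "enorm (- (\<i> * of_real (\<epsilon> * \<xi>^5)) * a \<tau> \<xi>) \<le> ennreal (\<epsilon> * L^5) * Fa \<tau> \<xi>"
      using \<epsilon>0 L by (simp add: ennreal_leI del: of_real_mult flip: ennreal_mult)
  qed
  finally show ?thesis .
qed

lemma Ez_le:
  assumes "\<bar>\<xi>\<bar> \<le> 2 * L" "\<tau> \<in> {0..t}"
  shows "enorm (Ez \<xi> \<tau>) \<le> ennreal (\<epsilon> * (2 * L)^5) * Fa \<tau> \<xi> + ennreal \<bar>\<xi>\<bar> * (A.Y \<tau> \<xi> + B.Y \<tau> \<xi>)"
proof -
  have "cmod (Ez \<xi> \<tau>) \<le> cmod (- (\<i> * of_real (\<epsilon> * \<xi>^5)) * a \<tau> \<xi>) + (cmod (bil (a \<tau>) (a \<tau>) \<xi>) + cmod (bil (b \<tau>) (b \<tau>) \<xi>))"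
    unfolding Ez_def by (rule order_trans[OF norm_triangle_ineq add_left_mono[OF norm_triangle_ineq]])
  then have "enorm (Ez \<xi> \<tau>) \<le> enorm (- (\<i> * of_real (\<epsilon> * \<xi>^5)) * a \<tau> \<xi>) +
      (enorm (bil (a \<tau>) (a \<tau>) \<xi>) + enorm (bil (b \<tau>) (b \<tau>) \<xi>))"
    by (simp add: ennreal_leI del: of_real_mult flip: ennreal_plus)
  also have "\<dots> \<le> ennreal (\<epsilon> * (2 * L)^5) * Fa \<tau> \<xi> + (ennreal \<bar>\<xi>\<bar> * A.Y \<tau> \<xi> + ennreal \<bar>\<xi>\<bar> * B.Y \<tau> \<xi>)"
  proof (intro add_mono bil_le)
    have "\<epsilon> * \<bar>\<xi>\<bar>^5 \<le> \<epsilon> * (2 * L)^5" using assms(1) \<epsilon>0 by (intro mult_left_mono power_mono) auto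
    then have "\<epsilon> * \<bar>\<xi>\<bar>^5 * cmod (a \<tau> \<xi>) \<le> \<epsilon> * (2 * L)^5 * cmod (a \<tau> \<xi>)" by (rule mult_right_mono) simp
    then have "cmod (- (\<i> * of_real (\<epsilon> * \<xi>^5)) * a \<tau> \<xi>) \<le> \<epsilon> * (2 * L)^5 * cmod (a \<tau> \<xi>)"
      using \<epsilon>0 by (simp add: norm_mult norm_power abs_mult power_abs)
    then show "enorm (- (\<i> * of_real (\<epsilon> * \<xi>^5)) * a \<tau> \<xi>) \<le> ennreal (\<epsilon> * (2 * L)^5) * Fa \<tau> \<xi>"
      using \<epsilon>0 L by (simp add: ennreal_leI del: of_real_mult flip: ennreal_mult)
  qed
  finally show ?thesis by (simp add: distrib_left)
qed

text \<open>The three lines belong to the factor hit by the time derivative: \<open>z\<close> at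
  \<open>\<eta>\<close>, then \<open>w\<close> at \<open>x\<close>, then \<open>w\<close> at
  \<open>x + \<eta>\<close>. The terms with \<open>\<epsilon>\<close> come from the forcing, those
  with \<open>1 / K\<close> from the nonlinearity.\<close>

abbreviation nonres_sum :: "real \<Rightarrow> real \<Rightarrow> real \<Rightarrow> ennreal" where
  "nonres_sum \<tau> \<eta> x \<equiv> ennreal (\<epsilon> * (2 * L)^5) * (Fw \<tau> x * Fw \<tau> (x + \<eta>) * Fa \<tau> \<eta>) + ennreal (2 / K) * (Fw \<tau> x * Fw \<tau> (x + \<eta>) * (A.Y \<tau> \<eta> + B.Y \<tau> \<eta>))
       + (ennreal (\<epsilon> * L^5) * (Fa \<tau> x * Fw \<tau> (x + \<eta>) * Fz \<tau> \<eta>) + ennreal (1 / K) * (Q \<tau> x * Fw \<tau> (x + \<eta>) * Fz \<tau> \<eta>))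
       + (ennreal (\<epsilon> * L^5) * (Fw \<tau> x * Fa \<tau> (x + \<eta>) * Fz \<tau> \<eta>) + ennreal (1 / K) * (Fw \<tau> x * Q \<tau> (x + \<eta>) * Fz \<tau> \<eta>))"

text \<open>For the KdV phase the resonance function is \<open>3 * \<eta> * x * v\<close>, so
  \<open>|\<eta>|\<close> is the resonance function times
  \<open>\<kappa> = 1 / (3 * |x| * |v|)\<close>. Both \<open>|x|\<close> and \<open>|v|\<close>
  exceed \<open>K\<close>: a derivative at \<open>x\<close> or \<open>v\<close> is thus worth
  \<open>1 / K\<close>, and one at \<open>\<eta>\<close>, where
  \<open>|\<eta>| <= |x| + |v|\<close>, is worth \<open>2 / K\<close>.\<close>

lemma w_nonres_pointwise:
  assumes x: "K < \<bar>x\<bar>" "\<bar>x\<bar> \<le> L" "K < \<bar>x + \<eta>\<bar>" "\<bar>x + \<eta>\<bar> \<le> L"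
  shows "ennreal (\<bar>\<eta>\<bar> * cmod (tri z wL wL t \<eta> x (- x - \<eta>))) \<le>
    ennreal (1 / K) * (Fw t x * Fw t (x + \<eta>) * Fz t \<eta> + Fw 0 x * Fw 0 (x + \<eta>) * Fz 0 \<eta>) +
    (NN \<tau>. indicator {0..t} \<tau> *
      nonres_sum \<tau> \<eta> x)"
proof -
  define v where "v = - x - \<eta>"
  have vx: "v = - (x + \<eta>)" and vabs: "\<bar>v\<bar> = \<bar>x + \<eta>\<bar>" and s: "\<eta> + x + v = 0" by (auto simp: v_def)
  have e: "Fa \<tau> v = Fa \<tau> (x + \<eta>)" "Fw \<tau> v = Fw \<tau> (x + \<eta>)" "Q \<tau> v = Q \<tau> (x + \<eta>)" for \<tau>
    unfolding vx using A.F_even Q_even by (simp_all only: w_reality complex_mod_cnj)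
  have wx: "wL \<tau> x = w \<tau> x" "wL \<tau> v = w \<tau> v" for \<tau> using x vabs by (simp_all add: wL_def cutoff_def)
  have pos: "0 < \<bar>x\<bar>" "0 < \<bar>v\<bar>" using x K vabs by auto
  define \<kappa> where "\<kappa> = 1 / (3 * \<bar>x\<bar> * \<bar>v\<bar>)"
  have \<kappa>: "0 \<le> \<kappa>" by (simp add: \<kappa>_def)
  have \<kappa>x: "\<kappa> * \<bar>x\<bar> \<le> 1 / K"
  proof -
    have "K \<le> 3 * \<bar>v\<bar>" using x vabs K by simp
    then have "1 / (3 * \<bar>v\<bar>) \<le> 1 / K" using K by (intro divide_left_mono) auto
    then show ?thesis using pos by (simp add: \<kappa>_def)
  qed
  have \<kappa>v: "\<kappa> * \<bar>v\<bar> \<le> 1 / K"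
  proof -
    have "K \<le> 3 * \<bar>x\<bar>" using x K by simp
    then have "1 / (3 * \<bar>x\<bar>) \<le> 1 / K" using K by (intro divide_left_mono) auto
    then show ?thesis using pos by (simp add: \<kappa>_def)
  qed
  have "\<kappa> * \<bar>\<eta>\<bar> \<le> \<kappa> * (\<bar>x\<bar> + \<bar>v\<bar>)" using \<kappa> s by (intro mult_left_mono) auto
  then have \<kappa>\<eta>: "\<kappa> * \<bar>\<eta>\<bar> \<le> 2 / K" using \<kappa>x \<kappa>v by (simp add: distrib_left)
  have "\<kappa> * 1 \<le> \<kappa> * \<bar>x\<bar>" using x K \<kappa> by (intro mult_left_mono) auto
  then have \<kappa>K: "\<kappa> \<le> 1 / K" using \<kappa>x by simp
  also have "1 / K \<le> 1" using K by simp
  finally have \<kappa>1: "\<kappa> \<le> 1" .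
  have r: "\<bar>\<eta>\<bar> = \<kappa> * \<bar>phase 0 \<eta> + phase 0 x + phase 0 v\<bar>"
    using res_factor[OF s, of 0] pos by (simp add: res_def \<kappa>_def abs_mult)
  have E1: "ennreal \<kappa> * enorm (Ez \<eta> \<tau>) \<le> ennreal (\<epsilon> * (2 * L)^5) * Fa \<tau> \<eta> + ennreal (2 / K) * (A.Y \<tau> \<eta> + B.Y \<tau> \<eta>)"
    if "\<tau> \<in> {0..t}" for \<tau>
  proof -
    have "\<bar>\<eta>\<bar> \<le> 2 * L" using s x vabs by linarith
    then have "ennreal \<kappa> * enorm (Ez \<eta> \<tau>) \<le> ennreal \<kappa> * (ennreal (\<epsilon> * (2 * L)^5) * Fa \<tau> \<eta> + ennreal \<bar>\<eta>\<bar> * (A.Y \<tau> \<eta> + B.Y \<tau> \<eta>))"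
      by (intro mult_left_mono Ez_le that) auto
    also have "\<dots> = ennreal \<kappa> * (ennreal (\<epsilon> * (2 * L)^5) * Fa \<tau> \<eta>) + ennreal (\<kappa> * \<bar>\<eta>\<bar>) * (A.Y \<tau> \<eta> + B.Y \<tau> \<eta>)"
      using \<kappa> by (simp only: distrib_left[of "ennreal \<kappa>"] ennreal_mult abs_ge_zero mult.assoc)
    also have "\<dots> \<le> 1 * (ennreal (\<epsilon> * (2 * L)^5) * Fa \<tau> \<eta>) + ennreal (2 / K) * (A.Y \<tau> \<eta> + B.Y \<tau> \<eta>)"
      using \<kappa>1 by (intro add_mono mult_right_mono ennreal_leI \<kappa>\<eta>) auto
    finally show ?thesis by simp
  qed
  have E2: "ennreal \<kappa> * enorm (Ew \<xi> \<tau>) \<le> ennreal (\<epsilon> * L^5) * Fa \<tau> \<xi> + ennreal (1 / K) * Q \<tau> \<xi>"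
    if "\<tau> \<in> {0..t}" "\<bar>\<xi>\<bar> \<le> L" "\<kappa> * \<bar>\<xi>\<bar> \<le> 1 / K" for \<tau> \<xi>
  proof -
    have "ennreal \<kappa> * enorm (Ew \<xi> \<tau>) \<le> ennreal \<kappa> * (ennreal (\<epsilon> * L^5) * Fa \<tau> \<xi> + ennreal \<bar>\<xi>\<bar> * Q \<tau> \<xi>)"
      by (intro mult_left_mono Ew_le that) auto
    also have "\<dots> = ennreal \<kappa> * (ennreal (\<epsilon> * L^5) * Fa \<tau> \<xi>) + ennreal (\<kappa> * \<bar>\<xi>\<bar>) * Q \<tau> \<xi>"
      using \<kappa> by (simp only: distrib_left[of "ennreal \<kappa>"] ennreal_mult abs_ge_zero mult.assoc)
    also have "\<dots> \<le> 1 * (ennreal (\<epsilon> * L^5) * Fa \<tau> \<xi>) + ennreal (1 / K) * Q \<tau> \<xi>"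
      using \<kappa>1 that(3) by (intro add_mono mult_right_mono ennreal_leI) auto
    finally show ?thesis by simp
  qed
  let ?g = "\<lambda>\<tau>. enorm (Ez \<eta> \<tau>) * Fw \<tau> x * Fw \<tau> v + Fz \<tau> \<eta> * enorm (Ew x \<tau>) * Fw \<tau> v + Fz \<tau> \<eta> * Fw \<tau> x * enorm (Ew v \<tau>)"
  have "ennreal (\<bar>phase 0 \<eta> + phase 0 x + phase 0 v\<bar> * cmod (tri z wL wL t \<eta> x v)) \<le>
     Fz t \<eta> * enorm (wL t x) * enorm (wL t v) + Fz 0 \<eta> * enorm (wL 0 x) * enorm (wL 0 v) +
     (NN \<tau>. indicator {0..t} \<tau> * (enorm (Ez \<eta> \<tau>) * enorm (wL \<tau> x) * enorm (wL \<tau> v)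
       + Fz \<tau> \<eta> * enorm (Ew x \<tau>) * enorm (wL \<tau> v) + Fz \<tau> \<eta> * enorm (wL \<tau> x) * enorm (Ew v \<tau>)))"
    by (rule normal_form[OF t deriv_z _ _ cont_Ez cont_Ew cont_Ew]) (simp_all only: wx deriv_w)
  then have nf: "ennreal (\<bar>phase 0 \<eta> + phase 0 x + phase 0 v\<bar> * cmod (tri z wL wL t \<eta> x v)) \<le>
     Fz t \<eta> * Fw t x * Fw t v + Fz 0 \<eta> * Fw 0 x * Fw 0 v + (NN \<tau>. indicator {0..t} \<tau> * ?g \<tau>)"
    by (simp only: wx)
  have "ennreal (\<bar>\<eta>\<bar> * cmod (tri z wL wL t \<eta> x v)) = ennreal \<kappa> * ennreal (\<bar>phase 0 \<eta> + phase 0 x + phase 0 v\<bar> * cmod (tri z wL wL t \<eta> x v))"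
    by (subst r) (simp only: mult.assoc ennreal_mult' ennreal_mult'' \<kappa>)
  also have "\<dots> \<le> ennreal \<kappa> * (Fz t \<eta> * Fw t x * Fw t v + Fz 0 \<eta> * Fw 0 x * Fw 0 v + (NN \<tau>. indicator {0..t} \<tau> * ?g \<tau>))"
    by (intro mult_left_mono nf) auto
  also have "\<dots> = ennreal \<kappa> * (Fz t \<eta> * Fw t x * Fw t v + Fz 0 \<eta> * Fw 0 x * Fw 0 v) + (NN \<tau>. ennreal \<kappa> * (indicator {0..t} \<tau> * ?g \<tau>))"
  proof -
    have "(NN \<tau>. ennreal \<kappa> * (indicator {0..t} \<tau> * ?g \<tau>)) = ennreal \<kappa> * (NN \<tau>. indicator {0..t} \<tau> * ?g \<tau>)"
    proof (rule nn_integral_cmult)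
      note [measurable (raw)] = measurable_bil_raw[OF A.meas A.meas] measurable_bil_raw[OF B.meas B.meas]
      show "(\<lambda>\<tau>. indicator {0..t} \<tau> * ?g \<tau>) \<in> borel_measurable lborel"
        unfolding Ez_def Ew_def by measurable
    qed
    then show ?thesis by (simp only: distrib_left)
  qed
  also have "\<dots> \<le> ennreal (1 / K) * (Fz t \<eta> * Fw t x * Fw t v + Fz 0 \<eta> * Fw 0 x * Fw 0 v) + 
    (NN \<tau>. indicator {0..t} \<tau> *
      (ennreal (\<epsilon> * (2 * L)^5) * (Fw \<tau> x * Fw \<tau> v * Fa \<tau> \<eta>) + ennreal (2 / K) * (Fw \<tau> x * Fw \<tau> v * (A.Y \<tau> \<eta> + B.Y \<tau> \<eta>))
       + (ennreal (\<epsilon> * L^5) * (Fa \<tau> x * Fw \<tau> v * Fz \<tau> \<eta>) + ennreal (1 / K) * (Q \<tau> x * Fw \<tau> v * Fz \<tau> \<eta>))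
       + (ennreal (\<epsilon> * L^5) * (Fw \<tau> x * Fa \<tau> v * Fz \<tau> \<eta>) + ennreal (1 / K) * (Fw \<tau> x * Q \<tau> v * Fz \<tau> \<eta>))))"
  proof (intro add_mono mult_right_mono ennreal_leI \<kappa>K nn_integral_mono)
    fix \<tau>
    show "ennreal \<kappa> * (indicator {0..t} \<tau> * ?g \<tau>) \<le> indicator {0..t} \<tau> *
      (ennreal (\<epsilon> * (2 * L)^5) * (Fw \<tau> x * Fw \<tau> v * Fa \<tau> \<eta>) + ennreal (2 / K) * (Fw \<tau> x * Fw \<tau> v * (A.Y \<tau> \<eta> + B.Y \<tau> \<eta>))
       + (ennreal (\<epsilon> * L^5) * (Fa \<tau> x * Fw \<tau> v * Fz \<tau> \<eta>) + ennreal (1 / K) * (Q \<tau> x * Fw \<tau> v * Fz \<tau> \<eta>))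
       + (ennreal (\<epsilon> * L^5) * (Fw \<tau> x * Fa \<tau> v * Fz \<tau> \<eta>) + ennreal (1 / K) * (Fw \<tau> x * Q \<tau> v * Fz \<tau> \<eta>)))"
    proof (cases "\<tau> \<in> {0..t}")
      case True
      have "ennreal \<kappa> * ?g \<tau> = (ennreal \<kappa> * enorm (Ez \<eta> \<tau>)) * (Fw \<tau> x * Fw \<tau> v) + (ennreal \<kappa> * enorm (Ew x \<tau>)) * (Fz \<tau> \<eta> * Fw \<tau> v)
         + (ennreal \<kappa> * enorm (Ew v \<tau>)) * (Fz \<tau> \<eta> * Fw \<tau> x)"
        by (simp only: distrib_left ac_simps)
      also have "\<dots> \<le> (ennreal (\<epsilon> * (2 * L)^5) * Fa \<tau> \<eta> + ennreal (2 / K) * (A.Y \<tau> \<eta> + B.Y \<tau> \<eta>)) * (Fw \<tau> x * Fw \<tau> v)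
         + (ennreal (\<epsilon> * L^5) * Fa \<tau> x + ennreal (1 / K) * Q \<tau> x) * (Fz \<tau> \<eta> * Fw \<tau> v)
         + (ennreal (\<epsilon> * L^5) * Fa \<tau> v + ennreal (1 / K) * Q \<tau> v) * (Fz \<tau> \<eta> * Fw \<tau> x)"
        by (intro add_mono mult_right_mono E1 E2 True \<kappa>x \<kappa>v) (use x vabs in auto)
      also have "\<dots> = ennreal (\<epsilon> * (2 * L)^5) * (Fw \<tau> x * Fw \<tau> v * Fa \<tau> \<eta>) + ennreal (2 / K) * (Fw \<tau> x * Fw \<tau> v * (A.Y \<tau> \<eta> + B.Y \<tau> \<eta>))
       + (ennreal (\<epsilon> * L^5) * (Fa \<tau> x * Fw \<tau> v * Fz \<tau> \<eta>) + ennreal (1 / K) * (Q \<tau> x * Fw \<tau> v * Fz \<tau> \<eta>))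
       + (ennreal (\<epsilon> * L^5) * (Fw \<tau> x * Fa \<tau> v * Fz \<tau> \<eta>) + ennreal (1 / K) * (Fw \<tau> x * Q \<tau> v * Fz \<tau> \<eta>))"
        by (simp only: distrib_right distrib_left ac_simps)
      finally show ?thesis using True by simp
    qed simp
  qed auto
  finally show ?thesis by (simp only: e v_def[symmetric] ac_simps)
qed

end

context fsol_pair
begin

text \<open>Resonant here means \<open>|x| <= K\<close> or \<open>|x + \<eta>| <= K\<close>, two
  intervals of total length at most \<open>4 * K\<close>; there the derivative stays on
  \<open>z\<close> in \<open>L^2\<close>. Outside the cutoff \<open>L\<close> the trilinear term
  vanishes.\<close>

lemma resonant_part_w:
  "(NN \<eta>. NN x. ennreal (\<bar>\<eta>\<bar> * cmod (tri z wL wL t \<eta> x (- x - \<eta>)))) \<le>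
    ennreal (t * (sqrt (4 * K) * y * y * (2 * H)) + 1 / K * (y * y * (4 * H) + y * y * (4 * H))
      + t * (\<epsilon> * (2 * L)^5 * (y * y * (2 * H)) + 2 / K * (y * y * (4 * H\<^sup>2 + 4 * H\<^sup>2))
        + (\<epsilon> * L^5 * (H * y * (4 * H)) + 1 / K * (4 * H * y * y * (4 * H)))
        + (\<epsilon> * L^5 * (y * H * (4 * H)) + 1 / K * (y * (4 * H * y) * (4 * H)))))"
proof -
  let ?B = "\<epsilon> * (2 * L)^5 * (y * y * (2 * H)) + 2 / K * (y * y * (4 * H\<^sup>2 + 4 * H\<^sup>2)) + (\<epsilon> * L^5 * (H * y * (4 * H)) + 1 / K * (4 * H * y * y * (4 * H))) + (\<epsilon> * L^5 * (y * H * (4 * H)) + 1 / K * (y * (4 * H * y) * (4 * H)))"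
  define S where "S \<eta> x \<longleftrightarrow> \<bar>x\<bar> \<le> K \<or> \<bar>x + \<eta>\<bar> \<le> K" for \<eta> x
  have Sm[measurable]: "Measurable.pred (borel \<Otimes>\<^sub>M borel) (\<lambda>(\<eta>, x). S \<eta> x)"
    unfolding S_def by measurable
  have Si: "(\<lambda>w. indicator {x. S (g w) x} (h w) :: ennreal) \<in> borel_measurable M"
    if [measurable]: "g \<in> borel_measurable M" "h \<in> borel_measurable M" for g h and M :: "'z measure"
    unfolding indicator_def S_def mem_Collect_eq by measurable
  note [measurable (raw)] = Si measurable_tri[OF z_meas wL_meas wL_meas]
  have S\<mu>: "emeasure lborel {x. S \<eta> x} \<le> ennreal (4 * K)" for \<eta>
  proof -
    have "{x. S \<eta> x} \<subseteq> {- K..K} \<union> {- \<eta> - K..- \<eta> + K}" by (auto simp: S_def abs_le_iff)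
    then have "emeasure lborel {x. S \<eta> x} \<le> emeasure lborel ({- K..K} \<union> {- \<eta> - K..- \<eta> + K})"
      by (rule emeasure_mono) simp
    also have "\<dots> \<le> emeasure lborel {- K..K} + emeasure lborel {- \<eta> - K..- \<eta> + K}"
      by (rule emeasure_subadditive) auto
    also have "\<dots> = ennreal (4 * K)" using K by (simp add: ennreal_plus[symmetric] del: ennreal_plus)
    finally show ?thesis .
  qed
  define R where "R \<eta> x = (NN \<tau>. indicator {0..t} \<tau> * (Fw \<tau> x * Fw \<tau> (x + \<eta>) * (ennreal \<bar>\<eta>\<bar> * Fz \<tau> \<eta>) * indicator {x. S \<eta> x} x))" for \<eta> x
  define bd where "bd \<tau> \<eta> x = Fw \<tau> x * Fw \<tau> (x + \<eta>) * Fz \<tau> \<eta>" for \<tau> \<eta> x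
  define N where "N \<eta> x = (NN \<tau>. indicator {0..t} \<tau> *
      nonres_sum \<tau> \<eta> x)" for \<eta> x
  have [measurable (raw)]: "(\<lambda>w. R (g w) (h w)) \<in> borel_measurable M" "(\<lambda>w. N (g w) (h w)) \<in> borel_measurable M" "(\<lambda>w. bd \<tau> (g w) (h w)) \<in> borel_measurable M"
    if [measurable]: "g \<in> borel_measurable M" "h \<in> borel_measurable M" for g h \<tau> and M :: "'z measure"
    unfolding R_def N_def bd_def by measurable
  have pt: "ennreal (\<bar>\<eta>\<bar> * cmod (tri z wL wL t \<eta> x (- x - \<eta>))) \<le> R \<eta> x + ennreal (1 / K) * (bd t \<eta> x + bd 0 \<eta> x) + N \<eta> x" for \<eta> x
  proof (cases "\<bar>x\<bar> \<le> L \<and> \<bar>x + \<eta>\<bar> \<le> L")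
    case False
    have "\<bar>- x - \<eta>\<bar> = \<bar>x + \<eta>\<bar>" by linarith
    then have "wL \<tau> x * wL \<tau> (- x - \<eta>) = 0" for \<tau> using False by (auto simp: wL_def cutoff_def)
    then have "(\<lambda>\<tau>. indicator {0..t} \<tau> *\<^sub>R (z \<tau> \<eta> * wL \<tau> x * wL \<tau> (- x - \<eta>))) = (\<lambda>_. 0)"
      by (simp only: mult.assoc) simp
    then have "tri z wL wL t \<eta> x (- x - \<eta>) = 0" unfolding tri_def by simp
    then show ?thesis by simp
  next
    case True
    show ?thesis
    proof (cases "S \<eta> x")
      case False
      then have x: "K < \<bar>x\<bar>" "K < \<bar>x + \<eta>\<bar>" by (auto simp: S_def)
      have "ennreal (\<bar>\<eta>\<bar> * cmod (tri z wL wL t \<eta> x (- x - \<eta>))) \<le> ennreal (1 / K) * (bd t \<eta> x + bd 0 \<eta> x) + N \<eta> x"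
        unfolding bd_def N_def using True x by (intro w_nonres_pointwise) auto
      then show ?thesis by (rule order_trans) (simp add: add.assoc)
    next
      case S: True
      have Fe: "enorm (wL \<tau> (- x - \<eta>)) \<le> Fw \<tau> (x + \<eta>)" for \<tau>
        using wL_le[of \<tau> "- x - \<eta>"] w_reality[of \<tau> "x + \<eta>"] by (simp add: ennreal_leI)
      have "ennreal (\<bar>\<eta>\<bar> * cmod (tri z wL wL t \<eta> x (- x - \<eta>))) \<le> ennreal \<bar>\<eta>\<bar> *
         (NN \<tau>. indicator {0..t} \<tau> * (Fz \<tau> \<eta> * enorm (wL \<tau> x) * enorm (wL \<tau> (- x - \<eta>))))"
        by (simp only: ennreal_mult abs_ge_zero norm_ge_zero) (intro mult_left_mono tri_le, simp)
      also have "\<dots> \<le> ennreal \<bar>\<eta>\<bar> * (NN \<tau>. indicator {0..t} \<tau> * (Fz \<tau> \<eta> * Fw \<tau> x * Fw \<tau> (x + \<eta>)))"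
        by (intro mult_left_mono nn_integral_mono mult_mono Fe ennreal_leI wL_le) auto
      also have "\<dots> = (NN \<tau>. ennreal \<bar>\<eta>\<bar> * (indicator {0..t} \<tau> * (Fz \<tau> \<eta> * Fw \<tau> x * Fw \<tau> (x + \<eta>))))"
        by (rule nn_integral_cmult[symmetric]) measurable
      also have "\<dots> = R \<eta> x"
        unfolding R_def using S by (intro nn_integral_cong) (simp add: ac_simps)
      finally show ?thesis by (rule order_trans) (simp add: add.assoc)
    qed
  qed
  have iR: "(NN \<eta>. NN x. R \<eta> x) \<le> ennreal (t * (sqrt (4 * K) * y * y * (2 * H)))"
    unfolding R_def
  proof (rule nn_integral_time_bound[OF _ _ t])
    fix \<tau> assume \<tau>: "\<tau> \<in> {0..t}"
    show "(NN \<eta>. NN x. Fw \<tau> x * Fw \<tau> (x + \<eta>) * (ennreal \<bar>\<eta>\<bar> * Fz \<tau> \<eta>) * indicator {x. S \<eta> x} x) \<le> ennreal (sqrt (4 * K) * y * y * (2 * H))"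
      by (rule trilinear_slices[OF wz_bounds(4) wz_bounds(4) wz_bounds(2) Sm S\<mu>]) (use \<tau> K in auto)
  qed measurable
  have ib: "(NN \<eta>. NN x. bd \<tau> \<eta> x) \<le> ennreal (y * y * (4 * H))" if "\<tau> \<in> {0..t}" for \<tau>
    unfolding bd_def by (rule trilinear_L1[OF wz_bounds(4) wz_bounds(4) wz_bounds(1)]) (use that in auto)
  have b1_add: "b1 (\<lambda>\<eta>. A.Y \<tau> \<eta> + B.Y \<tau> \<eta>) (4 * H\<^sup>2 + 4 * H\<^sup>2)" if "\<tau> \<in> {0..t}" for \<tau>
  proof -
    have "(NN \<eta>. A.Y \<tau> \<eta> + B.Y \<tau> \<eta>) = (NN \<eta>. A.Y \<tau> \<eta>) + (NN \<eta>. B.Y \<tau> \<eta>)"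
      by (rule nn_integral_add) measurable
    also have "\<dots> \<le> ennreal (4 * H\<^sup>2) + ennreal (4 * H\<^sup>2)"
      by (intro add_mono b1_le a_bounds that)
    also have "\<dots> = ennreal (4 * H\<^sup>2 + 4 * H\<^sup>2)" by (rule ennreal_plus[symmetric]) auto
    finally show ?thesis by (simp add: b1_def)
  qed
  have iN: "(NN \<eta>. NN x. N \<eta> x) \<le> ennreal (t * (?B))"
    unfolding N_def
  proof (rule nn_integral_time_bound[OF _ _ t])
    fix \<tau> assume \<tau>: "\<tau> \<in> {0..t}"
    have "(NN \<eta>. NN x. nonres_sum \<tau> \<eta> x)
      = ennreal (\<epsilon> * (2 * L)^5) * (NN \<eta>. NN x. Fw \<tau> x * Fw \<tau> (x + \<eta>) * Fa \<tau> \<eta>)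
       + ennreal (2 / K) * (NN \<eta>. NN x. Fw \<tau> x * Fw \<tau> (x + \<eta>) * (A.Y \<tau> \<eta> + B.Y \<tau> \<eta>))
       + (ennreal (\<epsilon> * L^5) * (NN \<eta>. NN x. Fa \<tau> x * Fw \<tau> (x + \<eta>) * Fz \<tau> \<eta>) + ennreal (1 / K) * (NN \<eta>. NN x. Q \<tau> x * Fw \<tau> (x + \<eta>) * Fz \<tau> \<eta>))
       + (ennreal (\<epsilon> * L^5) * (NN \<eta>. NN x. Fw \<tau> x * Fa \<tau> (x + \<eta>) * Fz \<tau> \<eta>) + ennreal (1 / K) * (NN \<eta>. NN x. Fw \<tau> x * Q \<tau> (x + \<eta>) * Fz \<tau> \<eta>))"
      by (simp add: nn_integral_add nn_integral_cmult)
    also have "\<dots> \<le> ennreal (\<epsilon> * (2 * L)^5) * ennreal (y * y * (2 * H)) + ennreal (2 / K) * ennreal (y * y * (4 * H\<^sup>2 + 4 * H\<^sup>2))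
       + (ennreal (\<epsilon> * L^5) * ennreal (H * y * (4 * H)) + ennreal (1 / K) * ennreal (4 * H * y * y * (4 * H)))
       + (ennreal (\<epsilon> * L^5) * ennreal (y * H * (4 * H)) + ennreal (1 / K) * ennreal (y * (4 * H * y) * (4 * H)))"
      by (intro add_mono mult_left_mono trilinear_L1 a_bounds wz_bounds b1_add \<tau>) auto
    also have "\<dots> = ennreal (?B)"
    proof -
      have *: "ennreal p1 * ennreal q1 + ennreal p2 * ennreal q2 + (ennreal p3 * ennreal q3 + ennreal p4 * ennreal q4) + (ennreal p5 * ennreal q5 + ennreal p6 * ennreal q6)
        = ennreal (p1 * q1 + p2 * q2 + (p3 * q3 + p4 * q4) + (p5 * q5 + p6 * q6))"
        if "0 \<le> p1" "0 \<le> p2" "0 \<le> p3" "0 \<le> p4" "0 \<le> p5" "0 \<le> p6" "0 \<le> q1" "0 \<le> q2" "0 \<le> q3" "0 \<le> q4" "0 \<le> q5" "0 \<le> q6"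
        for p1 p2 p3 p4 p5 p6 q1 q2 q3 q4 q5 q6
        using that by (simp add: ennreal_mult)
      show ?thesis by (rule *) (use \<epsilon>0 K L H0 y0 in auto)
    qed
    finally show "(NN \<eta>. NN x. nonres_sum \<tau> \<eta> x)
      \<le> ennreal (?B)" .
  qed measurable
  have "(NN \<eta>. NN x. ennreal (\<bar>\<eta>\<bar> * cmod (tri z wL wL t \<eta> x (- x - \<eta>)))) \<le>
     (NN \<eta>. NN x. R \<eta> x + ennreal (1 / K) * (bd t \<eta> x + bd 0 \<eta> x) + N \<eta> x)"
    by (intro nn_integral_mono pt)
  also have "\<dots> = (NN \<eta>. NN x. R \<eta> x) + ennreal (1 / K) *
     ((NN \<eta>. NN x. bd t \<eta> x) + (NN \<eta>. NN x. bd 0 \<eta> x)) + (NN \<eta>. NN x. N \<eta> x)"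
    by (simp add: nn_integral_add nn_integral_cmult)
  also have "\<dots> \<le> ennreal (t * (sqrt (4 * K) * y * y * (2 * H))) + ennreal (1 / K) * (ennreal (y * y * (4 * H)) + ennreal (y * y * (4 * H)))
     + ennreal (t * (?B))"
    using t by (intro add_mono mult_left_mono iR ib iN) auto
  also have "\<dots> = ennreal (t * (sqrt (4 * K) * y * y * (2 * H)) + 1 / K * (y * y * (4 * H) + y * y * (4 * H))
      + t * (?B))"
  proof -
    have *: "ennreal p1 + ennreal p2 * (ennreal p3 + ennreal p4) + ennreal p5 = ennreal (p1 + p2 * (p3 + p4) + p5)"
      if "0 \<le> p1" "0 \<le> p2" "0 \<le> p3" "0 \<le> p4" "0 \<le> p5" for p1 p2 p3 p4 p5
      using that by (simp add: ennreal_mult)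
    show ?thesis by (rule *) (use \<epsilon>0 K L H0 y0 t in auto)
  qed
  finally show ?thesis .
qed

text \<open>The full symmetry is lost because \<open>z\<close> differs from \<open>wL\<close>, but
  exchanging the two copies of \<open>wL\<close> is enough: it averages the symbol \<open>x\<close>
  with \<open>- \<eta> - x\<close>, and their sum \<open>- \<eta>\<close> moves the derivative onto
  \<open>z\<close>.\<close>

lemma swap_symmetry:
  defines "J \<equiv> (LBINT x. LBINT \<xi>. of_real x * tri z wL wL t \<xi> x (- \<xi> - x))"
  shows "ennreal (2 * cmod J) \<le> (NN \<eta>. NN x. ennreal (\<bar>\<eta>\<bar> * cmod (tri z wL wL t \<eta> x (- x - \<eta>))))"
proof -
  note [measurable (raw)] = measurable_tri[OF z_meas wL_meas wL_meas]
  let ?T = "\<lambda>\<eta> x. tri z wL wL t \<eta> x (- x - \<eta>)"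
  have fin: "(NN x. NN \<eta>. enorm (of_real x * tri z wL wL t \<eta> x (- \<eta> - x))) < \<infinity>"
    by (rule le_less_trans[OF trilinear_time[OF z_meas wL_meas wL_meas _ t wz_bounds(1) wL_bounds(2) wL_bounds(1)]])
      (auto simp: wL_reality)
  have m: "case_prod (\<lambda>x \<eta>. of_real x * tri z wL wL t \<eta> x (- \<eta> - x)) \<in> borel_measurable (borel \<Otimes>\<^sub>M borel)"
    by measurable
  have "J = (LBINT \<eta>. LBINT x. of_real x * ?T \<eta> x)"
    unfolding J_def using Fubini_nn(2)[OF m fin] by (simp add: minus_diff_commute)
  have finite_swapped: "(NN \<eta>. NN x. enorm (of_real x * ?T \<eta> x)) < \<infinity>"
  proof -
    have "(NN \<eta>. NN x. enorm (of_real x * ?T \<eta> x)) = (NN x. NN \<eta>. enorm (of_real x * ?T \<eta> x))"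
      by (rule lborel_pair.Fubini') measurable
    then show ?thesis using fin by (simp add: minus_diff_commute)
  qed
  have m2: "case_prod (\<lambda>\<eta> x. of_real x * ?T \<eta> x) \<in> borel_measurable (borel \<Otimes>\<^sub>M borel)" by measurable
  \<comment> \<open>The inner integral can be split only where it converges, which Fubini's theorem
    guarantees for almost every \<open>\<eta>\<close>.\<close>
  have "AE \<eta> in lborel. integrable lborel (\<lambda>x. of_real x * ?T \<eta> x)"
    using lborel_pair.AE_integrable_fst'[OF Fubini_nn(1)[OF m2 finite_swapped]] by simp
  then have AE: "AE \<eta> in lborel. 2 * (LBINT x. of_real x * ?T \<eta> x) = - (LBINT x. of_real \<eta> * ?T \<eta> x)"
  proof eventually_elim
    case (elim \<eta>)
    have Ts: "tri z wL wL t \<eta> (- \<eta> - x) x = ?T \<eta> x" for x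
      by (simp add: tri_def minus_diff_commute[of \<eta> x] mult.commute mult.left_commute)
    have r: "(LBINT x. of_real x * ?T \<eta> x) = (LBINT x. of_real (- \<eta> - x) * ?T \<eta> x)"
      using lborel_integral_real_affine[of "-1" "\<lambda>x. of_real x * ?T \<eta> x" "- \<eta>"] by (simp add: Ts)
    have i2: "integrable lborel (\<lambda>x. of_real (- \<eta> - x) * ?T \<eta> x)"
      using lborel_integrable_real_affine[OF elim, of "-1" "- \<eta>"] by (simp add: Ts)
    have "2 * (LBINT x. of_real x * ?T \<eta> x) = (LBINT x. of_real x * ?T \<eta> x) + (LBINT x. of_real (- \<eta> - x) * ?T \<eta> x)"
      using r by simp
    also have "\<dots> = (LBINT x. of_real x * ?T \<eta> x + of_real (- \<eta> - x) * ?T \<eta> x)"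
      by (rule Bochner_Integration.integral_add[OF elim i2, symmetric])
    also have "\<dots> = (LBINT x. - (of_real \<eta> * ?T \<eta> x))"
      by (intro Bochner_Integration.integral_cong refl) (simp add: algebra_simps)
    finally show ?case by simp
  qed
  have "2 * J = (LBINT \<eta>. 2 * (LBINT x. of_real x * ?T \<eta> x))"
    using \<open>J = _\<close> by simp
  also have "\<dots> = (LBINT \<eta>. - (LBINT x. of_real \<eta> * ?T \<eta> x))"
    by (rule integral_cong_AE[OF _ _ AE]) measurable
  finally have eq: "2 * J = (LBINT \<eta>. - (LBINT x. of_real \<eta> * ?T \<eta> x))" .
  have "ennreal (2 * cmod J) = enorm (2 * J)" by (simp only: norm_mult norm_numeral)
  also have "\<dots> \<le> (NN \<eta>. enorm (- (LBINT x. of_real \<eta> * ?T \<eta> x)))"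
    unfolding eq by (rule integral_norm_le_nn_integral)
  also have "\<dots> \<le> (NN \<eta>. NN x. enorm (of_real \<eta> * ?T \<eta> x))"
    unfolding norm_minus_cancel by (intro nn_integral_mono integral_norm_le_nn_integral)
  finally show ?thesis by (simp add: norm_mult)
qed

end

lemma nn_integral_time_bound1:
  assumes k: "case_prod k \<in> borel_measurable (borel \<Otimes>\<^sub>M borel)"
    and le: "\<And>\<tau>. \<tau> \<in> {0..t} \<Longrightarrow> (NN x. k \<tau> x) \<le> ennreal B" and t: "0 \<le> t"
  shows "(NN x. NN \<tau>. indicator {0..t} \<tau> * k \<tau> x) \<le> ennreal (t * B)"
proof -
  note [measurable (raw)] = measurable_compose[OF measurable_Pair k, simplified]
  have "(NN x. NN \<tau>. indicator {0..t} \<tau> * k \<tau> x) = (NN \<tau>. NN x. indicator {0..t} \<tau> * k \<tau> x)"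
    by (rule lborel_pair.Fubini') measurable
  also have "\<dots> = (NN \<tau>. indicator {0..t} \<tau> * (NN x. k \<tau> x))"
    by (intro nn_integral_cong nn_integral_cmult) measurable
  also have "\<dots> \<le> (NN \<tau>. indicator {0..t} \<tau> * ennreal B)"
    using le by (intro nn_integral_mono) (auto simp: indicator_def)
  also have "\<dots> = ennreal t * ennreal B" using t by (simp add: nn_integral_multc)
  also have "\<dots> = ennreal (t * B)" using t by (simp add: ennreal_mult')
  finally show ?thesis .
qed

context fsol_pair
begin

text \<open>The bound obtained in \<open>resonant_part_w\<close>.\<close>

definition NJ :: real where
  "NJ = t * (sqrt (4 * K) * y * y * (2 * H)) + 1 / K * (y * y * (4 * H) + y * y * (4 * H))
      + t * (\<epsilon> * (2 * L)^5 * (y * y * (2 * H)) + 2 / K * (y * y * (4 * H\<^sup>2 + 4 * H\<^sup>2))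
        + (\<epsilon> * L^5 * (H * y * (4 * H)) + 1 / K * (4 * H * y * y * (4 * H)))
        + (\<epsilon> * L^5 * (y * H * (4 * H)) + 1 / K * (y * (4 * H * y) * (4 * H))))"

lemma cont_wL: "continuous_on {0..t} (\<lambda>\<tau>. wL \<tau> \<xi>)"
  using cont_w[of \<xi>] by (cases "\<bar>\<xi>\<bar> \<le> L") (simp_all add: wL_def cutoff_def)

text \<open>The truncated difference does not satisfy a closed equation: the last slot contains the
  full \<open>w\<close>. Splitting it as \<open>wL + wH\<close> restores the swap symmetry, and the
  remainder is of size \<open>1 / L\<close> because \<open>wH\<close> is small in
  \<open>L^2\<close>.\<close>

lemma trilinear_difference:
  defines "J0 \<equiv> (LBINT x. LBINT \<xi>. of_real x * tri z wL w t \<xi> x (- \<xi> - x))"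
  shows "cmod J0 \<le> NJ + t * (2 * H * (2 * H / L) * (4 * H))"
    "integrable lborel (\<lambda>x. LBINT \<xi>. of_real x * tri z wL w t \<xi> x (- \<xi> - x))"
proof -
  note [measurable (raw)] = measurable_tri[OF z_meas wL_meas wL_meas] measurable_tri[OF z_meas wL_meas w_meas] measurable_tri[OF z_meas wL_meas wH_meas]
  have split: "tri z wL w t \<xi> x v = tri z wL wL t \<xi> x v + tri z wL wH t \<xi> x v" for \<xi> x v
  proof -
    have cz: "continuous_on {0..t} (\<lambda>\<tau>. z \<tau> \<xi>)" for \<xi> by (rule continuous_on_vector_derivative[OF deriv_z])
    have "integrable lborel (\<lambda>\<tau>. indicator {0..t} \<tau> *\<^sub>R (z \<tau> \<xi> * wL \<tau> x * wL \<tau> v))"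
      "integrable lborel (\<lambda>\<tau>. indicator {0..t} \<tau> *\<^sub>R (z \<tau> \<xi> * wL \<tau> x * wH \<tau> v))"
      unfolding wH_def by (rule borel_integrable_compact[OF compact_Icc]; intro continuous_intros cz cont_wL cont_w)+
    from Bochner_Integration.integral_add[OF this]
    show ?thesis unfolding tri_def by (simp only: scaleR_add_right[symmetric] distrib_left[symmetric]) (simp add: wH_def)
  qed
  let ?F = "\<lambda>b x \<xi>. of_real x * tri z wL b t \<xi> x (- \<xi> - x)"
  have wHr: "cmod (wH \<tau> (- \<xi>)) = cmod (wH \<tau> \<xi>)" for \<tau> \<xi> by (simp add: wH_def w_reality wL_reality flip: complex_cnj_diff)
  have f1: "(NN x. NN \<xi>. enorm (?F wL x \<xi>)) \<le> ennreal (t * (2 * H * y * (4 * H)))"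
    by (rule trilinear_time[OF z_meas wL_meas wL_meas _ t wz_bounds(1) wL_bounds(2) wL_bounds(1)]) (auto simp: wL_reality)
  have f2: "(NN x. NN \<xi>. enorm (?F wH x \<xi>)) \<le> ennreal (t * (2 * H * (2 * H / L) * (4 * H)))"
    by (rule trilinear_time[OF z_meas wL_meas wH_meas _ t wz_bounds(1) wL_bounds(2) wL_bounds(3)]) (auto simp: wHr)
  have f0: "(NN x. NN \<xi>. enorm (?F w x \<xi>)) \<le> ennreal (t * (2 * H * y * (4 * H)))"
    by (rule trilinear_time[OF z_meas wL_meas w_meas _ t wz_bounds(1) wL_bounds(2) wz_bounds(4)]) (auto simp: w_reality)
  note fin = le_less_trans[OF f0 ennreal_less_top, folded infinity_ennreal_def] le_less_trans[OF f1 ennreal_less_top, folded infinity_ennreal_def]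
    le_less_trans[OF f2 ennreal_less_top, folded infinity_ennreal_def]
  have m: "case_prod (?F w) \<in> borel_measurable (borel \<Otimes>\<^sub>M borel)" "case_prod (?F wL) \<in> borel_measurable (borel \<Otimes>\<^sub>M borel)"
    "case_prod (?F wH) \<in> borel_measurable (borel \<Otimes>\<^sub>M borel)" by measurable
  show "integrable lborel (\<lambda>x. LBINT \<xi>. ?F w x \<xi>)" by (rule Fubini_nn(4)[OF m(1) fin(1)])
  have "J0 = (LINT p|(lborel \<Otimes>\<^sub>M lborel). case_prod (?F w) p)" unfolding J0_def by (rule Fubini_nn(3)[OF m(1) fin(1)])
  also have "\<dots> = (LINT p|(lborel \<Otimes>\<^sub>M lborel). case_prod (?F wL) p + case_prod (?F wH) p)"
    by (intro Bochner_Integration.integral_cong refl) (auto simp: split distrib_left)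
  also have "\<dots> = (LINT p|(lborel \<Otimes>\<^sub>M lborel). case_prod (?F wL) p) + (LINT p|(lborel \<Otimes>\<^sub>M lborel). case_prod (?F wH) p)"
    by (rule Bochner_Integration.integral_add[OF Fubini_nn(1)[OF m(2) fin(2)] Fubini_nn(1)[OF m(3) fin(3)]])
  also have "\<dots> = (LBINT x. LBINT \<xi>. ?F wL x \<xi>) + (LINT p|(lborel \<Otimes>\<^sub>M lborel). case_prod (?F wH) p)"
    by (simp only: Fubini_nn(3)[OF m(2) fin(2)])
  finally have "cmod J0 \<le> cmod (LBINT x. LBINT \<xi>. ?F wL x \<xi>) + cmod (LINT p|(lborel \<Otimes>\<^sub>M lborel). case_prod (?F wH) p)"
    by (simp only: norm_triangle_ineq)
  moreover have "cmod (LBINT x. LBINT \<xi>. ?F wL x \<xi>) \<le> NJ"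
  proof -
    have NJ0: "0 \<le> NJ" unfolding NJ_def using \<epsilon>0 K L H0 y0 t by simp
    have "ennreal (2 * cmod (LBINT x. LBINT \<xi>. ?F wL x \<xi>)) \<le> ennreal NJ"
      unfolding NJ_def by (rule order_trans[OF swap_symmetry resonant_part_w])
    then have "2 * cmod (LBINT x. LBINT \<xi>. ?F wL x \<xi>) \<le> NJ" using NJ0 by (simp add: ennreal_le_iff)
    then show ?thesis using norm_ge_zero[of "LBINT x. LBINT \<xi>. ?F wL x \<xi>"] by linarith
  qed
  moreover have "cmod (LINT p|(lborel \<Otimes>\<^sub>M lborel). case_prod (?F wH) p) \<le> t * (2 * H * (2 * H / L) * (4 * H))"
  proof -
    have "enorm (LINT p|(lborel \<Otimes>\<^sub>M lborel). case_prod (?F wH) p) \<le> (\<integral>\<^sup>+p. enorm (case_prod (?F wH) p) \<partial>(lborel \<Otimes>\<^sub>M lborel))"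
      by (rule integral_norm_le_nn_integral)
    also have "\<dots> = (NN x. NN \<xi>. enorm (?F wH x \<xi>))"
      by (subst lborel.nn_integral_fst[symmetric]) (use m(3) in simp_all)
    also note f2
    finally show ?thesis using t H0 L by (simp add: ennreal_le_iff)
  qed
  ultimately show "cmod J0 \<le> NJ + t * (2 * H * (2 * H / L) * (4 * H))" by linarith
qed

text \<open>The energy identity is integrated for \<open>wL\<close>; \<open>P\<close> collects the
  forcing \<open>\<epsilon> * \<xi>^5\<close> and \<open>G\<close> the nonlinear term. The
  frequencies above \<open>L\<close> are added at the final time by their bound
  \<open>(2 * H / L)^2\<close>.\<close>

lemma difference_estimate:
  "(LBINT \<xi>. (cmod (w t \<xi>))\<^sup>2) \<le> (LBINT \<xi>. (cmod (w 0 \<xi>))\<^sup>2) + 2 * (t * (\<epsilon> * L^5 * (y * H)))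
     + (NJ + t * (2 * H * (2 * H / L) * (4 * H))) + (2 * H / L)\<^sup>2"
proof -
  define P where "P \<xi> = (LBINT \<tau>. indicator {0..t} \<tau> *\<^sub>R (wL \<tau> (- \<xi>) * (- (\<i> * of_real (\<epsilon> * \<xi>^5)) * a \<tau> \<xi>)))" for \<xi>
  define G where "G \<xi> = - (\<i> * of_real (\<xi> / (4 * pi))) * (LBINT \<eta>. tri z wL w t \<eta> (- \<xi>) (\<xi> - \<eta>))" for \<xi>
  have [measurable]: "P \<in> borel_measurable borel" unfolding P_def[abs_def] by measurable
  have wLm: "cnj (wL \<tau> \<xi>) = wL \<tau> (- \<xi>)" for \<tau> \<xi> by (simp add: wL_reality)
  have pt: "(cmod (wL t \<xi>))\<^sup>2 - (cmod (wL 0 \<xi>))\<^sup>2 = 2 * Re (P \<xi>) + 2 * Re (G \<xi>)" for \<xi>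
  proof (cases "\<bar>\<xi>\<bar> \<le> L")
    case True
    have wx: "wL \<tau> \<xi> = w \<tau> \<xi>" for \<tau> using True by (simp add: wL_def cutoff_def)
    have ca: "continuous_on {0..t} (\<lambda>\<tau>. a \<tau> \<xi>)" by (rule A.cont_f_on)
    have cb: "continuous_on {0..t} (\<lambda>\<tau>. bil (z \<tau>) (w \<tau>) \<xi>)"
      by (rule continuous_on_eq[OF continuous_on_diff[OF A.cont_bil_on B.cont_bil_on] bil_zw])
    have "(cmod (wL t \<xi>))\<^sup>2 - (cmod (wL 0 \<xi>))\<^sup>2 = 2 * Re (LBINT \<tau>. indicator {0..t} \<tau> *\<^sub>R (cnj (wL \<tau> \<xi>) * Ew \<xi> \<tau>))"
      unfolding wx by (rule energy_pointwise[OF t deriv_w cont_Ew])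
    also have "(LBINT \<tau>. indicator {0..t} \<tau> *\<^sub>R (cnj (wL \<tau> \<xi>) * Ew \<xi> \<tau>)) =
       (LBINT \<tau>. indicator {0..t} \<tau> *\<^sub>R (wL \<tau> (- \<xi>) * (- (\<i> * of_real (\<epsilon> * \<xi>^5)) * a \<tau> \<xi>)) +
         indicator {0..t} \<tau> *\<^sub>R (wL \<tau> (- \<xi>) * bil (z \<tau>) (w \<tau>) \<xi>))"
    proof (rule Bochner_Integration.integral_cong[OF refl])
      fix \<tau>
      show "indicator {0..t} \<tau> *\<^sub>R (cnj (wL \<tau> \<xi>) * Ew \<xi> \<tau>) = indicator {0..t} \<tau> *\<^sub>R (wL \<tau> (- \<xi>) * (- (\<i> * of_real (\<epsilon> * \<xi>^5)) * a \<tau> \<xi>)) +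
         indicator {0..t} \<tau> *\<^sub>R (wL \<tau> (- \<xi>) * bil (z \<tau>) (w \<tau>) \<xi>)"
        unfolding wLm by (cases "\<tau> \<in> {0..t}") (auto simp: Ew_def bil_zw distrib_left right_diff_distrib)
    qed
    also have "\<dots> = P \<xi> + (LBINT \<tau>. indicator {0..t} \<tau> *\<^sub>R (wL \<tau> (- \<xi>) * bil (z \<tau>) (w \<tau>) \<xi>))"
      unfolding P_def by (rule Bochner_Integration.integral_add; rule borel_integrable_compact[OF compact_Icc]; intro continuous_intros ca cb cont_wL)
    also have "(LBINT \<tau>. indicator {0..t} \<tau> *\<^sub>R (wL \<tau> (- \<xi>) * bil (z \<tau>) (w \<tau>) \<xi>)) = G \<xi>"
      unfolding G_def by (rule bil_energy[OF z_meas wL_meas w_meas wz_bounds(6) wz_bounds(4) cont_wL])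
    finally show ?thesis by simp
  next
    case False
    then have "wL \<tau> \<xi> = 0" "wL \<tau> (- \<xi>) = 0" for \<tau> by (auto simp: wL_def cutoff_def)
    then show ?thesis by (simp add: P_def G_def tri_def)
  qed
  have Pb: "(NN \<xi>. enorm (P \<xi>)) \<le> ennreal (t * (\<epsilon> * L^5 * (y * H)))"
  proof -
    have "(NN \<xi>. enorm (P \<xi>)) \<le> (NN \<xi>. NN \<tau>. indicator {0..t} \<tau> * (ennreal (\<epsilon> * L^5) * (Fw \<tau> \<xi> * Fa \<tau> \<xi>)))"
    proof (intro nn_integral_mono)
      fix \<xi>
      show "enorm (P \<xi>) \<le> (NN \<tau>. indicator {0..t} \<tau> * (ennreal (\<epsilon> * L^5) * (Fw \<tau> \<xi> * Fa \<tau> \<xi>)))"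
        unfolding P_def
      proof (rule order_trans[OF integral_norm_le_nn_integral nn_integral_mono])
        fix \<tau>
        have "cmod (wL \<tau> (- \<xi>) * (- (\<i> * of_real (\<epsilon> * \<xi>^5)) * a \<tau> \<xi>)) \<le> \<epsilon> * L^5 * (cmod (w \<tau> \<xi>) * cmod (a \<tau> \<xi>))"
        proof (cases "\<bar>\<xi>\<bar> \<le> L")
          case True
          then have "\<epsilon> * \<bar>\<xi>\<bar>^5 \<le> \<epsilon> * L^5" using \<epsilon>0 by (intro mult_left_mono power_mono) auto
          then have "\<epsilon> * \<bar>\<xi>\<bar>^5 * (cmod (w \<tau> \<xi>) * cmod (a \<tau> \<xi>)) \<le> \<epsilon> * L^5 * (cmod (w \<tau> \<xi>) * cmod (a \<tau> \<xi>))" by (rule mult_right_mono) simp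
          moreover have "cmod (wL \<tau> (- \<xi>)) = cmod (w \<tau> \<xi>)" using True by (simp add: wL_reality) (simp add: wL_def cutoff_def)
          ultimately show ?thesis using \<epsilon>0 by (simp add: norm_mult norm_power abs_mult power_abs ac_simps)
        next
          case False
          then show ?thesis using \<epsilon>0 L by (simp add: wL_def cutoff_def)
        qed
        then show "enorm (indicator {0..t} \<tau> *\<^sub>R (wL \<tau> (- \<xi>) * (- (\<i> * of_real (\<epsilon> * \<xi>^5)) * a \<tau> \<xi>))) \<le> indicator {0..t} \<tau> * (ennreal (\<epsilon> * L^5) * (Fw \<tau> \<xi> * Fa \<tau> \<xi>))"
          using \<epsilon>0 L by (cases "\<tau> \<in> {0..t}") (auto simp: ennreal_leI simp del: of_real_mult simp flip: ennreal_mult)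
      qed
    qed
    also have "\<dots> \<le> ennreal (t * (\<epsilon> * L^5 * (y * H)))"
    proof (rule nn_integral_time_bound1[OF _ _ t])
      fix \<tau> assume \<tau>: "\<tau> \<in> {0..t}"
      have "(NN \<xi>. ennreal (\<epsilon> * L^5) * (Fw \<tau> \<xi> * Fa \<tau> \<xi>)) = ennreal (\<epsilon> * L^5) * (NN \<xi>. Fw \<tau> \<xi> * Fa \<tau> \<xi>)"
        by (rule nn_integral_cmult) measurable
      also have "\<dots> \<le> ennreal (\<epsilon> * L^5) * ennreal (y * H)"
        by (intro mult_left_mono b1_le[OF b2_mult[OF wz_bounds(4)[OF \<tau>] a_bounds(1)[OF \<tau>]]]) auto
      finally show "(NN \<xi>. ennreal (\<epsilon> * L^5) * (Fw \<tau> \<xi> * Fa \<tau> \<xi>)) \<le> ennreal (\<epsilon> * L^5 * (y * H))"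
        using \<epsilon>0 L y0 H0 by (subst ennreal_mult) auto
    qed measurable
    finally show ?thesis .
  qed
  have iP: "integrable lborel P"
    using Pb by (intro integrableI_bounded) (auto intro: le_less_trans)
  have "cmod (LBINT \<xi>. P \<xi>) \<le> t * (\<epsilon> * L^5 * (y * H))"
    using order_trans[OF integral_norm_le_nn_integral Pb] t \<epsilon>0 L y0 H0 by (simp add: ennreal_le_iff)
  then have P': "Re (LBINT \<xi>. P \<xi>) \<le> t * (\<epsilon> * L^5 * (y * H))" using complex_Re_le_cmod order_trans by blast
  define J0 where "J0 = (LBINT x. LBINT \<xi>. of_real x * tri z wL w t \<xi> x (- \<xi> - x))"
  have Gm: "G (- x) = \<i> / (4 * pi) * (LBINT \<xi>. of_real x * tri z wL w t \<xi> x (- \<xi> - x))" for x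
    unfolding G_def by (simp add: minus_diff_commute)
  have iG: "integrable lborel G"
  proof -
    have "integrable lborel (\<lambda>y. G (- y))"
      unfolding Gm by (intro integrable_mult_right trilinear_difference(2))
    then show ?thesis using lborel_integrable_real_affine_iff[of "-1" G 0] by simp
  qed
  have LG: "(LBINT \<xi>. G \<xi>) = \<i> / (4 * pi) * J0"
    using lborel_integral_real_affine[of "-1" G 0] by (simp add: Gm J0_def)
  have "Re (LBINT \<xi>. G \<xi>) \<le> cmod (\<i> / (4 * pi) * J0)" unfolding LG by (rule complex_Re_le_cmod)
  then have G': "2 * Re (LBINT \<xi>. G \<xi>) \<le> NJ + t * (2 * H * (2 * H / L) * (4 * H))"
  proof -
    assume *: "Re (LBINT \<xi>. G \<xi>) \<le> cmod (\<i> / (4 * pi) * J0)"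
    have "2 * cmod (\<i> / (4 * pi) * J0) \<le> cmod J0"
      using pi_gt3 mult_left_mono[of 1 "2 * pi" "cmod J0"] by (simp add: norm_mult norm_divide divide_le_eq)
    then show ?thesis using * trilinear_difference(1) unfolding J0_def by linarith
  qed
  have b0: "0 \<in> {0..t}" "t \<in> {0..t}" using t by auto
  have sw: "square_integrable (w \<tau>)" "square_integrable (wL \<tau>)" "square_integrable (wH \<tau>)" if "\<tau> \<in> {0..t}" for \<tau>
    using wz_bounds(4)[OF that] wL_bounds(1,3)[OF that] by (auto simp: square_integrable_b2)
  have iw: "integrable lborel (\<lambda>\<xi>. (cmod (w \<tau> \<xi>))\<^sup>2)" "integrable lborel (\<lambda>\<xi>. (cmod (wL \<tau> \<xi>))\<^sup>2)" "integrable lborel (\<lambda>\<xi>. (cmod (wH \<tau> \<xi>))\<^sup>2)"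
    if "\<tau> \<in> {0..t}" for \<tau> using sw[OF that] by (auto simp: square_integrable_def)
  have "(LBINT \<xi>. (cmod (wL t \<xi>))\<^sup>2) - (LBINT \<xi>. (cmod (wL 0 \<xi>))\<^sup>2) = (LBINT \<xi>. 2 * Re (P \<xi>) + 2 * Re (G \<xi>))"
    using iw b0 by (subst Bochner_Integration.integral_diff[symmetric]) (auto simp: pt)
  also have "\<dots> = 2 * Re (LBINT \<xi>. P \<xi>) + 2 * Re (LBINT \<xi>. G \<xi>)"
    using iP iG by simp
  finally have m: "(LBINT \<xi>. (cmod (wL t \<xi>))\<^sup>2) \<le> (LBINT \<xi>. (cmod (wL 0 \<xi>))\<^sup>2) + 2 * (t * (\<epsilon> * L^5 * (y * H)))
     + (NJ + t * (2 * H * (2 * H / L) * (4 * H)))" using P' G' by linarith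
  have "(cmod (w t \<xi>))\<^sup>2 = (cmod (wL t \<xi>))\<^sup>2 + (cmod (wH t \<xi>))\<^sup>2" for \<xi>
    by (simp add: wH_def wL_def cutoff_def)
  then have "(LBINT \<xi>. (cmod (w t \<xi>))\<^sup>2) = (LBINT \<xi>. (cmod (wL t \<xi>))\<^sup>2) + (LBINT \<xi>. (cmod (wH t \<xi>))\<^sup>2)"
    using iw b0 by simp
  moreover have "(LBINT \<xi>. (cmod (wH t \<xi>))\<^sup>2) \<le> (2 * H / L)\<^sup>2"
  proof -
    have "L2_norm (wH t) \<le> 2 * H / L" by (rule L2_norm_le_b2[OF wL_bounds(3)[OF b0(2)]]) measurable
    then have "(L2_norm (wH t))\<^sup>2 \<le> (2 * H / L)\<^sup>2" by (intro power_mono) auto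
    then show ?thesis by (simp add: L2_norm_def integral_nonneg_AE)
  qed
  moreover have "(LBINT \<xi>. (cmod (wL 0 \<xi>))\<^sup>2) \<le> (LBINT \<xi>. (cmod (w 0 \<xi>))\<^sup>2)"
    using iw b0 wL_le by (intro Bochner_Integration.integral_mono power_mono) auto
  ultimately show ?thesis using m by linarith
qed

end

text \<open>The order of the choices matters: \<open>K\<close> and the time step
  \<open>\<delta>\<close> depend on \<open>H\<close> only, then \<open>L\<close> on
  \<open>\<kappa>\<close>, and finally \<open>\<rho>\<close> on \<open>L\<close>, since the forcing
  is of size \<open>\<epsilon> * L^5\<close>. Therefore \<open>\<delta>\<close> does not shrink with
  \<open>\<kappa>\<close>.\<close>

lemma difference_small:
  assumes H0: "0 \<le> H"
  shows "\<exists>\<delta>>0. \<forall>\<kappa>>0. \<exists>\<rho>>0. \<forall>\<epsilon> a b d. fsol \<epsilon> a \<longrightarrow> fsol 0 b \<longrightarrow> 0 \<le> \<epsilon> \<longrightarrow> \<epsilon> \<le> \<rho> \<longrightarrow> 0 \<le> d \<longrightarrow> d \<le> \<delta> \<longrightarrow>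
    (\<forall>\<tau>\<in>{0..d}. wb h1_weight (a \<tau>) H \<and> wb h1_weight (b \<tau>) H) \<longrightarrow>
    (\<forall>t\<in>{0..d}. (L2_norm (\<lambda>\<xi>. a t \<xi> - b t \<xi>))\<^sup>2 \<le> 2 * (L2_norm (\<lambda>\<xi>. a 0 \<xi> - b 0 \<xi>))\<^sup>2 + \<kappa>)"
proof -
  \<comment> \<open>Makes the boundary terms at most \<open>S / 4\<close>, where \<open>S\<close> is
    the supremum of the squared distance.\<close>
  define K where "K = 1 + 32 * H"
  have K: "1 \<le> K" using H0 by (simp add: K_def)
  \<comment> \<open>The coefficient of \<open>t * S\<close> in those terms of \<open>NJ\<close> that
    contain no \<open>\<epsilon>\<close>; the number 48 is \<open>16 + 16 + 16\<close>.\<close>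
  define M where "M = sqrt (4 * K) * (2 * H) + 48 * H\<^sup>2 / K"
  have M: "0 \<le> M" using H0 K by (simp add: M_def)
  define \<delta> where "\<delta> = 1 / (4 * M + 1)"
  have \<delta>: "0 < \<delta>" "\<delta> \<le> 1" using M by (simp_all add: \<delta>_def)
  have \<delta>M: "\<delta> * M \<le> 1/4" using M by (simp add: \<delta>_def divide_le_eq)
  have HK: "8 * H / K \<le> 1/4"
  proof -
    have "8 * H \<le> 1/4 * K" by (simp add: K_def)
    then show ?thesis using K by (simp add: pos_divide_le_eq)
  qed
  show ?thesis
  proof (rule exI[of _ \<delta>], rule conjI[OF \<delta>(1)], intro allI impI)
    fix \<kappa> :: real assume \<kappa>: "0 < \<kappa>"
    \<comment> \<open>Makes the two contributions of the high frequencies together at most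
      \<open>\<kappa> / 4\<close>.\<close>
    define L where "L = 1 + 4 * (16 * H^3 + 4 * H\<^sup>2) / \<kappa>"
    have L: "1 \<le> L" using H0 \<kappa> by (simp add: L_def)
    have Lk: "16 * H^3 / L + 4 * H\<^sup>2 / L\<^sup>2 \<le> \<kappa> / 4"
    proof -
      have "4 * H\<^sup>2 / L\<^sup>2 \<le> 4 * H\<^sup>2 / L"
        using L mult_left_mono[of 1 L L] by (intro divide_left_mono) (auto simp: power2_eq_square)
      then have "16 * H^3 / L + 4 * H\<^sup>2 / L\<^sup>2 \<le> (16 * H^3 + 4 * H\<^sup>2) / L" by (simp add: add_divide_distrib)
      also have "\<dots> \<le> \<kappa> / 4"
      proof -
        have "16 * H^3 + 4 * H\<^sup>2 = \<kappa> / 4 * (L - 1)" using \<kappa> by (simp add: L_def)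
        also have "\<dots> \<le> \<kappa> / 4 * L" using \<kappa> by (intro mult_left_mono) auto
        finally show ?thesis using L by (simp add: pos_divide_le_eq)
      qed
      finally show ?thesis .
    qed
    \<comment> \<open>All terms with \<open>\<epsilon>\<close>, evaluated at the largest possible
      values \<open>y = 2 * H\<close> and \<open>S = 4 * H^2\<close>; here
      \<open>272 = 256 + 16\<close>.\<close>
    define C where "C = L^5 * (272 * H^3 + 4 * H\<^sup>2)"
    have C: "0 \<le> C" using L H0 by (simp add: C_def)
    define \<rho> where "\<rho> = \<kappa> / (4 * (C + 1))"
    have \<rho>: "0 < \<rho>" using \<kappa> C by (simp add: \<rho>_def)
    have \<rho>C: "\<rho> * C \<le> \<kappa> / 4"
    proof -
      have "\<rho> * C \<le> \<rho> * (C + 1)" using \<rho> by (intro mult_left_mono) auto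
      also have "\<rho> * (C + 1) = \<kappa> / 4"
      proof -
        have "C + 1 \<noteq> 0" using C by simp
        moreover have "x / (4 * e) * e = x / 4" if "e \<noteq> 0" for x e :: real using that by simp
        ultimately show ?thesis unfolding \<rho>_def by blast
      qed
      finally show ?thesis .
    qed
    show "\<exists>\<rho>>0. \<forall>\<epsilon> a b d. fsol \<epsilon> a \<longrightarrow> fsol 0 b \<longrightarrow> 0 \<le> \<epsilon> \<longrightarrow> \<epsilon> \<le> \<rho> \<longrightarrow> 0 \<le> d \<longrightarrow> d \<le> \<delta> \<longrightarrow>
    (\<forall>\<tau>\<in>{0..d}. wb h1_weight (a \<tau>) H \<and> wb h1_weight (b \<tau>) H) \<longrightarrow>
    (\<forall>t\<in>{0..d}. (L2_norm (\<lambda>\<xi>. a t \<xi> - b t \<xi>))\<^sup>2 \<le> 2 * (L2_norm (\<lambda>\<xi>. a 0 \<xi> - b 0 \<xi>))\<^sup>2 + \<kappa>)"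
    proof (intro exI[of _ \<rho>] conjI allI impI ballI \<rho>)
      fix \<epsilon> a b d s
      assume a: "fsol \<epsilon> a" and b: "fsol 0 b" and \<epsilon>: "0 \<le> \<epsilon>" "\<epsilon> \<le> \<rho>" and d: "0 \<le> d" "d \<le> \<delta>"
        and h: "\<forall>\<tau>\<in>{0..d}. wb h1_weight (a \<tau>) H \<and> wb h1_weight (b \<tau>) H" and s: "s \<in> {0..d}"
      interpret A: fsol \<epsilon> a by (rule a)
      interpret B: fsol 0 b by (rule b)
      define D where "D \<tau> = (L2_norm (\<lambda>\<xi>. a \<tau> \<xi> - b \<tau> \<xi>))\<^sup>2" for \<tau>
      have DL: "D \<tau> = (LBINT \<xi>. (cmod (a \<tau> \<xi> - b \<tau> \<xi>))\<^sup>2)" for \<tau>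
        by (simp add: D_def L2_norm_def integral_nonneg_AE)
      have sq: "square_integrable (\<lambda>\<xi>. a \<tau> \<xi> - b \<tau> \<xi>)" "L2_norm (\<lambda>\<xi>. a \<tau> \<xi> - b \<tau> \<xi>) \<le> 2 * H" if "\<tau> \<in> {0..d}" for \<tau>
      proof -
        have "b2 (A.F \<tau>) H" "b2 (B.F \<tau>) H" using h that wb_h1D(1) by auto
        then have "square_integrable (a \<tau>)" "L2_norm (a \<tau>) \<le> H" "square_integrable (b \<tau>)" "L2_norm (b \<tau>) \<le> H"
          by (auto simp: square_integrable_b2 intro!: L2_norm_le_b2)
        then show "square_integrable (\<lambda>\<xi>. a \<tau> \<xi> - b \<tau> \<xi>)" "L2_norm (\<lambda>\<xi>. a \<tau> \<xi> - b \<tau> \<xi>) \<le> 2 * H"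
          using square_integrable_diff[of "a \<tau>" "b \<tau>"] by auto
      qed
      have DH: "D \<tau> \<le> (2 * H)\<^sup>2" if "\<tau> \<in> {0..d}" for \<tau>
        unfolding D_def by (intro power_mono sq that L2_norm_nonneg)
      have bdd: "bdd_above (D ` {0..d})"
        using DH by (intro bdd_aboveI[of _ "(2 * H)\<^sup>2"]) blast
      define S where "S = (SUP \<tau>\<in>{0..d}. D \<tau>)"
      have S: "D \<tau> \<le> S" if "\<tau> \<in> {0..d}" for \<tau> unfolding S_def by (rule cSUP_upper[OF that bdd])
      have S0: "0 \<le> S" using S[of 0] d by (simp add: D_def order_trans[OF zero_le_power2])
      have S4: "S \<le> (2 * H)\<^sup>2"
        unfolding S_def using d DH by (intro cSUP_least) auto
      define y where "y = sqrt S"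
      have yy: "y * y = S" "0 \<le> y" using S0 by (simp_all add: y_def)
      have yH: "y \<le> 2 * H" unfolding y_def using S4 H0 by (intro real_le_lsqrt) auto
      have step: "D t \<le> D 0 + S / 2 + \<kappa> / 2" if t: "t \<in> {0..d}" for t
      proof -
        have t1: "0 \<le> t" "t \<le> 1" "t \<le> \<delta>" using t d \<delta> by auto
        have ab: "wb h1_weight (a \<tau>) H" "wb h1_weight (b \<tau>) H" "b2 (\<lambda>\<xi>. enorm (a \<tau> \<xi> - b \<tau> \<xi>)) y"
          if "\<tau> \<in> {0..t}" for \<tau>
        proof -
          have \<tau>: "\<tau> \<in> {0..d}" using t that by auto
          show "wb h1_weight (a \<tau>) H" "wb h1_weight (b \<tau>) H" using h \<tau> by auto
          show "b2 (\<lambda>\<xi>. enorm (a \<tau> \<xi> - b \<tau> \<xi>)) y"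
          proof (rule b2_mono[OF b2_L2_norm[OF sq(1)[OF \<tau>]]])
            show "L2_norm (\<lambda>\<xi>. a \<tau> \<xi> - b \<tau> \<xi>) \<le> y"
              unfolding y_def using S[OF \<tau>] by (intro real_le_rsqrt) (simp add: D_def)
          qed auto
        qed
        interpret fsol_pair \<epsilon> a b t H K L y
          using t1(1) \<epsilon>(1) K L yH ab by unfold_locales
        have "D t \<le> D 0 + 2 * (t * (\<epsilon> * L^5 * (y * H))) + (NJ + t * (2 * H * (2 * H / L) * (4 * H))) + (2 * H / L)\<^sup>2"
          using difference_estimate unfolding DL w_def .
        also have "NJ = S * (t * M + 8 * H / K) + t * \<epsilon> * L^5 * (64 * H * S + 8 * H\<^sup>2 * y)"
          unfolding NJ_def M_def yy(1)[symmetric] by (simp add: algebra_simps power2_eq_square power_mult_distrib add_divide_distrib)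
        also have "t * (2 * H * (2 * H / L) * (4 * H)) = t * (16 * H^3 / L)"
          by (simp add: power3_eq_cube)
        also have "(2 * H / L)\<^sup>2 = 4 * H\<^sup>2 / L\<^sup>2" by (simp add: power_divide power_mult_distrib)
        finally have main: "D t \<le> D 0 + 2 * (t * (\<epsilon> * L^5 * (y * H))) + (S * (t * M + 8 * H / K) + t * \<epsilon> * L^5 * (64 * H * S + 8 * H\<^sup>2 * y)
          + t * (16 * H^3 / L)) + 4 * H\<^sup>2 / L\<^sup>2" .
        have "t * M \<le> \<delta> * M" using t1 M by (intro mult_right_mono) auto
        then have "t * M + 8 * H / K \<le> 1/2" using \<delta>M HK by linarith
        then have 1: "S * (t * M + 8 * H / K) \<le> S * (1/2)" using S0 by (intro mult_left_mono) auto
        have "t * (16 * H^3 / L) \<le> 1 * (16 * H^3 / L)" using t1 H0 L by (intro mult_right_mono) auto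
        then have 2: "t * (16 * H^3 / L) + 4 * H\<^sup>2 / L\<^sup>2 \<le> \<kappa> / 4" using Lk by simp
        have 3: "2 * (t * (\<epsilon> * L^5 * (y * H))) + t * \<epsilon> * L^5 * (64 * H * S + 8 * H\<^sup>2 * y) \<le> \<kappa> / 4"
        proof -
          have "2 * (t * (\<epsilon> * L^5 * (y * H))) + t * \<epsilon> * L^5 * (64 * H * S + 8 * H\<^sup>2 * y) = t * (\<epsilon> * (L^5 * (2 * H * y + 64 * H * S + 8 * H\<^sup>2 * y)))"
            by (simp add: algebra_simps)
          also have "\<dots> \<le> 1 * (\<rho> * (L^5 * (2 * H * (2 * H) + 64 * H * (2 * H)\<^sup>2 + 8 * H\<^sup>2 * (2 * H))))"
            using t1 \<epsilon> L H0 S0 yy(2) yH S4 by (intro mult_mono add_mono mult_left_mono mult_nonneg_nonneg add_nonneg_nonneg) auto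
          also have "\<dots> = \<rho> * C" by (simp add: C_def power2_eq_square power3_eq_cube)
          also note \<rho>C
          finally show ?thesis .
        qed
        show ?thesis using main 1 2 3 by linarith
      qed
      have "S \<le> D 0 + S / 2 + \<kappa> / 2" unfolding S_def using d step[unfolded S_def] by (intro cSUP_least) auto
      then show "(L2_norm (\<lambda>\<xi>. a s \<xi> - b s \<xi>))\<^sup>2 \<le> 2 * (L2_norm (\<lambda>\<xi>. a 0 \<xi> - b 0 \<xi>))\<^sup>2 + \<kappa>"
        using S[OF s] unfolding D_def by linarith
    qed
  qed
qed

section \<open>Convergence on the Fourier side\<close>

definition weighted :: "real \<Rightarrow> (real \<Rightarrow> complex) \<Rightarrow> real \<Rightarrow> complex" where
  "weighted s g \<xi> = of_real (bessel_symbol s \<xi>) * g \<xi>"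

definition insob :: "real \<Rightarrow> (real \<Rightarrow> complex) \<Rightarrow> bool" where
  "insob s g \<longleftrightarrow> g \<in> borel_measurable borel \<and> square_integrable (weighted s g)"

definition hn :: "real \<Rightarrow> (real \<Rightarrow> complex) \<Rightarrow> real" where
  "hn s g = L2_norm (weighted s g)"

definition Ws :: "real \<Rightarrow> real \<Rightarrow> real" where
  "Ws s \<xi> = (1 + \<xi>\<^sup>2) powr s"

lemma bessel_symbol_pos: "0 < bessel_symbol s \<xi>"
  unfolding bessel_symbol_def by (simp add: add_pos_nonneg less_imp_neq[symmetric])

lemma measurable_bessel[measurable]: "bessel_symbol s \<in> borel_measurable borel" "Ws s \<in> borel_measurable borel"
  unfolding bessel_symbol_def[abs_def] Ws_def[abs_def] by measurable

lemma bessel_sq: "(bessel_symbol s \<xi>)\<^sup>2 = Ws s \<xi>"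
  unfolding bessel_symbol_def Ws_def by (simp add: power2_eq_square flip: powr_add)

lemma Ws_nonneg[simp]: "0 \<le> Ws s \<xi>" by (simp add: Ws_def)

lemma Ws_1: "Ws 1 = h1_weight"
  by (rule ext) (simp add: Ws_def add_nonneg_nonneg)

lemma insob_measurable: "insob s g \<Longrightarrow> g \<in> borel_measurable borel" by (simp add: insob_def)

lemma hn_nonneg[simp]: "0 \<le> hn s g" by (simp add: hn_def)

lemma wnorm2_hn: "insob s g \<Longrightarrow> wnorm2 (Ws s) g = ennreal ((hn s g)\<^sup>2)"
  using nn_integral_L2_norm[of "weighted s g"]
  unfolding insob_def hn_def wnorm2_def weighted_def bessel_sq[symmetric]
  using bessel_symbol_pos[of s] by (simp add: norm_mult ennreal_mult power_mult_distrib ennreal_power less_imp_le)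

lemma insob_diff:
  assumes "insob s g" "insob s h"
  shows "insob s (\<lambda>\<xi>. g \<xi> - h \<xi>)"
  using assms square_integrable_diff(1)[of "weighted s g" "weighted s h"]
  by (auto simp: insob_def weighted_def[abs_def] right_diff_distrib)

lemma hn_reverse_triangle:
  assumes "insob s f" "insob s g"
  shows "\<bar>hn s f - hn s g\<bar> \<le> hn s (\<lambda>\<xi>. f \<xi> - g \<xi>)"
  using assms L2_norm_reverse_triangle[of "weighted s f" "weighted s g"]
  by (simp add: insob_def hn_def weighted_def[abs_def] right_diff_distrib)

lemma insob_mono:
  assumes "insob s g" "r \<le> s"
  shows "insob r g" "hn r g \<le> hn s g"
proof -
  have [measurable]: "g \<in> borel_measurable borel" using assms by (simp add: insob_def)
  have "bessel_symbol r \<xi> \<le> bessel_symbol s \<xi>" for \<xi>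
    unfolding bessel_symbol_def using assms(2) by (intro powr_mono) auto
  then have le: "cmod (weighted r g \<xi>) \<le> 1 * cmod (weighted s g \<xi>)" for \<xi>
    using bessel_symbol_pos[of r \<xi>] bessel_symbol_pos[of s \<xi>] by (simp add: weighted_def norm_mult mult_right_mono)
  have m: "weighted r g \<in> borel_measurable borel" unfolding weighted_def[abs_def] by measurable
  show "insob r g" "hn r g \<le> hn s g"
    using square_integrable_lift[OF _ m le] assms by (auto simp: insob_def hn_def)
qed

lemma wb_hn: "insob 1 g \<Longrightarrow> wb h1_weight g H \<longleftrightarrow> hn 1 g \<le> H"
proof -
  assume g: "insob 1 g"
  have [measurable]: "g \<in> borel_measurable borel" using g by (simp add: insob_def)
  have "wb h1_weight g H \<longleftrightarrow> 0 \<le> H \<and> wnorm2 h1_weight g \<le> ennreal (H\<^sup>2)"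
    by (rule wb_wnorm2) auto
  also have "wnorm2 h1_weight g = ennreal ((hn 1 g)\<^sup>2)" using wnorm2_hn[OF g] by (simp add: Ws_1)
  also have "0 \<le> H \<and> ennreal ((hn 1 g)\<^sup>2) \<le> ennreal (H\<^sup>2) \<longleftrightarrow> hn 1 g \<le> H"
    by (auto simp: ennreal_le_iff intro: power2_le_imp_le power_mono order_trans[OF hn_nonneg])
  finally show ?thesis .
qed

lemma hn_0:
  assumes "insob s g" "0 \<le> s"
  shows "L2_norm g \<le> hn s g"
proof -
  have "bessel_symbol 0 \<xi> = 1" for \<xi>
  proof -
    have "1 + \<xi>\<^sup>2 \<noteq> 0" by (smt (verit) zero_le_power2)
    then show ?thesis by (simp add: bessel_symbol_def)
  qed
  then have "hn 0 g = L2_norm g" by (simp add: hn_def weighted_def[abs_def])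
  then show ?thesis using insob_mono(2)[OF assms] by simp
qed

text \<open>The equation is autonomous, so every short step can be treated as starting at time
  0.\<close>

lemma fsol_shift:
  assumes "fsol \<epsilon> f" and t0: "0 \<le> t0"
  shows "fsol \<epsilon> (\<lambda>t. f (t0 + t))"
proof -
  interpret fsol \<epsilon> f by fact
  show ?thesis
  proof
    show "(\<lambda>(t, \<xi>). f (t0 + t) \<xi>) \<in> borel_measurable (borel \<Otimes>\<^sub>M borel)"
      unfolding split_beta' by measurable
    show "f (t0 + t) (- \<xi>) = cnj (f (t0 + t) \<xi>)" for t \<xi> by (rule reality)
    fix \<xi>
    have im: "(+) t0 ` {0..} \<subseteq> {0..}" using t0 by auto
    show "((\<lambda>t. f (t0 + t) \<xi>) has_vector_derivative \<i> * of_real (phase \<epsilon> \<xi>) * f (t0 + t) \<xi> + bil (f (t0 + t)) (f (t0 + t)) \<xi>) (at t within {0..})"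
      if "0 \<le> t" for t
    proof -
      have "((+) t0 has_vector_derivative 1) (at t within {0..})" by (auto intro!: derivative_eq_intros)
      moreover have "((\<lambda>t. f t \<xi>) has_vector_derivative \<i> * of_real (phase \<epsilon> \<xi>) * f (t0 + t) \<xi> + bil (f (t0 + t)) (f (t0 + t)) \<xi>) (at (t0 + t) within (+) t0 ` {0..})"
        by (rule has_vector_derivative_within_subset[OF deriv im]) (use that t0 in simp)
      ultimately show ?thesis using vector_diff_chain_within[of "(+) t0" 1 t "{0..}" "\<lambda>t. f t \<xi>"] by (simp add: o_def)
    qed
    show "continuous_on {0..} (\<lambda>t. bil (f (t0 + t)) (f (t0 + t)) \<xi>)"
      by (rule continuous_on_compose2[OF cont_bil]) (use t0 in \<open>auto intro!: continuous_intros\<close>)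
  qed
qed

definition hcont :: "real \<Rightarrow> (real \<Rightarrow> real \<Rightarrow> complex) \<Rightarrow> bool" where
  "hcont s f \<longleftrightarrow> (\<forall>t\<ge>0. insob s (f t)) \<and>
     (\<forall>t\<^sub>0\<ge>0. ((\<lambda>t. hn s (\<lambda>\<xi>. f t \<xi> - f t\<^sub>0 \<xi>)) \<longlongrightarrow> 0) (at t\<^sub>0 within {0..}))"

lemma hcont_shift:
  assumes "hcont s f" "0 \<le> t0"
  shows "hcont s (\<lambda>t. f (t0 + t))"
  unfolding hcont_def
proof (intro conjI allI impI)
  show "insob s (f (t0 + t))" if "0 \<le> t" for t using assms that by (simp add: hcont_def)
  fix t1 :: real assume t1: "0 \<le> t1"
  have "((\<lambda>t. hn s (\<lambda>\<xi>. f t \<xi> - f (t0 + t1) \<xi>)) \<longlongrightarrow> 0) (at (t0 + t1) within {0..})"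
    using assms t1 by (simp add: hcont_def)
  moreover have "filterlim ((+) t0) (at (t0 + t1) within {0..}) (at t1 within {0..})"
    unfolding filterlim_at using assms(2) by (auto simp: eventually_at_filter intro!: tendsto_intros always_eventually)
  ultimately show "((\<lambda>t. hn s (\<lambda>\<xi>. f (t0 + t) \<xi> - f (t0 + t1) \<xi>)) \<longlongrightarrow> 0) (at t1 within {0..})"
    by (rule filterlim_compose)
qed

lemma hcont_continuous:
  assumes f: "hcont s f" and r: "r \<le> s"
  shows "continuous_on {0..} (\<lambda>t. hn r (f t))"
  unfolding continuous_on_def
proof
  fix t0 :: real assume "t0 \<in> {0..}"
  then have t0: "0 \<le> t0" by simp
  have lim: "((\<lambda>t. hn s (\<lambda>\<xi>. f t \<xi> - f t0 \<xi>)) \<longlongrightarrow> 0) (at t0 within {0..})" using f t0 by (simp add: hcont_def)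
  show "((\<lambda>t. hn r (f t)) \<longlongrightarrow> hn r (f t0)) (at t0 within {0..})"
  proof (rule LIM_zero_cancel, rule Lim_null_comparison[OF _ lim])
    show "\<forall>\<^sub>F t in at t0 within {0..}. norm (hn r (f t) - hn r (f t0)) \<le> hn s (\<lambda>\<xi>. f t \<xi> - f t0 \<xi>)"
      unfolding eventually_at_filter
    proof (rule always_eventually, intro allI impI)
      fix t assume "t \<in> {0::real..}"
      then have i: "insob s (f t)" "insob s (f t0)" using f t0 by (auto simp: hcont_def)
      have "\<bar>hn r (f t) - hn r (f t0)\<bar> \<le> hn r (\<lambda>\<xi>. f t \<xi> - f t0 \<xi>)"
        by (intro hn_reverse_triangle insob_mono(1)[OF _ r] i)
      also have "\<dots> \<le> hn s (\<lambda>\<xi>. f t \<xi> - f t0 \<xi>)" by (intro insob_mono(2)[OF _ r] insob_diff i)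
      finally show "norm (hn r (f t) - hn r (f t0)) \<le> hn s (\<lambda>\<xi>. f t \<xi> - f t0 \<xi>)" by simp
    qed
  qed
qed

text \<open>At the first time where \<open>g\<close> equals \<open>3 * A\<close> the assumption of
  \<open>step\<close> holds up to and including that time, and \<open>step\<close> gives the
  contradictory value \<open>2 * A\<close>.\<close>

lemma continuity_argument:
  fixes g :: "real \<Rightarrow> real"
  assumes g: "continuous_on {0..d} g" and g0: "g 0 \<le> A" and A: "0 < A"
    and step: "\<And>t. t \<in> {0..d} \<Longrightarrow> (\<And>\<tau>. \<tau> \<in> {0..t} \<Longrightarrow> g \<tau> \<le> 3 * A) \<Longrightarrow> g t \<le> 2 * A" and t: "t \<in> {0..d}"
  shows "g t \<le> 3 * A"
proof (rule ccontr)
  assume "\<not> g t \<le> 3 * A"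
  define S where "S = {\<tau> \<in> {0..d}. g \<tau> = 3 * A}"
  have IVT: "\<exists>\<sigma>. \<sigma> \<in> S \<and> \<sigma> \<le> \<tau>" if "\<tau> \<in> {0..d}" "3 * A \<le> g \<tau>" for \<tau>
    using IVT'[of g 0 "3 * A" \<tau>] that g0 A continuous_on_subset[OF g, of "{0..\<tau>}"] by (auto simp: S_def)
  have "S \<noteq> {}" using IVT[of t] t \<open>\<not> g t \<le> 3 * A\<close> by auto
  moreover have "compact S"
  proof -
    have "S = {0..d} \<inter> g -` {3 * A}" by (auto simp: S_def)
    then have "closed S" using continuous_closed_preimage[OF g closed_atLeastAtMost closed_singleton, of "3 * A"] by simp
    moreover have "bounded S" by (rule bounded_subset[of "{0..d}"]) (auto simp: S_def)
    ultimately show ?thesis by (simp add: compact_eq_bounded_closed)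
  qed
  ultimately obtain m where m: "m \<in> S" "\<And>\<tau>. \<tau> \<in> S \<Longrightarrow> m \<le> \<tau>"
    using compact_attains_inf[of S] by metis
  have "g \<tau> \<le> 3 * A" if "\<tau> \<in> {0..m}" for \<tau>
  proof (rule ccontr)
    assume n: "\<not> g \<tau> \<le> 3 * A"
    have "\<tau> \<in> {0..d}" using that m by (auto simp: S_def)
    then obtain \<sigma> where "\<sigma> \<in> S" "\<sigma> \<le> \<tau>" using IVT n by force
    then have "\<tau> = m" using m(2) that by force
    then show False using n m(1) by (simp add: S_def)
  qed
  then have "g m \<le> 2 * A" using step[of m] m by (auto simp: S_def)
  then show False using m A by (simp add: S_def)
qed

text \<open>Equal to \<open>Ws s\<close> beyond the frequency \<open>R\<close> and admissible uniformly in \<open>R\<close>: the a priori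
  estimate for this weight bounds the high frequencies of all solutions at once.\<close>

definition tail_weight :: "real \<Rightarrow> real \<Rightarrow> real \<Rightarrow> real" where
  "tail_weight s R \<xi> = min (Ws s \<xi>) (1 / (1 + R\<^sup>2) * Ws (s + 1) \<xi>)"

lemma adm_tail_weight:
  assumes "0 \<le> s" "2 * s + 2 \<le> real c"
  shows "adm c (tail_weight s R)"
proof -
  have "adm c (Ws s)" "adm c (Ws (s + 1))"
    unfolding Ws_def[abs_def] by (intro adm_bessel; use assms in simp)+
  then show ?thesis unfolding tail_weight_def[abs_def] by (intro adm_min adm_cmult) auto
qed

lemma tail_weight_le: "tail_weight s R \<xi> \<le> Ws s \<xi>" by (simp add: tail_weight_def)

lemma tail_weight_eq:
  assumes "\<bar>R\<bar> \<le> \<bar>\<xi>\<bar>" shows "tail_weight s R \<xi> = Ws s \<xi>"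
proof -
  have "R\<^sup>2 \<le> \<xi>\<^sup>2" using assms by (simp add: abs_le_square_iff)
  then have "(1 + R\<^sup>2) * Ws s \<xi> \<le> (1 + \<xi>\<^sup>2) * Ws s \<xi>" by (intro mult_right_mono) auto
  also have "\<dots> = Ws (s + 1) \<xi>" by (simp add: Ws_def powr_add add_nonneg_nonneg)
  finally have "Ws s \<xi> \<le> Ws (s + 1) \<xi> / (1 + R\<^sup>2)"
    by (intro mult_imp_le_div_pos) (auto simp: mult.commute add_pos_nonneg)
  then show ?thesis by (simp add: tail_weight_def)
qed

lemma measurable_tail_weight[measurable]: "tail_weight s R \<in> borel_measurable borel"
  unfolding tail_weight_def[abs_def] by measurable

lemma wnorm2_diff_le:
  assumes [measurable]: "W \<in> borel_measurable borel" "g \<in> borel_measurable borel" "h \<in> borel_measurable borel"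
  shows "wnorm2 W (\<lambda>\<xi>. g \<xi> - h \<xi>) \<le> 2 * wnorm2 W g + 2 * wnorm2 W h"
proof -
  have "wnorm2 W (\<lambda>\<xi>. g \<xi> - h \<xi>) \<le> (NN \<xi>. 2 * (ennreal (W \<xi>) * (enorm (g \<xi>))\<^sup>2) + 2 * (ennreal (W \<xi>) * (enorm (h \<xi>))\<^sup>2))"
    unfolding wnorm2_def
  proof (rule nn_integral_mono)
    fix \<xi>
    have "(cmod (g \<xi> - h \<xi>))\<^sup>2 \<le> (cmod (g \<xi>) + cmod (h \<xi>))\<^sup>2" by (intro power_mono norm_triangle_ineq4) auto
    also have "\<dots> \<le> 2 * (cmod (g \<xi>))\<^sup>2 + 2 * (cmod (h \<xi>))\<^sup>2"
      using zero_le_power2[of "cmod (g \<xi>) - cmod (h \<xi>)"] by (simp add: power2_eq_square algebra_simps)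
    finally have "(enorm (g \<xi> - h \<xi>))\<^sup>2 \<le> 2 * (enorm (g \<xi>))\<^sup>2 + 2 * (enorm (h \<xi>))\<^sup>2"
      by (simp add: ennreal_power ennreal_leI flip: ennreal_plus ennreal_mult ennreal_numeral)
    from mult_left_mono[OF this, of "ennreal (W \<xi>)"]
    show "ennreal (W \<xi>) * (enorm (g \<xi> - h \<xi>))\<^sup>2 \<le> 2 * (ennreal (W \<xi>) * (enorm (g \<xi>))\<^sup>2) + 2 * (ennreal (W \<xi>) * (enorm (h \<xi>))\<^sup>2)"
      by (simp add: distrib_left mult.left_commute)
  qed
  also have "\<dots> = 2 * wnorm2 W g + 2 * wnorm2 W h"
    unfolding wnorm2_def by (subst nn_integral_add) (auto simp: nn_integral_cmult)
  finally show ?thesis .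
qed

lemma tail_to_0:
  assumes "insob s g"
  shows "(\<lambda>n. wnorm2 (tail_weight s (real n)) g) \<longlonglongrightarrow> 0"
proof -
  have [measurable]: "g \<in> borel_measurable borel" using assms by (simp add: insob_def)
  have "(\<lambda>n. (NN \<xi>. ennreal (tail_weight s (real n) \<xi>) * (enorm (g \<xi>))\<^sup>2)) \<longlonglongrightarrow> integral\<^sup>N lborel (\<lambda>\<xi>::real. 0)"
  proof (rule nn_integral_dominated_convergence[where w="\<lambda>\<xi>. ennreal (Ws s \<xi>) * (enorm (g \<xi>))\<^sup>2"])
    show "(NN \<xi>. ennreal (Ws s \<xi>) * (enorm (g \<xi>))\<^sup>2) < \<infinity>"
      using wnorm2_hn[OF assms] by (simp add: wnorm2_def)
    show "AE \<xi> in lborel. ennreal (tail_weight s (real n) \<xi>) * (enorm (g \<xi>))\<^sup>2 \<le> ennreal (Ws s \<xi>) * (enorm (g \<xi>))\<^sup>2" for n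
      by (intro AE_I2 mult_right_mono ennreal_leI tail_weight_le) auto
    show "AE \<xi> in lborel. (\<lambda>n. ennreal (tail_weight s (real n) \<xi>) * (enorm (g \<xi>))\<^sup>2) \<longlonglongrightarrow> 0"
    proof (rule AE_I2)
      fix \<xi>
      have "filterlim (\<lambda>n. 1 + (real n)\<^sup>2) at_top sequentially"
        by (intro filterlim_tendsto_add_at_top[OF tendsto_const] filterlim_pow_at_top filterlim_real_sequentially) auto
      then have "(\<lambda>n. 1 / (1 + (real n)\<^sup>2) * Ws (s + 1) \<xi>) \<longlonglongrightarrow> 0 * Ws (s + 1) \<xi>"
        by (intro tendsto_mult tendsto_const tendsto_divide_0[OF tendsto_const] filterlim_at_top_imp_at_infinity)
      then have "(\<lambda>n. tail_weight s (real n) \<xi>) \<longlonglongrightarrow> min (Ws s \<xi>) 0"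
        unfolding tail_weight_def by (intro tendsto_min tendsto_const) simp
      then have "(\<lambda>n. ennreal (tail_weight s (real n) \<xi> * (cmod (g \<xi>))\<^sup>2)) \<longlonglongrightarrow> ennreal (min (Ws s \<xi>) 0 * (cmod (g \<xi>))\<^sup>2)"
        by (intro tendsto_ennrealI tendsto_intros)
      moreover have "min (Ws s \<xi>) 0 = 0" using Ws_nonneg[of s \<xi>] by (rule min_absorb2)
      ultimately show "(\<lambda>n. ennreal (tail_weight s (real n) \<xi>) * (enorm (g \<xi>))\<^sup>2) \<longlonglongrightarrow> 0"
        by (simp add: ennreal_power ennreal_mult'')
    qed
  qed measurable
  then show ?thesis by (simp add: wnorm2_def)
qed

text \<open>Below the frequency \<open>R\<close> the weight is at most
  \<open>(1 + R^2) powr s\<close>, and beyond it \<open>tail_weight\<close> equals the full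
  weight.\<close>

lemma hn_tail_split:
  assumes w: "insob s w" and s: "0 \<le> s" and R: "0 \<le> R"
  shows "ennreal ((hn s w)\<^sup>2) \<le> ennreal ((1 + R\<^sup>2) powr s * (L2_norm w)\<^sup>2) + wnorm2 (tail_weight s R) w"
proof -
  have [measurable]: "w \<in> borel_measurable borel" using w by (simp add: insob_def)
  have sq: "square_integrable w"
    using insob_mono(1)[OF w s] insob_measurable[OF w] bessel_sq[of 0]
    by (rule_tac square_integrable_lift(1)[of "weighted 0 w" _ 1])
       (auto simp: insob_def weighted_def bessel_symbol_def norm_mult add_pos_nonneg less_imp_neq[symmetric])
  have "wnorm2 (Ws s) w \<le> (NN \<xi>. ennreal ((1 + R\<^sup>2) powr s) * (enorm (w \<xi>))\<^sup>2 + ennreal (tail_weight s R \<xi>) * (enorm (w \<xi>))\<^sup>2)"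
    unfolding wnorm2_def
  proof (rule nn_integral_mono)
    fix \<xi>
    have t0: "0 \<le> tail_weight s R \<xi>" by (simp add: tail_weight_def add_nonneg_nonneg)
    have "Ws s \<xi> \<le> (1 + R\<^sup>2) powr s + tail_weight s R \<xi>"
    proof (cases "R \<le> \<bar>\<xi>\<bar>")
      case True
      then show ?thesis using tail_weight_eq[of R \<xi> s] R by simp
    next
      case False
      then have "\<xi>\<^sup>2 \<le> R\<^sup>2" using R by (simp add: abs_le_square_iff[symmetric])
      then have "Ws s \<xi> \<le> (1 + R\<^sup>2) powr s" unfolding Ws_def using s by (intro powr_mono2) auto
      then show ?thesis using t0 by simp
    qed
    then have "ennreal (Ws s \<xi>) \<le> ennreal ((1 + R\<^sup>2) powr s) + ennreal (tail_weight s R \<xi>)"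
      using t0 by (simp add: ennreal_leI flip: ennreal_plus)
    from mult_right_mono[OF this, of "(enorm (w \<xi>))\<^sup>2"]
    show "ennreal (Ws s \<xi>) * (enorm (w \<xi>))\<^sup>2 \<le> ennreal ((1 + R\<^sup>2) powr s) * (enorm (w \<xi>))\<^sup>2 + ennreal (tail_weight s R \<xi>) * (enorm (w \<xi>))\<^sup>2"
      by (simp add: distrib_right)
  qed
  also have "\<dots> = ennreal ((1 + R\<^sup>2) powr s) * (NN \<xi>. (enorm (w \<xi>))\<^sup>2) + wnorm2 (tail_weight s R) w"
    unfolding wnorm2_def by (subst nn_integral_add) (auto simp: nn_integral_cmult)
  also have "\<dots> = ennreal ((1 + R\<^sup>2) powr s * (L2_norm w)\<^sup>2) + wnorm2 (tail_weight s R) w"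
    using nn_integral_L2_norm[OF sq] by (simp add: ennreal_mult)
  finally show ?thesis using wnorm2_hn[OF w] by simp
qed

text \<open>The a priori bound for the weight \<open>Ws 1\<close> doubles the squared norm at most;
  as \<open>sqrt 2 * A\<close> is below \<open>2 * A\<close>, the provisional bound
  \<open>3 * A\<close> improves itself.\<close>

lemma h1_bootstrap:
  assumes f: "fsol \<epsilon> f" and hc: "hcont s f" and s: "1 \<le> s" and d: "0 \<le> d" and A: "0 < A" and f0: "hn 1 (f 0) \<le> A"
    and ap: "\<And>t W. 0 \<le> t \<Longrightarrow> t \<le> d \<Longrightarrow> \<forall>\<tau>\<in>{0..t}. wb h1_weight (f \<tau>) (3 * A) \<Longrightarrow> adm c W \<Longrightarrow> wnorm2 W (f t) \<le> 2 * wnorm2 W (f 0)"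
    and c: "2 \<le> c" and t: "t \<in> {0..d}"
  shows "hn 1 (f t) \<le> 3 * A"
proof (rule continuity_argument[of d "\<lambda>t. hn 1 (f t)" A])
  show "continuous_on {0..d} (\<lambda>t. hn 1 (f t))" by (rule continuous_on_subset[OF hcont_continuous[OF hc s]]) auto
  fix t assume t: "t \<in> {0..d}" and le: "\<And>\<tau>. \<tau> \<in> {0..t} \<Longrightarrow> hn 1 (f \<tau>) \<le> 3 * A"
  have ins: "insob 1 (f \<tau>)" if "0 \<le> \<tau>" for \<tau> using hc that s by (auto simp: hcont_def intro: insob_mono(1))
  have "adm c (Ws 1)" using adm_bessel[of 1 c] c by (simp add: Ws_def[abs_def])
  then have "wnorm2 (Ws 1) (f t) \<le> 2 * wnorm2 (Ws 1) (f 0)" using le wb_hn ins t by (intro ap) auto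
  then have "ennreal ((hn 1 (f t))\<^sup>2) \<le> 2 * ennreal ((hn 1 (f 0))\<^sup>2)" using wnorm2_hn ins t by simp
  also have "\<dots> = ennreal (2 * (hn 1 (f 0))\<^sup>2)" by (simp add: ennreal_mult)
  finally have "(hn 1 (f t))\<^sup>2 \<le> 2 * (hn 1 (f 0))\<^sup>2" by (simp add: ennreal_le_iff)
  also have "\<dots> \<le> 2 * A\<^sup>2" using f0 by (intro mult_left_mono power_mono) auto
  also have "\<dots> \<le> (2 * A)\<^sup>2" by (simp add: power_mult_distrib)
  finally show "hn 1 (f t) \<le> 2 * A" using A by (intro power2_le_imp_le[of "hn 1 (f t)" "2 * A"]) auto
qed (use f0 A t in auto)

lemma wnorm2_minus_commute: "wnorm2 W (\<lambda>\<xi>. g \<xi> - h \<xi>) = wnorm2 W (\<lambda>\<xi>. h \<xi> - g \<xi>)"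
  unfolding wnorm2_def by (simp add: norm_minus_commute)

lemma wnorm2_le_diff:
  assumes [measurable]: "W \<in> borel_measurable borel" "g \<in> borel_measurable borel" "h \<in> borel_measurable borel"
  shows "wnorm2 W g \<le> 2 * wnorm2 W h + 2 * wnorm2 W (\<lambda>\<xi>. g \<xi> - h \<xi>)"
  using wnorm2_diff_le[of W h "\<lambda>\<xi>. h \<xi> - g \<xi>"] wnorm2_minus_commute[of W g h] by simp

text \<open>Only the tail of the fixed datum \<open>b0\<close> has to be small: that of
  \<open>a0\<close> differs from it by at most the distance \<open>h\<close>. Each tail is doubled
  by the a priori estimate and again by the triangle inequality for squares, which gives
  \<open>8 * q + 4 * q\<close> and \<open>8 * h^2\<close>.\<close>

lemma difference_tail_bound:
  assumes s: "0 \<le> s" and R: "0 \<le> R" and ins: "insob s a" "insob s b" "insob s a0" "insob s b0"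
    and a: "wnorm2 (tail_weight s R) a \<le> 2 * wnorm2 (tail_weight s R) a0"
    and b: "wnorm2 (tail_weight s R) b \<le> 2 * wnorm2 (tail_weight s R) b0"
    and L: "(L2_norm (\<lambda>\<xi>. a \<xi> - b \<xi>))\<^sup>2 \<le> 2 * (L2_norm (\<lambda>\<xi>. a0 \<xi> - b0 \<xi>))\<^sup>2 + \<kappa>"
    and h: "hn s (\<lambda>\<xi>. a0 \<xi> - b0 \<xi>) = h" and q: "wnorm2 (tail_weight s R) b0 \<le> ennreal q" "0 \<le> q"
  shows "(hn s (\<lambda>\<xi>. a \<xi> - b \<xi>))\<^sup>2 \<le> (2 * (1 + R\<^sup>2) powr s + 8) * h\<^sup>2 + (1 + R\<^sup>2) powr s * \<kappa> + 12 * q"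
proof -
  let ?w = "\<lambda>\<xi>. a0 \<xi> - b0 \<xi>"
  let ?d = "\<lambda>\<xi>. a \<xi> - b \<xi>"
  let ?W = "tail_weight s R" and ?M = "(1 + R\<^sup>2) powr s"
  note [measurable] = ins[THEN insob_measurable]
  have two: "2 * ennreal x = ennreal (2 * x)" for x by (simp add: ennreal_mult')
  have "wnorm2 ?W ?w \<le> wnorm2 (Ws s) ?w" by (intro wnorm2_mono tail_weight_le)
  then have d0: "wnorm2 ?W ?w \<le> ennreal (h\<^sup>2)" using wnorm2_hn[OF insob_diff[OF ins(3,4)]] h by simp
  have "wnorm2 ?W a0 \<le> 2 * wnorm2 ?W b0 + 2 * wnorm2 ?W ?w" by (rule wnorm2_le_diff) measurable
  also have "\<dots> \<le> 2 * ennreal q + 2 * ennreal (h\<^sup>2)" by (intro add_mono mult_left_mono q d0) auto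
  also have "\<dots> = ennreal (2 * q + 2 * h\<^sup>2)" using q by (simp add: ennreal_mult)
  finally have a0: "wnorm2 ?W a0 \<le> ennreal (2 * q + 2 * h\<^sup>2)" .
  have "wnorm2 ?W ?d \<le> 2 * wnorm2 ?W a + 2 * wnorm2 ?W b" by (rule wnorm2_diff_le) measurable
  also have "\<dots> \<le> 2 * (2 * wnorm2 ?W a0) + 2 * (2 * wnorm2 ?W b0)" by (intro add_mono mult_left_mono a b) auto
  also have "\<dots> \<le> 2 * (2 * ennreal (2 * q + 2 * h\<^sup>2)) + 2 * (2 * ennreal q)" by (intro add_mono mult_left_mono q a0) auto
  also have "\<dots> = ennreal (2 * (2 * (2 * q + 2 * h\<^sup>2)) + 2 * (2 * q))"
    unfolding two by (rule ennreal_plus[symmetric]) (use q in simp_all)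
  also have "2 * (2 * (2 * q + 2 * h\<^sup>2)) + 2 * (2 * q) = 12 * q + 8 * h\<^sup>2" by simp
  finally have w: "wnorm2 ?W ?d \<le> ennreal (12 * q + 8 * h\<^sup>2)" .
  have "ennreal ((hn s ?d)\<^sup>2) \<le> ennreal (?M * (L2_norm ?d)\<^sup>2) + wnorm2 ?W ?d"
    by (intro hn_tail_split insob_diff ins s R)
  also have "\<dots> \<le> ennreal (?M * (L2_norm ?d)\<^sup>2) + ennreal (12 * q + 8 * h\<^sup>2)" by (intro add_mono w order_refl)
  also have "\<dots> = ennreal (?M * (L2_norm ?d)\<^sup>2 + (12 * q + 8 * h\<^sup>2))" using q by simp
  finally have 1: "(hn s ?d)\<^sup>2 \<le> ?M * (L2_norm ?d)\<^sup>2 + (12 * q + 8 * h\<^sup>2)"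
    by (rule iffD1[OF ennreal_le_iff, rotated]) (use q in auto)
  have "(L2_norm ?w)\<^sup>2 \<le> h\<^sup>2"
    using hn_0[OF insob_diff[OF ins(3,4)] s] h by (intro power_mono) (auto simp: L2_norm_def)
  then have "(L2_norm ?d)\<^sup>2 \<le> 2 * h\<^sup>2 + \<kappa>" using L by linarith
  then have "?M * (L2_norm ?d)\<^sup>2 \<le> ?M * (2 * h\<^sup>2 + \<kappa>)" by (intro mult_left_mono) auto
  with 1 show ?thesis by (simp add: algebra_simps)
qed

section \<open>Convergence on a short interval and its iteration\<close>

definition hclose :: "real \<Rightarrow> (nat \<Rightarrow> real \<Rightarrow> real \<Rightarrow> complex) \<Rightarrow> (real \<Rightarrow> real \<Rightarrow> complex) \<Rightarrow> nat \<Rightarrow> real \<Rightarrow> real" where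
  "hclose s a b n t = hn s (\<lambda>\<xi>. a n t \<xi> - b t \<xi>)"

text \<open>The step length depends only on the \<open>H^1\<close> bound \<open>A\<close> of the
  limit, so it can be used repeatedly. For a given accuracy the choices are made in the order
  \<open>q\<close>, \<open>R\<close>, \<open>\<kappa>\<close>, \<open>\<rho>\<close>: first the
  frequency beyond which the tail of \<open>b 0\<close> is small, then the \<open>L^2\<close>
  accuracy needed below it.\<close>

lemma local_convergence:
  assumes s: "1 \<le> s" and A: "0 < A"
  shows "\<exists>\<delta>>0. \<forall>a b \<epsilon> d. (\<forall>n. fsol (\<epsilon> n) (a n)) \<longrightarrow> fsol 0 b \<longrightarrow> (\<forall>n. hcont s (a n)) \<longrightarrow> hcont s b \<longrightarrow>
    (\<forall>n. 0 \<le> \<epsilon> n) \<longrightarrow> \<epsilon> \<longlonglongrightarrow> 0 \<longrightarrow> 0 \<le> d \<longrightarrow> d \<le> \<delta> \<longrightarrow> (\<forall>t\<in>{0..d}. hn 1 (b t) \<le> A) \<longrightarrow>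
    (\<lambda>n. hclose s a b n 0) \<longlonglongrightarrow> 0 \<longrightarrow> uniform_limit {0..d} (hclose s a b) (\<lambda>_. 0) sequentially"
proof -
  \<comment> \<open>The 1 leaves room for the initial distance to \<open>b 0\<close>, which is
    eventually below 1; the factor 3 in \<open>H\<close> is the one of
    \<open>h1_bootstrap\<close>.\<close>
  define A' where "A' = A + 1"
  define H where "H = 3 * A'"
  have A': "0 < A'" and H: "0 \<le> H" using A by (auto simp: A'_def H_def)
  obtain c :: nat where c: "2 * s + 2 \<le> real c" using real_arch_simple by blast
  then have c2: "2 \<le> c" using s by linarith
  obtain \<delta>1 where d1: "0 < \<delta>1" and ap: "\<And>\<epsilon> f t W. fsol \<epsilon> f \<Longrightarrow> 0 \<le> \<epsilon> \<Longrightarrow> \<epsilon> \<le> 1 \<Longrightarrow> 0 \<le> t \<Longrightarrow> t \<le> \<delta>1 \<Longrightarrow>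
      \<forall>\<tau>\<in>{0..t}. wb h1_weight (f \<tau>) H \<Longrightarrow> adm c W \<Longrightarrow> wnorm2 W (f t) \<le> 2 * wnorm2 W (f 0)"
    using a_priori[OF H, of c] by metis
  obtain \<delta>2 where d2: "0 < \<delta>2" and ds: "\<forall>\<kappa>>0. \<exists>\<rho>>0. \<forall>\<epsilon> a b d. fsol \<epsilon> a \<longrightarrow> fsol 0 b \<longrightarrow> 0 \<le> \<epsilon> \<longrightarrow> \<epsilon> \<le> \<rho> \<longrightarrow> 0 \<le> d \<longrightarrow> d \<le> \<delta>2 \<longrightarrow>
      (\<forall>\<tau>\<in>{0..d}. wb h1_weight (a \<tau>) H \<and> wb h1_weight (b \<tau>) H) \<longrightarrow>
      (\<forall>t\<in>{0..d}. (L2_norm (\<lambda>\<xi>. a t \<xi> - b t \<xi>))\<^sup>2 \<le> 2 * (L2_norm (\<lambda>\<xi>. a 0 \<xi> - b 0 \<xi>))\<^sup>2 + \<kappa>)"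
    using difference_small[OF H] by (elim exE conjE) (rule that)
  show ?thesis
  proof (rule exI[of _ "min \<delta>1 \<delta>2"], rule conjI, use d1 d2 in simp, intro allI impI)
    fix a :: "nat \<Rightarrow> real \<Rightarrow> real \<Rightarrow> complex" and b \<epsilon> d
    assume sol: "\<forall>n. fsol (\<epsilon> n) (a n)" "fsol 0 b" and hc: "\<forall>n. hcont s (a n)" "hcont s b"
      and e: "\<forall>n. 0 \<le> \<epsilon> n" "\<epsilon> \<longlonglongrightarrow> 0" and d: "0 \<le> d" "d \<le> min \<delta>1 \<delta>2" and bA: "\<forall>t\<in>{0..d}. hn 1 (b t) \<le> A"
      and lim: "(\<lambda>n. hclose s a b n 0) \<longlonglongrightarrow> 0"
    have ins: "insob s (a n t)" "insob s (b t)" if "0 \<le> t" for n t using hc that by (auto simp: hcont_def)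
    have ins1: "insob 1 (a n t)" "insob 1 (b t)" if "0 \<le> t" for n t using ins[OF that] s by (auto intro: insob_mono)
    show "uniform_limit {0..d} (hclose s a b) (\<lambda>_. 0) sequentially"
    proof (rule uniform_limitI)
      fix e0 :: real assume e0: "0 < e0"
      \<comment> \<open>Three contributions of at most \<open>e0^2 / 8\<close> are aimed at; this
        one enters as \<open>12 * q\<close>.\<close>
      define q where "q = e0\<^sup>2 / 96"
      have q: "0 < q" using e0 by (simp add: q_def)
      have "(\<lambda>n. wnorm2 (tail_weight s (real n)) (b 0)) \<longlonglongrightarrow> 0" by (rule tail_to_0[OF ins(2)]) simp
      then have "\<forall>\<^sub>F n in sequentially. wnorm2 (tail_weight s (real n)) (b 0) < ennreal q" by (rule order_tendstoD) (use q in simp)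
      then obtain N where "wnorm2 (tail_weight s (real N)) (b 0) < ennreal q" by (auto simp: eventually_sequentially)
      define R where "R = real N"
      have R: "0 \<le> R" "wnorm2 (tail_weight s R) (b 0) \<le> ennreal q" using \<open>_ < ennreal q\<close> by (auto simp: R_def)
      define M where "M = (1 + R\<^sup>2) powr s"
      have "1 + R\<^sup>2 \<noteq> 0" by (smt (verit) zero_le_power2)
      then have M: "0 < M" by (simp add: M_def)
      define \<kappa> where "\<kappa> = e0\<^sup>2 / (8 * M)"
      have k: "0 < \<kappa>" using M e0 by (simp add: \<kappa>_def)
      have "\<exists>\<rho>>0. \<forall>\<epsilon> a b d. fsol \<epsilon> a \<longrightarrow> fsol 0 b \<longrightarrow> 0 \<le> \<epsilon> \<longrightarrow> \<epsilon> \<le> \<rho> \<longrightarrow> 0 \<le> d \<longrightarrow> d \<le> \<delta>2 \<longrightarrow>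
          (\<forall>\<tau>\<in>{0..d}. wb h1_weight (a \<tau>) H \<and> wb h1_weight (b \<tau>) H) \<longrightarrow>
          (\<forall>t\<in>{0..d}. (L2_norm (\<lambda>\<xi>. a t \<xi> - b t \<xi>))\<^sup>2 \<le> 2 * (L2_norm (\<lambda>\<xi>. a 0 \<xi> - b 0 \<xi>))\<^sup>2 + \<kappa>)"
        using ds[rule_format, OF k] .
      then obtain \<rho> where rho: "0 < \<rho>" and dr: "\<forall>\<epsilon> a b d. fsol \<epsilon> a \<longrightarrow> fsol 0 b \<longrightarrow> 0 \<le> \<epsilon> \<longrightarrow> \<epsilon> \<le> \<rho> \<longrightarrow> 0 \<le> d \<longrightarrow> d \<le> \<delta>2 \<longrightarrow>
          (\<forall>\<tau>\<in>{0..d}. wb h1_weight (a \<tau>) H \<and> wb h1_weight (b \<tau>) H) \<longrightarrow>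
          (\<forall>t\<in>{0..d}. (L2_norm (\<lambda>\<xi>. a t \<xi> - b t \<xi>))\<^sup>2 \<le> 2 * (L2_norm (\<lambda>\<xi>. a 0 \<xi> - b 0 \<xi>))\<^sup>2 + \<kappa>)"
        by (elim exE conjE) (rule that)
      have "(\<lambda>n. (2 * M + 8) * (hclose s a b n 0)\<^sup>2) \<longlonglongrightarrow> (2 * M + 8) * 0\<^sup>2" by (intro tendsto_intros lim)
      then have E1: "\<forall>\<^sub>F n in sequentially. (2 * M + 8) * (hclose s a b n 0)\<^sup>2 < e0\<^sup>2 / 8" by (rule order_tendstoD) (use e0 in simp)
      have E2: "\<forall>\<^sub>F n in sequentially. hclose s a b n 0 < 1" using lim by (rule order_tendstoD) simp
      have E3: "\<forall>\<^sub>F n in sequentially. \<epsilon> n < min 1 \<rho>" using e(2) by (rule order_tendstoD) (use rho in simp)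
      show "\<forall>\<^sub>F n in sequentially. \<forall>t\<in>{0..d}. dist (hclose s a b n t) 0 < e0"
        using E1 E2 E3
      proof eventually_elim
        case (elim n)
        have "hn 1 (\<lambda>\<xi>. a n 0 \<xi> - b 0 \<xi>) \<le> hclose s a b n 0" unfolding hclose_def by (intro insob_mono(2)[OF insob_diff] ins s order_refl)
        moreover have "\<bar>hn 1 (a n 0) - hn 1 (b 0)\<bar> \<le> hn 1 (\<lambda>\<xi>. a n 0 \<xi> - b 0 \<xi>)" by (intro hn_reverse_triangle ins1 order_refl)
        moreover have "hn 1 (b 0) \<le> A" using bA d by simp
        ultimately have a0: "hn 1 (a n 0) \<le> A'" using elim(2) by (simp add: A'_def)
        have ap': "wnorm2 W (a n t) \<le> 2 * wnorm2 W (a n 0)" if "0 \<le> t" "t \<le> d" "\<forall>\<tau>\<in>{0..t}. wb h1_weight (a n \<tau>) (3 * A')" "adm c W" for t W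
          by (rule ap[OF sol(1)[rule_format]]) (use sol e elim(3) that d in \<open>auto simp: H_def\<close>)
        have aH: "wb h1_weight (a n \<tau>) H" if "\<tau> \<in> {0..d}" for \<tau>
        proof -
          have "hn 1 (a n \<tau>) \<le> 3 * A'"
            by (rule h1_bootstrap[OF sol(1)[rule_format] hc(1)[rule_format] s d(1) A' a0 ap' c2 that])
          then show ?thesis using wb_hn[OF ins1(1)] that by (simp add: H_def)
        qed
        have bH: "wb h1_weight (b \<tau>) H" if "\<tau> \<in> {0..d}" for \<tau>
        proof -
          have "hn 1 (b \<tau>) \<le> H" using bA that A by (fastforce simp: H_def A'_def)
          then show ?thesis using wb_hn[OF ins1(2)] that by simp
        qed
        have adm: "adm c (tail_weight s R)" by (rule adm_tail_weight) (use s c in auto)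
        show ?case
        proof
          fix t assume t: "t \<in> {0..d}"
          have "(hn s (\<lambda>\<xi>. a n t \<xi> - b t \<xi>))\<^sup>2 \<le> (2 * M + 8) * (hclose s a b n 0)\<^sup>2 + M * \<kappa> + 12 * q"
            unfolding M_def
          proof (rule difference_tail_bound)
            show "wnorm2 (tail_weight s R) (a n t) \<le> 2 * wnorm2 (tail_weight s R) (a n 0)"
              by (rule ap') (use t aH adm in \<open>auto simp: H_def\<close>)
            show "wnorm2 (tail_weight s R) (b t) \<le> 2 * wnorm2 (tail_weight s R) (b 0)"
              by (rule ap[OF sol(2)]) (use t d bH adm in auto)
            show "(L2_norm (\<lambda>\<xi>. a n t \<xi> - b t \<xi>))\<^sup>2 \<le> 2 * (L2_norm (\<lambda>\<xi>. a n 0 \<xi> - b 0 \<xi>))\<^sup>2 + \<kappa>"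
              by (rule dr[rule_format, OF sol(1)[rule_format] sol(2), of n d]) (use e elim(3) d t aH bH in auto)
          qed (use s R q k t ins in \<open>auto simp: hclose_def\<close>)
          also have "\<dots> < e0\<^sup>2 / 8 + e0\<^sup>2 / 8 + e0\<^sup>2 / 8"
          proof -
            have "M * \<kappa> = e0\<^sup>2 / 8" "12 * q = e0\<^sup>2 / 8" using M by (auto simp: \<kappa>_def q_def)
            then show ?thesis using elim(1) by linarith
          qed
          also have "\<dots> \<le> e0\<^sup>2" by simp
          finally have "hn s (\<lambda>\<xi>. a n t \<xi> - b t \<xi>) < e0" using e0 by (rule power2_less_imp_less[OF _ less_imp_le])
          then show "dist (hclose s a b n t) 0 < e0" by (simp add: hclose_def)
        qed
      qed
    qed
  qed
qed

lemma uniform_limit_Icc_join: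
  fixes g :: "nat \<Rightarrow> real \<Rightarrow> real"
  assumes "uniform_limit {0..r} g (\<lambda>_. 0) sequentially" "uniform_limit {0..d} (\<lambda>n t. g n (r + t)) (\<lambda>_. 0) sequentially"
  shows "uniform_limit {0..r + d} g (\<lambda>_. 0) sequentially"
proof (rule uniform_limitI)
  fix e :: real assume "0 < e"
  from uniform_limitD[OF assms(1) this] uniform_limitD[OF assms(2) this]
  show "\<forall>\<^sub>F n in sequentially. \<forall>t\<in>{0..r + d}. dist (g n t) 0 < e"
  proof eventually_elim
    case (elim n)
    show ?case
    proof
      fix t assume t: "t \<in> {0..r + d}"
      show "dist (g n t) 0 < e"
      proof (cases "t \<le> r")
        case False
        then have "t - r \<in> {0..d}" using t by auto
        with elim(2) have "dist (g n (r + (t - r))) 0 < e" by blast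
        then show ?thesis by simp
      qed (use elim t in auto)
    qed
  qed
qed

text \<open>The bound \<open>A\<close> comes from the limit on all of \<open>{0..T}\<close>, hence
  one step length serves throughout. The Kawahara solutions need no bound of their own: at the start
  of a step they are close to \<open>b\<close> by the previous step.\<close>

theorem fourier_side_convergence:
  assumes s: "1 \<le> s" and T: "0 \<le> T"
    and sol: "\<And>n. fsol (\<epsilon> n) (a n)" "fsol 0 b" and hc: "\<And>n. hcont s (a n)" "hcont s b"
    and e: "\<And>n. 0 \<le> \<epsilon> n" "\<epsilon> \<longlonglongrightarrow> 0" and lim: "(\<lambda>n. hclose s a b n 0) \<longlonglongrightarrow> 0"
  shows "uniform_limit {0..T} (hclose s a b) (\<lambda>_. 0) sequentially"
proof -
  have "compact ((\<lambda>t. hn 1 (b t)) ` {0..T})"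
    by (rule compact_continuous_image[OF continuous_on_subset[OF hcont_continuous[OF hc(2) s]]]) auto
  then obtain A0 where A0: "\<And>t. t \<in> {0..T} \<Longrightarrow> \<bar>hn 1 (b t)\<bar> \<le> A0"
    by (metis (no_types, lifting) bounded_iff compact_imp_bounded imageI real_norm_def)
  define A where "A = \<bar>A0\<bar> + 1"
  have A: "0 < A" by (simp add: A_def)
  have bA: "hn 1 (b t) \<le> A" if "t \<in> {0..T}" for t using A0[OF that] by (simp add: A_def)
  obtain \<delta> where d: "0 < \<delta>" and step: "\<And>a b \<epsilon> d. \<forall>n. fsol (\<epsilon> n) (a n) \<Longrightarrow> fsol 0 b \<Longrightarrow> \<forall>n. hcont s (a n) \<Longrightarrow> hcont s b \<Longrightarrow>
    \<forall>n. 0 \<le> \<epsilon> n \<Longrightarrow> \<epsilon> \<longlonglongrightarrow> 0 \<Longrightarrow> 0 \<le> d \<Longrightarrow> d \<le> \<delta> \<Longrightarrow> \<forall>t\<in>{0..d}. hn 1 (b t) \<le> A \<Longrightarrow>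
    (\<lambda>n. hclose s a b n 0) \<longlonglongrightarrow> 0 \<Longrightarrow> uniform_limit {0..d} (hclose s a b) (\<lambda>_. 0) sequentially"
    using local_convergence[OF s A] by metis
  have ind: "uniform_limit {0..min T (real k * \<delta>)} (hclose s a b) (\<lambda>_. 0) sequentially" for k
  proof (induction k)
    case 0
    have "{0..min T (real 0 * \<delta>)} = {0}" using T by (auto simp: min_def)
    then show ?case using lim by (simp add: uniform_limit_singleton)
  next
    case (Suc k)
    define r where "r = min T (real k * \<delta>)"
    define d where "d = min T (real (Suc k) * \<delta>) - r"
    have r: "0 \<le> r" "r \<le> T" using T d by (auto simp: r_def)
    have "real (Suc k) * \<delta> = real k * \<delta> + \<delta>" by (simp add: distrib_right)
    then have d': "0 \<le> d" "d \<le> \<delta>" "r + d \<le> T" unfolding d_def r_def using d by linarith+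
    have "(\<lambda>n. hclose s a b n r) \<longlonglongrightarrow> 0" using tendsto_uniform_limitI[OF Suc.IH, of r] r by (simp add: r_def)
    then have lim_r: "(\<lambda>n. hclose s (\<lambda>n t. a n (r + t)) (\<lambda>t. b (r + t)) n 0) \<longlonglongrightarrow> 0" by (simp add: hclose_def)
    have "uniform_limit {0..d} (hclose s (\<lambda>n t. a n (r + t)) (\<lambda>t. b (r + t))) (\<lambda>_. 0) sequentially"
    proof (rule step[of \<epsilon>, OF _ _ _ _ _ e(2) d'(1,2) _ lim_r])
      show "\<forall>n. fsol (\<epsilon> n) (\<lambda>t. a n (r + t))" using fsol_shift[OF sol(1) r(1)] by simp
      show "fsol 0 (\<lambda>t. b (r + t))" by (rule fsol_shift[OF sol(2) r(1)])
      show "\<forall>n. hcont s (\<lambda>t. a n (r + t))" using hcont_shift[OF hc(1) r(1)] by simp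
      show "hcont s (\<lambda>t. b (r + t))" by (rule hcont_shift[OF hc(2) r(1)])
      show "\<forall>n. 0 \<le> \<epsilon> n" using e(1) by simp
      show "\<forall>t\<in>{0..d}. hn 1 (b (r + t)) \<le> A" using bA r d' by auto
    qed
    then have "uniform_limit {0..d} (\<lambda>n t. hclose s a b n (r + t)) (\<lambda>_. 0) sequentially" by (simp add: hclose_def[abs_def])
    with Suc.IH[folded r_def] have "uniform_limit {0..r + d} (hclose s a b) (\<lambda>_. 0) sequentially"
      by (rule uniform_limit_Icc_join[where g="hclose s a b" and r=r and d=d])
    then show ?case by (simp add: d_def)
  qed
  obtain k where "T < real k * \<delta>" using reals_Archimedean3[OF d] by metis
  then show ?thesis using ind[of k] by (simp add: min_def)
qed

section \<open>Test functions\<close>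

text \<open>A smooth function is represented by the sequence of its derivatives.\<close>

definition smooth_seq :: "(nat \<Rightarrow> real \<Rightarrow> real) \<Rightarrow> bool" where
  "smooth_seq d \<longleftrightarrow> (\<forall>k x. (d k has_real_derivative d (Suc k) x) (at x))"

lemma smooth_seqD: "smooth_seq d \<Longrightarrow> (d k has_real_derivative d (Suc k) x) (at x)"
  by (simp add: smooth_seq_def)

lemma smooth_seq_continuous: "smooth_seq d \<Longrightarrow> continuous_on S (d k)"
  by (meson DERIV_isCont continuous_at_imp_continuous_on smooth_seqD)

lemma smooth_seq_measurable: "smooth_seq d \<Longrightarrow> d k \<in> borel_measurable borel"
  by (intro borel_measurable_continuous_onI smooth_seq_continuous)

lemma smooth_seq_affine:
  assumes "smooth_seq d"
  shows "smooth_seq (\<lambda>k x. d k ((x - a) / r) / r ^ k)"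
  unfolding smooth_seq_def
proof (intro allI)
  fix k x
  have "((\<lambda>x. d k ((x - a) / r)) has_real_derivative d (Suc k) ((x - a) / r) * (1 / r)) (at x)"
    by (rule DERIV_chain'[OF _ smooth_seqD[OF assms]]) (cases "r = 0"; auto intro!: derivative_eq_intros)
  from DERIV_cdivide[OF this, of "r ^ k"]
  show "((\<lambda>x. d k ((x - a) / r) / r ^ k) has_real_derivative d (Suc k) ((x - a) / r) / r ^ Suc k) (at x)"
    by simp
qed

lemma smooth_seq_diff:
  assumes "smooth_seq d" "smooth_seq e"
  shows "smooth_seq (\<lambda>k x. d k x - e k x)"
  using assms unfolding smooth_seq_def by (auto intro: DERIV_diff)

lemma smooth_seq_support:
  assumes d: "smooth_seq d" and z: "\<And>x. r < \<bar>x\<bar> \<Longrightarrow> d 0 x = 0" and x: "r < \<bar>x\<bar>"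
  shows "d k x = 0"
  using x
proof (induction k arbitrary: x)
  case (Suc k)
  have "open {x. r < \<bar>x\<bar>}" by (intro open_Collect_less continuous_intros)
  then have "\<forall>\<^sub>F y in nhds x. d k y = 0"
    using Suc by (intro eventually_mono[OF eventually_nhds_in_open[of "{x. r < \<bar>x\<bar>}"]]) auto
  then have "(d k has_real_derivative 0) (at x) \<longleftrightarrow> ((\<lambda>_. 0::real) has_real_derivative 0) (at x)"
    by (intro DERIV_cong_ev) auto
  then show ?case using smooth_seqD[OF d, of k x] DERIV_unique by (metis DERIV_const)
qed (use z in auto)

definition tensor :: "(real \<Rightarrow> real) \<Rightarrow> (real \<Rightarrow> real) \<Rightarrow> real \<times> real \<Rightarrow> real" where
  "tensor f g = (\<lambda>(t, x). f t * g x)"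

lemma partial_tensor:
  assumes "smooth_seq d" "smooth_seq e"
  shows "partial_t (tensor (d i) (e j)) = tensor (d (Suc i)) (e j)"
    and "partial_x (tensor (d i) (e j)) = tensor (d i) (e (Suc j))"
proof -
  have "deriv (\<lambda>\<tau>. d i \<tau> * e j x) t = d (Suc i) t * e j x" for t x
    by (intro DERIV_imp_deriv DERIV_cmult_right smooth_seqD assms)
  then show "partial_t (tensor (d i) (e j)) = tensor (d (Suc i)) (e j)" by (auto simp: partial_t_def tensor_def)
  have "deriv (\<lambda>y. d i t * e j y) x = d i t * e (Suc j) x" for t x
    by (intro DERIV_imp_deriv DERIV_cmult smooth_seqD assms)
  then show "partial_x (tensor (d i) (e j)) = tensor (d i) (e (Suc j))" by (auto simp: partial_x_def tensor_def)
qed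

lemma partial_x_tensor_funpow:
  assumes "smooth_seq d" "smooth_seq e"
  shows "(partial_x ^^ n) (tensor (d i) (e j)) = tensor (d i) (e (n + j))"
  by (induction n) (simp_all add: partial_tensor[OF assms])

text \<open>Partial derivatives of a tensor product are again tensor products with shifted indices,
  so the induction runs over all \<open>i\<close> and \<open>j\<close> at once.\<close>

lemma C_k_tensor:
  assumes d: "smooth_seq d" and e: "smooth_seq e"
  shows "C_k n (tensor (d i) (e j))"
proof (induction n arbitrary: i j)
  case 0
  show ?case unfolding tensor_def split_beta'
    by (auto intro!: continuous_intros continuous_on_compose2[OF smooth_seq_continuous[OF d]] continuous_on_compose2[OF smooth_seq_continuous[OF e]])
next
  case (Suc n)
  have "d i differentiable at x" "e j differentiable at x" for x
    using smooth_seqD[OF d] smooth_seqD[OF e] unfolding real_differentiable_def by blast+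
  then have "(\<lambda>z. d i (fst z)) differentiable at z" "(\<lambda>z. e j (snd z)) differentiable at z" for z :: "real \<times> real"
    using differentiable_chain_at[of fst z "d i"] differentiable_chain_at[of snd z "e j"]
    by (auto simp: o_def bounded_linear_imp_differentiable bounded_linear_fst bounded_linear_snd)
  then have "tensor (d i) (e j) differentiable_on UNIV"
    unfolding tensor_def split_beta' differentiable_on_def by (auto intro: differentiable_mult)
  then show ?case using Suc by (simp add: partial_tensor[OF d e])
qed

lemma test_function_tensor:
  assumes d: "smooth_seq d" and e: "smooth_seq e"
    and sd: "\<And>t. q < \<bar>t\<bar> \<Longrightarrow> d 0 t = 0" and se: "\<And>x. r < \<bar>x\<bar> \<Longrightarrow> e 0 x = 0"
  shows "test_function (tensor (d 0) (e 0))"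
  unfolding test_function_def
proof (intro conjI allI C_k_tensor d e)
  have "{z. tensor (d 0) (e 0) z \<noteq> 0} \<subseteq> {-q..q} \<times> {-r..r}"
  proof
    fix z assume "z \<in> {z. tensor (d 0) (e 0) z \<noteq> 0}"
    then have "d 0 (fst z) \<noteq> 0" "e 0 (snd z) \<noteq> 0" by (auto simp: tensor_def split_beta)
    then have "\<bar>fst z\<bar> \<le> q" "\<bar>snd z\<bar> \<le> r" using sd se by (meson not_le)+
    then show "z \<in> {-q..q} \<times> {-r..r}" by (auto simp: mem_Times_iff abs_le_iff)
  qed
  then have "bounded {z. tensor (d 0) (e 0) z \<noteq> 0}"
    by (rule bounded_subset[rotated]) (intro bounded_Times bounded_closed_interval)
  then show "compact (closure {z. tensor (d 0) (e 0) z \<noteq> 0})" by (rule compact_closure[THEN iffD2])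
qed

text \<open>Glues a function to zero at a boundary point; for \<open>bump\<close> it treats the end
  points and the exterior of the unit interval alike.\<close>

lemma DERIV_quadratic:
  fixes g :: "real \<Rightarrow> real"
  assumes "\<And>x. \<bar>g x\<bar> \<le> C * (x - a)\<^sup>2"
  shows "(g has_real_derivative 0) (at a)"
  unfolding has_field_derivative_iff
proof (rule Lim_null_comparison)
  have "g a = 0" using assms[of a] by simp
  show "\<forall>\<^sub>F x in at a. norm ((g x - g a) / (x - a)) \<le> C * \<bar>x - a\<bar>"
    unfolding eventually_at_filter
  proof (rule always_eventually, intro allI impI)
    fix x assume x: "x \<noteq> a"
    have "\<bar>g x\<bar> \<le> C * \<bar>x - a\<bar> * \<bar>x - a\<bar>" using assms[of x] by (simp add: power2_eq_square)
    then have "\<bar>g x\<bar> / \<bar>x - a\<bar> \<le> C * \<bar>x - a\<bar>" using x by (subst pos_divide_le_eq) auto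
    then show "norm ((g x - g a) / (x - a)) \<le> C * \<bar>x - a\<bar>" using \<open>g a = 0\<close> by simp
  qed
  have "((\<lambda>x. C * \<bar>x - a\<bar>) \<longlongrightarrow> C * \<bar>a - a\<bar>) (at a)" by (intro tendsto_intros)
  then show "((\<lambda>x. C * \<bar>x - a\<bar>) \<longlongrightarrow> 0) (at a)" by simp
qed

text \<open>The inequality \<open>z <= exp z\<close> at \<open>z = 1 / (m * w)\<close>, inverted and
  raised to the power \<open>m\<close>.\<close>

lemma exp_minus_inverse_le:
  fixes w :: real
  assumes "0 < w" "0 < m"
  shows "exp (- (1 / w)) \<le> (real m * w) ^ m"
proof -
  have "1 / (real m * w) \<le> exp (1 / (real m * w))" using exp_ge_add_one_self[of "1 / (real m * w)"] by linarith
  then have "inverse (exp (1 / (real m * w))) \<le> inverse (1 / (real m * w))" using assms by (intro le_imp_inverse_le) auto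
  then have "exp (- (1 / (real m * w))) \<le> real m * w" by (simp add: exp_minus)
  then have "exp (- (1 / (real m * w))) ^ m \<le> (real m * w) ^ m" by (intro power_mono) auto
  moreover have "exp (- (1 / (real m * w))) ^ m = exp (- (1 / w))" using assms by (simp add: exp_of_nat_mult[symmetric])
  ultimately show ?thesis by simp
qed

section \<open>A bump function, a smooth step and a plateau\<close>

abbreviation bump_denom :: "real \<Rightarrow> real" where
  "bump_denom x \<equiv> x * (1 - x)"

text \<open>With \<open>w\<close> for \<open>[:0, 1, -1:]\<close> and \<open>w'\<close> for
  \<open>[:1, -2:]\<close>: differentiating \<open>p * exp (- 1 / w - 2 * k * ln w)\<close> gives
  \<open>p' + p * (w' / w^2 - 2 * k * w' / w)\<close> times the same exponential, and a factor
  \<open>w^(-2)\<close> is moved into the exponent for the next index.\<close>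

primrec bump_poly :: "nat \<Rightarrow> real poly" where
  "bump_poly 0 = 1"
| "bump_poly (Suc k) = pderiv (bump_poly k) * [:0, 1, -1:]\<^sup>2 + bump_poly k * [:1, -2:]
     - smult (2 * real k) (bump_poly k * [:1, -2:] * [:0, 1, -1:])"

text \<open>The derivatives of \<open>exp (- 1 / w)\<close>, \<open>w = x (1 - x)\<close>; the power \<open>w\<^sup>- \<^sup>2\<^sup>k\<close> is kept inside the exponential.\<close>

definition bump :: "nat \<Rightarrow> real \<Rightarrow> real" where
  "bump k x = (if 0 < x \<and> x < 1 then poly (bump_poly k) x * exp (- (1 / bump_denom x) - 2 * real k * ln (bump_denom x)) else 0)"

text \<open>The power \<open>m = 2 * k + 2\<close> compensates \<open>w^(- 2 * k)\<close> and leaves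
  \<open>w^2\<close>; finally \<open>w\<close> is at most \<open>x\<close> and at most
  \<open>1 - x\<close>.\<close>

lemma bump_quadratic:
  obtains C where "\<And>x. \<bar>bump k x\<bar> \<le> C * x\<^sup>2" "\<And>x. \<bar>bump k x\<bar> \<le> C * (x - 1)\<^sup>2"
proof -
  have "compact ((\<lambda>x. poly (bump_poly k) x) ` {0..1})" by (intro compact_continuous_image continuous_intros) auto
  then have "bounded ((\<lambda>x. poly (bump_poly k) x) ` {0..1})" by (rule compact_imp_bounded)
  then obtain B where "\<forall>y\<in>(\<lambda>x. poly (bump_poly k) x) ` {0..1}. norm y \<le> B" unfolding bounded_iff by blast
  then have B: "\<bar>poly (bump_poly k) x\<bar> \<le> B" if "0 \<le> x" "x \<le> 1" for x using that by auto
  define m where "m = 2 * k + 2"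
  define C where "C = B * real m ^ m"
  have B0: "0 \<le> B" using B[of 0] by linarith
  then have C0: "0 \<le> C" by (simp add: C_def)
  have *: "\<bar>bump k x\<bar> \<le> C * (bump_denom x)\<^sup>2" if x: "0 < x" "x < 1" for x
  proof -
    define w where "w = bump_denom x"
    have w: "0 < w" using x by (simp add: w_def)
    have "exp (- (1 / w) - 2 * real k * ln w) = exp (- (1 / w)) / w ^ (2 * k)"
      using w exp_of_nat_mult[of "2 * k" "ln w"] by (simp add: exp_diff)
    also have "\<dots> \<le> (real m * w) ^ m / w ^ (2 * k)" using w by (intro divide_right_mono exp_minus_inverse_le) (auto simp: m_def)
    also have "\<dots> = real m ^ m * w\<^sup>2" using w by (simp add: m_def power_mult_distrib power_add power2_eq_square)
    finally have "exp (- (1 / w) - 2 * real k * ln w) \<le> real m ^ m * w\<^sup>2" .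
    then have "\<bar>poly (bump_poly k) x\<bar> * exp (- (1 / w) - 2 * real k * ln w) \<le> B * (real m ^ m * w\<^sup>2)"
      using B0 x by (intro mult_mono B) auto
    then show ?thesis using x by (simp add: bump_def abs_mult C_def w_def mult.assoc)
  qed
  have "\<bar>bump k x\<bar> \<le> C * x\<^sup>2" "\<bar>bump k x\<bar> \<le> C * (x - 1)\<^sup>2" for x
  proof -
    show "\<bar>bump k x\<bar> \<le> C * x\<^sup>2"
    proof (cases "0 < x \<and> x < 1")
      case True
      then have "bump_denom x \<le> x" by (intro mult_left_le) auto
      then have "(bump_denom x)\<^sup>2 \<le> x\<^sup>2" using True by (intro power_mono) auto
      then show ?thesis using *[of x] True C0 by (meson mult_left_mono order_trans)
    qed (use C0 in \<open>auto simp: bump_def\<close>)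
    show "\<bar>bump k x\<bar> \<le> C * (x - 1)\<^sup>2"
    proof (cases "0 < x \<and> x < 1")
      case True
      then have "bump_denom x \<le> 1 - x" by (intro mult_left_le_one_le) auto
      then have "(bump_denom x)\<^sup>2 \<le> (1 - x)\<^sup>2" using True by (intro power_mono) auto
      then show ?thesis using *[of x] True C0 by (metis power2_commute mult_left_mono order_trans)
    qed (use C0 in \<open>auto simp: bump_def\<close>)
  qed
  then show thesis by (rule that)
qed

lemma smooth_bump: "smooth_seq bump"
  unfolding smooth_seq_def
proof (intro allI)
  fix k x
  obtain C where C: "\<And>x. \<bar>bump k x\<bar> \<le> C * x\<^sup>2" "\<And>x. \<bar>bump k x\<bar> \<le> C * (x - 1)\<^sup>2" 
    using bump_quadratic[of k] by metis
  have C0: "0 \<le> C" using C(1)[of 1] by simp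
  show "(bump k has_real_derivative bump (Suc k) x) (at x)"
  proof (cases "0 < x \<and> x < 1")
    case True
    define w where "w = bump_denom x"
    have w: "0 < w" using True by (simp add: w_def)
    have "((\<lambda>x. poly (bump_poly k) x * exp (- (1 / bump_denom x) - 2 * real k * ln (bump_denom x))) has_real_derivative
        (poly (pderiv (bump_poly k)) x + poly (bump_poly k) x * ((1 - 2 * x) / w\<^sup>2 - 2 * real k * ((1 - 2 * x) / w))) * exp (- (1 / w) - 2 * real k * ln w)) (at x)"
      unfolding w_def using True
      by (auto intro!: derivative_eq_intros simp: w_def power2_eq_square algebra_simps add_divide_distrib diff_divide_distrib)
    also have "exp (- (1 / w) - 2 * real k * ln w) = w\<^sup>2 * exp (- (1 / w) - 2 * real (Suc k) * ln w)"
    proof -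
      have "w\<^sup>2 = exp (2 * ln w)" using w exp_of_nat_mult[of 2 "ln w"] by simp
      then show ?thesis by (simp add: exp_add[symmetric] algebra_simps)
    qed
    also have "(poly (pderiv (bump_poly k)) x + poly (bump_poly k) x * ((1 - 2 * x) / w\<^sup>2 - 2 * real k * ((1 - 2 * x) / w))) *
        (w\<^sup>2 * exp (- (1 / w) - 2 * real (Suc k) * ln w)) = bump (Suc k) x"
    proof -
      have "(poly (pderiv (bump_poly k)) x + poly (bump_poly k) x * ((1 - 2 * x) / w\<^sup>2 - 2 * real k * ((1 - 2 * x) / w))) * w\<^sup>2
          = poly (pderiv (bump_poly k)) x * w\<^sup>2 + poly (bump_poly k) x * (1 - 2 * x) - 2 * real k * (poly (bump_poly k) x * (1 - 2 * x) * w)"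
        using w by (simp add: field_simps power2_eq_square)
      also have "\<dots> = poly (bump_poly (Suc k)) x" by (simp add: w_def algebra_simps)
      finally show ?thesis using True by (simp add: bump_def w_def flip: mult.assoc)
    qed
    finally have D: "((\<lambda>x. poly (bump_poly k) x * exp (- (1 / bump_denom x) - 2 * real k * ln (bump_denom x))) has_real_derivative bump (Suc k) x) (at x)" .
    have "\<forall>\<^sub>F y in nhds x. bump k y = poly (bump_poly k) y * exp (- (1 / bump_denom y) - 2 * real k * ln (bump_denom y))"
      using True by (intro eventually_mono[OF eventually_nhds_in_open[of "{0<..<1}"]]) (auto simp: bump_def)
    then show ?thesis using D by (subst DERIV_cong_ev[OF refl _ refl]) auto
  next
    case False
    \<comment> \<open>A point \<open>x\<close> outside the open unit interval is at least as far
      from an inner point \<open>y\<close> as one of the end points is, so the quadratic bound holds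
      around \<open>x\<close> too.\<close>
    have "\<bar>bump k y\<bar> \<le> C * (y - x)\<^sup>2" for y
    proof (cases "0 < y \<and> y < 1")
      case True
      consider "x \<le> 0" | "1 \<le> x" using False by linarith
      then show ?thesis
      proof cases
        case 1
        then have "y\<^sup>2 \<le> (y - x)\<^sup>2" using True by (intro power_mono) auto
        then show ?thesis using C(1)[of y] C0 by (meson mult_left_mono order_trans)
      next
        case 2
        then have "(1 - y)\<^sup>2 \<le> (x - y)\<^sup>2" using True by (intro power_mono) auto
        then show ?thesis using C(2)[of y] C0 by (metis power2_commute mult_left_mono order_trans)
      qed
    qed (use C0 in \<open>auto simp: bump_def\<close>)
    then have "(bump k has_real_derivative 0) (at x)" by (rule DERIV_quadratic)
    moreover have "bump (Suc k) x = 0" using False by (auto simp: bump_def)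
    ultimately show ?thesis by simp
  qed
qed

lemma bump_0_nonneg: "0 \<le> bump 0 x" by (simp add: bump_def)
lemma bump_0_pos: "0 < x \<Longrightarrow> x < 1 \<Longrightarrow> 0 < bump 0 x" by (simp add: bump_def)

lemma bump_outside: "x \<le> 0 \<or> 1 \<le> x \<Longrightarrow> bump k x = 0" by (auto simp: bump_def)


text \<open>The normalised primitive of \<open>bump 0\<close>. Its derivative
  \<open>\<sigma> 1\<close> is supported in the unit interval with total mass 1, so its rescalings
  form an approximate identity.\<close>

lemma smooth_step:
  obtains \<sigma> where "smooth_seq \<sigma>" "\<And>x. x \<le> 0 \<Longrightarrow> \<sigma> 0 x = 0" "\<And>x. 1 \<le> x \<Longrightarrow> \<sigma> 0 x = 1"
    "\<And>x. \<bar>\<sigma> 0 x\<bar> \<le> 1" "\<And>x. x \<notin> {0..1} \<Longrightarrow> \<sigma> 1 x = 0"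
proof -
  define F where "F x = (LBINT y=0..x. bump 0 y)" for x :: real
  have dF: "(F has_real_derivative bump 0 x) (at x)" for x
  proof -
    define a b where "a = min x 0 - 1" and "b = max x 0 + 1"
    have "((\<lambda>u. LBINT y=(0::real)..u. bump 0 y) has_vector_derivative bump 0 x) (at x within {a..b})"
      by (rule interval_integral_FTC2) (auto simp: a_def b_def intro: smooth_seq_continuous[OF smooth_bump])
    then have "(F has_vector_derivative bump 0 x) (at x within {a..b})" by (simp add: F_def[abs_def] zero_ereal_def)
    moreover have "at x within {a..b} = at x" by (rule at_within_Icc_at) (auto simp: a_def b_def)
    ultimately show ?thesis by (simp add: has_real_derivative_iff_has_vector_derivative)
  qed
  have F0: "F x = F 0" if "x \<le> 0" for x
  proof (cases "x = 0")
    case False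
    have "\<exists>z. x < z \<and> z < 0 \<and> F 0 - F x = (0 - x) * bump 0 z" using False that by (intro MVT2 dF) auto
    then show ?thesis by (auto simp: bump_outside)
  qed simp
  have F1: "F x = F 1" if "1 \<le> x" for x
  proof (cases "x = 1")
    case False
    have "\<exists>z. 1 < z \<and> z < x \<and> F x - F 1 = (x - 1) * bump 0 z" using False that by (intro MVT2 dF) auto
    then show ?thesis by (auto simp: bump_outside)
  qed simp
  have "F 0 < F 1"
    by (rule DERIV_pos_imp_increasing_open) (use dF bump_0_pos in \<open>auto intro: DERIV_isCont intro!: continuous_at_imp_continuous_on\<close>)
  moreover have "F 0 = 0" by (simp add: F_def zero_ereal_def[symmetric] flip: ereal_eq_0)
  ultimately have Fp: "0 < F 1" by simp
  define \<sigma> where "\<sigma> k x = (case k of 0 \<Rightarrow> F x | Suc j \<Rightarrow> bump j x) / F 1" for k x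
  have "(\<sigma> k has_real_derivative \<sigma> (Suc k) x) (at x)" for k x
  proof (cases k)
    case 0
    then show ?thesis using DERIV_cdivide[OF dF[of x], of "F 1"] by (simp add: \<sigma>_def[abs_def])
  next
    case (Suc j)
    then show ?thesis using DERIV_cdivide[OF smooth_seqD[OF smooth_bump, of j x], of "F 1"] by (simp add: \<sigma>_def[abs_def])
  qed
  then have "smooth_seq \<sigma>" by (simp add: smooth_seq_def)
  moreover have "\<sigma> 0 x = 0" if "x \<le> 0" for x using F0[OF that] \<open>F 0 = 0\<close> by (simp add: \<sigma>_def)
  moreover have "\<sigma> 0 x = 1" if "1 \<le> x" for x using F1[OF that] Fp by (simp add: \<sigma>_def)
  moreover have "\<bar>\<sigma> 0 x\<bar> \<le> 1" for x
  proof -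
    have mono: "F x \<le> F y" if "x \<le> y" for x y
      by (rule DERIV_nonneg_imp_nondecreasing[OF that]) (use dF bump_0_nonneg in blast)
    have "F 0 \<le> F x" using mono[of 0 x] F0[of x] by (cases "0 \<le> x") auto
    moreover have "F x \<le> F 1" using mono[of x 1] F1[of x] by (cases "x \<le> 1") auto
    ultimately show ?thesis using Fp \<open>F 0 = 0\<close> by (simp add: \<sigma>_def)
  qed
  moreover have "\<sigma> 1 x = 0" if "x \<notin> {0..1}" for x using that by (auto simp: \<sigma>_def bump_def)
  ultimately show thesis by (rule that)
qed

lemma smooth_plateau:
  obtains \<omega> where "smooth_seq \<omega>" "\<And>x. \<bar>x\<bar> \<le> 1 \<Longrightarrow> \<omega> 0 x = 1" "\<And>x. 2 < \<bar>x\<bar> \<Longrightarrow> \<omega> 0 x = 0"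
proof -
  obtain \<sigma> where \<sigma>: "smooth_seq \<sigma>" "\<And>x. x \<le> 0 \<Longrightarrow> \<sigma> 0 x = 0" "\<And>x. 1 \<le> x \<Longrightarrow> \<sigma> 0 x = 1"
    using smooth_step by metis
  \<comment> \<open>One step up on \<open>{-2..-1}\<close> and one down on \<open>{1..2}\<close>;
    the trivial divisions and powers match the form of \<open>smooth_seq_affine\<close>.\<close>
  define \<omega> where "\<omega> k x = \<sigma> k ((x - (-2)) / 1) / 1 ^ k - \<sigma> k ((x - 1) / 1) / 1 ^ k" for k x
  have "smooth_seq \<omega>" unfolding \<omega>_def[abs_def] by (intro smooth_seq_diff smooth_seq_affine \<sigma>(1))
  moreover have "\<omega> 0 x = 1" if "\<bar>x\<bar> \<le> 1" for x using \<sigma>(2)[of "x - 1"] \<sigma>(3)[of "x + 2"] that by (simp add: \<omega>_def)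
  moreover have "\<omega> 0 x = 0" if "2 < \<bar>x\<bar>" for x
    using \<sigma>(2)[of "x - 1"] \<sigma>(2)[of "x + 2"] \<sigma>(3)[of "x - 1"] \<sigma>(3)[of "x + 2"] that by (cases "0 \<le> x") (auto simp: \<omega>_def)
  ultimately show thesis by (rule that)
qed

lemma smooth_seq_bounded:
  assumes d: "smooth_seq d" and z: "\<And>x. r < \<bar>x\<bar> \<Longrightarrow> d 0 x = 0"
  obtains C where "0 \<le> C" "\<And>x. \<bar>d k x\<bar> \<le> C"
proof -
  have "compact (d k ` {-r..r})" by (intro compact_continuous_image smooth_seq_continuous d) auto
  then have "bounded (d k ` {-r..r})" by (rule compact_imp_bounded)
  then obtain B where B: "\<forall>y\<in>d k ` {-r..r}. norm y \<le> B" unfolding bounded_iff by blast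
  have "\<bar>d k x\<bar> \<le> \<bar>B\<bar>" for x
  proof (cases "r < \<bar>x\<bar>")
    case False
    then have "x \<in> {-r..r}" by auto
    then have "\<bar>d k x\<bar> \<le> B" using B by auto
    then show ?thesis by linarith
  qed (simp add: smooth_seq_support[OF d z])
  then show thesis by (intro that[of "\<bar>B\<bar>"]) auto
qed

lemma integrable_continuous_support:
  fixes g :: "real \<Rightarrow> 'a::{banach, second_countable_topology}"
  assumes g: "continuous_on UNIV g" and z: "\<And>x. x \<notin> {a..b} \<Longrightarrow> g x = 0"
  shows "integrable lborel g"
proof -
  have "integrable lborel (\<lambda>x. indicator {a..b} x *\<^sub>R g x)"
    by (rule borel_integrable_compact[OF compact_Icc continuous_on_subset[OF g]]) auto
  also have "(\<lambda>x. indicator {a..b} x *\<^sub>R g x) = g" using z by (auto simp: indicator_def fun_eq_iff)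
  finally show ?thesis .
qed

lemma mollified_limit:
  fixes g :: "real \<Rightarrow> real"
  assumes \<sigma>: "smooth_seq \<sigma>" "\<sigma> 0 0 = 0" "\<sigma> 0 1 = 1" and z: "\<And>x. x \<notin> {0..1} \<Longrightarrow> \<sigma> 1 x = 0"
    and g: "continuous_on UNIV g"
  shows "(\<lambda>n. LBINT t. \<sigma> 1 ((t - a) / (1 / real (Suc n))) / (1 / real (Suc n)) * g t) \<longlonglongrightarrow> g a"
proof -
  have cs: "continuous_on S (\<sigma> 1)" for S by (rule smooth_seq_continuous[OF \<sigma>(1)])
  have [measurable]: "\<sigma> 1 \<in> borel_measurable borel" by (rule smooth_seq_measurable[OF \<sigma>(1)])
  have [measurable]: "g \<in> borel_measurable borel" by (intro borel_measurable_continuous_onI g)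
  have isig: "integrable lborel (\<sigma> 1)" by (rule integrable_continuous_support[OF cs z])
  have "compact (g ` {a..a + 1})" by (intro compact_continuous_image continuous_on_subset[OF g]) auto
  then have "bounded (g ` {a..a + 1})" by (rule compact_imp_bounded)
  then obtain B where B: "\<forall>y\<in>g ` {a..a + 1}. norm y \<le> B" unfolding bounded_iff by blast
  have "(LBINT t. \<sigma> 1 ((t - a) / (1 / real (Suc n))) / (1 / real (Suc n)) * g t) = (LBINT y. \<sigma> 1 y * g (a + 1 / real (Suc n) * y))" for n
  proof -
    have "(LBINT t. \<sigma> 1 ((t - a) / (1 / real (Suc n))) / (1 / real (Suc n)) * g t)
      = \<bar>1 / real (Suc n)\<bar> *\<^sub>R (LBINT y. \<sigma> 1 ((a + 1 / real (Suc n) * y - a) / (1 / real (Suc n))) / (1 / real (Suc n)) * g (a + 1 / real (Suc n) * y))"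
      by (rule lborel_integral_real_affine) simp
    also have "\<dots> = (LBINT y. \<bar>1 / real (Suc n)\<bar> *\<^sub>R (\<sigma> 1 ((a + 1 / real (Suc n) * y - a) / (1 / real (Suc n))) / (1 / real (Suc n)) * g (a + 1 / real (Suc n) * y)))"
      by (rule integral_scaleR_right[symmetric])
    also have "\<dots> = (LBINT y. \<sigma> 1 y * g (a + 1 / real (Suc n) * y))"
      by (intro Bochner_Integration.integral_cong refl) (simp del: of_nat_Suc)
    finally show ?thesis .
  qed
  moreover have "(\<lambda>n. LBINT y. \<sigma> 1 y * g (a + 1 / real (Suc n) * y)) \<longlonglongrightarrow> (LBINT y. \<sigma> 1 y * g a)"
  proof (rule integral_dominated_convergence[where w="\<lambda>y. \<bar>\<sigma> 1 y\<bar> * B"])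
    show "integrable lborel (\<lambda>y. \<bar>\<sigma> 1 y\<bar> * B)" using isig by (intro integrable_mult_left) (simp add: integrable_abs)
    show "AE y in lborel. (\<lambda>n. \<sigma> 1 y * g (a + 1 / real (Suc n) * y)) \<longlonglongrightarrow> \<sigma> 1 y * g a"
    proof (rule AE_I2, rule tendsto_mult[OF tendsto_const])
      fix y
      have "(\<lambda>n. a + 1 / real (Suc n) * y) \<longlonglongrightarrow> a + 0 * y" by (intro tendsto_intros LIMSEQ_Suc[OF lim_1_over_n])
      then show "(\<lambda>n. g (a + 1 / real (Suc n) * y)) \<longlonglongrightarrow> g a"
        using g by (intro continuous_on_tendsto_compose[of UNIV g]) auto
    qed
    show "AE y in lborel. norm (\<sigma> 1 y * g (a + 1 / real (Suc n) * y)) \<le> \<bar>\<sigma> 1 y\<bar> * B" for n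
    proof (rule AE_I2)
      fix y
      show "norm (\<sigma> 1 y * g (a + 1 / real (Suc n) * y)) \<le> \<bar>\<sigma> 1 y\<bar> * B"
      proof (cases "y \<in> {0..1}")
        case True
        then have "1 / real (Suc n) * y \<le> 1 * 1" by (intro mult_mono) auto
        then have "norm (g (a + 1 / real (Suc n) * y)) \<le> B" using B True by auto
        then show ?thesis by (simp add: abs_mult mult_left_mono del: of_nat_Suc)
      qed (simp add: z del: One_nat_def)
    qed
  qed measurable
  moreover have "(LBINT y. \<sigma> 1 y * g a) = g a"
  proof -
    have "(LBINT y. \<sigma> 1 y) = (LBINT y. \<sigma> 1 y * indicator {0..1} y)"
      by (intro Bochner_Integration.integral_cong refl) (use z in \<open>auto simp: indicator_def\<close>)
    also have "\<dots> = \<sigma> 0 1 - \<sigma> 0 0"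
    proof (rule integral_FTC_Icc_real)
      show "DERIV (\<sigma> 0) x :> \<sigma> 1 x" for x using smooth_seqD[OF \<sigma>(1), of 0] by simp
      show "isCont (\<sigma> 1) x" for x using smooth_seqD[OF \<sigma>(1)] by (rule DERIV_isCont)
    qed simp
    finally show ?thesis using \<sigma> by simp
  qed
  ultimately show ?thesis by (simp only:)
qed

text \<open>The weak identity is tested with a smoothed indicator function of the interval, a
  difference of two steps of width \<open>r n\<close>. Its derivative is a difference of approximate
  identities at \<open>t1\<close> and \<open>t2\<close>, which evaluate the continuous function
  \<open>m\<close> there.\<close>

lemma weak_derivative_integral:
  fixes m b :: "real \<Rightarrow> real"
  assumes m: "continuous_on UNIV m" and b: "continuous_on UNIV b"
    and weak: "\<And>\<theta> q. smooth_seq \<theta> \<Longrightarrow> (\<And>t. q < \<bar>t\<bar> \<Longrightarrow> \<theta> 0 t = 0) \<Longrightarrow> (LBINT t. \<theta> 1 t * m t + \<theta> 0 t * b t) = 0"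
    and t: "t1 \<le> t2"
  shows "m t2 - m t1 = (LINT t:{t1..t2}|lborel. b t)"
proof -
  obtain \<sigma> where \<sigma>: "smooth_seq \<sigma>" "\<And>x. x \<le> 0 \<Longrightarrow> \<sigma> 0 x = 0" "\<And>x. 1 \<le> x \<Longrightarrow> \<sigma> 0 x = 1" "\<And>x. \<bar>\<sigma> 0 x\<bar> \<le> 1"
      "\<And>x. x \<notin> {0..1} \<Longrightarrow> \<sigma> 1 x = 0"
    using smooth_step by metis
  define r where "r n = 1 / real (Suc n)" for n
  have r: "0 < r n" "r n \<le> 1" for n by (auto simp: r_def)
  define \<theta> where "\<theta> n k t = \<sigma> k ((t - t1) / r n) / r n ^ k - \<sigma> k ((t - t2) / r n) / r n ^ k" for n k t
  have smooth: "smooth_seq (\<theta> n)" for n unfolding \<theta>_def[abs_def] by (intro smooth_seq_diff smooth_seq_affine \<sigma>(1))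
  have z0: "\<theta> n 0 x = 0" if "x \<notin> {t1..t2 + 1}" for n x
  proof (cases "x < t1")
    case True
    then show ?thesis using \<sigma>(2)[of "(x - t1) / r n"] \<sigma>(2)[of "(x - t2) / r n"] r[of n] t by (simp add: \<theta>_def divide_nonpos_pos)
  next
    case False
    then have "r n \<le> x - t1" "r n \<le> x - t2" using that t r[of n] by auto
    then show ?thesis using \<sigma>(3)[of "(x - t1) / r n"] \<sigma>(3)[of "(x - t2) / r n"] r[of n] by (simp add: \<theta>_def)
  qed
  have z0': "\<theta> n 0 x = 0" if "\<bar>t1\<bar> + \<bar>t2\<bar> + 1 < \<bar>x\<bar>" for n x by (rule z0) (use that in auto)
  note c = continuous_on_mult[OF smooth_seq_continuous[OF smooth]]
  have int0: "integrable lborel (\<lambda>t. \<theta> n 0 t * b t)" for n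
    by (rule integrable_continuous_support[OF c[OF b], where a=t1 and b="t2 + 1"]) (simp add: z0)
  have ms: "integrable lborel (\<lambda>t. \<sigma> 1 ((t - a) / r n) / r n * m t)" for n a
  proof (rule integrable_continuous_support[of _ a "a + 1"])
    show "continuous_on UNIV (\<lambda>t. \<sigma> 1 ((t - a) / r n) / r n * m t)"
      using r[of n] by (intro continuous_intros m continuous_on_compose2[OF smooth_seq_continuous[OF \<sigma>(1), of UNIV]]) auto
    fix x assume x: "x \<notin> {a..a + 1}"
    have "(x - a) / r n \<notin> {0..1}" using x r[of n] by (auto simp: zero_le_divide_iff)
    then show "\<sigma> 1 ((x - a) / r n) / r n * m x = 0" using \<sigma>(5) by simp
  qed
  have eq: "(LBINT t. \<theta> n 0 t * b t) = (LBINT t. \<sigma> 1 ((t - t2) / r n) / r n * m t) - (LBINT t. \<sigma> 1 ((t - t1) / r n) / r n * m t)" for n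
  proof -
    have th1: "(\<lambda>t. \<theta> n 1 t * m t) = (\<lambda>t. \<sigma> 1 ((t - t1) / r n) / r n * m t - \<sigma> 1 ((t - t2) / r n) / r n * m t)"
      by (simp add: \<theta>_def left_diff_distrib)
    have "integrable lborel (\<lambda>t. \<theta> n 1 t * m t)" unfolding th1 by (intro Bochner_Integration.integrable_diff ms)
    then have "(LBINT t. \<theta> n 1 t * m t) + (LBINT t. \<theta> n 0 t * b t) = 0"
      using weak[of "\<theta> n" "\<bar>t1\<bar> + \<bar>t2\<bar> + 1", OF smooth z0'] int0[of n] by simp
    moreover have "(LBINT t. \<theta> n 1 t * m t) = (LBINT t. \<sigma> 1 ((t - t1) / r n) / r n * m t) - (LBINT t. \<sigma> 1 ((t - t2) / r n) / r n * m t)"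
      unfolding th1 by (intro Bochner_Integration.integral_diff ms)
    ultimately show ?thesis by linarith
  qed
  have "(\<lambda>n. LBINT t. \<theta> n 0 t * b t) \<longlonglongrightarrow> m t2 - m t1"
    unfolding eq r_def using \<sigma> by (intro tendsto_diff mollified_limit m) auto
  moreover have "(\<lambda>n. LBINT t. \<theta> n 0 t * b t) \<longlonglongrightarrow> (LBINT t. indicator {t1<..t2} t * b t)"
  proof (rule integral_dominated_convergence[where w="\<lambda>t. 2 * (indicator {t1..t2 + 1} t * \<bar>b t\<bar>)"])
    have [measurable]: "b \<in> borel_measurable borel" by (intro borel_measurable_continuous_onI b)
    show "(\<lambda>t. indicator {t1<..t2} t * b t) \<in> borel_measurable lborel" by measurable
    show "(\<lambda>t. \<theta> n 0 t * b t) \<in> borel_measurable lborel" for n using int0[of n] by auto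
    have "integrable lborel (\<lambda>t. indicator {t1..t2 + 1} t *\<^sub>R \<bar>b t\<bar>)"
      by (rule borel_integrable_compact[OF compact_Icc]) (intro continuous_intros continuous_on_subset[OF b]; simp)
    then show "integrable lborel (\<lambda>t. 2 * (indicator {t1..t2 + 1} t * \<bar>b t\<bar>))" by simp
    show "AE t in lborel. norm (\<theta> n 0 t * b t) \<le> 2 * (indicator {t1..t2 + 1} t * \<bar>b t\<bar>)" for n
    proof (rule AE_I2)
      fix x
      have "\<bar>\<theta> n 0 x\<bar> \<le> 2" using \<sigma>(4)[of "(x - t1) / r n"] \<sigma>(4)[of "(x - t2) / r n"] by (simp add: \<theta>_def)
      then show "norm (\<theta> n 0 x * b x) \<le> 2 * (indicator {t1..t2 + 1} x * \<bar>b x\<bar>)"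
        using z0[of x n] by (cases "x \<in> {t1..t2 + 1}") (auto simp: abs_mult intro: mult_right_mono)
    qed
    show "AE t in lborel. (\<lambda>n. \<theta> n 0 t * b t) \<longlonglongrightarrow> indicator {t1<..t2} t * b t"
    proof (rule AE_I2, rule tendsto_mult[OF _ tendsto_const])
      fix x
      have step: "(\<lambda>n. \<sigma> 0 ((x - a) / r n)) \<longlonglongrightarrow> (if a < x then 1 else 0)" for a
      proof (cases "a < x")
        case True
        then obtain N where N: "1 / real (Suc N) < x - a" using nat_approx_posE[of "x - a"] by auto
        have "\<forall>n\<ge>N. \<sigma> 0 ((x - a) / r n) = 1"
        proof (intro allI impI \<sigma>(3))
          fix n assume "N \<le> n"
          then have "r n \<le> 1 / real (Suc N)" by (simp add: r_def frac_le)
          then show "1 \<le> (x - a) / r n" using N r[of n] by simp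
        qed
        then show ?thesis using True by (intro tendsto_eventually) (auto simp: eventually_sequentially)
      next
        case False
        then have "\<sigma> 0 ((x - a) / r n) = 0" for n using r[of n] by (intro \<sigma>(2)) (simp add: divide_nonpos_pos)
        then show ?thesis using False by simp
      qed
      have "(\<lambda>n. \<theta> n 0 x) \<longlonglongrightarrow> (if t1 < x then 1 else 0) - (if t2 < x then 1 else 0)"
        unfolding \<theta>_def using tendsto_diff[OF step[of t1] step[of t2]] by simp
      also have "(if t1 < x then 1 else 0) - (if t2 < x then 1 else 0) = (indicator {t1<..t2} x :: real)"
        using t by (auto simp: indicator_def)
      finally show "(\<lambda>n. \<theta> n 0 x) \<longlonglongrightarrow> indicator {t1<..t2} x" .
    qed
  qed
  ultimately have "m t2 - m t1 = (LBINT t. indicator {t1<..t2} t * b t)" by (rule LIMSEQ_unique)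
  also have "\<dots> = (LBINT t. indicator {t1..t2} t * b t)"
  proof (rule integral_cong_AE)
    have [measurable]: "b \<in> borel_measurable borel" by (intro borel_measurable_continuous_onI b)
    show "(\<lambda>t. indicator {t1<..t2} t * b t) \<in> borel_measurable lborel" "(\<lambda>t. indicator {t1..t2} t * b t) \<in> borel_measurable lborel"
      by measurable
    show "AE t in lborel. indicator {t1<..t2} t * b t = indicator {t1..t2} t * b t"
      using AE_lborel_singleton[of t1] by eventually_elim (auto simp: indicator_def)
  qed
  finally show ?thesis by (simp add: set_lebesgue_integral_def)
qed

section \<open>From the weak formulation to the Fourier side\<close>

text \<open>Pascal's rule makes this the sum of
  \<open>binomial k j * A j * z^(k - j)\<close>.\<close>

primrec leib :: "nat \<Rightarrow> (nat \<Rightarrow> complex) \<Rightarrow> complex \<Rightarrow> complex" where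
  "leib 0 A z = A 0"
| "leib (Suc k) A z = leib k (\<lambda>j. A (Suc j)) z + z * leib k A z"

lemma leib_zero: "(\<And>j. A j = 0) \<Longrightarrow> leib k A z = 0"
  by (induction k arbitrary: A) auto

lemma leib_deriv:
  assumes "\<And>j. ((\<lambda>x. A x j) has_vector_derivative A x (Suc j)) (at x)"
  shows "((\<lambda>x. leib k (A x) z) has_vector_derivative leib k (\<lambda>j. A x (Suc j)) z) (at x)"
  using assms
proof (induction k arbitrary: A)
  case (Suc k)
  have "((\<lambda>x. leib k (\<lambda>j. A x (Suc j)) z) has_vector_derivative leib k (\<lambda>j. A x (Suc (Suc j))) z) (at x)"
    by (rule Suc.IH) (rule Suc.prems)
  moreover have "((\<lambda>x. leib k (A x) z) has_vector_derivative leib k (\<lambda>j. A x (Suc j)) z) (at x)"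
    by (rule Suc.IH) (rule Suc.prems)
  then have "((\<lambda>x. z * leib k (A x) z) has_vector_derivative z * leib k (\<lambda>j. A x (Suc j)) z) (at x)"
    by (rule has_vector_derivative_mult_right)
  ultimately show ?case by (simp add: has_vector_derivative_add)
qed simp

lemma leib_le:
  assumes "\<And>j. j \<le> k \<Longrightarrow> cmod (A j) \<le> m"
  shows "cmod (leib k A z) \<le> (1 + cmod z) ^ k * m"
  using assms
proof (induction k arbitrary: A)
  case (Suc k)
  have "cmod (leib k (\<lambda>j. A (Suc j)) z) \<le> (1 + cmod z) ^ k * m" "cmod (leib k A z) \<le> (1 + cmod z) ^ k * m"
    by (rule Suc.IH; rule Suc.prems; simp)+
  then have "cmod (leib k (\<lambda>j. A (Suc j)) z + z * leib k A z) \<le> (1 + cmod z) ^ k * m + cmod z * ((1 + cmod z) ^ k * m)"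
    by (intro order_trans[OF norm_triangle_ineq] add_mono) (auto simp: norm_mult mult_left_mono)
  then show ?case by (simp add: algebra_simps)
qed simp

text \<open>Every term except \<open>z ^ k * A 0\<close> contains some \<open>A j\<close> with
  \<open>1 <= j\<close>, a derivative of the cutoff, which is small when the cutoff is wide.\<close>

lemma leib_approx:
  assumes "\<And>j. j \<le> k \<Longrightarrow> 1 \<le> j \<Longrightarrow> cmod (A j) \<le> m" and m: "0 \<le> m"
  shows "cmod (leib k A z - z ^ k * A 0) \<le> real k * (1 + cmod z) ^ k * m"
  using assms(1)
proof (induction k)
  case (Suc k)
  let ?c = "1 + cmod z"
  have 1: "cmod (leib k (\<lambda>j. A (Suc j)) z) \<le> ?c ^ k * m" by (rule leib_le) (simp add: Suc.prems)
  have "cmod (leib k A z - z ^ k * A 0) \<le> real k * ?c ^ k * m" by (rule Suc.IH) (simp add: Suc.prems)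
  then have 2: "cmod (z * (leib k A z - z ^ k * A 0)) \<le> cmod z * (real k * ?c ^ k * m)" by (simp add: norm_mult mult_left_mono)
  have eq: "leib (Suc k) A z - z ^ Suc k * A 0 = leib k (\<lambda>j. A (Suc j)) z + z * (leib k A z - z ^ k * A 0)"
    by (simp add: algebra_simps)
  have "cmod (leib (Suc k) A z - z ^ Suc k * A 0) \<le> ?c ^ k * m + cmod z * (real k * ?c ^ k * m)"
    unfolding eq by (intro order_trans[OF norm_triangle_ineq] add_mono 1 2)
  also have "\<dots> \<le> ?c ^ k * m + cmod z * (real k * ?c ^ k * m) + (cmod z * (?c ^ k * m) + real k * ?c ^ k * m)"
    using m by simp
  also have "\<dots> = real (Suc k) * ?c ^ Suc k * m" by (simp add: algebra_simps)
  finally show ?case .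
qed simp

text \<open>\<open>wave d \<xi> k\<close> is the \<open>k\<close>-th derivative of \<open>x \<mapsto> d 0 x * cis (- \<xi> x)\<close>; \<open>leib\<close> computes
  the Leibniz sum by recursion instead of with binomial coefficients.\<close>

definition wave :: "(nat \<Rightarrow> real \<Rightarrow> real) \<Rightarrow> real \<Rightarrow> nat \<Rightarrow> real \<Rightarrow> complex" where
  "wave d \<xi> k x = leib k (\<lambda>j. of_real (d j x)) (- (\<i> * of_real \<xi>)) * cis (- (\<xi> * x))"

lemma cis_linear_deriv:
  "((\<lambda>x. cis (a * x)) has_vector_derivative \<i> * of_real a * cis (a * x)) (at x within S)"
  unfolding has_vector_derivative_def
  by (auto intro!: derivative_eq_intros simp: scaleR_conv_of_real fun_eq_iff)

lemma wave_deriv: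
  assumes "smooth_seq d"
  shows "(wave d \<xi> k has_vector_derivative wave d \<xi> (Suc k) x) (at x)"
proof -
  let ?z = "- (\<i> * of_real \<xi>)"
  have "((\<lambda>x. complex_of_real (d j x)) has_vector_derivative of_real (d (Suc j) x)) (at x)" for j
    using smooth_seqD[OF assms] by (intro has_vector_derivative_of_real) (simp add: has_real_derivative_iff_has_vector_derivative)
  then have 1: "((\<lambda>x. leib k (\<lambda>j. of_real (d j x)) ?z) has_vector_derivative leib k (\<lambda>j. of_real (d (Suc j) x)) ?z) (at x)"
    by (rule leib_deriv)
  show ?thesis unfolding wave_def[abs_def]
    using has_vector_derivative_mult[OF 1 cis_linear_deriv[of "- \<xi>" x UNIV]] by (simp add: algebra_simps)
qed

lemma smooth_wave:
  assumes "smooth_seq d"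
  shows "smooth_seq (\<lambda>k x. Re (wave d \<xi> k x))" "smooth_seq (\<lambda>k x. Im (wave d \<xi> k x))"
  unfolding smooth_seq_def has_real_derivative_iff_has_vector_derivative
  using bounded_linear.has_vector_derivative[OF bounded_linear_Re wave_deriv[OF assms]]
    bounded_linear.has_vector_derivative[OF bounded_linear_Im wave_deriv[OF assms]] by auto

lemma wave_continuous: "smooth_seq d \<Longrightarrow> continuous_on S (wave d \<xi> k)"
  by (rule continuous_on_vector_derivative) (rule has_vector_derivative_at_within[OF wave_deriv])

lemma wave_support:
  assumes "smooth_seq d" "\<And>x. r < \<bar>x\<bar> \<Longrightarrow> d 0 x = 0" "r < \<bar>x\<bar>"
  shows "wave d \<xi> k x = 0"
  using smooth_seq_support[OF assms] by (simp add: wave_def leib_zero)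

lemma square_integrable_continuous_support:
  fixes k :: "real \<Rightarrow> complex"
  assumes k: "continuous_on UNIV k" and z: "\<And>x. r < \<bar>x\<bar> \<Longrightarrow> k x = 0"
  shows "square_integrable k"
proof -
  have "integrable lborel (\<lambda>x. (cmod (k x))\<^sup>2)"
    by (rule integrable_continuous_support[where a="-r" and b=r]) (use z in \<open>auto intro!: continuous_intros k\<close>)
  then show ?thesis using k by (simp add: square_integrable_def borel_measurable_continuous_onI)
qed

lemma bounded_continuous_support:
  fixes k :: "real \<Rightarrow> complex"
  assumes k: "continuous_on UNIV k" and z: "\<And>x. r < \<bar>x\<bar> \<Longrightarrow> k x = 0"
  shows "\<exists>C\<ge>0. \<forall>x. cmod (k x) \<le> C"
proof -
  have "compact (k ` {-r..r})" by (intro compact_continuous_image continuous_on_subset[OF k]) auto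
  then have "bounded (k ` {-r..r})" by (rule compact_imp_bounded)
  then obtain B where B: "\<forall>y\<in>k ` {-r..r}. norm y \<le> B" unfolding bounded_iff by blast
  have "cmod (k x) \<le> \<bar>B\<bar>" for x
  proof (cases "r < \<bar>x\<bar>")
    case False
    then have "x \<in> {-r..r}" by auto
    then have "cmod (k x) \<le> B" using B by auto
    then show ?thesis by linarith
  qed (simp add: z)
  then show ?thesis by (intro exI[of _ "\<bar>B\<bar>"]) auto
qed

text \<open>The square is integrable, so boundedness of the kernel is enough; the difference is
  estimated through \<open>(v - w) * (v + w)\<close>. The kernel enters only through its bound
  \<open>C\<close>, which makes the modulus of continuity uniform over frequencies.\<close>

lemma quadratic_pairing:
  assumes v: "square_integrable v" and w: "square_integrable w" and [measurable]: "k \<in> borel_measurable borel"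
    and k: "\<And>x. cmod (k x) \<le> C" "0 \<le> C"
  shows "integrable lborel (\<lambda>x. (v x)\<^sup>2 * k x)" "cmod (LBINT x. (v x)\<^sup>2 * k x) \<le> C * (L2_norm v)\<^sup>2"
    and "cmod ((LBINT x. (v x)\<^sup>2 * k x) - (LBINT x. (w x)\<^sup>2 * k x)) \<le> C * (L2_norm (\<lambda>x. v x - w x) * (L2_norm v + L2_norm w))"
proof -
  note [measurable] = square_integrable_measurable[OF v] square_integrable_measurable[OF w]
  have lift: "square_integrable (\<lambda>x. h x * k x)" "L2_norm (\<lambda>x. h x * k x) \<le> C * L2_norm h" if h: "square_integrable h" for h
  proof -
    note [measurable] = square_integrable_measurable[OF h]
    have "cmod (h x * k x) \<le> C * cmod (h x)" for x 
      using mult_left_mono[OF k(1)[of x], of "cmod (h x)"] by (simp add: norm_mult mult.commute)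
    then show "square_integrable (\<lambda>x. h x * k x)" "L2_norm (\<lambda>x. h x * k x) \<le> C * L2_norm h"
      by (intro square_integrable_lift[OF h _ _ k(2)]; simp)+
  qed
  have int: "integrable lborel (\<lambda>x. (h x)\<^sup>2 * k x)" if "square_integrable h" for h
    using square_integrable_mult(1)[OF that lift(1)[OF that]] by (simp add: power2_eq_square mult.assoc)
  then show i: "integrable lborel (\<lambda>x. (v x)\<^sup>2 * k x)" using v .
  have "cmod (LBINT x. v x * (v x * k x)) \<le> L2_norm v * (C * L2_norm v)"
    by (rule order_trans[OF square_integrable_mult(2)[OF v lift(1)[OF v]]]) (intro mult_left_mono lift(2) v; simp)
  then show "cmod (LBINT x. (v x)\<^sup>2 * k x) \<le> C * (L2_norm v)\<^sup>2"
    by (simp add: power2_eq_square mult.assoc mult.left_commute)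
  have "(LBINT x. (v x)\<^sup>2 * k x) - (LBINT x. (w x)\<^sup>2 * k x) = (LBINT x. (v x)\<^sup>2 * k x - (w x)\<^sup>2 * k x)"
    by (rule Bochner_Integration.integral_diff[symmetric]) (intro int v w)+
  also have "\<dots> = (LBINT x. (v x - w x) * ((v x + w x) * k x))"
    by (intro Bochner_Integration.integral_cong refl) (simp add: power2_eq_square algebra_simps)
  also have "cmod \<dots> \<le> L2_norm (\<lambda>x. v x - w x) * L2_norm (\<lambda>x. (v x + w x) * k x)"
    by (intro square_integrable_mult(2) square_integrable_diff(1) lift(1) square_integrable_add(1) v w)
  also have "\<dots> \<le> L2_norm (\<lambda>x. v x - w x) * (C * (L2_norm v + L2_norm w))"
    by (intro mult_left_mono order_trans[OF lift(2)] square_integrable_add v w k(2)) simp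
  finally show "cmod ((LBINT x. (v x)\<^sup>2 * k x) - (LBINT x. (w x)\<^sup>2 * k x)) \<le> C * (L2_norm (\<lambda>x. v x - w x) * (L2_norm v + L2_norm w))"
    by (simp add: mult.left_commute)
qed

section \<open>Continuous curves in \<open>L^2\<close> and their pairings with fixed kernels\<close>

locale l2curve =
  fixes v :: "real \<Rightarrow> real \<Rightarrow> complex"
  assumes sq: "square_integrable (v t)"
    and cont: "((\<lambda>t. L2_norm (\<lambda>x. v t x - v t\<^sub>0 x)) \<longlongrightarrow> 0) (at t\<^sub>0)"
begin

lemma tendsto_L2_norm: "((\<lambda>t. L2_norm (v t)) \<longlongrightarrow> L2_norm (v t\<^sub>0)) (at t\<^sub>0)"
  by (rule LIM_zero_cancel, rule Lim_null_comparison[OF always_eventually cont])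
    (simp add: L2_norm_reverse_triangle sq)

lemma continuous_norm: "continuous_on S (\<lambda>t. L2_norm (v t))"
  using tendsto_L2_norm by (auto simp: continuous_on_def intro: tendsto_within_subset)

lemma continuous_pairing:
  assumes k: "square_integrable k"
  shows "continuous_on S (\<lambda>t. LBINT x. v t x * k x)"
  unfolding continuous_on_def
proof
  fix t0
  have "((\<lambda>t. LBINT x. v t x * k x) \<longlongrightarrow> (LBINT x. v t0 x * k x)) (at t0)"
  proof (rule LIM_zero_cancel, rule Lim_null_comparison[OF always_eventually])
    show "((\<lambda>t. L2_norm (\<lambda>x. v t x - v t0 x) * L2_norm k) \<longlongrightarrow> 0) (at t0)" by (rule tendsto_mult_left_zero[OF cont])
    show "\<forall>t. norm ((LBINT x. v t x * k x) - (LBINT x. v t0 x * k x)) \<le> L2_norm (\<lambda>x. v t x - v t0 x) * L2_norm k"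
    proof
      fix t
      have "(LBINT x. v t x * k x) - (LBINT x. v t0 x * k x) = (LBINT x. (v t x - v t0 x) * k x)"
        unfolding left_diff_distrib by (rule Bochner_Integration.integral_diff[symmetric]) (intro square_integrable_mult sq k)+
      then show "norm ((LBINT x. v t x * k x) - (LBINT x. v t0 x * k x)) \<le> L2_norm (\<lambda>x. v t x - v t0 x) * L2_norm k"
        using square_integrable_mult(2)[OF square_integrable_diff(1)[OF sq sq] k] by simp
    qed
  qed
  then show "((\<lambda>t. LBINT x. v t x * k x) \<longlongrightarrow> (LBINT x. v t0 x * k x)) (at t0 within S)"
    by (rule tendsto_within_subset) simp
qed

text \<open>The modulus of continuity in \<open>t\<close> is uniform over kernels bounded by one.\<close>

lemma quadratic_modulus: "((\<lambda>t. L2_norm (\<lambda>x. v t x - v t\<^sub>0 x) * (L2_norm (v t) + L2_norm (v t\<^sub>0))) \<longlongrightarrow> 0) (at t\<^sub>0)"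
  using tendsto_mult[OF cont tendsto_add[OF tendsto_L2_norm tendsto_const]] by simp

lemma continuous_quadratic:
  assumes [measurable]: "k \<in> borel_measurable borel" and k: "\<And>x. cmod (k x) \<le> C"
  shows "continuous_on S (\<lambda>t. LBINT x. (v t x)\<^sup>2 * k x)"
  unfolding continuous_on_def
proof
  fix t0
  have C: "0 \<le> C" using k[of 0] by (meson norm_ge_zero order_trans)
  have "((\<lambda>t. LBINT x. (v t x)\<^sup>2 * k x) \<longlongrightarrow> (LBINT x. (v t0 x)\<^sup>2 * k x)) (at t0)"
  proof (rule LIM_zero_cancel, rule Lim_null_comparison[OF always_eventually])
    show "((\<lambda>t. C * (L2_norm (\<lambda>x. v t x - v t0 x) * (L2_norm (v t) + L2_norm (v t0)))) \<longlongrightarrow> 0) (at t0)"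
      by (rule tendsto_mult_right_zero[OF quadratic_modulus])
    show "\<forall>t. norm ((LBINT x. (v t x)\<^sup>2 * k x) - (LBINT x. (v t0 x)\<^sup>2 * k x)) \<le> C * (L2_norm (\<lambda>x. v t x - v t0 x) * (L2_norm (v t) + L2_norm (v t0)))"
      using quadratic_pairing(3)[OF sq sq assms(1) k C] by simp
  qed
  then show "((\<lambda>t. LBINT x. (v t x)\<^sup>2 * k x) \<longlongrightarrow> (LBINT x. (v t0 x)\<^sup>2 * k x)) (at t0 within S)"
    by (rule tendsto_within_subset) simp
qed

end

lemma set_integral_has_vector_derivative:
  fixes f :: "real \<Rightarrow> complex"
  assumes f: "continuous_on {0..T} f" and t: "t \<in> {0..T}"
  shows "((\<lambda>t. LBINT \<tau>. indicator {0..t} \<tau> *\<^sub>R f \<tau>) has_vector_derivative f t) (at t within {0..T})"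
proof -
  have eq: "(LBINT y=(0::real)..u. f y) = (LBINT \<tau>. indicator {0..u} \<tau> *\<^sub>R f \<tau>)" if "u \<in> {0..T}" for u
    using interval_integral_Icc[of 0 u f] that by (simp add: set_lebesgue_integral_def)
  have "((\<lambda>u. LBINT y=(0::real)..u. f y) has_vector_derivative f t) (at t within {0..T})"
    by (rule interval_integral_FTC2) (use t f in auto)
  then show ?thesis
    by (rule has_vector_derivative_transform[OF t, rotated]) (simp only: eq)
qed

lemma phase_eq: "(- (\<i> * of_real \<xi>)) ^ 3 + of_real \<epsilon> * (- (\<i> * of_real \<xi>)) ^ 5 = \<i> * of_real (phase \<epsilon> \<xi>)"
  by (simp add: phase_def power_mult_distrib power3_eq_cube numeral_eq_Suc algebra_simps)

section \<open>Weak solutions tested with truncated plane waves\<close>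

locale weak_solution = l2curve "\<lambda>t x. of_real (u t x)" for u :: "real \<Rightarrow> real \<Rightarrow> real" +
  fixes \<epsilon> :: real
  assumes weak: "kawahara_equation \<epsilon> u"
begin

abbreviation v :: "real \<Rightarrow> real \<Rightarrow> complex" where
  "v t x \<equiv> of_real (u t x)"

definition moment :: "(nat \<Rightarrow> real \<Rightarrow> real) \<Rightarrow> real \<Rightarrow> real \<Rightarrow> complex" where
  "moment d \<xi> t = (LBINT x. v t x * wave d \<xi> 0 x)"

text \<open>The time derivative of \<open>moment\<close> according to the weak equation, with all
  space derivatives on the truncated wave.\<close>

definition flux :: "(nat \<Rightarrow> real \<Rightarrow> real) \<Rightarrow> real \<Rightarrow> real \<Rightarrow> complex" where
  "flux d \<xi> t = (LBINT x. v t x * (wave d \<xi> 3 x + of_real \<epsilon> * wave d \<xi> 5 x)) + (LBINT x. (v t x)\<^sup>2 * (wave d \<xi> 1 x / 2))"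

context
  fixes d :: "nat \<Rightarrow> real \<Rightarrow> real" and r :: real
  assumes d: "smooth_seq d" and supp: "\<And>x. r < \<bar>x\<bar> \<Longrightarrow> d 0 x = 0"
begin

lemma wave_square_integrable: "square_integrable (wave d \<xi> k)"
  by (rule square_integrable_continuous_support[OF wave_continuous[OF d] wave_support[OF d supp]])

lemma wave_comb_square_integrable: "square_integrable (\<lambda>x. wave d \<xi> 3 x + of_real \<epsilon> * wave d \<xi> 5 x)"
  by (intro square_integrable_add square_integrable_cmult wave_square_integrable)

lemma wave_half: "wave d \<xi> k \<in> borel_measurable borel" "\<exists>C. \<forall>x. cmod (wave d \<xi> k x / 2) \<le> C"
proof -
  show "wave d \<xi> k \<in> borel_measurable borel" by (intro borel_measurable_continuous_onI wave_continuous[OF d])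
  obtain C where "\<forall>x. cmod (wave d \<xi> k x) \<le> C"
    using bounded_continuous_support[of "wave d \<xi> k" r, OF wave_continuous[OF d]] wave_support[OF d supp] by blast
  then have "\<forall>x. cmod (wave d \<xi> k x / 2) \<le> C / 2" by (simp add: norm_divide)
  then show "\<exists>C. \<forall>x. cmod (wave d \<xi> k x / 2) \<le> C" by blast
qed

lemma continuous_moment: "continuous_on S (moment d \<xi>)"
  unfolding moment_def by (rule continuous_pairing[OF wave_square_integrable])

lemma quadratic_wave: "continuous_on S (\<lambda>t. LBINT x. (v t x)\<^sup>2 * (wave d \<xi> k x / 2))"
  and integrable_quadratic_wave: "integrable lborel (\<lambda>x. (v t x)\<^sup>2 * (wave d \<xi> k x / 2))"
proof -
  note [measurable] = wave_half(1)
  have m: "(\<lambda>x. wave d \<xi> k x / 2) \<in> borel_measurable borel" by measurable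
  obtain C where C: "\<forall>x. cmod (wave d \<xi> k x / 2) \<le> C" using wave_half(2) by blast
  then have "0 \<le> C" by (meson norm_ge_zero order_trans)
  show "continuous_on S (\<lambda>t. LBINT x. (v t x)\<^sup>2 * (wave d \<xi> k x / 2))"
    by (rule continuous_quadratic[OF m C[rule_format]])
  show "integrable lborel (\<lambda>x. (v t x)\<^sup>2 * (wave d \<xi> k x / 2))"
    by (rule quadratic_pairing(1)[OF sq sq m C[rule_format] \<open>0 \<le> C\<close>])
qed

lemma continuous_flux: "continuous_on S (flux d \<xi>)"
  unfolding flux_def by (intro continuous_on_add continuous_pairing wave_comb_square_integrable quadratic_wave)

text \<open>Test functions are real whereas the wave is complex, so the identity is proved for
  \<open>P\<close> equal to \<open>Re\<close> or \<open>Im\<close>. The test function is a product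
  of a function of time and a component of the wave.\<close>

lemma moment_component:
  fixes P :: "complex \<Rightarrow> real"
  assumes P: "bounded_linear P" and sP: "smooth_seq (\<lambda>k x. P (wave d \<xi> k x))" and t: "t1 \<le> t2"
  shows "P (moment d \<xi> t2) - P (moment d \<xi> t1) = (LINT t:{t1..t2}|lborel. P (flux d \<xi> t))"
proof (rule weak_derivative_integral[OF _ _ _ t])
  interpret bounded_linear P by fact
  have Pr: "P (of_real a * z) = a * P z" for a z using scaleR[of a z] by (simp add: scaleR_conv_of_real)
  show "continuous_on UNIV (\<lambda>t. P (moment d \<xi> t))" "continuous_on UNIV (\<lambda>t. P (flux d \<xi> t))"
    by (intro continuous_on continuous_moment continuous_flux)+
  fix \<theta> q assume \<theta>: "smooth_seq \<theta>" "\<And>t. q < \<bar>t\<bar> \<Longrightarrow> \<theta> 0 t = 0"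
  let ?e = "\<lambda>k x. P (wave d \<xi> k x)"
  have e0: "?e 0 x = 0" if "r < \<bar>x\<bar>" for x using wave_support[OF d supp that] by (simp add: zero)
  define \<psi> where "\<psi> = tensor (\<theta> 0) (?e 0)"
  have "test_function \<psi>" unfolding \<psi>_def by (rule test_function_tensor[OF \<theta>(1) sP \<theta>(2) e0])
  then have "(LBINT t. LINT x|lborel.
        u t x * partial_t \<psi> (t, x) + u t x * (partial_x ^^ 3) \<psi> (t, x)
        + \<epsilon> * u t x * (partial_x ^^ 5) \<psi> (t, x) + (u t x)\<^sup>2 / 2 * partial_x \<psi> (t, x)) = 0"
    using weak by (simp add: kawahara_equation_def)
  moreover have "(LBINT x. u t x * partial_t \<psi> (t, x) + u t x * (partial_x ^^ 3) \<psi> (t, x)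
        + \<epsilon> * u t x * (partial_x ^^ 5) \<psi> (t, x) + (u t x)\<^sup>2 / 2 * partial_x \<psi> (t, x))
      = \<theta> 1 t * P (moment d \<xi> t) + \<theta> 0 t * P (flux d \<xi> t)" for t
  proof -
    have i: "integrable lborel (\<lambda>x. v t x * wave d \<xi> 0 x)"
      "integrable lborel (\<lambda>x. v t x * (wave d \<xi> 3 x + of_real \<epsilon> * wave d \<xi> 5 x))"
      "integrable lborel (\<lambda>x. (v t x)\<^sup>2 * (wave d \<xi> 1 x / 2))"
      by (intro square_integrable_mult(1) sq wave_square_integrable wave_comb_square_integrable integrable_quadratic_wave)+
    let ?F = "\<lambda>x. of_real (\<theta> 1 t) * (v t x * wave d \<xi> 0 x) + of_real (\<theta> 0 t) * (v t x * (wave d \<xi> 3 x + of_real \<epsilon> * wave d \<xi> 5 x) + (v t x)\<^sup>2 * (wave d \<xi> 1 x / 2))"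
    have "partial_t \<psi> = tensor (\<theta> 1) (?e 0)" "(partial_x ^^ 3) \<psi> = tensor (\<theta> 0) (?e 3)"
      "(partial_x ^^ 5) \<psi> = tensor (\<theta> 0) (?e 5)" "partial_x \<psi> = tensor (\<theta> 0) (?e 1)"
      unfolding \<psi>_def using partial_tensor[OF \<theta>(1) sP, of 0 0] partial_x_tensor_funpow[OF \<theta>(1) sP, of 3 0 0] partial_x_tensor_funpow[OF \<theta>(1) sP, of 5 0 0] by simp_all
    moreover have "u t x * (\<theta> 1 t * ?e 0 x) + u t x * (\<theta> 0 t * ?e 3 x) + \<epsilon> * u t x * (\<theta> 0 t * ?e 5 x) + (u t x)\<^sup>2 / 2 * (\<theta> 0 t * ?e 1 x) = P (?F x)" for x
    proof -
      have "(v t x)\<^sup>2 * (wave d \<xi> 1 x / 2) = of_real ((u t x)\<^sup>2 / 2) * wave d \<xi> 1 x" by simp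
      then have "P ((v t x)\<^sup>2 * (wave d \<xi> 1 x / 2)) = (u t x)\<^sup>2 / 2 * ?e 1 x" by (simp only: Pr)
      then show ?thesis unfolding add Pr by (simp only: distrib_left distrib_right mult_ac add_ac)
    qed
    ultimately have "(LBINT x. u t x * partial_t \<psi> (t, x) + u t x * (partial_x ^^ 3) \<psi> (t, x)
        + \<epsilon> * u t x * (partial_x ^^ 5) \<psi> (t, x) + (u t x)\<^sup>2 / 2 * partial_x \<psi> (t, x)) = (LBINT x. P (?F x))"
      by (simp only: tensor_def prod.case)
    also have "\<dots> = P (LBINT x. ?F x)" by (rule integral_bounded_linear[OF P]) (intro Bochner_Integration.integrable_add integrable_mult_right i)
    also have "(LBINT x. ?F x) = of_real (\<theta> 1 t) * moment d \<xi> t + of_real (\<theta> 0 t) * flux d \<xi> t"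
      unfolding moment_def flux_def using i by (simp only: Bochner_Integration.integral_add Bochner_Integration.integrable_add integrable_mult_right integral_mult_right_zero)
    finally show ?thesis by (simp only: add Pr)
  qed
  ultimately show "(LBINT t. \<theta> 1 t * P (moment d \<xi> t) + \<theta> 0 t * P (flux d \<xi> t)) = 0" by simp
qed

lemma moment_integral:
  assumes "0 \<le> t"
  shows "moment d \<xi> t = moment d \<xi> 0 + (LBINT \<tau>. indicator {0..t} \<tau> *\<^sub>R flux d \<xi> \<tau>)"
proof -
  have i: "integrable lborel (\<lambda>\<tau>. indicator {0..t} \<tau> *\<^sub>R flux d \<xi> \<tau>)"
    by (rule borel_integrable_compact[OF compact_Icc continuous_flux])
  show ?thesis
  proof (rule complex_eqI)
    show "Re (moment d \<xi> t) = Re (moment d \<xi> 0 + (LBINT \<tau>. indicator {0..t} \<tau> *\<^sub>R flux d \<xi> \<tau>))"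
      using moment_component[OF bounded_linear_Re smooth_wave(1)[OF d] assms, of \<xi>] integral_Re[OF i]
      by (simp add: set_lebesgue_integral_def)
    show "Im (moment d \<xi> t) = Im (moment d \<xi> 0 + (LBINT \<tau>. indicator {0..t} \<tau> *\<^sub>R flux d \<xi> \<tau>))"
      using moment_component[OF bounded_linear_Im smooth_wave(2)[OF d] assms, of \<xi>] integral_Im[OF i]
      by (simp add: set_lebesgue_integral_def)
  qed
qed

text \<open>The integrating factor leaves \<open>flux\<close> minus the dispersive multiple of
  \<open>moment\<close> under the integral. That combination converges at every frequency when the
  cutoff is removed, whereas the moments themselves are only known to converge in the mean.\<close>

lemma moment_duhamel:
  assumes T: "0 \<le> T"
  shows "cis (- phase \<epsilon> \<xi> * T) * moment d \<xi> T - moment d \<xi> 0 =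
    (LBINT \<tau>. indicator {0..T} \<tau> *\<^sub>R (cis (- phase \<epsilon> \<xi> * \<tau>) * (flux d \<xi> \<tau> - \<i> * of_real (phase \<epsilon> \<xi>) * moment d \<xi> \<tau>)))"
proof -
  let ?p = "phase \<epsilon> \<xi>"
  have "(moment d \<xi> has_vector_derivative flux d \<xi> t) (at t within {0..T})" if t: "t \<in> {0..T}" for t
  proof (rule has_vector_derivative_transform[OF t])
    show "((\<lambda>t. moment d \<xi> 0 + (LBINT \<tau>. indicator {0..t} \<tau> *\<^sub>R flux d \<xi> \<tau>)) has_vector_derivative flux d \<xi> t) (at t within {0..T})"
      using has_vector_derivative_add[OF has_vector_derivative_const set_integral_has_vector_derivative[OF continuous_flux t]] by simp
    show "moment d \<xi> t = moment d \<xi> 0 + (LBINT \<tau>. indicator {0..t} \<tau> *\<^sub>R flux d \<xi> \<tau>)" if "t \<in> {0..T}" for t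
      by (rule moment_integral) (use that in simp)
  qed
  note D = has_vector_derivative_mult[OF cis_linear_deriv[of "- ?p"] this]
  have "(LBINT \<tau>. indicator {0..T} \<tau> *\<^sub>R (cis (- ?p * \<tau>) * flux d \<xi> \<tau> + \<i> * of_real (- ?p) * cis (- ?p * \<tau>) * moment d \<xi> \<tau>))
      = cis (- ?p * T) * moment d \<xi> T - cis (- ?p * 0) * moment d \<xi> 0"
    by (rule integral_FTC_Icc[OF T D]) (auto intro!: continuous_intros continuous_moment continuous_flux)
  then show ?thesis by (simp add: algebra_simps)
qed

end

end

context weak_solution
begin

text \<open>The transform of \<open>- (u^2 / 2)\<close> differentiated once in \<open>x\<close>,
  given by an absolutely convergent integral at every frequency because the square of
  \<open>u t\<close> is integrable.\<close>

definition nl :: "real \<Rightarrow> real \<Rightarrow> complex" where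
  "nl t \<xi> = - (\<i> * of_real \<xi>) / 2 * (LBINT x. (v t x)\<^sup>2 * cis (- (\<xi> * x)))"

lemma continuous_nl: "continuous_on S (\<lambda>t. nl t \<xi>)"
  unfolding nl_def by (intro continuous_intros continuous_quadratic[of _ 1]) auto

end

text \<open>The cutoff will be stretched by the factor \<open>n + 1\<close>; \<open>C\<close> bounds
  its derivatives up to 5, the order of the equation.\<close>

locale cutoff_solution = weak_solution +
  fixes \<omega> :: "nat \<Rightarrow> real \<Rightarrow> real" and C :: real
  assumes \<omega>: "smooth_seq \<omega>" and one: "\<And>x. \<bar>x\<bar> \<le> 1 \<Longrightarrow> \<omega> 0 x = 1" and supp: "\<And>x. 2 < \<bar>x\<bar> \<Longrightarrow> \<omega> 0 x = 0"
    and C: "\<And>j x. j \<le> 5 \<Longrightarrow> \<bar>\<omega> j x\<bar> \<le> C"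
begin

definition cutoff_seq :: "nat \<Rightarrow> nat \<Rightarrow> real \<Rightarrow> real" where
  "cutoff_seq n k x = \<omega> k ((x - 0) / real (Suc n)) / real (Suc n) ^ k"

lemma C_nonneg: "0 \<le> C" using C[of 0 0] by simp

lemma smooth_cutoff: "smooth_seq (cutoff_seq n)"
  unfolding cutoff_seq_def[abs_def] by (rule smooth_seq_affine[OF \<omega>])

lemma cutoff_support: "2 * real (Suc n) < \<bar>x\<bar> \<Longrightarrow> cutoff_seq n 0 x = 0"
  unfolding cutoff_seq_def by (simp add: supp abs_divide less_divide_eq del: of_nat_Suc)

lemma cutoff_le:
  assumes "j \<le> 5" shows "\<bar>cutoff_seq n j x\<bar> \<le> C"
proof -
  have "\<bar>cutoff_seq n j x\<bar> = \<bar>\<omega> j (x / real (Suc n))\<bar> / real (Suc n) ^ j" by (simp add: cutoff_seq_def abs_divide)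
  also have "\<dots> \<le> C / 1" using C_nonneg by (intro frac_le C assms one_le_power) auto
  finally show ?thesis by simp
qed

lemma cutoff_deriv_le:
  assumes "j \<le> 5" "1 \<le> j" shows "\<bar>cutoff_seq n j x\<bar> \<le> C / real (Suc n)"
proof -
  have "\<bar>cutoff_seq n j x\<bar> = \<bar>\<omega> j (x / real (Suc n))\<bar> / real (Suc n) ^ j" by (simp add: cutoff_seq_def abs_divide)
  also have "\<dots> \<le> C / real (Suc n)" using C_nonneg assms by (intro frac_le C self_le_power) auto
  finally show ?thesis .
qed

lemma cutoff_tendsto: "(\<lambda>n. cutoff_seq n 0 x) \<longlonglongrightarrow> 1"
proof (rule tendsto_eventually)
  obtain N where "\<bar>x\<bar> < real N" using reals_Archimedean2 by blast
  then have "cutoff_seq n 0 x = 1" if "N \<le> n" for n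
    unfolding cutoff_seq_def using that by (simp add: one abs_divide)
  then show "\<forall>\<^sub>F n in sequentially. cutoff_seq n 0 x = 1" by (auto simp: eventually_sequentially)
qed

abbreviation wave_error :: "nat \<Rightarrow> real \<Rightarrow> nat \<Rightarrow> real \<Rightarrow> complex" where
  "wave_error n \<xi> k x \<equiv> wave (cutoff_seq n) \<xi> k x - (- (\<i> * of_real \<xi>)) ^ k * wave (cutoff_seq n) \<xi> 0 x"

definition errc :: "real \<Rightarrow> real" where
  "errc \<xi> = 5 * (1 + \<bar>\<xi>\<bar>) ^ 5 * C"

lemma errc_nonneg: "0 \<le> errc \<xi>" using C_nonneg by (simp add: errc_def)

lemma wave_error_le:
  assumes "k \<le> 5"
  shows "cmod (wave_error n \<xi> k x) \<le> errc \<xi> / real (Suc n)"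
proof -
  let ?z = "- (\<i> * of_real \<xi>)" and ?A = "\<lambda>j. complex_of_real (cutoff_seq n j x)"
  have "cmod (wave_error n \<xi> k x) = cmod (leib k ?A ?z - ?z ^ k * ?A 0)"
    by (simp add: wave_def norm_mult flip: left_diff_distrib mult.assoc)
  also have "\<dots> \<le> real k * (1 + cmod ?z) ^ k * (C / real (Suc n))"
    using C_nonneg assms by (intro leib_approx) (auto simp: cutoff_deriv_le simp del: of_nat_Suc)
  also have "\<dots> \<le> 5 * (1 + cmod ?z) ^ 5 * (C / real (Suc n))"
    using C_nonneg assms by (intro mult_right_mono mult_mono power_increasing) auto
  finally show ?thesis by (simp add: errc_def norm_mult)
qed

lemma wave_error_support: "2 * real (Suc n) < \<bar>x\<bar> \<Longrightarrow> wave_error n \<xi> k x = 0"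
  using wave_support[OF smooth_cutoff cutoff_support] by (simp del: of_nat_Suc)

lemma square_integrable_wave_error: "square_integrable (wave_error n \<xi> k)"
  by (intro square_integrable_diff square_integrable_cmult wave_square_integrable[OF smooth_cutoff cutoff_support])

lemma square_integrable_wave_error_comb: "square_integrable (\<lambda>x. wave_error n \<xi> 3 x + of_real \<epsilon> * wave_error n \<xi> 5 x)"
  by (intro square_integrable_add square_integrable_cmult square_integrable_wave_error)

text \<open>As \<open>u t\<close> is only in \<open>L^2\<close>, the error of the wave is measured
  in \<open>L^2\<close>: height of order \<open>1 / (n + 1)\<close> on an interval of length
  \<open>4 * (n + 1)\<close> gives decay like \<open>(n + 1)^(-1/2)\<close>.\<close>

lemma linear_error_le:
  "cmod (LBINT x. v t x * (wave_error n \<xi> 3 x + of_real \<epsilon> * wave_error n \<xi> 5 x))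
    \<le> L2_norm (v t) * (2 * (1 + \<bar>\<epsilon>\<bar>) * errc \<xi> / sqrt (real (Suc n)))"
proof -
  let ?R = "real (Suc n)" and ?w = "\<lambda>x. wave_error n \<xi> 3 x + of_real \<epsilon> * wave_error n \<xi> 5 x"
  let ?c = "(1 + \<bar>\<epsilon>\<bar>) * errc \<xi> / ?R" and ?I = "\<lambda>x. complex_of_real (indicator {- (2 * ?R)..2 * ?R} x)"
  have "(LBINT x. indicat_real {- (2 * ?R)..2 * ?R} x) = 4 * ?R" by simp
  moreover have "(cmod (?I x))\<^sup>2 = indicat_real {- (2 * ?R)..2 * ?R} x" for x by (simp add: indicator_def)
  ultimately have I: "square_integrable ?I" "L2_norm ?I = sqrt (4 * ?R)"
    by (auto simp: square_integrable_def L2_norm_def)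
  have "cmod (?w x) \<le> ?c * cmod (?I x)" for x
  proof (cases "2 * ?R < \<bar>x\<bar>")
    case True
    have w: "wave_error n \<xi> k x = 0" for k by (rule wave_error_support[OF True])
    show ?thesis unfolding w using errc_nonneg[of \<xi>] by simp
  next
    case False
    have g: "cmod (a + of_real \<epsilon> * b) \<le> cmod a + \<bar>\<epsilon>\<bar> * cmod b" for a b
      using norm_triangle_ineq[of a "of_real \<epsilon> * b"] by (simp add: norm_mult)
    have "cmod (?w x) \<le> errc \<xi> / ?R + \<bar>\<epsilon>\<bar> * (errc \<xi> / ?R)"
      by (intro order_trans[OF g] add_mono mult_left_mono wave_error_le) auto
    also have "\<dots> = ?c" by (simp add: distrib_right add_divide_distrib)
    finally have le: "cmod (?w x) \<le> ?c" .
    have "x \<in> {- (2 * ?R)..2 * ?R}" using False unfolding atLeastAtMost_iff by linarith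
    then have "?I x = 1" by (simp only: indicator_simps of_real_1)
    then show ?thesis using le by (simp only: norm_one mult_1_right)
  qed
  then have "L2_norm ?w \<le> ?c * sqrt (4 * ?R)"
    unfolding I(2)[symmetric] using errc_nonneg
    by (intro square_integrable_lift(2)[OF I(1)] square_integrable_measurable[OF square_integrable_wave_error_comb]) auto
  also have "\<dots> = 2 * (1 + \<bar>\<epsilon>\<bar>) * errc \<xi> / sqrt ?R"
  proof -
    have "?R = sqrt ?R * sqrt ?R" by simp
    then have "?c * sqrt (4 * ?R) = (1 + \<bar>\<epsilon>\<bar>) * errc \<xi> / (sqrt ?R * sqrt ?R) * (2 * sqrt ?R)" by (simp only: real_sqrt_mult real_sqrt_four)
    also have "\<dots> = 2 * (1 + \<bar>\<epsilon>\<bar>) * errc \<xi> / sqrt ?R" by (simp del: of_nat_Suc real_sqrt_mult_self)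
    finally show ?thesis .
  qed
  finally have "L2_norm (v t) * L2_norm ?w \<le> L2_norm (v t) * (2 * (1 + \<bar>\<epsilon>\<bar>) * errc \<xi> / sqrt ?R)"
    by (intro mult_left_mono) auto
  then show ?thesis by (rule order_trans[OF square_integrable_mult(2)[OF sq square_integrable_wave_error_comb]])
qed

lemma measurable_wave_cutoff[measurable]: "wave (cutoff_seq n) \<xi> k \<in> borel_measurable borel" "cutoff_seq n k \<in> borel_measurable borel"
  by (intro borel_measurable_continuous_onI wave_continuous smooth_seq_continuous smooth_cutoff)+

lemma quadratic_error_le:
  "cmod (LBINT x. (v t x)\<^sup>2 * (wave_error n \<xi> 1 x / 2)) \<le> errc \<xi> / real (Suc n) * (L2_norm (v t))\<^sup>2"
proof (rule quadratic_pairing(2)[OF sq sq])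
  have "cmod (w / 2) \<le> cmod w" for w by (simp add: norm_divide)
  then show "cmod (wave_error n \<xi> 1 x / 2) \<le> errc \<xi> / real (Suc n)" for x
    by (rule order_trans[OF _ wave_error_le]) simp
  show "0 \<le> errc \<xi> / real (Suc n)" using errc_nonneg by simp
qed measurable

text \<open>The error of replacing the cutoff itself by 1 in the quadratic term. No derivative falls
  on the cutoff here, so there is no rate in \<open>n\<close>, and dominated convergence takes
  over.\<close>

abbreviation low_error :: "nat \<Rightarrow> real \<Rightarrow> real \<Rightarrow> complex" where
  "low_error n \<xi> x \<equiv> - (\<i> * of_real \<xi>) / 2 * ((of_real (cutoff_seq n 0 x) - 1) * cis (- (\<xi> * x)))"

lemma low_error_le: "cmod (low_error n \<xi> x) \<le> \<bar>\<xi>\<bar> * (C + 1)"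
proof -
  have "cmod (of_real (cutoff_seq n 0 x) - 1) \<le> C + 1"
    using cutoff_le[of 0 n x] norm_triangle_ineq4[of "complex_of_real (cutoff_seq n 0 x)" 1] by simp
  then have "\<bar>\<xi>\<bar> / 2 * cmod (of_real (cutoff_seq n 0 x) - 1) \<le> \<bar>\<xi>\<bar> * (C + 1)" by (intro mult_mono) auto
  then show ?thesis by (simp add: norm_mult norm_divide)
qed

lemma measurable_low_error: "low_error n \<xi> \<in> borel_measurable borel" by measurable

lemma low_error_tendsto: "(\<lambda>n. LBINT x. (v t x)\<^sup>2 * low_error n \<xi> x) \<longlonglongrightarrow> 0"
proof -
  note [measurable] = square_integrable_measurable[OF sq[of t]]
  have "(\<lambda>n. LBINT x. (v t x)\<^sup>2 * low_error n \<xi> x) \<longlonglongrightarrow> integral\<^sup>L lborel (\<lambda>x::real. 0::complex)"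
  proof (rule integral_dominated_convergence[where w="\<lambda>x. (cmod (v t x))\<^sup>2 * (\<bar>\<xi>\<bar> * (C + 1))"])
    show "integrable lborel (\<lambda>x. (cmod (v t x))\<^sup>2 * (\<bar>\<xi>\<bar> * (C + 1)))"
      using sq[of t] by (intro integrable_mult_left) (simp add: square_integrable_def)
    show "AE x in lborel. norm ((v t x)\<^sup>2 * low_error n \<xi> x) \<le> (cmod (v t x))\<^sup>2 * (\<bar>\<xi>\<bar> * (C + 1))" for n
      unfolding norm_mult[of "(v t _)\<^sup>2"] norm_power by (intro AE_I2 mult_left_mono low_error_le) simp
    show "AE x in lborel. (\<lambda>n. (v t x)\<^sup>2 * low_error n \<xi> x) \<longlonglongrightarrow> 0"
    proof (rule AE_I2)
      fix x
      have "(\<lambda>n. (v t x)\<^sup>2 * low_error n \<xi> x) \<longlonglongrightarrow> (v t x)\<^sup>2 * (- (\<i> * of_real \<xi>) / 2 * ((of_real 1 - 1) * cis (- (\<xi> * x))))"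
        by (intro tendsto_intros cutoff_tendsto) 
      then show "(\<lambda>n. (v t x)\<^sup>2 * low_error n \<xi> x) \<longlonglongrightarrow> 0" by simp
    qed
  qed measurable
  then show ?thesis by simp
qed

definition err :: "nat \<Rightarrow> real \<Rightarrow> real \<Rightarrow> complex" where
  "err n \<xi> t = flux (cutoff_seq n) \<xi> t - \<i> * of_real (phase \<epsilon> \<xi>) * moment (cutoff_seq n) \<xi> t - nl t \<xi>"

lemma err_eq:
  "err n \<xi> t = (LBINT x. v t x * (wave_error n \<xi> 3 x + of_real \<epsilon> * wave_error n \<xi> 5 x))
     + (LBINT x. (v t x)\<^sup>2 * (wave_error n \<xi> 1 x / 2)) + (LBINT x. (v t x)\<^sup>2 * low_error n \<xi> x)"
proof -
  let ?z = "- (\<i> * of_real \<xi>)" and ?W = "wave (cutoff_seq n) \<xi>"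
  have L: "(LBINT x. v t x * (wave_error n \<xi> 3 x + of_real \<epsilon> * wave_error n \<xi> 5 x))
     = (LBINT x. v t x * (?W 3 x + of_real \<epsilon> * ?W 5 x)) - \<i> * of_real (phase \<epsilon> \<xi>) * moment (cutoff_seq n) \<xi> t"
  proof -
    have eq: "v t x * (wave_error n \<xi> 3 x + of_real \<epsilon> * wave_error n \<xi> 5 x) =
       v t x * (?W 3 x + of_real \<epsilon> * ?W 5 x) - \<i> * of_real (phase \<epsilon> \<xi>) * (v t x * ?W 0 x)" for x
      unfolding phase_eq[symmetric] by (simp only: algebra_simps)
    show ?thesis unfolding eq moment_def
      by (subst Bochner_Integration.integral_diff)
        (auto intro!: square_integrable_mult(1) sq integrable_mult_right wave_square_integrable[OF smooth_cutoff cutoff_support]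
           wave_comb_square_integrable[OF smooth_cutoff cutoff_support])
  qed
  have q: "integrable lborel (\<lambda>x. (v t x)\<^sup>2 * (?W 1 x / 2))" by (rule integrable_quadratic_wave[OF smooth_cutoff cutoff_support])
  have i0: "integrable lborel (\<lambda>x. (v t x)\<^sup>2 * (?W 0 x / 2))" by (rule integrable_quadratic_wave[OF smooth_cutoff cutoff_support])
  have ic: "integrable lborel (\<lambda>x. (v t x)\<^sup>2 * cis (- (\<xi> * x)))"
    by (rule quadratic_pairing(1)[OF sq sq, of _ 1]) auto
  have Q1: "(LBINT x. (v t x)\<^sup>2 * (wave_error n \<xi> 1 x / 2)) = (LBINT x. (v t x)\<^sup>2 * (?W 1 x / 2)) - ?z * (LBINT x. (v t x)\<^sup>2 * (?W 0 x / 2))"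
  proof -
    have eq: "(v t x)\<^sup>2 * (wave_error n \<xi> 1 x / 2) = (v t x)\<^sup>2 * (?W 1 x / 2) - ?z * ((v t x)\<^sup>2 * (?W 0 x / 2))" for x
      by (simp only: power_one_right diff_divide_distrib right_diff_distrib times_divide_eq_right mult.left_commute)
    show ?thesis unfolding eq using q i0 by (simp only: Bochner_Integration.integral_diff integrable_mult_right integral_mult_right_zero)
  qed
  have Q2: "(LBINT x. (v t x)\<^sup>2 * low_error n \<xi> x) = ?z * (LBINT x. (v t x)\<^sup>2 * (?W 0 x / 2)) - nl t \<xi>"
  proof -
    have eq: "(v t x)\<^sup>2 * low_error n \<xi> x = ?z * ((v t x)\<^sup>2 * (?W 0 x / 2)) - ?z / 2 * ((v t x)\<^sup>2 * cis (- (\<xi> * x)))" for x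
      by (simp add: wave_def field_simps)
    show ?thesis unfolding eq nl_def
      using ic i0 by (simp only: Bochner_Integration.integral_diff integrable_mult_right integral_mult_right_zero)
  qed
  show ?thesis unfolding L Q1 Q2 err_def flux_def by (simp only: algebra_simps)
qed

lemma err_le:
  "cmod (err n \<xi> t) \<le> L2_norm (v t) * (2 * (1 + \<bar>\<epsilon>\<bar>) * errc \<xi> / sqrt (real (Suc n))) + errc \<xi> / real (Suc n) * (L2_norm (v t))\<^sup>2
     + cmod (LBINT x. (v t x)\<^sup>2 * low_error n \<xi> x)"
  unfolding err_eq
  by (intro order_trans[OF norm_triangle_ineq] add_mono linear_error_le quadratic_error_le order_refl)

lemma err_tendsto: "(\<lambda>n. err n \<xi> t) \<longlonglongrightarrow> 0"
proof (rule Lim_null_comparison[OF always_eventually], rule allI, rule err_le)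
  have s: "filterlim (\<lambda>n. sqrt (real (Suc n))) at_top sequentially"
    by (intro filterlim_compose[OF sqrt_at_top] filterlim_compose[OF filterlim_real_sequentially] filterlim_Suc)
  have r: "filterlim (\<lambda>n. real (Suc n)) at_top sequentially"
    by (intro filterlim_compose[OF filterlim_real_sequentially] filterlim_Suc)
  have "(\<lambda>n. L2_norm (v t) * (2 * (1 + \<bar>\<epsilon>\<bar>) * errc \<xi> / sqrt (real (Suc n))) + errc \<xi> / real (Suc n) * (L2_norm (v t))\<^sup>2
     + cmod (LBINT x. (v t x)\<^sup>2 * low_error n \<xi> x)) \<longlonglongrightarrow> L2_norm (v t) * 0 + 0 * (L2_norm (v t))\<^sup>2 + cmod 0"
    by (intro tendsto_add tendsto_mult tendsto_const tendsto_norm low_error_tendsto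
         tendsto_divide_0[OF tendsto_const] filterlim_at_top_imp_at_infinity s r)
  then show "(\<lambda>n. L2_norm (v t) * (2 * (1 + \<bar>\<epsilon>\<bar>) * errc \<xi> / sqrt (real (Suc n))) + errc \<xi> / real (Suc n) * (L2_norm (v t))\<^sup>2
     + cmod (LBINT x. (v t x)\<^sup>2 * low_error n \<xi> x)) \<longlonglongrightarrow> 0" by simp
qed

text \<open>Independent of \<open>n\<close> and continuous in \<open>t\<close>: the majorant used to
  pass to the limit under the time integral in \<open>duhamel_limit\<close>.\<close>

lemma err_bound:
  "cmod (err n \<xi> t) \<le> L2_norm (v t) * (2 * (1 + \<bar>\<epsilon>\<bar>) * errc \<xi>) + (errc \<xi> + \<bar>\<xi>\<bar> * (C + 1)) * (L2_norm (v t))\<^sup>2"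
proof -
  have "2 * (1 + \<bar>\<epsilon>\<bar>) * errc \<xi> / sqrt (real (Suc n)) \<le> 2 * (1 + \<bar>\<epsilon>\<bar>) * errc \<xi> / 1"
    using errc_nonneg by (intro divide_left_mono) auto
  then have 1: "L2_norm (v t) * (2 * (1 + \<bar>\<epsilon>\<bar>) * errc \<xi> / sqrt (real (Suc n))) \<le> L2_norm (v t) * (2 * (1 + \<bar>\<epsilon>\<bar>) * errc \<xi>)"
    by (intro mult_left_mono) auto
  have "errc \<xi> / real (Suc n) \<le> errc \<xi> / 1" using errc_nonneg by (intro divide_left_mono) auto
  then have 2: "errc \<xi> / real (Suc n) * (L2_norm (v t))\<^sup>2 \<le> errc \<xi> * (L2_norm (v t))\<^sup>2" by (intro mult_right_mono) auto
  have 3: "cmod (LBINT x. (v t x)\<^sup>2 * low_error n \<xi> x) \<le> \<bar>\<xi>\<bar> * (C + 1) * (L2_norm (v t))\<^sup>2"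
    by (rule quadratic_pairing(2)[OF sq sq measurable_low_error low_error_le]) (use C_nonneg in simp)
  show ?thesis using err_le[of n \<xi> t] 1 2 3 by (simp only: distrib_right)
qed

lemma duhamel_limit:
  assumes T: "0 \<le> T"
  shows "(\<lambda>n. cis (- phase \<epsilon> \<xi> * T) * moment (cutoff_seq n) \<xi> T - moment (cutoff_seq n) \<xi> 0)
    \<longlonglongrightarrow> (LBINT \<tau>. indicator {0..T} \<tau> *\<^sub>R (cis (- phase \<epsilon> \<xi> * \<tau>) * nl \<tau> \<xi>))"
proof -
  let ?G = "\<lambda>\<tau>. indicator {0..T} \<tau> *\<^sub>R (cis (- phase \<epsilon> \<xi> * \<tau>) * nl \<tau> \<xi>)"
  let ?E = "\<lambda>n \<tau>. indicator {0..T} \<tau> *\<^sub>R (cis (- phase \<epsilon> \<xi> * \<tau>) * (nl \<tau> \<xi> + err n \<xi> \<tau>))"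
  let ?B = "\<lambda>t. cmod (nl t \<xi>) + (L2_norm (v t) * (2 * (1 + \<bar>\<epsilon>\<bar>) * errc \<xi>) + (errc \<xi> + \<bar>\<xi>\<bar> * (C + 1)) * (L2_norm (v t))\<^sup>2)"
  have eq: "cis (- phase \<epsilon> \<xi> * T) * moment (cutoff_seq n) \<xi> T - moment (cutoff_seq n) \<xi> 0
     = (LBINT \<tau>. ?E n \<tau>)" for n
    using moment_duhamel[OF smooth_cutoff cutoff_support T] by (simp add: err_def)
  have ce: "continuous_on S (err n \<xi>)" for S n
    unfolding err_def by (intro continuous_intros continuous_flux continuous_moment continuous_nl smooth_cutoff cutoff_support)
  show ?thesis unfolding eq
  proof (rule integral_dominated_convergence[where w="\<lambda>\<tau>. indicator {0..T} \<tau> *\<^sub>R ?B \<tau>"])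
    show "integrable lborel (\<lambda>\<tau>. indicator {0..T} \<tau> *\<^sub>R ?B \<tau>)"
      by (rule borel_integrable_compact[OF compact_Icc]) (intro continuous_intros continuous_nl continuous_norm)
    have "integrable lborel (\<lambda>\<tau>. ?G \<tau>)"
      by (rule borel_integrable_compact[OF compact_Icc]) (intro continuous_intros continuous_nl)
    then show "(\<lambda>\<tau>. ?G \<tau>) \<in> borel_measurable lborel" by simp
    have "integrable lborel (\<lambda>\<tau>. ?E n \<tau>)" for n
      by (rule borel_integrable_compact[OF compact_Icc]) (intro continuous_intros continuous_nl ce)
    then show "(\<lambda>\<tau>. ?E n \<tau>) \<in> borel_measurable lborel" for n by simp
    show "AE \<tau> in lborel. (\<lambda>n. ?E n \<tau>)
        \<longlonglongrightarrow> ?G \<tau>"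
    proof (rule AE_I2)
      fix \<tau>
      have "(\<lambda>n. ?E n \<tau>)
        \<longlonglongrightarrow> indicator {0..T} \<tau> *\<^sub>R (cis (- phase \<epsilon> \<xi> * \<tau>) * (nl \<tau> \<xi> + 0))"
        by (intro tendsto_intros err_tendsto)
      then show "(\<lambda>n. ?E n \<tau>)
        \<longlonglongrightarrow> ?G \<tau>" by simp
    qed
    show "AE \<tau> in lborel. norm (?E n \<tau>) \<le> indicator {0..T} \<tau> *\<^sub>R ?B \<tau>" for n
    proof (rule AE_I2)
      fix \<tau>
      have "cmod (nl \<tau> \<xi> + err n \<xi> \<tau>) \<le> ?B \<tau>" by (intro order_trans[OF norm_triangle_ineq] add_mono err_bound order_refl)
      then show "norm (?E n \<tau>) \<le> indicator {0..T} \<tau> *\<^sub>R ?B \<tau>"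
        by (simp add: indicator_def norm_mult)
    qed
  qed
qed

end

section \<open>Removal of the cutoff: Duhamel's formula for the transform\<close>

lemma square_integrable_cong_AE:
  assumes "square_integrable f" "AE x in lborel. f x = g x" "g \<in> borel_measurable borel"
  shows "square_integrable g"
proof -
  note [measurable] = assms(3) square_integrable_measurable[OF assms(1)]
  have "integrable lborel (\<lambda>x. (cmod (f x))\<^sup>2) \<longleftrightarrow> integrable lborel (\<lambda>x. (cmod (g x))\<^sup>2)"
    by (rule integrable_cong_AE) (use assms(2) in auto)
  then show ?thesis using assms by (simp add: square_integrable_def)
qed

lemma has_fourier_cong_AE:
  assumes F: "has_fourier f F" and eq: "AE \<xi> in lborel. F \<xi> = G \<xi>" and [measurable]: "G \<in> borel_measurable borel"
  shows "has_fourier f G"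
proof -
  note h = has_fourierD[OF F]
  note [measurable] = square_integrable_measurable[OF h(2)] square_integrable_measurable[OF Plancherel_truncated(1)[OF h(1)]]
  have "L2_norm (\<lambda>\<xi>. truncated_fourier R f \<xi> - F \<xi>) = L2_norm (\<lambda>\<xi>. truncated_fourier R f \<xi> - G \<xi>)" for R
    by (rule L2_norm_cong_AE) (use eq in auto)
  then show ?thesis
    using h square_integrable_cong_AE[OF h(2) eq] by (simp add: has_fourier_def)
qed

text \<open>Fatou's lemma bounds the norm of the pointwise limit by every positive number.\<close>

lemma LIMSEQ_AE_eq_0:
  assumes D: "\<And>n. square_integrable (D n)" and [measurable]: "G \<in> borel_measurable borel"
    and lim: "\<And>\<xi>. (\<lambda>n. D n \<xi>) \<longlonglongrightarrow> G \<xi>" and L2: "(\<lambda>n. L2_norm (D n)) \<longlonglongrightarrow> 0"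
  shows "AE \<xi> in lborel. G \<xi> = 0"
proof -
  have ev: "\<forall>\<^sub>F n in sequentially. L2_norm (D n) \<le> a" if "0 < a" for a
    using order_tendstoD(2)[OF L2 that] by eventually_elim simp
  note F = L2_norm_Fatou[OF D _ AE_I2[OF lim] ev]
  have "L2_norm G \<le> a" if "0 < a" for a using F(2)[of a] that by simp
  then have "L2_norm G \<le> 0" by (meson dense_ge)
  then have "L2_norm G = 0" using L2_norm_nonneg[of G] by linarith
  then show ?thesis using F(1)[of 1] by (intro L2_norm_eq_0D) auto
qed

context cutoff_solution
begin

lemma moment_FT: "moment (cutoff_seq n) \<xi> t = FT (\<lambda>x. v t x * of_real (cutoff_seq n 0 x)) \<xi>"
  unfolding moment_def FT_def wave_def by (intro Bochner_Integration.integral_cong refl) (simp add: mult_ac)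

lemma square_integrable_cutoff_mult: "square_integrable (\<lambda>x. v t x * of_real (cutoff_seq n 0 x))"
proof -
  note [measurable] = square_integrable_measurable[OF sq[of t]]
  have "cmod (v t x * of_real (cutoff_seq n 0 x)) \<le> C * cmod (v t x)" for x
    using mult_left_mono[OF cutoff_le[of 0 n x], of "cmod (v t x)"] by (simp add: norm_mult mult.commute)
  then show ?thesis using C_nonneg by (intro square_integrable_lift(1)[OF sq[of t]]) auto
qed

lemma moment_has_fourier: "has_fourier (\<lambda>x. v t x * of_real (cutoff_seq n 0 x)) (\<lambda>\<xi>. moment (cutoff_seq n) \<xi> t)"
  unfolding moment_FT
  by (rule has_fourier_FT[OF square_integrable_cutoff_mult, of "2 * real (Suc n)"]) (simp add: cutoff_support del: of_nat_Suc)

lemma moment_L2_limit: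
  assumes F: "has_fourier (v t) F"
  shows "(\<lambda>n. L2_norm (\<lambda>\<xi>. moment (cutoff_seq n) \<xi> t - F \<xi>)) \<longlonglongrightarrow> 0"
proof -
  note [measurable] = square_integrable_measurable[OF sq[of t]]
  have "(\<lambda>n. LBINT x. (cmod (v t x * of_real (cutoff_seq n 0 x) - v t x))\<^sup>2) \<longlonglongrightarrow> integral\<^sup>L lborel (\<lambda>x::real. 0::real)"
  proof (rule integral_dominated_convergence[where w="\<lambda>x. (C + 1)\<^sup>2 * (cmod (v t x))\<^sup>2"])
    show "integrable lborel (\<lambda>x. (C + 1)\<^sup>2 * (cmod (v t x))\<^sup>2)"
      using sq[of t] by (intro integrable_mult_right) (simp add: square_integrable_def)
    show "AE x in lborel. norm ((cmod (v t x * of_real (cutoff_seq n 0 x) - v t x))\<^sup>2) \<le> (C + 1)\<^sup>2 * (cmod (v t x))\<^sup>2" for n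
    proof (rule AE_I2)
      fix x
      have eq: "v t x * of_real (cutoff_seq n 0 x) - v t x = of_real (cutoff_seq n 0 x - 1) * v t x" by (simp add: algebra_simps)
      have "\<bar>cutoff_seq n 0 x - 1\<bar> \<le> C + 1" using cutoff_le[of 0 n x] by simp
      then have "\<bar>cutoff_seq n 0 x - 1\<bar> * cmod (v t x) \<le> (C + 1) * cmod (v t x)" by (intro mult_right_mono) auto
      then have "(\<bar>cutoff_seq n 0 x - 1\<bar> * cmod (v t x))\<^sup>2 \<le> ((C + 1) * cmod (v t x))\<^sup>2" by (intro power_mono) auto
      then show "norm ((cmod (v t x * of_real (cutoff_seq n 0 x) - v t x))\<^sup>2) \<le> (C + 1)\<^sup>2 * (cmod (v t x))\<^sup>2"
        unfolding eq norm_mult norm_of_real by (simp add: power_mult_distrib)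
    qed
    show "AE x in lborel. (\<lambda>n. (cmod (v t x * of_real (cutoff_seq n 0 x) - v t x))\<^sup>2) \<longlonglongrightarrow> 0"
    proof (rule AE_I2)
      fix x
      have "(\<lambda>n. (cmod (v t x * of_real (cutoff_seq n 0 x) - v t x))\<^sup>2) \<longlonglongrightarrow> (cmod (v t x * of_real 1 - v t x))\<^sup>2"
        by (intro tendsto_intros cutoff_tendsto)
      then show "(\<lambda>n. (cmod (v t x * of_real (cutoff_seq n 0 x) - v t x))\<^sup>2) \<longlonglongrightarrow> 0" by simp
    qed
  qed measurable
  then have "(\<lambda>n. sqrt (2 * pi) * L2_norm (\<lambda>x. v t x * of_real (cutoff_seq n 0 x) - v t x)) \<longlonglongrightarrow> sqrt (2 * pi) * sqrt (integral\<^sup>L lborel (\<lambda>x::real. 0::real))"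
    unfolding L2_norm_def by (intro tendsto_mult tendsto_const tendsto_real_sqrt)
  then show ?thesis by (simp add: has_fourier_norm[OF has_fourier_diff[OF moment_has_fourier F]])
qed

text \<open>Two limits of one sequence are compared: pointwise, at every frequency, the time
  integral of \<open>nl\<close> from \<open>duhamel_limit\<close>; in \<open>L^2\<close>, by the
  isometry, the combination of \<open>F\<close> and \<open>F\<^sub>0\<close>.\<close>

lemma fourier_duhamel_cutoff:
  assumes T: "0 \<le> T" and FT: "has_fourier (v T) F" and F0: "has_fourier (v 0) F\<^sub>0"
  shows "AE \<xi> in lborel. (LBINT \<tau>. indicator {0..T} \<tau> *\<^sub>R (cis (- phase \<epsilon> \<xi> * \<tau>) * nl \<tau> \<xi>))
      - (cis (- phase \<epsilon> \<xi> * T) * F \<xi> - F\<^sub>0 \<xi>) = 0"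
proof (rule LIMSEQ_AE_eq_0)
  let ?m = "\<lambda>n t \<xi>. moment (cutoff_seq n) \<xi> t"
  let ?D = "\<lambda>n \<xi>. cis (- phase \<epsilon> \<xi> * T) * (?m n T \<xi> - F \<xi>) - (?m n 0 \<xi> - F\<^sub>0 \<xi>)"
  have sm: "square_integrable (?m n t)" for n t using has_fourierD(2)[OF moment_has_fourier] .
  note [measurable] = square_integrable_measurable[OF has_fourierD(2)[OF FT]] square_integrable_measurable[OF has_fourierD(2)[OF F0]]
    square_integrable_measurable[OF sm]
  have [measurable]: "phase \<epsilon> \<in> borel_measurable borel" unfolding phase_def[abs_def] by measurable
  have d: "square_integrable (\<lambda>\<xi>. ?m n T \<xi> - F \<xi>)" "square_integrable (\<lambda>\<xi>. ?m n 0 \<xi> - F\<^sub>0 \<xi>)" for n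
    by (intro square_integrable_diff sm has_fourierD(2)[OF FT] has_fourierD(2)[OF F0])+
  have D: "square_integrable (?D n)" "L2_norm (?D n) \<le> L2_norm (\<lambda>\<xi>. ?m n T \<xi> - F \<xi>) + L2_norm (\<lambda>\<xi>. ?m n 0 \<xi> - F\<^sub>0 \<xi>)" for n
  proof -
    have "cmod (?D n \<xi>) \<le> cmod (?m n T \<xi> - F \<xi>) + cmod (?m n 0 \<xi> - F\<^sub>0 \<xi>)" for \<xi>
      by (rule order_trans[OF norm_triangle_ineq4]) (simp add: norm_mult)
    then show "square_integrable (?D n)" "L2_norm (?D n) \<le> L2_norm (\<lambda>\<xi>. ?m n T \<xi> - F \<xi>) + L2_norm (\<lambda>\<xi>. ?m n 0 \<xi> - F\<^sub>0 \<xi>)"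
      by (intro square_integrable_sum[OF d]; measurable)+
  qed
  show "square_integrable (?D n)" for n by (rule D(1))
  let ?J = "\<lambda>\<xi>. LBINT \<tau>. indicator {0..T} \<tau> *\<^sub>R (cis (- phase \<epsilon> \<xi> * \<tau>) * nl \<tau> \<xi>)"
  have "?J \<in> borel_measurable borel"
    by (rule borel_measurable_LIMSEQ_metric[OF _ duhamel_limit[OF T]]) measurable
  then show "(\<lambda>\<xi>. ?J \<xi> - (cis (- phase \<epsilon> \<xi> * T) * F \<xi> - F\<^sub>0 \<xi>)) \<in> borel_measurable borel" by measurable
  show "(\<lambda>n. ?D n \<xi>) \<longlonglongrightarrow> ?J \<xi> - (cis (- phase \<epsilon> \<xi> * T) * F \<xi> - F\<^sub>0 \<xi>)" for \<xi>
    using tendsto_diff[OF duhamel_limit[OF T, of \<xi>] tendsto_const[of "cis (- phase \<epsilon> \<xi> * T) * F \<xi> - F\<^sub>0 \<xi>"]]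
    by (simp add: algebra_simps)
  show "(\<lambda>n. L2_norm (?D n)) \<longlonglongrightarrow> 0"
  proof (rule Lim_null_comparison[OF always_eventually])
    show "\<forall>n. norm (L2_norm (?D n)) \<le> L2_norm (\<lambda>\<xi>. ?m n T \<xi> - F \<xi>) + L2_norm (\<lambda>\<xi>. ?m n 0 \<xi> - F\<^sub>0 \<xi>)" using D(2) by simp
    show "(\<lambda>n. L2_norm (\<lambda>\<xi>. ?m n T \<xi> - F \<xi>) + L2_norm (\<lambda>\<xi>. ?m n 0 \<xi> - F\<^sub>0 \<xi>)) \<longlonglongrightarrow> 0"
      by (rule tendsto_add_zero[OF moment_L2_limit[OF FT] moment_L2_limit[OF F0]])
  qed
qed

end

context weak_solution
begin

lemma fourier_duhamel:
  assumes T: "0 \<le> T" and FT: "has_fourier (v T) F" and F0: "has_fourier (v 0) F\<^sub>0"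
  shows "AE \<xi> in lborel. F \<xi> = cis (phase \<epsilon> \<xi> * T) *
    (F\<^sub>0 \<xi> + (LBINT \<tau>. indicator {0..T} \<tau> *\<^sub>R (cis (- phase \<epsilon> \<xi> * \<tau>) * nl \<tau> \<xi>)))"
proof -
  obtain \<omega> where \<omega>: "smooth_seq \<omega>" "\<And>x. \<bar>x\<bar> \<le> 1 \<Longrightarrow> \<omega> 0 x = 1" "\<And>x. 2 < \<bar>x\<bar> \<Longrightarrow> \<omega> 0 x = 0"
    using smooth_plateau by metis
  have "\<exists>c\<ge>0. \<forall>x. \<bar>\<omega> j x\<bar> \<le> c" for j
    by (rule smooth_seq_bounded[OF \<omega>(1), of 2 j]) (use \<omega>(3) in auto)
  then obtain c where c: "\<And>j. 0 \<le> c j" "\<And>j x. \<bar>\<omega> j x\<bar> \<le> c j" by metis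
  have C: "\<bar>\<omega> j x\<bar> \<le> (\<Sum>i\<le>5. c i)" if "j \<le> 5" for j x
    using c(2)[of j x] member_le_sum[of j "{..5}" c] c(1) that by simp
  interpret cutoff_solution u \<epsilon> \<omega> "\<Sum>i\<le>5. c i"
    by unfold_locales (use \<omega> C in auto)
  show ?thesis
    using fourier_duhamel_cutoff[OF assms]
  proof eventually_elim
    case (elim \<xi>)
    let ?J = "LBINT \<tau>. indicator {0..T} \<tau> *\<^sub>R (cis (- phase \<epsilon> \<xi> * \<tau>) * nl \<tau> \<xi>)"
    have "cis (- phase \<epsilon> \<xi> * T) * F \<xi> = F\<^sub>0 \<xi> + ?J" using elim by (simp add: algebra_simps)
    then have "cis (phase \<epsilon> \<xi> * T) * (cis (- phase \<epsilon> \<xi> * T) * F \<xi>) = cis (phase \<epsilon> \<xi> * T) * (F\<^sub>0 \<xi> + ?J)" by (rule arg_cong)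
    then show ?case by (simp add: cis_mult flip: mult.assoc)
  qed
qed

lemma continuous_FT:
  assumes g: "integrable lborel (g :: real \<Rightarrow> complex)"
  shows "isCont (\<lambda>\<xi>. LBINT x. g x * cis (- (\<xi> * x))) \<xi>\<^sub>0"
  unfolding continuous_at_sequentially
proof (intro allI impI)
  fix X assume X: "X \<longlonglongrightarrow> \<xi>\<^sub>0"
  have [measurable]: "g \<in> borel_measurable borel" using g by auto
  show "((\<lambda>\<xi>. LBINT x. g x * cis (- (\<xi> * x))) \<circ> X) \<longlonglongrightarrow> (LBINT x. g x * cis (- (\<xi>\<^sub>0 * x)))"
    unfolding o_def
  proof (rule integral_dominated_convergence[where w="\<lambda>x. cmod (g x)"])
    show "integrable lborel (\<lambda>x. cmod (g x))" using g by simp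
    show "AE x in lborel. (\<lambda>n. g x * cis (- (X n * x))) \<longlonglongrightarrow> g x * cis (- (\<xi>\<^sub>0 * x))"
      by (intro AE_I2 tendsto_intros X)
  qed (auto simp: norm_mult)
qed

text \<open>Continuity in time is uniform in the frequency by \<open>quadratic_pairing\<close>, so
  it combines with continuity in the frequency at fixed time. This is the source of the joint
  measurability required by \<open>fsol\<close>, as nothing is assumed about \<open>u\<close>
  jointly in \<open>(t, x)\<close>.\<close>

lemma continuous_nl_joint: "continuous_on UNIV (case_prod nl)"
proof (rule continuous_at_imp_continuous_on, rule ballI)
  fix z :: "real \<times> real"
  obtain t0 \<xi>0 where z: "z = (t0, \<xi>0)" by fastforce
  let ?Q = "\<lambda>t \<xi>. LBINT x. (v t x)\<^sup>2 * cis (- (\<xi> * x))"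
  let ?M = "\<lambda>t. L2_norm (\<lambda>x. v t x - v t0 x) * (L2_norm (v t) + L2_norm (v t0))"
  have M: "isCont ?M t0" using quadratic_modulus[of t0] by (simp add: isCont_def L2_norm_def)
  have "isCont (\<lambda>\<xi>. ?Q t0 \<xi>) \<xi>0"
    by (rule continuous_FT) (use square_integrable_mult(1)[OF sq sq] in \<open>simp add: power2_eq_square\<close>)
  then have Q: "isCont (\<lambda>z. ?Q t0 (snd z)) (t0, \<xi>0)" by (intro isCont_o2[OF isCont_snd[OF continuous_ident]]) simp
  have "((\<lambda>z. ?Q (fst z) (snd z) - ?Q t0 (snd z)) \<longlongrightarrow> 0) (at (t0, \<xi>0))"
  proof (rule Lim_null_comparison[OF always_eventually])
    have "isCont (\<lambda>z. ?M (fst z)) (t0, \<xi>0)" by (intro isCont_o2[OF isCont_fst[OF continuous_ident]]) (use M in simp)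
    then show "((\<lambda>z::real \<times> real. ?M (fst z)) \<longlongrightarrow> 0) (at (t0, \<xi>0))" by (simp add: isCont_def L2_norm_def)
    show "\<forall>z. norm (?Q (fst z) (snd z) - ?Q t0 (snd z)) \<le> ?M (fst z)"
    proof
      fix z :: "real \<times> real"
      show "norm (?Q (fst z) (snd z) - ?Q t0 (snd z)) \<le> ?M (fst z)"
        using quadratic_pairing(3)[OF sq[of "fst z"] sq[of t0], of "\<lambda>x. cis (- (snd z * x))" 1] by simp
    qed
  qed
  from tendsto_add[OF this Q[unfolded isCont_def]]
  have "isCont (\<lambda>z. ?Q (fst z) (snd z)) (t0, \<xi>0)" by (simp add: isCont_def)
  then have "isCont (\<lambda>z. - (\<i> * of_real (snd z)) / 2 * ?Q (fst z) (snd z)) (t0, \<xi>0)" by (intro continuous_intros) auto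
  moreover have "case_prod nl = (\<lambda>z. - (\<i> * of_real (snd z)) / 2 * ?Q (fst z) (snd z))"
    by (rule ext) (simp add: nl_def split_beta)
  ultimately show "isCont (case_prod nl) z" by (simp only: z)
qed

lemma measurable_nl: "case_prod nl \<in> borel_measurable (borel \<Otimes>\<^sub>M borel)"
  unfolding borel_prod by (rule borel_measurable_continuous_onI[OF continuous_nl_joint])

end

context weak_solution
begin

text \<open>The average enforces the reality condition at every frequency and changes the transform
  of the datum only on a null set.\<close>

definition init :: "real \<Rightarrow> complex" where
  "init \<xi> = (fourier (v 0) \<xi> + cnj (fourier (v 0) (- \<xi>))) / 2"

text \<open>A representative of the Fourier transform of \<open>u t\<close> satisfying the equation and the reality
  condition at every frequency, not only at almost every one.\<close>

definition rep :: "real \<Rightarrow> real \<Rightarrow> complex" where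
  "rep t \<xi> = cis (phase \<epsilon> \<xi> * t) *
    (init \<xi> + (LBINT \<tau>. indicator {0..t} \<tau> *\<^sub>R (cis (- phase \<epsilon> \<xi> * \<tau>) * nl \<tau> \<xi>)))"

lemma fourier_v: "has_fourier (v t) (fourier (v t))" by (rule has_fourier_fourier[OF sq])

lemma measurable_init[measurable]: "init \<in> borel_measurable borel"
proof -
  note [measurable] = square_integrable_measurable[OF has_fourierD(2)[OF fourier_v[of 0]]]
  show ?thesis unfolding init_def[abs_def] by measurable
qed

lemma measurable_phase[measurable]: "phase \<epsilon> \<in> borel_measurable borel"
  unfolding phase_def[abs_def] by measurable

lemma init_AE: "AE \<xi> in lborel. init \<xi> = fourier (v 0) \<xi>"
proof -
  have "has_fourier (v 0) (\<lambda>\<xi>. cnj (fourier (v 0) (- \<xi>)))" using has_fourier_cnj[OF fourier_v[of 0]] by simp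
  then have "AE \<xi> in lborel. fourier (v 0) \<xi> = cnj (fourier (v 0) (- \<xi>))"
    by (rule has_fourier_unique_AE[OF fourier_v]) simp
  then show ?thesis by eventually_elim (simp add: init_def)
qed

lemma measurable_rep: "case_prod rep \<in> borel_measurable (borel \<Otimes>\<^sub>M borel)"
proof -
  note [measurable (raw)] = measurable_curried[OF measurable_nl]
  have eq: "indicator {0..t} \<tau> *\<^sub>R z = (if 0 \<le> \<tau> \<and> \<tau> \<le> t then z else 0)" for t \<tau> :: real and z :: complex
    by (simp add: indicator_def)
  have J: "(\<lambda>w. LBINT \<tau>. (if 0 \<le> \<tau> \<and> \<tau> \<le> fst w then cis (- phase \<epsilon> (snd w) * \<tau>) * nl \<tau> (snd w) else 0))
      \<in> borel_measurable (borel \<Otimes>\<^sub>M borel)"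
    by measurable
  have "case_prod rep = (\<lambda>w. cis (phase \<epsilon> (snd w) * fst w) * (init (snd w) +
      (LBINT \<tau>. (if 0 \<le> \<tau> \<and> \<tau> \<le> fst w then cis (- phase \<epsilon> (snd w) * \<tau>) * nl \<tau> (snd w) else 0))))"
    by (rule ext) (simp only: rep_def eq split_beta)
  moreover have "(\<lambda>w. cis (phase \<epsilon> (snd w) * fst w)) \<in> borel_measurable (borel \<Otimes>\<^sub>M borel)"
    "(\<lambda>w. init (snd w)) \<in> borel_measurable (borel \<Otimes>\<^sub>M borel)" by measurable
  ultimately show ?thesis using borel_measurable_times[OF _ borel_measurable_add[OF _ J]] by (simp only:)
qed

lemma measurable_rep_slice[measurable]: "rep t \<in> borel_measurable borel"
  by (rule measurable_curried[OF measurable_rep measurable_const measurable_ident_sets[OF refl]]) simp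

lemma rep_AE:
  assumes "0 \<le> t"
  shows "AE \<xi> in lborel. fourier (v t) \<xi> = rep t \<xi>"
  using fourier_duhamel[OF assms fourier_v fourier_v] init_AE
  by eventually_elim (simp add: rep_def)

lemma has_fourier_rep:
  assumes "0 \<le> t"
  shows "has_fourier (v t) (rep t)"
  by (rule has_fourier_cong_AE[OF fourier_v rep_AE[OF assms]]) measurable

lemma nl_reality: "nl t (- \<xi>) = cnj (nl t \<xi>)"
  unfolding nl_def by (simp add: cis_cnj flip: Bochner_Integration.integral_cnj)

lemma rep_reality: "rep t (- \<xi>) = cnj (rep t \<xi>)"
proof -
  have p: "phase \<epsilon> (- \<xi>) = - phase \<epsilon> \<xi>" by (simp add: phase_def)
  have "cnj (LBINT \<tau>. indicator {0..t} \<tau> *\<^sub>R (cis (- phase \<epsilon> \<xi> * \<tau>) * nl \<tau> \<xi>))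
    = (LBINT \<tau>. indicator {0..t} \<tau> *\<^sub>R (cis (- phase \<epsilon> (- \<xi>) * \<tau>) * nl \<tau> (- \<xi>)))"
    unfolding Bochner_Integration.integral_cnj[symmetric] by (simp add: p nl_reality cis_cnj)
  then show ?thesis by (simp add: rep_def p cis_cnj init_def add.commute)
qed

text \<open>\<open>FT_square\<close> holds at every frequency for any representative of the
  transform, so the convolution of \<open>rep t\<close> reproduces the integral over
  \<open>x\<close> without exception.\<close>

lemma bil_rep:
  assumes "0 \<le> t"
  shows "bil (rep t) (rep t) \<xi> = nl t \<xi>"
proof -
  have "2 * pi * FT (\<lambda>x. of_real ((u t x)\<^sup>2)) \<xi> = (LBINT \<eta>. rep t (\<eta> + \<xi>) * cnj (rep t \<eta>))"
    by (rule FT_square[OF has_fourier_rep[OF assms]])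
  also have "\<dots> = (LBINT \<eta>. rep t (\<xi> + \<eta>) * rep t (- \<eta>))" by (simp add: rep_reality add.commute)
  also have "\<dots> = (LBINT \<eta>. rep t \<eta> * rep t (\<xi> - \<eta>))"
    by (subst lborel_integral_real_affine[where c="-1" and t=0]) (auto simp: mult.commute)
  finally have "(LBINT \<eta>. rep t \<eta> * rep t (\<xi> - \<eta>)) = 2 * pi * FT (\<lambda>x. of_real ((u t x)\<^sup>2)) \<xi>" by simp
  then have "bil (rep t) (rep t) \<xi> = - (\<i> * of_real (\<xi> / (4 * pi))) * (2 * pi * FT (\<lambda>x. of_real ((u t x)\<^sup>2)) \<xi>)"
    by (simp only: bil_def)
  also have "\<dots> = - (\<i> * of_real \<xi>) / 2 * FT (\<lambda>x. of_real ((u t x)\<^sup>2)) \<xi>" by (simp add: field_simps)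
  also have "FT (\<lambda>x. of_real ((u t x)\<^sup>2)) \<xi> = (LBINT x. (v t x)\<^sup>2 * cis (- (\<xi> * x)))"
    by (simp add: FT_def mult.commute)
  finally show ?thesis by (simp only: nl_def)
qed

lemma rep_deriv:
  assumes t: "0 \<le> t"
  shows "((\<lambda>t. rep t \<xi>) has_vector_derivative \<i> * of_real (phase \<epsilon> \<xi>) * rep t \<xi> + nl t \<xi>) (at t within {0..})"
proof -
  let ?J = "\<lambda>t. LBINT \<tau>. indicator {0..t} \<tau> *\<^sub>R (cis (- phase \<epsilon> \<xi> * \<tau>) * nl \<tau> \<xi>)"
  have "(?J has_vector_derivative cis (- phase \<epsilon> \<xi> * t) * nl t \<xi>) (at t within {0..t + 1})"
    by (rule set_integral_has_vector_derivative) (use t in \<open>auto intro!: continuous_intros continuous_nl\<close>)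
  then have "((\<lambda>t. init \<xi> + ?J t) has_vector_derivative cis (- phase \<epsilon> \<xi> * t) * nl t \<xi>) (at t within {0..t + 1})"
    by (auto intro!: derivative_eq_intros)
  from has_vector_derivative_mult[OF cis_linear_deriv[of "phase \<epsilon> \<xi>"] this]
  have "((\<lambda>t. rep t \<xi>) has_vector_derivative cis (phase \<epsilon> \<xi> * t) * (cis (- phase \<epsilon> \<xi> * t) * nl t \<xi>)
      + \<i> * of_real (phase \<epsilon> \<xi>) * cis (phase \<epsilon> \<xi> * t) * (init \<xi> + ?J t)) (at t within {0..t + 1})"
    by (simp only: rep_def[abs_def])
  also have "cis (phase \<epsilon> \<xi> * t) * (cis (- phase \<epsilon> \<xi> * t) * nl t \<xi>) + \<i> * of_real (phase \<epsilon> \<xi>) * cis (phase \<epsilon> \<xi> * t) * (init \<xi> + ?J t)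
      = \<i> * of_real (phase \<epsilon> \<xi>) * rep t \<xi> + nl t \<xi>"
    by (simp add: rep_def cis_mult flip: mult.assoc)
  also have "at t within {0..t + 1} = at t within {0..}"
    by (rule at_within_nhd[of t "{..<t + 1}"]) auto
  finally show ?thesis .
qed

lemma fsol_rep: "fsol \<epsilon> rep"
proof
  show "case_prod rep \<in> borel_measurable (borel \<Otimes>\<^sub>M borel)" by (rule measurable_rep)
  show "rep t (- \<xi>) = cnj (rep t \<xi>)" for t \<xi> by (rule rep_reality)
  show "((\<lambda>t. rep t \<xi>) has_vector_derivative \<i> * of_real (phase \<epsilon> \<xi>) * rep t \<xi> + bil (rep t) (rep t) \<xi>) (at t within {0..})"
    if "0 \<le> t" for t \<xi> using rep_deriv[OF that] by (simp add: bil_rep[OF that])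
  show "continuous_on {0..} (\<lambda>t. bil (rep t) (rep t) \<xi>)" for \<xi>
    by (rule continuous_on_eq[OF continuous_nl]) (simp add: bil_rep)
qed

end

section \<open>Back to the Sobolev norms\<close>

lemma sobolev_fourier:
  assumes u: "u \<in> sobolev s" and F: "has_fourier (\<lambda>x. of_real (u x)) F"
  shows "insob s F"
proof -
  let ?F = "fourier (\<lambda>x. complex_of_real (u x))"
  have sq: "square_integrable (\<lambda>x. complex_of_real (u x))" "square_integrable (weighted s ?F)"
    using u by (auto simp: sobolev_def weighted_def[abs_def])
  note [measurable] = square_integrable_measurable[OF has_fourierD(2)[OF F]]
  have "AE \<xi> in lborel. ?F \<xi> = F \<xi>" by (rule has_fourier_unique_AE[OF has_fourier_fourier[OF sq(1)] F]) simp
  then have "AE \<xi> in lborel. weighted s ?F \<xi> = weighted s F \<xi>" by (auto simp: weighted_def)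
  moreover have "weighted s F \<in> borel_measurable borel" unfolding weighted_def[abs_def] by measurable
  ultimately have "square_integrable (weighted s F)" by (rule square_integrable_cong_AE[OF sq(2)])
  then show ?thesis by (simp add: insob_def)
qed

text \<open>\<open>inverse_fourier\<close> carries the factor \<open>1 / (2 * pi)\<close>, and the
  transform multiplies \<open>L^2\<close> norms by \<open>sqrt (2 * pi)\<close>; the quotient
  remains.\<close>

lemma sobolev_dist_fourier:
  assumes F: "has_fourier (\<lambda>x. of_real (f x)) F" and G: "has_fourier (\<lambda>x. of_real (g x)) G"
    and s: "f \<in> sobolev s" "g \<in> sobolev s"
  shows "sobolev_dist s f g = hn s (\<lambda>\<xi>. F \<xi> - G \<xi>) / sqrt (2 * pi)"
proof -
  have ins: "insob s (\<lambda>\<xi>. F \<xi> - G \<xi>)" by (intro insob_diff sobolev_fourier[OF _ F] sobolev_fourier[OF _ G] s)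
  have D: "has_fourier (\<lambda>x. complex_of_real (f x - g x)) (\<lambda>\<xi>. F \<xi> - G \<xi>)" using has_fourier_diff[OF F G] by simp
  let ?H = "fourier (\<lambda>x. complex_of_real (f x - g x))"
  have H: "has_fourier (\<lambda>x. complex_of_real (f x - g x)) ?H" by (rule has_fourier_fourier[OF has_fourierD(1)[OF D]])
  note [measurable] = square_integrable_measurable[OF has_fourierD(2)[OF H]] insob_measurable[OF ins]
  have "AE \<xi> in lborel. F \<xi> - G \<xi> = ?H \<xi>" by (rule has_fourier_unique_AE[OF D H]) simp
  then have eq: "AE \<xi> in lborel. weighted s (\<lambda>\<xi>. F \<xi> - G \<xi>) \<xi> = weighted s ?H \<xi>" by (auto simp: weighted_def)
  have m: "weighted s (\<lambda>\<xi>. F \<xi> - G \<xi>) \<in> borel_measurable borel" "weighted s ?H \<in> borel_measurable borel"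
    unfolding weighted_def[abs_def] by measurable
  have W: "square_integrable (weighted s ?H)"
    using square_integrable_cong_AE[OF _ eq m(2)] ins by (simp add: insob_def)
  have "sobolev_dist s f g = L2_norm (\<lambda>x. (1 / of_real (2 * pi)) * fourier (weighted s ?H) (0 + (-1) * x))"
    by (simp add: sobolev_dist_def sobolev_norm_def bessel_def inverse_fourier_def[abs_def] weighted_def[abs_def])
  also have "\<dots> = 1 / (2 * pi) * L2_norm (fourier (weighted s ?H))"
    by (subst L2_norm_cmult, subst L2_norm_affine) (simp_all add: norm_divide)
  also have "L2_norm (fourier (weighted s ?H)) = sqrt (2 * pi) * L2_norm (weighted s ?H)"
    by (rule has_fourier_norm[OF has_fourier_fourier[OF W]])
  also have "L2_norm (weighted s ?H) = hn s (\<lambda>\<xi>. F \<xi> - G \<xi>)"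
    unfolding hn_def by (rule L2_norm_cong_AE[symmetric, OF eq m])
  also have "1 / (2 * pi) * (sqrt (2 * pi) * hn s (\<lambda>\<xi>. F \<xi> - G \<xi>)) = hn s (\<lambda>\<xi>. F \<xi> - G \<xi>) / sqrt (2 * pi)"
    by (simp add: field_simps real_sqrt_mult)
  finally show ?thesis .
qed

lemma solution_fourier:
  assumes s: "1 \<le> s" and cont: "continuous_in_sobolev s u" and eq: "kawahara_equation \<epsilon> u"
  obtains f where "fsol \<epsilon> f" "hcont s f" "\<And>t. 0 \<le> t \<Longrightarrow> has_fourier (\<lambda>x. of_real (u t x)) (f t)"
proof -
  have u: "u t \<in> sobolev s" for t using cont by (simp add: continuous_in_sobolev_def)
  then have sq: "square_integrable (\<lambda>x. complex_of_real (u t x))" for t by (simp add: sobolev_def)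
  note F = has_fourier_fourier[OF sq]
  have "L2_norm (\<lambda>x. complex_of_real (u t x) - of_real (u t0 x)) \<le> sobolev_dist s (u t) (u t0)" for t t0
  proof -
    let ?D = "\<lambda>\<xi>. fourier (\<lambda>x. complex_of_real (u t x)) \<xi> - fourier (\<lambda>x. complex_of_real (u t0 x)) \<xi>"
    have "sqrt (2 * pi) * L2_norm (\<lambda>x. complex_of_real (u t x) - of_real (u t0 x)) = L2_norm ?D"
      using has_fourier_norm[OF has_fourier_diff[OF F F]] by simp
    also have "\<dots> \<le> hn s ?D" by (rule hn_0) (use s in \<open>auto intro!: insob_diff sobolev_fourier[OF u F]\<close>)
    also have "\<dots> = sqrt (2 * pi) * sobolev_dist s (u t) (u t0)" by (simp add: sobolev_dist_fourier[OF F F u u])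
    finally show ?thesis by simp
  qed
  then have le: "\<forall>t. norm (L2_norm (\<lambda>x. complex_of_real (u t x) - of_real (u t0 x))) \<le> sobolev_dist s (u t) (u t0)" for t0
    by simp
  have lim: "((\<lambda>t. sobolev_dist s (u t) (u t0)) \<longlongrightarrow> 0) (at t0)" for t0
    using cont unfolding continuous_in_sobolev_def by blast
  interpret weak_solution u \<epsilon>
  proof
    show "square_integrable (\<lambda>x. complex_of_real (u t x))" for t by (rule sq)
    show "((\<lambda>t. L2_norm (\<lambda>x. complex_of_real (u t x) - of_real (u t0 x))) \<longlongrightarrow> 0) (at t0)" for t0
      by (rule Lim_null_comparison[OF always_eventually[OF le] lim])
    show "kawahara_equation \<epsilon> u" by (rule eq)
  qed
  have "hcont s rep"
    unfolding hcont_def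
  proof (intro conjI allI impI)
    show "insob s (rep t)" if "0 \<le> t" for t by (rule sobolev_fourier[OF u has_fourier_rep[OF that]])
    fix t0 :: real assume t0: "0 \<le> t0"
    have "((\<lambda>t. sqrt (2 * pi) * sobolev_dist s (u t) (u t0)) \<longlongrightarrow> 0) (at t0 within {0..})"
      by (rule tendsto_mult_right_zero[OF tendsto_within_subset[OF lim]]) simp
    then show "((\<lambda>t. hn s (\<lambda>\<xi>. rep t \<xi> - rep t0 \<xi>)) \<longlongrightarrow> 0) (at t0 within {0..})"
    proof (rule Lim_transform_eventually)
      show "\<forall>\<^sub>F t in at t0 within {0..}. sqrt (2 * pi) * sobolev_dist s (u t) (u t0) = hn s (\<lambda>\<xi>. rep t \<xi> - rep t0 \<xi>)"
        unfolding eventually_at_filter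
        by (rule always_eventually) (auto simp: sobolev_dist_fourier[OF has_fourier_rep has_fourier_rep[OF t0] u u])
    qed
  qed
  then show thesis by (rule that[OF fsol_rep _ has_fourier_rep])
qed

text \<open>Lets everything proved for \<open>0 <= \<epsilon>\<close> apply to the limit
  equation.\<close>

lemma kdv_kawahara: "kdv_equation u \<longleftrightarrow> kawahara_equation 0 u"
  by (simp add: kdv_equation_def kawahara_equation_def)

theorem theorem1p1:
  fixes s T :: real and \<phi> :: "real \<Rightarrow> real" and \<epsilon> :: "nat \<Rightarrow> real"
    and u\<^sub>n :: "nat \<Rightarrow> real \<Rightarrow> real \<Rightarrow> real" and u :: "real \<Rightarrow> real \<Rightarrow> real"
  assumes "s \<ge> 1" and "\<phi> \<in> sobolev s" and "T > 0"
    and "\<And>n. \<epsilon> n > 0" and "decseq \<epsilon>" and "\<epsilon> \<longlonglongrightarrow> 0"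
    and "\<And>n. kawahara_solution s (\<epsilon> n) \<phi> (u\<^sub>n n)"
    and "kdv_solution s \<phi> u"
  shows "converges_in_C_sobolev T s u\<^sub>n u"
proof -
  have U: "continuous_in_sobolev s (u\<^sub>n n)" "kawahara_equation (\<epsilon> n) (u\<^sub>n n)" "AE x in lborel. u\<^sub>n n 0 x = \<phi> x" for n
    using assms(7) by (auto simp: kawahara_solution_def)
  have u: "continuous_in_sobolev s u" "kawahara_equation 0 u" "AE x in lborel. u 0 x = \<phi> x"
    using assms(8) by (auto simp: kdv_solution_def kdv_kawahara)
  have "\<exists>f. fsol (\<epsilon> n) f \<and> hcont s f \<and> (\<forall>t\<ge>0. has_fourier (\<lambda>x. of_real (u\<^sub>n n t x)) (f t))" for n
    by (rule solution_fourier[OF assms(1) U(1,2)]) blast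
  then obtain a where a: "\<And>n. fsol (\<epsilon> n) (a n)" "\<And>n. hcont s (a n)"
    "\<And>n t. 0 \<le> t \<Longrightarrow> has_fourier (\<lambda>x. of_real (u\<^sub>n n t x)) (a n t)"
    by metis
  obtain b where b: "fsol 0 b" "hcont s b" "\<And>t. 0 \<le> t \<Longrightarrow> has_fourier (\<lambda>x. of_real (u t x)) (b t)"
    using solution_fourier[OF assms(1) u(1,2)] by blast
  have sob: "u\<^sub>n n t \<in> sobolev s" "u t \<in> sobolev s" for n t using U(1) u(1) by (auto simp: continuous_in_sobolev_def)
  have dist: "sobolev_dist s (u\<^sub>n n t) (u t) = hclose s a b n t / sqrt (2 * pi)" if "0 \<le> t" for n t
    unfolding hclose_def by (rule sobolev_dist_fourier[OF a(3)[OF that] b(3)[OF that] sob])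
  \<comment> \<open>Both solutions agree with \<open>\<phi>\<close> at time 0 only almost
    everywhere; their transforms then agree almost everywhere, which the norm does not see.\<close>
  have "hclose s a b n 0 = 0" for n
  proof -
    have "AE x in lborel. complex_of_real (u\<^sub>n n 0 x) = of_real (u 0 x)" using U(3)[of n] u(3) by eventually_elim simp
    then have "AE \<xi> in lborel. a n 0 \<xi> = b 0 \<xi>" by (rule has_fourier_unique_AE[OF a(3) b(3), rotated 2]) auto
    then have eq: "AE \<xi> in lborel. weighted s (\<lambda>\<xi>. a n 0 \<xi> - b 0 \<xi>) \<xi> = 0" by (auto simp: weighted_def)
    have "weighted s (\<lambda>\<xi>. a n 0 \<xi> - b 0 \<xi>) \<in> borel_measurable borel"
      using insob_diff[of s "a n 0" "b 0"] a(2) b(2) by (auto simp: hcont_def insob_def intro: square_integrable_measurable)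
    then have "L2_norm (weighted s (\<lambda>\<xi>. a n 0 \<xi> - b 0 \<xi>)) = L2_norm (\<lambda>_. 0)" by (rule L2_norm_cong_AE[OF eq]) simp
    then show ?thesis by (simp add: hclose_def hn_def L2_norm_def)
  qed
  then have "uniform_limit {0..T} (hclose s a b) (\<lambda>_. 0) sequentially"
    by (intro fourier_side_convergence[OF assms(1) less_imp_le[OF assms(3)] a(1) b(1) a(2) b(2) less_imp_le[OF assms(4)] assms(6)]) simp
  then have "uniform_limit {0..T} (\<lambda>n t. hclose s a b n t / sqrt (2 * pi)) (\<lambda>_. 0 / sqrt (2 * pi)) sequentially"
    by (rule bounded_linear.uniform_limit[OF bounded_linear_divide])
  also have "?this \<longleftrightarrow> uniform_limit {0..T} (\<lambda>n t. sobolev_dist s (u\<^sub>n n t) (u t)) (\<lambda>_. 0) sequentially"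
    by (rule uniform_limit_cong') (auto simp: dist)
  finally show ?thesis by (simp only: converges_in_C_sobolev_def)
qed

end
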